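(* Let $d,N\in\mathbb{N}$ with $d\le N$. Then the map $S\mapsto X(S)$ induces a bijection between (i) the set of affinely generating non-empty subsets $S\subseteq\mathbb{Z}^d$ with $|S|\le N+1$, up to affine equivalence, and (ii) the set of toric subvarieties $X\subseteq\mathbb{P}^N$ of dimension $d$, up to projective equivalence.
   Context: Everything is over $\mathbb{C}$; $\mathbb{P}^N=\mathbb{P}^N(\mathbb{C})$ and $\mathbb{N}$ includes $0$. A torus is an algebraic group isomorphic to $(\mathbb{C}^* )^k$ for some $k\ge 0$. A closed subvariety $X\subseteq\mathbb{P}^N$ is called toric if it is the closure $\overline{Tx}$ of the orbit of some point $x\in\mathbb{P}^N$ under some subtorus $T\subseteq\mathrm{PGL}(N+1)=\mathrm{PGL}(N+1,\mathbb{C})$ (the torus is not part of the structure; no normality is assumed). Two subvarieties $X,X'\subseteq\mathbb{P}^N$ are projectively equivalent if there is $g\in\mathrm{PGL}(N+1)$ with $g(X)=X'$. Construction of $X(S)$: let $S\subseteq\mathbb{Z}^d$ be a non-empty subset with $|S|\le N+1$, and enumerate $S=\{m_0,\ldots,m_r\}$ with the $m_i$ distinct (so $r\le N$). For $t=(t_1,\dots,t_d)\in(\mathbb{C}^* )^d$ and $m=(a_1,\dots,a_d)\in\mathbb{Z}^d$ put $t^m=t_1^{a_1}\cdots t_d^{a_d}$. Let $T\subseteq\mathrm{PGL}(N+1)$ be the image of the homomorphism $(\mathbb{C}^* )^d\to\mathrm{PGL}(N+1)$, $t\mapsto\mathrm{diag}(t^{m_0},\ldots,t^{m_r},1,\ldots,1)$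 (with $N-r$ ones), and let $x=[1:\ldots:1:0:\ldots:0]\in\mathbb{P}^N$ (with $r+1$ ones and $N-r$ zeros). Then $X(S):=\overline{Tx}\subseteq\mathbb{P}^N$. It depends on the enumeration of $S$, but any two enumerations give projectively equivalent subvarieties. A subset $S\subseteq\mathbb{Z}^d$ is affinely generating if $\mathbb{Z}^d$ is generated as a group by the differences $m-m'$ with $m,m'\in S$. Two subsets $S,S'\subseteq\mathbb{Z}^d$ are affinely equivalent if $S'=\Phi(S)$ for some map $\Phi:\mathbb{Z}^d\to\mathbb{Z}^d$ of the form $\Phi(m)=Am+b$ with $A\in\mathrm{GL}(d,\mathbb{Z})$ and $b\in\mathbb{Z}^d$. *)

theory Defs
  imports
    "HOL-Analysis.Abstract_Topology"
    "HOL-Library.Extended_Nat"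
    "HOL-Library.Poly_Mapping"
    "HOL-Algebra.Coset"
    "HOL-Algebra.Generated_Groups"
    "Jordan_Normal_Form.Matrix"
begin

text \<open>
  The variables are indexed by natural numbers. A monomial is its exponent function, and
  polynomials are evaluated at vectors, the \<open>i\<close>-th entry being substituted for the
  \<open>i\<close>-th variable.
\<close>

type_synonym cpoly = "(nat \<Rightarrow>\<^sub>0 nat) \<Rightarrow>\<^sub>0 complex"

definition mono_eval :: "(nat \<Rightarrow>\<^sub>0 nat) \<Rightarrow> complex vec \<Rightarrow> complex" where
  "mono_eval m v = (\<Prod>i<dim_vec v. (v $ i) ^ Poly_Mapping.lookup m i)"

definition poly_eval :: "cpoly \<Rightarrow> complex vec \<Rightarrow> complex" where
  "poly_eval f v = (\<Sum>m\<in>Poly_Mapping.keys f. Poly_Mapping.lookup f m * mono_eval m v)"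

text \<open>The zero polynomial is homogeneous of every degree.\<close>

definition homogeneous :: "nat \<Rightarrow> nat \<Rightarrow> cpoly \<Rightarrow> bool" where
  "homogeneous n e f \<longleftrightarrow>
    (\<forall>m\<in>Poly_Mapping.keys f. Poly_Mapping.keys m \<subseteq> {..<n} \<and> (\<Sum>i<n. Poly_Mapping.lookup m i) = e)"

lemma poly_eval_superset:
  assumes "finite K" "Poly_Mapping.keys f \<subseteq> K"
  shows "poly_eval f v = (\<Sum>m\<in>K. Poly_Mapping.lookup f m * mono_eval m v)"
  unfolding poly_eval_def using assms
  by (intro sum.mono_neutral_left) (auto simp: in_keys_iff)

lemma poly_eval_0 [simp]: "poly_eval 0 v = 0"
  by (simp add: poly_eval_def)

lemma poly_eval_add: "poly_eval (f + g) v = poly_eval f v + poly_eval g v"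
proof -
  have "Poly_Mapping.keys (f + g) \<subseteq> Poly_Mapping.keys f \<union> Poly_Mapping.keys g"
    by (rule keys_add)
  then show ?thesis
    by (subst (1 2 3) poly_eval_superset[where K = "Poly_Mapping.keys f \<union> Poly_Mapping.keys g"])
       (auto simp: lookup_add algebra_simps sum.distrib)
qed

lemma poly_eval_sum: "poly_eval (sum F A) v = (\<Sum>a\<in>A. poly_eval (F a) v)"
  by (induction A rule: infinite_finite_induct) (auto simp: poly_eval_add)

lemma poly_eval_single: "poly_eval (Poly_Mapping.single m c) v = c * mono_eval m v"
  by (subst poly_eval_superset[where K = "{m}"]) auto

lemma cpoly_eq_sum_single: "(f :: cpoly) = (\<Sum>m\<in>Poly_Mapping.keys f. Poly_Mapping.single m (Poly_Mapping.lookup f m))"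
  by (rule poly_mapping_eqI) (auto simp: lookup_sum lookup_single when_def in_keys_iff)

lemma mono_eval_add: "mono_eval (m + m') v = mono_eval m v * mono_eval m' v"
  by (simp add: mono_eval_def lookup_add power_add prod.distrib)

lemma poly_eval_mult: "poly_eval (f * g) v = poly_eval f v * poly_eval g v"
proof -
  have "f * g = (\<Sum>m\<in>Poly_Mapping.keys f. \<Sum>m'\<in>Poly_Mapping.keys g.
      Poly_Mapping.single (m + m') (Poly_Mapping.lookup f m * Poly_Mapping.lookup g m'))"
    by (subst cpoly_eq_sum_single[of f], subst cpoly_eq_sum_single[of g])
       (simp add: sum_product mult_single)
  then have "poly_eval (f * g) v = (\<Sum>m\<in>Poly_Mapping.keys f. \<Sum>m'\<in>Poly_Mapping.keys g.
      Poly_Mapping.lookup f m * Poly_Mapping.lookup g m' * (mono_eval m v * mono_eval m' v))"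
    by (simp only: poly_eval_sum poly_eval_single mono_eval_add)
  also have "\<dots> = poly_eval f v * poly_eval g v"
    unfolding poly_eval_def sum_product by (simp add: mult_ac)
  finally show ?thesis .
qed

lemma homogeneous_mult:
  assumes "homogeneous n e f" "homogeneous n e' g"
  shows "homogeneous n (e + e') (f * g)"
  unfolding homogeneous_def
proof
  fix k assume "k \<in> Poly_Mapping.keys (f * g)"
  then obtain a b where ab: "a \<in> Poly_Mapping.keys f" "b \<in> Poly_Mapping.keys g" "k = a + b"
    using keys_mult[of f g] by auto
  have "Poly_Mapping.keys k \<subseteq> {..<n}"
    using assms ab keys_add[of a b] unfolding homogeneous_def by blast
  moreover have "(\<Sum>i<n. Poly_Mapping.lookup k i) = e + e'"
    using assms ab by (simp add: homogeneous_def lookup_add sum.distrib)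
  ultimately show "Poly_Mapping.keys k \<subseteq> {..<n} \<and> (\<Sum>i<n. Poly_Mapping.lookup k i) = e + e'"
    by simp
qed

lemma poly_eval_smult:
  assumes "homogeneous n e f" "v \<in> carrier_vec n"
  shows "poly_eval f (c \<cdot>\<^sub>v v) = c ^ e * poly_eval f v"
proof -
  have "mono_eval m (c \<cdot>\<^sub>v v) = c ^ e * mono_eval m v" if "m \<in> Poly_Mapping.keys f" for m
    using assms that
    by (auto simp: mono_eval_def homogeneous_def power_mult_distrib prod.distrib power_sum)
  then show ?thesis
    by (simp add: poly_eval_def sum_distrib_left algebra_simps)
qed

text \<open>
  A point of a projective space is the set of all its homogeneous coordinate vectors;
  \<open>proj_space n\<close> is the projectivization of \<open>\<complex>\<^sup>n\<close>, so it has dimension \<open>n - 1\<close>.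
\<close>

definition proj_pt :: "complex vec \<Rightarrow> complex vec set" where
  "proj_pt v = {c \<cdot>\<^sub>v v | c. c \<noteq> 0}"

definition proj_space :: "nat \<Rightarrow> complex vec set set" where
  "proj_space n = proj_pt ` (carrier_vec n - {0\<^sub>v n})"

definition zero_locus :: "nat \<Rightarrow> cpoly set \<Rightarrow> complex vec set set" where
  "zero_locus n F = {p \<in> proj_space n. \<forall>f\<in>F. \<forall>v\<in>p. poly_eval f v = 0}"

definition zariski :: "nat \<Rightarrow> complex vec set topology" where
  "zariski n = topology (\<lambda>U. \<exists>F. (\<forall>f\<in>F. \<exists>e. homogeneous n e f) \<and>
                                 U = proj_space n - zero_locus n F)"

lemma zero_locus_pointwise:
  assumes "p \<in> proj_space n" "homogeneous n e f" "v \<in> p" "w \<in> p" "poly_eval f v = 0"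
  shows "poly_eval f w = 0"
proof -
  obtain u a b where "u \<in> carrier_vec n" "a \<noteq> 0" "v = a \<cdot>\<^sub>v u" "w = b \<cdot>\<^sub>v u"
    using assms by (auto simp: proj_space_def proj_pt_def)
  then show ?thesis
    using assms by (simp add: poly_eval_smult)
qed

lemma istopology_zariski:
  "istopology (\<lambda>U. \<exists>F. (\<forall>f\<in>F. \<exists>e. homogeneous n e f) \<and> U = proj_space n - zero_locus n F)"
  unfolding istopology_def
proof (intro conjI allI impI, goal_cases)
  case (1 S T)
  then obtain F G where F: "\<forall>f\<in>F. \<exists>e. homogeneous n e f" "S = proj_space n - zero_locus n F"
    and G: "\<forall>f\<in>G. \<exists>e. homogeneous n e f" "T = proj_space n - zero_locus n G"
    by blast
  let ?H = "{f * g | f g. f \<in> F \<and> g \<in> G}"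
  have "S \<inter> T = proj_space n - zero_locus n ?H"
  proof (rule Set.set_eqI, rule iffI)
    fix p assume "p \<in> S \<inter> T"
    then obtain f g v w where *: "p \<in> proj_space n" "f \<in> F" "g \<in> G" "v \<in> p" "w \<in> p"
      "poly_eval f v \<noteq> 0" "poly_eval g w \<noteq> 0"
      using F G by (auto simp: zero_locus_def)
    then have "poly_eval g v \<noteq> 0"
      using G zero_locus_pointwise by blast
    then have "poly_eval (f * g) v \<noteq> 0"
      using * by (simp add: poly_eval_mult)
    then show "p \<in> proj_space n - zero_locus n ?H"
      using * unfolding zero_locus_def by blast
  next
    fix p assume "p \<in> proj_space n - zero_locus n ?H"
    then show "p \<in> S \<inter> T"
      using F G by (auto simp: zero_locus_def poly_eval_mult)
  qed
  moreover have "\<forall>f\<in>?H. \<exists>e. homogeneous n e f"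
    using F G homogeneous_mult by blast
  ultimately show ?case by blast
next
  case (2 K)
  then obtain F where F: "\<And>U. U \<in> K \<Longrightarrow> (\<forall>f\<in>F U. \<exists>e. homogeneous n e f) \<and>
      U = proj_space n - zero_locus n (F U)"
    by metis
  have "(\<lambda>U. U) ` K = (\<lambda>U. proj_space n - zero_locus n (F U)) ` K"
    by (rule image_cong[OF refl]) (use F in blast)
  then have "\<Union>K = (\<Union>U\<in>K. proj_space n - zero_locus n (F U))"
    by simp
  also have "\<dots> = proj_space n - zero_locus n (\<Union>U\<in>K. F U)"
    by (auto simp: zero_locus_def)
  finally have "\<Union>K = proj_space n - zero_locus n (\<Union>U\<in>K. F U)" .
  moreover have "\<forall>f\<in>(\<Union>U\<in>K. F U). \<exists>e. homogeneous n e f"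
    using F by blast
  ultimately show ?case
    by (intro exI[of _ "\<Union>U\<in>K. F U"] conjI)
qed

lemma openin_zariski:
  "openin (zariski n) U \<longleftrightarrow>
    (\<exists>F. (\<forall>f\<in>F. \<exists>e. homogeneous n e f) \<and> U = proj_space n - zero_locus n F)"
  unfolding zariski_def by (simp add: topology_inverse'[OF istopology_zariski])

lemma topspace_zariski [simp]: "topspace (zariski n) = proj_space n"
proof
  show "topspace (zariski n) \<subseteq> proj_space n"
    unfolding topspace_def by (auto simp: openin_zariski)
  have "homogeneous n 0 1"
    by (auto simp: homogeneous_def)
  moreover have "poly_eval 1 v = 1" for v
    using poly_eval_single[of 0 1 v] by (simp add: mono_eval_def)
  moreover have "p \<noteq> {}" if "p \<in> proj_space n" for p
    using that unfolding proj_space_def proj_pt_def by (auto intro: exI[of _ 1])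
  ultimately have "zero_locus n {1} = {}" "\<forall>f\<in>{1}. \<exists>e. homogeneous n e f"
    unfolding zero_locus_def by auto
  then have "openin (zariski n) (proj_space n)"
    unfolding openin_zariski by (intro exI[of _ "{1}"]) auto
  then show "proj_space n \<subseteq> topspace (zariski n)"
    by (rule openin_subset)
qed

lemma closedin_zariski:
  "closedin (zariski n) Z \<longleftrightarrow>
    (\<exists>F. (\<forall>f\<in>F. \<exists>e. homogeneous n e f) \<and> Z = zero_locus n F)"
proof -
  have "zero_locus n F \<subseteq> proj_space n" for F
    by (auto simp: zero_locus_def)
  then show ?thesis
    unfolding closedin_def openin_zariski topspace_zariski by blast
qed

definition irreducible_space :: "'a topology \<Rightarrow> bool" where
  "irreducible_space X \<longleftrightarrow> topspace X \<noteq> {} \<and>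
    (\<forall>A B. closedin X A \<and> closedin X B \<and> A \<union> B = topspace X \<longrightarrow>
      A = topspace X \<or> B = topspace X)"

text \<open>The Krull dimension; the empty space gets dimension \<open>0\<close>.\<close>

definition krull_dim :: "'a topology \<Rightarrow> enat" where
  "krull_dim X = (SUP n \<in> {n. \<exists>Z :: nat \<Rightarrow> 'a set.
      (\<forall>i\<le>n. closedin X (Z i) \<and> irreducible_space (subtopology X (Z i))) \<and>
      (\<forall>i<n. Z i \<subset> Z (Suc i))}. enat n)"

text \<open>
  The map \<open>\<iota>\<close> identifies the set \<open>X\<close> with a locally closed subset of \<open>proj_space n\<close>, and
  \<open>\<kappa>\<close> identifies \<open>Y\<close> with a locally closed subset of \<open>proj_space m\<close>. A map of quasi-projective
  varieties is regular if it is given locally by homogeneous polynomials of equal degree without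
  common zeros; they have no common zeros because points of \<open>proj_space m\<close> do not
  contain the zero vector.
\<close>

definition regular_map ::
  "nat \<Rightarrow> ('a \<Rightarrow> complex vec set) \<Rightarrow> 'a set \<Rightarrow> nat \<Rightarrow> ('b \<Rightarrow> complex vec set) \<Rightarrow> 'b set
    \<Rightarrow> ('a \<Rightarrow> 'b) \<Rightarrow> bool" where
  "regular_map n \<iota> X m \<kappa> Y f \<longleftrightarrow> f \<in> X \<rightarrow> Y \<and>
    (\<forall>x\<in>X. \<exists>U e F. openin (zariski n) U \<and> \<iota> x \<in> U \<and> (\<forall>j<m. homogeneous n e (F j)) \<and>
      (\<forall>y\<in>X. \<iota> y \<in> U \<longrightarrow> (\<forall>v\<in>\<iota> y. vec m (\<lambda>j. poly_eval (F j) v) \<in> \<kappa> (f y))))"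

text \<open>The group \<open>(\<complex>\<^sup>*)\<^sup>k\<close>, with the embedding \<open>t \<mapsto> [1 : t\<^sub>1 : \<dots> : t\<^sub>k]\<close>.\<close>

definition torus :: "nat \<Rightarrow> complex vec monoid" where
  "torus k = \<lparr>carrier = {t \<in> carrier_vec k. \<forall>i<k. t $ i \<noteq> 0},
              monoid.mult = (\<lambda>s t. vec k (\<lambda>i. s $ i * t $ i)),
              one = vec k (\<lambda>_. 1)\<rparr>"

definition torus_pt :: "complex vec \<Rightarrow> complex vec set" where
  "torus_pt t = proj_pt (vCons 1 t)"

definition GL :: "'a::comm_ring_1 itself \<Rightarrow> nat \<Rightarrow> 'a mat monoid" where
  "GL ty n = units_of (ring_mat ty n ())"

definition scalars :: "nat \<Rightarrow> complex mat set" where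
  "scalars n = {c \<cdot>\<^sub>m 1\<^sub>m n | c. c \<noteq> 0}"

text \<open>
  An element of \<open>PGL n\<close> is the set of all matrices representing it. Listing the matrix entries
  row by row embeds \<open>PGL n\<close> into \<open>proj_space (n * n)\<close> as the open set where the determinant
  does not vanish.
\<close>

definition PGL :: "nat \<Rightarrow> complex mat set monoid" where
  "PGL n = GL TYPE(complex) n Mod scalars n"

definition PGL_class :: "nat \<Rightarrow> complex mat \<Rightarrow> complex mat set" where
  "PGL_class n A = scalars n #>\<^bsub>GL TYPE(complex) n\<^esub> A"

definition PGL_pt :: "nat \<Rightarrow> complex mat set \<Rightarrow> complex vec set" where
  "PGL_pt n g = (\<lambda>A. vec (n * n) (\<lambda>k. A $$ (k div n, k mod n))) ` g"

definition PGL_act :: "complex mat set \<Rightarrow> complex vec set \<Rightarrow> complex vec set" where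
  "PGL_act g p = {A *\<^sub>v v | A v. A \<in> g \<and> v \<in> p}"

definition subtorus :: "nat \<Rightarrow> complex mat set set \<Rightarrow> bool" where
  "subtorus n T \<longleftrightarrow> subgroup T (PGL n) \<and>
    closedin (subtopology (zariski (n * n)) (PGL_pt n ` carrier (PGL n))) (PGL_pt n ` T) \<and>
    (\<exists>k \<phi>. \<phi> \<in> iso (torus k) (PGL n\<lparr>carrier := T\<rparr>) \<and>
      regular_map (Suc k) torus_pt (carrier (torus k)) (n * n) (PGL_pt n) T \<phi> \<and>
      regular_map (n * n) (PGL_pt n) T (Suc k) torus_pt (carrier (torus k))
        (inv_into (carrier (torus k)) \<phi>))"

definition toric :: "nat \<Rightarrow> complex vec set set \<Rightarrow> bool" where
  "toric N X \<longleftrightarrow> closedin (zariski (Suc N)) X \<and>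
    (\<exists>T x. subtorus (Suc N) T \<and> x \<in> proj_space (Suc N) \<and>
      X = zariski (Suc N) closure_of ((\<lambda>g. PGL_act g x) ` T))"

definition toric_subvarieties :: "nat \<Rightarrow> nat \<Rightarrow> complex vec set set set" where
  "toric_subvarieties d N =
    {X. toric N X \<and> krull_dim (subtopology (zariski (Suc N)) X) = enat d}"

definition proj_equiv :: "nat \<Rightarrow> complex vec set set \<Rightarrow> complex vec set set \<Rightarrow> bool" where
  "proj_equiv N X X' \<longleftrightarrow> (\<exists>g \<in> carrier (PGL (Suc N)). PGL_act g ` X = X')"

definition affinely_generating :: "nat \<Rightarrow> int vec set \<Rightarrow> bool" where
  "affinely_generating d S \<longleftrightarrow>
    generate (monoid_vec TYPE(int) d) {m - m' | m m'. m \<in> S \<and> m' \<in> S} = carrier_vec d"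

definition generating_sets :: "nat \<Rightarrow> nat \<Rightarrow> int vec set set" where
  "generating_sets d N = {S. S \<subseteq> carrier_vec d \<and> S \<noteq> {} \<and> finite S \<and> card S \<le> N + 1 \<and>
    affinely_generating d S}"

definition affine_equiv :: "nat \<Rightarrow> int vec set \<Rightarrow> int vec set \<Rightarrow> bool" where
  "affine_equiv d S S' \<longleftrightarrow>
    (\<exists>A \<in> carrier (GL TYPE(int) d). \<exists>b \<in> carrier_vec d. S' = (\<lambda>m. A *\<^sub>v m + b) ` S)"

definition character :: "nat \<Rightarrow> int vec \<Rightarrow> complex vec \<Rightarrow> complex" where
  "character d m t = (\<Prod>i<d. (t $ i) powi (m $ i))"

text \<open>
  The enumeration of \<open>S\<close>, on which \<open>X(S)\<close> depends, is the list \<open>ms\<close> of exponent vectors.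
\<close>

definition toric_torus :: "nat \<Rightarrow> nat \<Rightarrow> int vec list \<Rightarrow> complex mat set set" where
  "toric_torus d N ms =
    (\<lambda>t. PGL_class (Suc N)
       (mat_diag (Suc N) (\<lambda>i. if i < length ms then character d (ms ! i) t else 1)))
    ` carrier (torus d)"

definition toric_base_pt :: "nat \<Rightarrow> int vec list \<Rightarrow> complex vec set" where
  "toric_base_pt N ms = proj_pt (vec (Suc N) (\<lambda>i. if i < length ms then 1 else 0))"

definition toric_of :: "nat \<Rightarrow> nat \<Rightarrow> int vec list \<Rightarrow> complex vec set set" where
  "toric_of d N ms = zariski (Suc N) closure_of
    ((\<lambda>g. PGL_act g (toric_base_pt N ms)) ` toric_torus d N ms)"

definition affine_rel :: "nat \<Rightarrow> nat \<Rightarrow> int vec set rel" where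
  "affine_rel d N =
    {(S, S'). S \<in> generating_sets d N \<and> S' \<in> generating_sets d N \<and> affine_equiv d S S'}"

definition proj_rel :: "nat \<Rightarrow> nat \<Rightarrow> complex vec set set rel" where
  "proj_rel d N =
    {(X, X'). X \<in> toric_subvarieties d N \<and> X' \<in> toric_subvarieties d N \<and> proj_equiv N X X'}"

end

theory Submission
  imports
    Defs
    "Jordan_Normal_Form.Jordan_Normal_Form_Existence"
    "Subresultants.Subresultant_Gcd"
    "HOL-Computational_Algebra.Field_as_Ring"
begin

text \<open>
  On the orbit of a torus every form restricts to a Laurent polynomial, and powers of a point with
  prime coordinates separate characters; this gives irreducibility, linear independence of
  characters, and the dimension of an orbit closure by counting forms.

  Surjectivity: the matrices of a subtorus are simultaneously diagonalizable because entries of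
  their powers along the prime point cannot grow with polynomial factors, and a basis of the lattice
  spanned by the weight differences brings the weights into the required form.

  Injectivity: let \<open>G\<close> carry the cone with weights \<open>m'\<close> onto the cone with weights \<open>m\<close>. The cone
  is preserved by the matrices \<open>D(s) * G * D'(s') * G\<inverse>\<close> with \<open>D, D'\<close> from the two tori. Moving
  \<open>(s, s')\<close> along a path from \<open>(p, 1)\<close> to \<open>(1, p)\<close>, the eigenvalues move from the values
  at the prime point \<open>p\<close> of the characters \<open>m\<close> to those of the characters \<open>m'\<close>. The number of values of degree \<open>q\<close> monomials in the eigenvalues is bounded above by the
  Hilbert function of the cone, and generically equal to it, so multiplicative relations among the
  eigenvalues are constant along the path. Hence the additive relations of \<open>m\<close> are relations of a
  permutation of \<open>m'\<close>.
\<close>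

text \<open>The usual argument for injectivity conjugates maximal tori inside the symmetry group of
  the cone; comparing spectra along a path makes no use of the structure of that group. Several
  obstacles shape the path. Negative exponents are cleared by a common monomial factor, so that the
  matrices are polynomial in one complex parameter and each bad event (a zero coordinate, a multiple
  eigenvalue, a vanishing counting determinant) excludes finitely many parameters. A real segment
  could meet them, hence a complex arc. At its far end the determinant is not known to be nonzero,
  so relations arrive there only by continuity, while the spectrum there is simple because it is
  explicit. Eigenvalues carry no order, so limits hold up to permutations. One degree
  \<open>q\<close> suffices, since finitely many relations express all weights through a generating
  family. For the dimension, a chain of length \<open>k\<close> forces \<open>q choose k\<close>
  independent forms in degree \<open>E * q\<close>, while an orbit with \<open>d\<close> torus
  parameters allows only O(q^d).\<close>

no_notation eq_closure_of (\<open>closure'_of\<index>\<close>)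

section \<open>Linear algebra\<close>

text \<open>Elimination of one equation at a time. Arbitrary finite index sets are allowed because
  the unknowns will be coefficients of forms and the equations will be indexed by characters or by
  eigenvalues.\<close>

lemma underdetermined_system:
  fixes a :: "'i \<Rightarrow> 'j \<Rightarrow> 'a::field"
  assumes "finite J" "finite I" "card J < card I"
  shows "\<exists>c. (\<exists>i\<in>I. c i \<noteq> 0) \<and> (\<forall>j\<in>J. (\<Sum>i\<in>I. c i * a i j) = 0)"
  using assms
proof (induction J arbitrary: I a rule: finite_induct)
  case empty
  then show ?case by (intro exI[of _ "\<lambda>_. 1"]) (auto simp: card_gt_0_iff)
next
  case (insert j J)
  show ?case
  proof (cases "\<forall>i\<in>I. a i j = 0")
    case True
    obtain c where "\<exists>i\<in>I. c i \<noteq> 0" "\<forall>j\<in>J. (\<Sum>i\<in>I. c i * a i j) = 0"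
      using insert.IH[of I a] insert.prems insert.hyps by auto
    with True show ?thesis by (intro exI[of _ c]) auto
  next
    case False
    then obtain k where k: "k \<in> I" "a k j \<noteq> 0" by blast
    \<comment> \<open>Coefficients after eliminating unknown \<open>k\<close>, with its coefficient
      in equation \<open>j\<close> as pivot; \<open>c'\<close> below recovers the value of
      \<open>k\<close> from equation \<open>j\<close>.\<close>
    define a' where "a' = (\<lambda>i l. a i l - a i j / a k j * a k l)"
    obtain c where c: "\<exists>i\<in>I - {k}. c i \<noteq> 0" "\<forall>l\<in>J. (\<Sum>i\<in>I - {k}. c i * a' i l) = 0"
    proof -
      have "card J < card (I - {k})" using insert.prems insert.hyps k by auto
      then show ?thesis using insert.IH[of "I - {k}" a'] insert.prems that by blast
    qed
    define c' where "c' = (\<lambda>i. if i = k then - (\<Sum>i\<in>I - {k}. c i * a i j) / a k j else c i)"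
    have *: "(\<Sum>i\<in>I. c' i * a i l) = c' k * a k l + (\<Sum>i\<in>I - {k}. c i * a i l)" for l
      by (subst sum.remove[OF insert.prems(1) k(1)]) (auto simp: c'_def intro!: sum.cong)
    have "(\<Sum>i\<in>I. c' i * a i l) = (\<Sum>i\<in>I - {k}. c i * a' i l)" for l
    proof -
      have "(\<Sum>i\<in>I - {k}. c i * a' i l)
          = (\<Sum>i\<in>I - {k}. c i * a i l) - (\<Sum>i\<in>I - {k}. c i * a i j) * (a k l / a k j)"
        unfolding a'_def sum_distrib_right sum_subtractf[symmetric]
        by (intro sum.cong) (auto simp: algebra_simps)
      then show ?thesis unfolding * by (simp add: c'_def)
    qed
    moreover have "(\<Sum>i\<in>I. c' i * a i j) = 0"
      unfolding * using k by (simp add: c'_def)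
    ultimately show ?thesis
      using c by (intro exI[of _ c']) (auto simp: c'_def)
  qed
qed

text \<open>Combining the equations with the coefficients of a polynomial that vanishes at every
  node except \<open>l k\<close> isolates the term of \<open>k\<close>.\<close>

lemma vandermonde_independent:
  fixes l z :: "'i \<Rightarrow> 'a::field"
  assumes "finite I" "inj_on l I" and sys: "\<And>j. j < card I \<Longrightarrow> (\<Sum>i\<in>I. l i ^ j * z i) = 0"
    and "k \<in> I"
  shows "z k = 0"
proof -
  define p where "p = (\<Prod>i\<in>I - {k}. [:- l i, 1:])"
  have deg: "degree p < card I"
  proof -
    have "degree p = card (I - {k})"
      unfolding p_def by (subst degree_prod_eq_sum_degree) auto
    moreover have "card I > 0" using assms by (auto simp: card_gt_0_iff)
    ultimately show ?thesis using assms by simp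
  qed
  have eval: "poly p x = (\<Sum>j<card I. coeff p j * x ^ j)" for x
    unfolding poly_altdef using deg
    by (intro sum.mono_neutral_left) (auto simp: coeff_eq_0)
  have "(\<Sum>i\<in>I. poly p (l i) * z i) = (\<Sum>j<card I. coeff p j * (\<Sum>i\<in>I. l i ^ j * z i))"
    unfolding eval sum_distrib_left sum_distrib_right
    by (subst sum.swap) (simp add: mult_ac)
  also have "\<dots> = 0" using sys by simp
  also have "(\<Sum>i\<in>I. poly p (l i) * z i) = poly p (l k) * z k"
    using assms by (subst sum.remove[of I k]) (auto simp: p_def poly_prod intro!: sum.neutral)
  finally show ?thesis
    using assms by (auto simp: p_def poly_prod inj_on_def)
qed

section \<open>Homogeneous polynomial functions\<close>

definition monomials :: "nat \<Rightarrow> nat \<Rightarrow> (nat \<Rightarrow>\<^sub>0 nat) set" where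
  "monomials n e = {m. Poly_Mapping.keys m \<subseteq> {..<n} \<and> (\<Sum>i<n. Poly_Mapping.lookup m i) = e}"

text \<open>Forms are treated as functions on \<open>carrier_vec n\<close>, so that substitution of
  matrices and products of linear forms become closure properties instead of computations with
  coefficients.\<close>

definition hpoly :: "nat \<Rightarrow> nat \<Rightarrow> (complex vec \<Rightarrow> complex) \<Rightarrow> bool" where
  "hpoly n e f \<longleftrightarrow> (\<exists>F. homogeneous n e F \<and> (\<forall>v\<in>carrier_vec n. f v = poly_eval F v))"

lemma finite_monomials: "finite (monomials n e)"
proof -
  have "inj_on (\<lambda>m. restrict (Poly_Mapping.lookup m) {..<n}) (monomials n e)"
  proof (rule inj_onI)
    fix m m' assume *: "m \<in> monomials n e" "m' \<in> monomials n e"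
      "restrict (Poly_Mapping.lookup m) {..<n} = restrict (Poly_Mapping.lookup m') {..<n}"
    show "m = m'"
    proof (rule poly_mapping_eqI)
      fix i show "Poly_Mapping.lookup m i = Poly_Mapping.lookup m' i"
      proof (cases "i < n")
        case True
        with *(3) show ?thesis by (metis lessThan_iff restrict_apply)
      next
        case False
        then have "i \<notin> Poly_Mapping.keys m" "i \<notin> Poly_Mapping.keys m'"
          using * by (auto simp: monomials_def)
        then show ?thesis by (simp add: in_keys_iff)
      qed
    qed
  qed
  moreover have "(\<lambda>m. restrict (Poly_Mapping.lookup m) {..<n}) ` monomials n e \<subseteq> {..<n} \<rightarrow>\<^sub>E {..e}"
    by (rule image_subsetI) (auto simp: monomials_def intro!: member_le_sum)
  ultimately show ?thesis
    by (meson finite_PiE finite_atMost finite_imageD finite_lessThan finite_subset)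
qed

lemma mono_eval_carrier:
  "v \<in> carrier_vec n \<Longrightarrow> mono_eval m v = (\<Prod>i<n. (v $ i) ^ Poly_Mapping.lookup m i)"
  by (auto simp: mono_eval_def)

lemma hpoly_cong:
  "hpoly n e f \<Longrightarrow> (\<And>v. v \<in> carrier_vec n \<Longrightarrow> f v = g v) \<Longrightarrow> hpoly n e g"
  by (auto simp: hpoly_def)

lemma hpoly_poly_eval: "homogeneous n e F \<Longrightarrow> hpoly n e (poly_eval F)"
  by (auto simp: hpoly_def)

lemma hpoly_expand:
  assumes "hpoly n e f"
  obtains c where "\<And>v. v \<in> carrier_vec n \<Longrightarrow> f v = (\<Sum>m\<in>monomials n e. c m * mono_eval m v)"
proof -
  obtain F where F: "homogeneous n e F" "\<And>v. v \<in> carrier_vec n \<Longrightarrow> f v = poly_eval F v"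
    using assms by (auto simp: hpoly_def)
  have "Poly_Mapping.keys F \<subseteq> monomials n e"
    using F(1) by (auto simp: homogeneous_def monomials_def)
  then show ?thesis
    using F(2) by (intro that[of "Poly_Mapping.lookup F"])
      (auto simp: poly_eval_superset[OF finite_monomials])
qed

lemma hpoly_0 [intro!]: "hpoly n e (\<lambda>_. 0)"
  unfolding hpoly_def by (intro exI[of _ 0]) (auto simp: homogeneous_def)

lemma hpoly_const: "hpoly n 0 (\<lambda>_. c)"
  unfolding hpoly_def
  by (intro exI[of _ "Poly_Mapping.single 0 c"])
     (auto simp: homogeneous_def poly_eval_single mono_eval_def split: if_splits)

lemma hpoly_coord: "i < n \<Longrightarrow> hpoly n 1 (\<lambda>v. v $ i)"
  unfolding hpoly_def
proof (intro exI[of _ "Poly_Mapping.single (Poly_Mapping.single i 1) 1"] conjI ballI, goal_cases)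
  case 1
  then show ?case
    by (auto simp: homogeneous_def lookup_single when_def sum.delta')
next
  case (2 v)
  have "(\<Prod>j<n. (v $ j) ^ Poly_Mapping.lookup (Poly_Mapping.single i 1) j)
      = (\<Prod>j<n. if j = i then v $ i else 1)"
    by (intro prod.cong) (auto simp: lookup_single when_def)
  also have "\<dots> = v $ i" using 2 by (simp add: prod.delta)
  finally show ?case using 2 by (simp add: poly_eval_single mono_eval_carrier)
qed

lemma hpoly_add:
  assumes "hpoly n e f" "hpoly n e g" shows "hpoly n e (\<lambda>v. f v + g v)"
proof -
  obtain F G where *: "homogeneous n e F" "\<And>v. v \<in> carrier_vec n \<Longrightarrow> f v = poly_eval F v"
    "homogeneous n e G" "\<And>v. v \<in> carrier_vec n \<Longrightarrow> g v = poly_eval G v"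
    using assms unfolding hpoly_def by blast
  have "homogeneous n e (F + G)"
    using * keys_add[of F G] unfolding homogeneous_def by blast
  then show ?thesis
    unfolding hpoly_def using * by (intro exI[of _ "F + G"]) (auto simp: poly_eval_add)
qed

lemma hpoly_mult:
  assumes "hpoly n e f" "hpoly n e' g" shows "hpoly n (e + e') (\<lambda>v. f v * g v)"
  using assms unfolding hpoly_def by (metis homogeneous_mult poly_eval_mult)

lemma hpoly_cmult: "hpoly n e f \<Longrightarrow> hpoly n e (\<lambda>v. c * f v)"
  using hpoly_mult[OF hpoly_const, of n e f c] by simp

lemma hpoly_diff: "hpoly n e f \<Longrightarrow> hpoly n e g \<Longrightarrow> hpoly n e (\<lambda>v. f v - g v)"
  using hpoly_add[OF _ hpoly_cmult, of n e f g "-1"] by simp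

lemma hpoly_sum: "(\<And>i. i \<in> I \<Longrightarrow> hpoly n e (f i)) \<Longrightarrow> hpoly n e (\<lambda>v. \<Sum>i\<in>I. f i v)"
  by (induction I rule: infinite_finite_induct) (auto intro: hpoly_add)

lemma hpoly_prod:
  "(\<And>i. i \<in> I \<Longrightarrow> hpoly n (e i) (f i)) \<Longrightarrow> hpoly n (\<Sum>i\<in>I. e i) (\<lambda>v. \<Prod>i\<in>I. f i v)"
  by (induction I rule: infinite_finite_induct) (auto intro: hpoly_mult hpoly_const)

lemma hpoly_power: "hpoly n e f \<Longrightarrow> hpoly n (k * e) (\<lambda>v. f v ^ k)"
  by (induction k) (auto intro: hpoly_mult hpoly_const)

lemma hpoly_mono_eval_comp:
  assumes "\<And>i. i < n \<Longrightarrow> hpoly k d (g i)" "m \<in> monomials n e"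
  shows "hpoly k (d * e) (\<lambda>v. \<Prod>i<n. g i v ^ Poly_Mapping.lookup m i)"
proof -
  have "hpoly k (\<Sum>i<n. Poly_Mapping.lookup m i * d) (\<lambda>v. \<Prod>i<n. g i v ^ Poly_Mapping.lookup m i)"
    by (intro hpoly_prod hpoly_power) (use assms in auto)
  then show ?thesis
    using assms(2) by (simp add: monomials_def mult.commute flip: sum_distrib_left)
qed

lemma hpoly_comp:
  assumes "hpoly n e f" "\<And>i. i < n \<Longrightarrow> hpoly k d (g i)"
  shows "hpoly k (d * e) (\<lambda>v. f (vec n (\<lambda>i. g i v)))"
proof -
  obtain c where c: "\<And>v. v \<in> carrier_vec n \<Longrightarrow> f v = (\<Sum>m\<in>monomials n e. c m * mono_eval m v)"
    using hpoly_expand[OF assms(1)] by blast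
  have "hpoly k (d * e) (\<lambda>v. \<Sum>m\<in>monomials n e. c m * (\<Prod>i<n. g i v ^ Poly_Mapping.lookup m i))"
    by (intro hpoly_sum hpoly_cmult hpoly_mono_eval_comp) (use assms in auto)
  then show ?thesis
    by (rule hpoly_cong) (simp add: c mono_eval_def)
qed

lemma hpoly_mono_eval:
  assumes "m \<in> monomials n e" shows "hpoly n e (mono_eval m)"
  using hpoly_mono_eval_comp[of n n 1 "\<lambda>i v. v $ i", OF hpoly_coord assms]
  by (auto simp: mono_eval_carrier elim!: hpoly_cong)

lemma hpoly_linear: "hpoly n 1 (\<lambda>v. \<Sum>i<n. a i * v $ i)"
  by (intro hpoly_sum hpoly_cmult hpoly_coord) auto

lemma hpoly_mat_comp:
  assumes "hpoly n e f" "A \<in> carrier_mat n k" shows "hpoly k e (\<lambda>v. f (A *\<^sub>v v))"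
proof -
  have "hpoly k (1 * e) (\<lambda>v. f (vec n (\<lambda>i. \<Sum>j<k. A $$ (i, j) * v $ j)))"
    by (intro hpoly_comp[OF assms(1)] hpoly_linear)
  moreover have "vec n (\<lambda>i. \<Sum>j<k. A $$ (i, j) * v $ j) = A *\<^sub>v v" if "v \<in> carrier_vec k" for v
    using assms(2) that by (intro eq_vecI) (auto simp: scalar_prod_def atLeast0LessThan intro!: sum.cong)
  ultimately show ?thesis
    by (auto elim!: hpoly_cong)
qed

lemma hpoly_smult:
  assumes "hpoly n e f" "v \<in> carrier_vec n" shows "f (c \<cdot>\<^sub>v v) = c ^ e * f v"
  using assms by (auto simp: hpoly_def poly_eval_smult)

section \<open>Points and the Zariski topology\<close>

lemma mem_proj_pt [simp]: "v \<in> proj_pt v"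
  unfolding proj_pt_def by (auto intro!: exI[of _ 1])

lemma proj_pt_smult [simp]: "c \<noteq> 0 \<Longrightarrow> proj_pt (c \<cdot>\<^sub>v v) = proj_pt v"
proof -
  assume c: "c \<noteq> 0"
  then have "proj_pt (c \<cdot>\<^sub>v v) \<subseteq> proj_pt v"
    by (auto simp: proj_pt_def smult_smult_assoc)
  moreover have "a \<cdot>\<^sub>v v \<in> proj_pt (c \<cdot>\<^sub>v v)" if "a \<noteq> 0" for a
    using c that by (auto simp: proj_pt_def smult_smult_assoc intro!: exI[of _ "a / c"])
  ultimately show ?thesis by (auto simp: proj_pt_def)
qed

lemma proj_pt_in_space: "v \<in> carrier_vec n \<Longrightarrow> v \<noteq> 0\<^sub>v n \<Longrightarrow> proj_pt v \<in> proj_space n"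
  by (auto simp: proj_space_def)

lemma proj_space_mem:
  assumes "v \<in> p" "p \<in> proj_space n" shows "v \<in> carrier_vec n" "v \<noteq> 0\<^sub>v n"
proof -
  obtain w c where w: "w \<in> carrier_vec n" "w \<noteq> 0\<^sub>v n" "c \<noteq> 0" "v = c \<cdot>\<^sub>v w"
    using assms by (auto simp: proj_space_def proj_pt_def)
  then show "v \<in> carrier_vec n" by simp
  have "w = inverse c \<cdot>\<^sub>v v" using w by (simp add: smult_smult_assoc)
  then show "v \<noteq> 0\<^sub>v n" using w by auto
qed

lemma proj_space_cases:
  assumes "p \<in> proj_space n"
  obtains v where "v \<in> carrier_vec n" "v \<noteq> 0\<^sub>v n" "p = proj_pt v"
  using assms by (auto simp: proj_space_def)

text \<open>All representatives of a point are tested; for a form a single one decides, by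
  \<open>hpoly_proj_pt_0\<close>.\<close>

definition vanishes :: "(complex vec \<Rightarrow> complex) \<Rightarrow> complex vec set set \<Rightarrow> bool" where
  "vanishes f Z \<longleftrightarrow> (\<forall>p\<in>Z. \<forall>v\<in>p. f v = 0)"

lemma vanishes_mono: "vanishes f Z \<Longrightarrow> Y \<subseteq> Z \<Longrightarrow> vanishes f Y"
  by (auto simp: vanishes_def)

lemma hpoly_proj_pt_0:
  assumes "hpoly n e f" "v \<in> carrier_vec n" "w \<in> proj_pt v"
  shows "f w = 0 \<longleftrightarrow> f v = 0"
  using assms by (auto simp: proj_pt_def hpoly_smult)

lemma closedin_hzero:
  assumes "hpoly n e f"
  shows "closedin (zariski n) {p \<in> proj_space n. \<forall>v\<in>p. f v = 0}"
proof -
  obtain F where F: "homogeneous n e F" "\<And>v. v \<in> carrier_vec n \<Longrightarrow> f v = poly_eval F v"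
    using assms by (auto simp: hpoly_def)
  have "{p \<in> proj_space n. \<forall>v\<in>p. f v = 0} = zero_locus n {F}"
    using F(2) proj_space_mem(1) unfolding zero_locus_def by fastforce
  with F(1) show ?thesis unfolding closedin_zariski by blast
qed

lemma closed_separation:
  assumes "closedin (zariski n) Z" "p \<in> proj_space n" "p \<notin> Z"
  obtains e f where "hpoly n e f" "vanishes f Z" "\<And>v. v \<in> p \<Longrightarrow> f v \<noteq> 0"
proof -
  obtain F where F: "\<And>f. f \<in> F \<Longrightarrow> \<exists>e. homogeneous n e f" "Z = zero_locus n F"
    using assms(1) unfolding closedin_zariski by blast
  obtain f v where f: "f \<in> F" "v \<in> p" "poly_eval f v \<noteq> 0"
    using assms(2,3) F(2) by (auto simp: zero_locus_def)
  obtain e where e: "homogeneous n e f" using F f by blast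
  show ?thesis
  proof (rule that[OF hpoly_poly_eval[OF e]])
    show "vanishes (poly_eval f) Z" using f F by (auto simp: vanishes_def zero_locus_def)
    show "poly_eval f w \<noteq> 0" if "w \<in> p" for w
      using zero_locus_pointwise[OF assms(2) e that f(2)] f(3) by blast
  qed
qed

lemma vanishes_closure:
  assumes "hpoly n e f" "Y \<subseteq> proj_space n" "vanishes f Y"
  shows "vanishes f (zariski n closure_of Y)"
proof -
  have "Y \<subseteq> {p \<in> proj_space n. \<forall>v\<in>p. f v = 0}"
    using assms by (auto simp: vanishes_def)
  then have "zariski n closure_of Y \<subseteq> {p \<in> proj_space n. \<forall>v\<in>p. f v = 0}"
    by (rule closure_of_minimal[OF _ closedin_hzero[OF assms(1)]])
  then show ?thesis by (auto simp: vanishes_def)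
qed

text \<open>A point of the difference is separated by a form. Strict inclusions of closed sets are
  exploited through such forms, both for irreducibility and for dimension.\<close>

lemma closed_vanish_strict:
  assumes "closedin (zariski n) Z" "closedin (zariski n) Z'" "Z \<subset> Z'"
  obtains e f where "hpoly n e f" "vanishes f Z" "\<not> vanishes f Z'"
proof -
  obtain p where p: "p \<in> Z'" "p \<notin> Z" using assms by blast
  have sp: "p \<in> proj_space n" using closedin_subset[OF assms(2)] p by auto
  obtain e f where f: "hpoly n e f" "vanishes f Z" "\<And>v. v \<in> p \<Longrightarrow> f v \<noteq> 0"
    using closed_separation[OF assms(1) sp p(2)] by blast
  have "\<not> vanishes f Z'"
    using f(3) p sp mem_proj_pt unfolding vanishes_def by (metis proj_space_cases)
  with f show ?thesis using that by blast
qed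

section \<open>Projective transformations\<close>

text \<open>The action of one representing matrix; \<open>PGL_act_class\<close> and
  \<open>proj_equiv_iff\<close> replace classes in \<open>PGL\<close> by it.\<close>

definition act :: "complex mat \<Rightarrow> complex vec set \<Rightarrow> complex vec set" where
  "act A p = (\<lambda>v. A *\<^sub>v v) ` p"

lemma act_proj_pt:
  assumes "A \<in> carrier_mat n k" "v \<in> carrier_vec k"
  shows "act A (proj_pt v) = proj_pt (A *\<^sub>v v)"
proof -
  have "A *\<^sub>v (c \<cdot>\<^sub>v v) = c \<cdot>\<^sub>v (A *\<^sub>v v)" for c
    using assms by (rule mult_mat_vec)
  then show ?thesis by (simp add: act_def proj_pt_def setcompr_eq_image image_image)
qed

lemma smult_mat_vec:
  assumes "A \<in> carrier_mat n k" "v \<in> carrier_vec k"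
  shows "(c \<cdot>\<^sub>m A) *\<^sub>v v = c \<cdot>\<^sub>v (A *\<^sub>v v :: 'a::comm_ring_1 vec)"
  using assms by (intro eq_vecI) (auto simp: scalar_prod_def sum_distrib_left mult.assoc intro!: sum.cong)

lemma GL_iff:
  "A \<in> carrier (GL TYPE('a::comm_ring_1) n) \<longleftrightarrow> A \<in> carrier_mat n n \<and>
    (\<exists>B\<in>carrier_mat n n. A * B = 1\<^sub>m n \<and> B * A = 1\<^sub>m n)"
  by (auto simp: GL_def units_of_def Units_def ring_mat_def)

lemma GL_mult [simp]: "A \<otimes>\<^bsub>GL TYPE('a::comm_ring_1) n\<^esub> B = A * B"
  by (simp add: GL_def units_of_def ring_mat_def)

lemma group_GL: "group (GL TYPE('a::comm_ring_1) n)"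
  unfolding GL_def by (rule monoid.units_group) (simp add: ring.is_monoid ring_mat)

lemma PGL_class_eq:
  assumes "A \<in> carrier_mat n n" shows "PGL_class n A = {c \<cdot>\<^sub>m A | c. c \<noteq> 0}"
proof -
  have "c \<cdot>\<^sub>m 1\<^sub>m n * A = c \<cdot>\<^sub>m A" for c
    using assms by (metis left_mult_one_mat mult_smult_assoc_mat one_carrier_mat)
  then show ?thesis
    by (auto simp: PGL_class_def r_coset_def scalars_def)
qed

lemma carrier_PGL: "carrier (PGL n) = PGL_class n ` carrier (GL TYPE(complex) n)"
  by (auto simp: PGL_def FactGroup_def RCOSETS_def PGL_class_def)

lemma PGL_act_class:
  assumes "A \<in> carrier_mat n n" "p \<in> proj_space n"
  shows "PGL_act (PGL_class n A) p = act A p"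
proof -
  obtain v where v: "v \<in> carrier_vec n" "p = proj_pt v"
    using assms(2) by (auto elim: proj_space_cases)
  have eq: "c \<cdot>\<^sub>m A *\<^sub>v (a \<cdot>\<^sub>v v) = (c * a) \<cdot>\<^sub>v (A *\<^sub>v v)" for a c
    using assms v by (simp add: mult_mat_vec smult_smult_assoc smult_mat_vec[of _ n n])
  have "PGL_act (PGL_class n A) p = proj_pt (A *\<^sub>v v)"
  proof (rule Set.equalityI; rule Set.subsetI)
    fix x assume "x \<in> PGL_act (PGL_class n A) p"
    then show "x \<in> proj_pt (A *\<^sub>v v)"
      using eq by (auto simp: PGL_act_def PGL_class_eq[OF assms(1)] v(2) proj_pt_def)
  next
    fix x assume "x \<in> proj_pt (A *\<^sub>v v)"
    then obtain c where c: "c \<noteq> 0" "x = c \<cdot>\<^sub>v (A *\<^sub>v v)" by (auto simp: proj_pt_def)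
    then have "x = c \<cdot>\<^sub>m A *\<^sub>v v" using eq[of c 1] by simp
    with c show "x \<in> PGL_act (PGL_class n A) p"
      unfolding PGL_act_def PGL_class_eq[OF assms(1)] v(2) using mem_proj_pt by blast
  qed
  then show ?thesis using act_proj_pt[OF assms(1) v(1)] v(2) by simp
qed

lemma GL_mult_vec_nonzero:
  assumes "A \<in> carrier (GL TYPE(complex) n)" "v \<in> carrier_vec n" "v \<noteq> 0\<^sub>v n"
  shows "A *\<^sub>v v \<noteq> 0\<^sub>v n"
proof
  assume 0: "A *\<^sub>v v = 0\<^sub>v n"
  obtain B where B: "A \<in> carrier_mat n n" "B \<in> carrier_mat n n" "B * A = 1\<^sub>m n"
    using assms by (auto simp: GL_iff)
  have "v = B *\<^sub>v (A *\<^sub>v v)"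
    using B assms(2) assoc_mult_mat_vec[of B n n A n v] by simp
  then show False using 0 B assms(3) by auto
qed

lemma act_in_space:
  assumes "A \<in> carrier (GL TYPE(complex) n)" "p \<in> proj_space n"
  shows "act A p \<in> proj_space n"
  using assms(2)
proof (rule proj_space_cases)
  fix v assume v: "v \<in> carrier_vec n" "v \<noteq> 0\<^sub>v n" "p = proj_pt v"
  have A: "A \<in> carrier_mat n n" using assms by (auto simp: GL_iff)
  then show ?thesis
    using v GL_mult_vec_nonzero[OF assms(1) v(1,2)]
    by (auto simp: act_proj_pt[OF A v(1)] intro!: proj_pt_in_space)
qed

lemma act_mult:
  assumes "A \<in> carrier_mat n n" "B \<in> carrier_mat n n" "p \<in> proj_space n"
  shows "act (A * B) p = act A (act B p)"
proof -
  have "(A * B) *\<^sub>v v = A *\<^sub>v (B *\<^sub>v v)" if "v \<in> p" for v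
    using assms proj_space_mem[OF that assms(3)] by (intro assoc_mult_mat_vec)
  then show ?thesis by (simp add: act_def image_image)
qed

lemma act_one: "p \<in> proj_space n \<Longrightarrow> act (1\<^sub>m n) p = p"
  using proj_space_mem(1)[of _ p n] by (simp add: act_def)

lemma proj_equiv_iff:
  assumes "X \<subseteq> proj_space (Suc N)"
  shows "proj_equiv N X X' \<longleftrightarrow> (\<exists>A \<in> carrier (GL TYPE(complex) (Suc N)). act A ` X = X')"
proof -
  have "PGL_act (PGL_class (Suc N) A) ` X = act A ` X" if "A \<in> carrier (GL TYPE(complex) (Suc N))" for A
    using that assms by (intro image_cong) (auto simp: GL_iff PGL_act_class)
  then show ?thesis
    unfolding proj_equiv_def carrier_PGL by (metis (no_types, lifting) image_iff)
qed

lemma vanishes_act: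
  assumes "A \<in> carrier_mat n n" "Y \<subseteq> proj_space n"
  shows "vanishes f (act A ` Y) \<longleftrightarrow> vanishes (\<lambda>v. f (A *\<^sub>v v)) Y"
  by (auto simp: vanishes_def act_def)

lemma act_image_inverse:
  assumes "A \<in> carrier_mat n n" "B \<in> carrier_mat n n" "B * A = 1\<^sub>m n" "Y \<subseteq> proj_space n"
  shows "act B ` act A ` Y = Y"
proof -
  have "act B (act A p) = p" if "p \<in> Y" for p
    using act_mult[OF assms(2,1), of p] act_one[of p n] that assms(3,4) by auto
  then show ?thesis by (force simp: image_image)
qed

lemma act_GL_space:
  "A \<in> carrier (GL TYPE(complex) n) \<Longrightarrow> Y \<subseteq> proj_space n \<Longrightarrow> act A ` Y \<subseteq> proj_space n"
  using act_in_space by blast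

text \<open>The image is the common zero set of all forms vanishing on it: a point outside is
  separated by composing with the inverse matrix a form that separates its preimage from
  \<open>Z\<close>.\<close>

lemma closedin_act:
  assumes A: "A \<in> carrier (GL TYPE(complex) n)" and Z: "closedin (zariski n) Z"
  shows "closedin (zariski n) (act A ` Z)"
proof -
  obtain B where B: "A \<in> carrier_mat n n" "B \<in> carrier_mat n n" "A * B = 1\<^sub>m n" "B * A = 1\<^sub>m n"
    using A by (auto simp: GL_iff)
  then have BG: "B \<in> carrier (GL TYPE(complex) n)" by (auto simp: GL_iff)
  have Zs: "Z \<subseteq> proj_space n" using closedin_subset[OF Z] by simp
  define \<F> where "\<F> = {{p \<in> proj_space n. \<forall>v\<in>p. f v = 0} | f. (\<exists>e. hpoly n e f) \<and> vanishes f (act A ` Z)}"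
  have "closedin (zariski n) (\<Inter> (insert (proj_space n) \<F>))"
    using closedin_topspace[of "zariski n"]
    by (intro closedin_Inter) (auto simp: \<F>_def intro: closedin_hzero)
  moreover have "act A ` Z = \<Inter> (insert (proj_space n) \<F>)"
  proof (rule Set.equalityI; rule Set.subsetI)
    fix p assume "p \<in> act A ` Z"
    then show "p \<in> \<Inter> (insert (proj_space n) \<F>)"
      using act_GL_space[OF A Zs] by (auto simp: \<F>_def vanishes_def)
  next
    fix p assume p: "p \<in> \<Inter> (insert (proj_space n) \<F>)"
    then have ps: "p \<in> proj_space n" by auto
    show "p \<in> act A ` Z"
    proof (rule ccontr)
      assume np: "p \<notin> act A ` Z"
      have "act B p \<notin> Z"
        using np act_mult[OF B(1,2) ps] B(3) act_one[OF ps] by force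
      then obtain e f where f: "hpoly n e f" "vanishes f Z" "\<And>v. v \<in> act B p \<Longrightarrow> f v \<noteq> 0"
        using closed_separation[OF Z act_in_space[OF BG ps]] by blast
      have "vanishes (\<lambda>v. f (B *\<^sub>v v)) (act A ` Z)"
        using f(2) act_image_inverse[OF B(1,2,4) Zs] vanishes_act[OF B(2) act_GL_space[OF A Zs], of f]
        by simp
      then have "\<forall>v\<in>p. f (B *\<^sub>v v) = 0"
        using p hpoly_mat_comp[OF f(1) B(2)] unfolding \<F>_def by auto
      moreover obtain v where "v \<in> p" using ps mem_proj_pt unfolding proj_space_def by blast
      ultimately show False using f(3)[of "B *\<^sub>v v"] by (auto simp: act_def)
    qed
  qed
  ultimately show ?thesis by simp
qed

text \<open>Minimality of the closure gives one inclusion directly and the other after applying the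
  inverse matrix.\<close>

lemma closure_act:
  assumes A: "A \<in> carrier (GL TYPE(complex) n)" and Y: "Y \<subseteq> proj_space n"
  shows "zariski n closure_of (act A ` Y) = act A ` (zariski n closure_of Y)"
proof
  obtain B where B: "A \<in> carrier_mat n n" "B \<in> carrier_mat n n" "A * B = 1\<^sub>m n" "B * A = 1\<^sub>m n"
    using A by (auto simp: GL_iff)
  then have BG: "B \<in> carrier (GL TYPE(complex) n)" by (auto simp: GL_iff)
  have cl: "zariski n closure_of Y \<subseteq> proj_space n" for Y
    using closure_of_subset_topspace[of "zariski n"] by simp
  have Ys: "Y \<subseteq> zariski n closure_of Y" by (rule closure_of_subset) (use Y in auto)
  have Zs: "act A ` Y \<subseteq> zariski n closure_of (act A ` Y)"
    by (rule closure_of_subset) (use act_GL_space[OF A Y] in auto)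
  show "zariski n closure_of (act A ` Y) \<subseteq> act A ` (zariski n closure_of Y)"
    by (intro closure_of_minimal closedin_act[OF A] image_mono Ys) auto
  have "Y \<subseteq> act B ` (zariski n closure_of (act A ` Y))"
    using image_mono[OF Zs, of "act B"] act_image_inverse[OF B(1,2,4) Y] by simp
  then have "zariski n closure_of Y \<subseteq> act B ` (zariski n closure_of (act A ` Y))"
    by (intro closure_of_minimal closedin_act[OF BG]) auto
  from image_mono[OF this, of "act A"]
  show "act A ` (zariski n closure_of Y) \<subseteq> zariski n closure_of (act A ` Y)"
    using act_image_inverse[OF B(2,1,3) cl] by simp
qed

section \<open>Characters and Laurent polynomials\<close>

abbreviation tor :: "nat \<Rightarrow> complex vec set" where
  "tor d \<equiv> carrier (torus d)"

lemma tor_iff: "t \<in> tor d \<longleftrightarrow> t \<in> carrier_vec d \<and> (\<forall>i<d. t $ i \<noteq> 0)"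
  by (simp add: torus_def)

lemma vec_in_tor [simp]: "vec d f \<in> tor d \<longleftrightarrow> (\<forall>i<d. f i \<noteq> 0)"
  by (auto simp: tor_iff)

definition tpow :: "complex vec \<Rightarrow> nat \<Rightarrow> complex vec" where
  "tpow t n = vec (dim_vec t) (\<lambda>i. t $ i ^ n)"

definition tmul :: "complex vec \<Rightarrow> complex vec \<Rightarrow> complex vec" where
  "tmul s t = vec (dim_vec s) (\<lambda>i. s $ i * t $ i)"

lemma tpow_tor: "t \<in> tor d \<Longrightarrow> tpow t n \<in> tor d"
  by (auto simp: tor_iff tpow_def)

lemma tmul_tor: "s \<in> tor d \<Longrightarrow> t \<in> tor d \<Longrightarrow> tmul s t \<in> tor d"
  by (auto simp: tor_iff tmul_def)

text \<open>With the exponents of a monomial as coefficients, this is the character to which the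
  monomial restricts on an orbit; see \<open>mono_eval_orbit_vec\<close>.\<close>

definition wsum :: "nat \<Rightarrow> nat \<Rightarrow> (nat \<Rightarrow> int) \<Rightarrow> (nat \<Rightarrow> int vec) \<Rightarrow> int vec" where
  "wsum d n a m = vec d (\<lambda>l. \<Sum>i<n. a i * m i $ l)"

lemma wsum_carrier [simp]: "wsum d n a m \<in> carrier_vec d"
  by (simp add: wsum_def)

lemma wsum_index [simp]: "l < d \<Longrightarrow> wsum d n a m $ l = (\<Sum>i<n. a i * m i $ l)"
  by (simp add: wsum_def)

lemma character_nonzero: "t \<in> tor d \<Longrightarrow> character d m t \<noteq> 0"
  by (auto simp: character_def tor_iff)

lemma character_0: "character d (0\<^sub>v d) t = 1"
  by (simp add: character_def)

lemma character_add:
  assumes "t \<in> tor d" "m \<in> carrier_vec d" "m' \<in> carrier_vec d"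
  shows "character d (m + m') t = character d m t * character d m' t"
  unfolding character_def prod.distrib[symmetric]
  using assms by (intro prod.cong) (auto simp: tor_iff power_int_add)

lemma character_diff:
  assumes "t \<in> tor d" "m \<in> carrier_vec d" "m' \<in> carrier_vec d"
  shows "character d (m - m') t = character d m t / character d m' t"
  unfolding character_def prod_dividef[symmetric]
  using assms by (intro prod.cong) (auto simp: tor_iff power_int_diff)

lemma character_tmul:
  assumes "s \<in> tor d" "t \<in> tor d"
  shows "character d m (tmul s t) = character d m s * character d m t"
  unfolding character_def prod.distrib[symmetric]
  using assms by (intro prod.cong) (auto simp: tor_iff tmul_def power_int_mult_distrib)

lemma character_tpow: "t \<in> tor d \<Longrightarrow> character d m (tpow t n) = character d m t ^ n"
  unfolding character_def prod_power_distrib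
proof (intro prod.cong refl)
  fix i assume *: "t \<in> tor d" "i \<in> {..<d}"
  then have "tpow t n $ i powi m $ i = (t $ i ^ n) powi m $ i"
    by (auto simp: tpow_def tor_iff)
  also have "\<dots> = (t $ i powi m $ i) ^ n"
    by (simp only: power_int_power power_int_power' mult.commute)
  finally show "tpow t n $ i powi m $ i = (t $ i powi m $ i) ^ n" .
qed

lemma power_int_sum:
  "x \<noteq> 0 \<Longrightarrow> (x :: 'a::field) powi (\<Sum>i\<in>I. f i) = (\<Prod>i\<in>I. x powi f i)"
  by (induction I rule: infinite_finite_induct) (auto simp: power_int_add)

lemma power_int_prod: "(\<Prod>i\<in>I. (f i :: 'a::field)) powi k = (\<Prod>i\<in>I. f i powi k)"
  by (induction I rule: infinite_finite_induct) (auto simp: power_int_mult_distrib)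

lemma character_wsum:
  assumes "t \<in> tor d"
  shows "character d (wsum d n a m) t = (\<Prod>i<n. character d (m i) t powi a i)"
proof -
  have "character d (wsum d n a m) t = (\<Prod>l<d. \<Prod>i<n. (t $ l) powi (a i * m i $ l))"
    using assms by (auto simp: character_def tor_iff power_int_sum intro!: prod.cong)
  also have "\<dots> = (\<Prod>i<n. \<Prod>l<d. ((t $ l) powi (m i $ l)) powi a i)"
    by (subst prod.swap) (simp add: mult.commute flip: power_int_mult)
  finally show ?thesis by (simp add: character_def power_int_prod)
qed

lemma character_wsum_nat:
  assumes "t \<in> tor d"
  shows "character d (wsum d n (\<lambda>i. int (a i)) m) t = (\<Prod>i<n. character d (m i) t ^ a i)"
  using character_wsum[OF assms, of n "\<lambda>i. int (a i)" m] by (simp add: power_int_of_nat)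

text \<open>
  The point whose coordinates are distinct primes takes different positive real values at different
  characters, so along its powers a Laurent polynomial is dominated by a single term.
\<close>

definition nthprime :: "nat \<Rightarrow> nat" where
  "nthprime i = enumerate {p. prime p} i"

lemma prime_nthprime: "prime (nthprime i)"
  using enumerate_in_set[of "{p::nat. prime p}" i] primes_infinite by (simp add: nthprime_def)

lemma inj_nthprime: "nthprime i = nthprime j \<longleftrightarrow> i = j"
  using inj_enumerate[of "{p::nat. prime p}"] primes_infinite
  by (auto simp: nthprime_def inj_on_def)

definition prime_pt :: "nat \<Rightarrow> complex vec" where
  "prime_pt d = vec d (\<lambda>i. of_nat (nthprime i))"

definition prime_val :: "nat \<Rightarrow> int vec \<Rightarrow> real" where
  "prime_val d m = (\<Prod>i<d. real (nthprime i) powi (m $ i))"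

lemma nthprime_pos: "nthprime i > 0"
  using prime_nthprime prime_gt_0_nat by blast

lemma prime_pt_tor [simp]: "prime_pt d \<in> tor d"
  using nthprime_pos by (auto simp: prime_pt_def)

lemma prime_val_pos: "prime_val d m > 0"
  using nthprime_pos by (auto simp: prime_val_def intro!: prod_pos zero_less_power_int)

lemma character_prime_pt: "character d m (prime_pt d) = of_real (prime_val d m)"
  by (auto simp: character_def prime_pt_def prime_val_def of_real_power_int intro!: prod.cong)

text \<open>Unique factorization, once both sides are multiplied by enough primes to make all
  exponents natural.\<close>

lemma prime_val_inj: "inj_on (prime_val d) (carrier_vec d)"
proof (rule inj_onI)
  fix m m' :: "int vec" assume m: "m \<in> carrier_vec d" "m' \<in> carrier_vec d" "prime_val d m = prime_val d m'"
  \<comment> \<open>Positive part of one vector plus negative part of the other; \<open>a\<close>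
    and \<open>b\<close> agree exactly when \<open>m\<close> and \<open>m'\<close> do.\<close>
  define a where "a = (\<lambda>i. nat (m $ i) + nat (- (m' $ i)))"
  define b where "b = (\<lambda>i. nat (m' $ i) + nat (- (m $ i)))"
  have *: "x powi u * x ^ (nat v + nat (-u)) = x powi v * x ^ (nat u + nat (-v))"
    if "x \<noteq> 0" for x :: real and u v :: int
  proof -
    have "x powi u * x powi (int (nat v + nat (-u))) = x powi v * x powi (int (nat u + nat (-v)))"
      using that by (subst (1 2) power_int_add[symmetric]) (auto intro!: arg_cong[of _ _ "(powi) x"])
    then show ?thesis by (simp only: power_int_of_nat)
  qed
  have "prime_val d m * (\<Prod>i<d. real (nthprime i) ^ b i) = prime_val d m' * (\<Prod>i<d. real (nthprime i) ^ a i)"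
    unfolding prime_val_def prod.distrib[symmetric] a_def b_def
    using nthprime_pos by (intro prod.cong refl *) auto
  then have "(\<Prod>i<d. real (nthprime i) ^ b i) = (\<Prod>i<d. real (nthprime i) ^ a i)"
    using m(3) prime_val_pos[of d m] by simp
  then have "real (\<Prod>i<d. nthprime i ^ b i) = real (\<Prod>i<d. nthprime i ^ a i)"
    by simp
  then have ab: "(\<Prod>i<d. nthprime i ^ b i) = (\<Prod>i<d. nthprime i ^ a i)"
    by (simp only: of_nat_eq_iff)
  have mult: "multiplicity (nthprime j) (\<Prod>i<d. nthprime i ^ a i) = a j" if "j < d" for j a
  proof -
    have inj: "inj_on nthprime {..<d}" using inj_nthprime by (auto simp: inj_on_def)
    define g where "g = the_inv_into {..<d} nthprime"
    have "(\<Prod>i<d. nthprime i ^ a i) = (\<Prod>p\<in>nthprime ` {..<d}. p ^ a (g p))"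
      unfolding g_def using inj by (subst prod.reindex) (auto simp: the_inv_into_f_f intro!: prod.cong)
    then show ?thesis
      using that inj prime_nthprime multiplicity_prod_prime_powers[of "nthprime ` {..<d}" "nthprime j" "a \<circ> g"]
      by (auto simp: g_def the_inv_into_f_f)
  qed
  have "m $ j = m' $ j" if "j < d" for j
    using mult[OF that, of a] mult[OF that, of b] ab by (auto simp: a_def b_def)
  then show "m = m'" using m by (intro eq_vecI) auto
qed

section \<open>Growth of exponential sums\<close>

lemma dominant_term:
  fixes x :: "'i \<Rightarrow> real" and c :: "'i \<Rightarrow> complex"
  assumes "finite M" "inj_on x M" "\<And>m. m \<in> M \<Longrightarrow> x m > 0" "m \<in> M" and "\<And>k. k \<in> M \<Longrightarrow> x k > x m \<Longrightarrow> c k = 0"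
  shows "(\<lambda>n. \<Sum>k\<in>M. c k * of_real (x k / x m) ^ n) \<longlonglongrightarrow> c m"
proof -
  have "(\<lambda>n. c k * of_real (x k / x m) ^ n) \<longlonglongrightarrow> (if k = m then c k else 0)" if k: "k \<in> M" for k
  proof (cases "k = m")
    case True
    then show ?thesis using assms(3,4) by (auto simp: less_imp_neq[symmetric])
  next
    case False
    then have "x k \<noteq> x m" using assms(2,4) k by (auto simp: inj_on_def)
    then consider "x k > x m" | "x k < x m" by linarith
    then show ?thesis
    proof cases
      case 1
      then show ?thesis using assms(5)[OF k] False by simp
    next
      case 2
      then have "norm (of_real (x k / x m) :: complex) < 1"
        using assms(3)[OF k] assms(3)[OF assms(4)] by (simp add: norm_divide)
      then show ?thesis using False tendsto_mult_left[OF LIMSEQ_power_zero, of _ "c k"] by simp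
    qed
  qed
  then have "(\<lambda>n. \<Sum>k\<in>M. c k * of_real (x k / x m) ^ n) \<longlonglongrightarrow> (\<Sum>k\<in>M. if k = m then c k else 0)"
    by (intro tendsto_sum)
  then show ?thesis using assms(1,4) by simp
qed

lemma obtain_dominant:
  fixes x :: "'i \<Rightarrow> real"
  assumes "finite M" "\<exists>k\<in>M. P k"
  obtains m where "m \<in> M" "P m" "\<And>k. k \<in> M \<Longrightarrow> x k > x m \<Longrightarrow> \<not> P k"
proof -
  have fin: "finite {k\<in>M. P k}" "{k\<in>M. P k} \<noteq> {}" using assms by auto
  obtain m where "m \<in> {k\<in>M. P k}" "x m = Max (x ` {k\<in>M. P k})"
    using Max_in[of "x ` {k\<in>M. P k}"] fin by (auto simp: image_iff)
  moreover have "x k \<le> Max (x ` {k\<in>M. P k})" if "k \<in> M" "P k" for k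
    using that fin by (intro Max_ge) auto
  ultimately show ?thesis using that by fastforce
qed

lemma sum_scale_power:
  fixes x :: "'i \<Rightarrow> real" and c :: "'i \<Rightarrow> complex"
  assumes "r > 0"
  shows "(\<Sum>k\<in>M. c k * of_real (x k) ^ n) = of_real r ^ n * (\<Sum>k\<in>M. c k * of_real (x k / r) ^ n)"
  using assms by (auto simp: sum_distrib_left power_divide intro!: sum.cong)

text \<open>After division by the growth of the largest term present, the sum tends to its
  coefficient. The conclusion holds for all large \<open>n\<close>, so finitely many such conditions
  can be met at a common power.\<close>

lemma exponential_sum_eventually_nonzero:
  fixes x :: "'i \<Rightarrow> real" and c :: "'i \<Rightarrow> complex"
  assumes "finite M" "inj_on x M" "\<And>m. m \<in> M \<Longrightarrow> x m > 0" "\<exists>k\<in>M. c k \<noteq> 0"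
  shows "\<forall>\<^sub>F n in sequentially. (\<Sum>k\<in>M. c k * of_real (x k) ^ n) \<noteq> 0"
proof -
  obtain m where m: "m \<in> M" "c m \<noteq> 0" "\<And>k. k \<in> M \<Longrightarrow> x k > x m \<Longrightarrow> c k = 0"
    using obtain_dominant[OF assms(1,4)] by (metis not_not)
  have "\<forall>\<^sub>F n in sequentially. (\<Sum>k\<in>M. c k * of_real (x k / x m) ^ n) \<noteq> 0"
    by (rule tendsto_imp_eventually_ne[OF dominant_term[where c = c, OF assms(1-3) m(1,3)] m(2)])
  then show ?thesis
    using assms(3)[OF m(1)] by (simp add: sum_scale_power[where r = "x m"])
qed

text \<open>The growth of an exponential sum with simple bases cannot absorb a factor
  \<open>n\<close>. This is what excludes nontrivial Jordan blocks for tori.\<close>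

lemma exponential_sum_times_n:
  fixes x :: "'i \<Rightarrow> real" and a b :: "'i \<Rightarrow> complex"
  assumes "finite M" "inj_on x M" "\<And>m. m \<in> M \<Longrightarrow> x m > 0"
    and eq: "\<And>n. of_nat n * (\<Sum>k\<in>M. a k * of_real (x k) ^ n) = (\<Sum>k\<in>M. b k * of_real (x k) ^ n)"
    and "k \<in> M"
  shows "a k = 0"
proof (rule ccontr)
  assume "a k \<noteq> 0"
  \<comment> \<open>\<open>m\<close> has the largest base among all terms of both sums, so both can
    be rescaled by the same power.\<close>
  then obtain m where m: "m \<in> M" "a m \<noteq> 0 \<or> b m \<noteq> 0"
    "\<And>k. k \<in> M \<Longrightarrow> x k > x m \<Longrightarrow> \<not> (a k \<noteq> 0 \<or> b k \<noteq> 0)"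
    using obtain_dominant[OF assms(1), of "\<lambda>k. a k \<noteq> 0 \<or> b k \<noteq> 0" x] assms(5) by blast
  define A where "A = (\<lambda>n. \<Sum>k\<in>M. a k * of_real (x k / x m) ^ n)"
  define B where "B = (\<lambda>n. \<Sum>k\<in>M. b k * of_real (x k / x m) ^ n)"
  have pos: "x m > 0" using assms(3) m(1) .
  have lim: "A \<longlonglongrightarrow> a m" "B \<longlonglongrightarrow> b m"
    unfolding A_def B_def using m(3) by (intro dominant_term[OF assms(1-3) m(1)]; blast)+
  have nA: "of_nat n * A n = B n" for n
    using eq[of n] pos sum_scale_power[OF pos, of a x n M] sum_scale_power[OF pos, of b x n M]
    unfolding A_def B_def by simp
  have "(\<lambda>n. B n * (1 / of_nat n)) \<longlonglongrightarrow> b m * 0"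
    by (intro tendsto_mult lim lim_1_over_n)
  moreover have "\<forall>\<^sub>F n in sequentially. B n * (1 / of_nat n) = A n"
    using eventually_gt_at_top[of 0] by eventually_elim (simp flip: nA)
  ultimately have "A \<longlonglongrightarrow> 0"
    by (simp add: tendsto_cong)
  then have am: "a m = 0" using lim(1) LIMSEQ_unique by blast
  \<comment> \<open>With the leading coefficient of \<open>A\<close> gone, its other bases are
    smaller than that of \<open>m\<close>, and a geometric decay beats the factor \<open>n\<close>;
    so \<open>B\<close> tends to 0 as well.\<close>
  have "(\<lambda>n. of_nat n * (a k * of_real (x k / x m) ^ n)) \<longlonglongrightarrow> 0" if k: "k \<in> M" for k
  proof (cases "a k = 0")
    case False
    then have "x k \<noteq> x m" using am assms(2) m(1) k by (auto simp: inj_on_def)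
    then have "x k < x m" using m(3)[OF k] False by force
    then have "norm (of_real (x k / x m) :: complex) < 1"
      using assms(3)[OF k] pos by (simp add: norm_divide)
    from tendsto_mult_left[OF powser_times_n_limit_0[OF this], of "a k"]
    show ?thesis by (simp add: mult.left_commute)
  qed simp
  then have "(\<lambda>n. \<Sum>k\<in>M. of_nat n * (a k * of_real (x k / x m) ^ n)) \<longlonglongrightarrow> (\<Sum>k\<in>M. 0)"
    by (intro tendsto_sum)
  moreover have "(\<lambda>n. \<Sum>k\<in>M. of_nat n * (a k * of_real (x k / x m) ^ n)) = B"
    unfolding fun_eq_iff nA[symmetric] A_def sum_distrib_left by simp
  ultimately have "B \<longlonglongrightarrow> (\<Sum>k\<in>M. 0)" by (simp only:)
  then have "B \<longlonglongrightarrow> 0" by simp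
  then have "b m = 0" using lim(2) LIMSEQ_unique by blast
  then show False using m(2) am by blast
qed

section \<open>Laurent polynomials on a torus\<close>

definition laurent_on :: "nat \<Rightarrow> int vec set \<Rightarrow> (complex vec \<Rightarrow> complex) \<Rightarrow> bool" where
  "laurent_on d M f \<longleftrightarrow> finite M \<and> M \<subseteq> carrier_vec d \<and>
    (\<exists>c. \<forall>t\<in>tor d. f t = (\<Sum>m\<in>M. c m * character d m t))"

lemma laurent_on_prime_powers:
  assumes "finite M" "M \<subseteq> carrier_vec d" "\<And>t. t \<in> tor d \<Longrightarrow> f t = (\<Sum>m\<in>M. c m * character d m t)"
  shows "f (tpow (prime_pt d) n) = (\<Sum>m\<in>M. c m * of_real (prime_val d m) ^ n)"
  by (simp add: assms(3)[OF tpow_tor] character_tpow character_prime_pt)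

lemma laurent_eventually_nonzero:
  assumes "laurent_on d M f" "t \<in> tor d" "f t \<noteq> 0"
  shows "\<forall>\<^sub>F n in sequentially. f (tpow (prime_pt d) n) \<noteq> 0"
proof -
  obtain c where c: "finite M" "M \<subseteq> carrier_vec d" "\<And>t. t \<in> tor d \<Longrightarrow> f t = (\<Sum>m\<in>M. c m * character d m t)"
    using assms(1) unfolding laurent_on_def by blast
  have "\<exists>k\<in>M. c k \<noteq> 0"
    using assms(3) c(3)[OF assms(2)] by (metis (no_types, lifting) mult_eq_0_iff sum.neutral)
  then have "\<forall>\<^sub>F n in sequentially. (\<Sum>m\<in>M. c m * of_real (prime_val d m) ^ n) \<noteq> 0"
    by (intro exponential_sum_eventually_nonzero c(1) inj_on_subset[OF prime_val_inj c(2)] prime_val_pos)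
  then show ?thesis
    by (simp only: laurent_on_prime_powers[OF c])
qed

text \<open>Both functions are nonzero at all large powers of the prime point. This takes the place
  of the ring of Laurent polynomials being a domain.\<close>

lemma laurent_nonzero_prod:
  assumes "laurent_on d M f" "laurent_on d M' g" "t \<in> tor d" "f t \<noteq> 0" "s \<in> tor d" "g s \<noteq> 0"
  obtains u where "u \<in> tor d" "f u \<noteq> 0" "g u \<noteq> 0"
proof -
  have "\<forall>\<^sub>F n in sequentially. f (tpow (prime_pt d) n) \<noteq> 0 \<and> g (tpow (prime_pt d) n) \<noteq> 0"
    using assms by (intro eventually_conj laurent_eventually_nonzero)
  then obtain n where "f (tpow (prime_pt d) n) \<noteq> 0" "g (tpow (prime_pt d) n) \<noteq> 0"
    by (auto simp: eventually_sequentially)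
  then show ?thesis using that tpow_tor[OF prime_pt_tor] by blast
qed

text \<open>A nonzero coefficient is already detected at large powers of the prime point.\<close>

lemma characters_independent:
  assumes "finite M" "M \<subseteq> carrier_vec d" "\<And>t. t \<in> tor d \<Longrightarrow> (\<Sum>m\<in>M. c m * character d m t) = 0" "m \<in> M"
  shows "c m = 0"
proof (rule ccontr)
  assume "c m \<noteq> 0"
  then have "\<forall>\<^sub>F n in sequentially. (\<Sum>m\<in>M. c m * of_real (prime_val d m) ^ n) \<noteq> 0"
    using assms(4)
    by (intro exponential_sum_eventually_nonzero assms(1) inj_on_subset[OF prime_val_inj assms(2)] prime_val_pos) auto
  moreover have "(\<Sum>m\<in>M. c m * of_real (prime_val d m) ^ n) = 0" for n
    using laurent_on_prime_powers[OF assms(1,2), of "\<lambda>_. 0" c n] assms(3) by simp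
  ultimately show False by simp
qed

section \<open>Orbits\<close>

text \<open>A representative in the affine cone of the point obtained from \<open>x\<close> by the
  torus element \<open>t\<close> acting with weights \<open>m\<close>.\<close>

definition orbit_vec :: "nat \<Rightarrow> nat \<Rightarrow> (nat \<Rightarrow> int vec) \<Rightarrow> (nat \<Rightarrow> complex) \<Rightarrow> complex vec \<Rightarrow> complex vec" where
  "orbit_vec n d m x t = vec n (\<lambda>i. x i * character d (m i) t)"

definition orbit :: "nat \<Rightarrow> nat \<Rightarrow> (nat \<Rightarrow> int vec) \<Rightarrow> (nat \<Rightarrow> complex) \<Rightarrow> complex vec set set" where
  "orbit n d m x = (\<lambda>t. proj_pt (orbit_vec n d m x t)) ` tor d"

lemma orbit_vec_carrier [simp]: "orbit_vec n d m x t \<in> carrier_vec n"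
  by (simp add: orbit_vec_def)

lemma orbit_vec_index [simp]: "i < n \<Longrightarrow> orbit_vec n d m x t $ i = x i * character d (m i) t"
  by (simp add: orbit_vec_def)

lemma orbit_vec_nonzero:
  assumes "i < n" "x i \<noteq> 0" "t \<in> tor d" shows "orbit_vec n d m x t \<noteq> 0\<^sub>v n"
proof
  assume "orbit_vec n d m x t = 0\<^sub>v n"
  then have "orbit_vec n d m x t $ i = 0" using assms(1) by simp
  then show False using assms character_nonzero[OF assms(3)] by simp
qed

lemma orbit_space: "i < n \<Longrightarrow> x i \<noteq> 0 \<Longrightarrow> orbit n d m x \<subseteq> proj_space n"
  using orbit_vec_nonzero by (auto simp: orbit_def intro!: proj_pt_in_space)

text \<open>Its cardinality bounds the Hilbert function of the orbit closure in degree
  \<open>e\<close>, with equality when all coordinates \<open>x i\<close> are nonzero.\<close>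

definition supp_chars :: "nat \<Rightarrow> nat \<Rightarrow> nat \<Rightarrow> (nat \<Rightarrow> int vec) \<Rightarrow> int vec set" where
  "supp_chars n d e m = (\<lambda>a. wsum d n (\<lambda>i. int (Poly_Mapping.lookup a i)) m) ` monomials n e"

lemma finite_supp_chars: "finite (supp_chars n d e m)"
  by (simp add: supp_chars_def finite_monomials)

lemma supp_chars_carrier: "supp_chars n d e m \<subseteq> carrier_vec d"
  by (auto simp: supp_chars_def)

lemma mono_eval_orbit_vec:
  assumes "t \<in> tor d"
  shows "mono_eval a (orbit_vec n d m x t) = (\<Prod>i<n. x i ^ Poly_Mapping.lookup a i) *
    character d (wsum d n (\<lambda>i. int (Poly_Mapping.lookup a i)) m) t"
  unfolding character_wsum_nat[OF assms]
  by (simp add: mono_eval_carrier[OF orbit_vec_carrier] power_mult_distrib prod.distrib)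

lemma hpoly_orbit:
  assumes "hpoly n e f"
  shows "laurent_on d (supp_chars n d e m) (\<lambda>t. f (orbit_vec n d m x t))"
proof -
  obtain c where c: "\<And>v. v \<in> carrier_vec n \<Longrightarrow> f v = (\<Sum>a\<in>monomials n e. c a * mono_eval a v)"
    using hpoly_expand[OF assms] by blast
  define w where "w = (\<lambda>a. wsum d n (\<lambda>i. int (Poly_Mapping.lookup a i)) m)"
  \<comment> \<open>Monomials of the same weight restrict to multiples of the same character, so
    their coefficients are collected.\<close>
  define c' where "c' = (\<lambda>\<mu>. \<Sum>a\<in>{a\<in>monomials n e. w a = \<mu>}. c a * (\<Prod>i<n. x i ^ Poly_Mapping.lookup a i))"
  have "f (orbit_vec n d m x t) = (\<Sum>\<mu>\<in>supp_chars n d e m. c' \<mu> * character d \<mu> t)" if t: "t \<in> tor d" for t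
  proof -
    have "f (orbit_vec n d m x t) = (\<Sum>a\<in>monomials n e. c a * (\<Prod>i<n. x i ^ Poly_Mapping.lookup a i) * character d (w a) t)"
      by (simp add: c mono_eval_orbit_vec[OF t] w_def mult.assoc)
    also have "\<dots> = (\<Sum>\<mu>\<in>w ` monomials n e. \<Sum>a\<in>{a\<in>monomials n e. w a = \<mu>}.
        c a * (\<Prod>i<n. x i ^ Poly_Mapping.lookup a i) * character d (w a) t)"
      by (rule sum.image_gen[OF finite_monomials])
    also have "\<dots> = (\<Sum>\<mu>\<in>w ` monomials n e. c' \<mu> * character d \<mu> t)"
      unfolding c'_def sum_distrib_right by (intro sum.cong) auto
    finally show ?thesis by (simp add: supp_chars_def w_def)
  qed
  then show ?thesis
    unfolding laurent_on_def using finite_supp_chars supp_chars_carrier by blast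
qed

lemma vanishes_orbit:
  assumes "hpoly n e f"
  shows "vanishes f (orbit n d m x) \<longleftrightarrow> (\<forall>t\<in>tor d. f (orbit_vec n d m x t) = 0)"
  using hpoly_proj_pt_0[OF assms orbit_vec_carrier[of n d m x]]
  by (fastforce simp: vanishes_def orbit_def)

text \<open>Taking the closure imposes no new condition on forms, so the ideal of an orbit closure
  can be computed on the torus.\<close>

lemma vanishes_orbit_closure:
  assumes "hpoly n e f" "orbit n d m x \<subseteq> proj_space n"
  shows "vanishes f (zariski n closure_of orbit n d m x) \<longleftrightarrow> (\<forall>t\<in>tor d. f (orbit_vec n d m x t) = 0)"
proof -
  have "orbit n d m x \<subseteq> zariski n closure_of orbit n d m x"
    using assms(2) by (intro closure_of_subset) simp
  then show ?thesis
    using vanishes_closure[OF assms] vanishes_mono vanishes_orbit[OF assms(1), of d m x] by blast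
qed

text \<open>Two proper closed subsets are contained in the zero sets of forms whose restrictions to
  the torus are nonzero Laurent polynomials. A torus point where neither vanishes lies in neither
  subset.\<close>

lemma irreducible_orbit_closure:
  assumes "i < n" "x i \<noteq> 0"
  shows "irreducible_space (subtopology (zariski n) (zariski n closure_of orbit n d m x))"
    (is "irreducible_space (subtopology _ ?Z)")
proof -
  have Zs: "?Z \<subseteq> proj_space n"
    using closure_of_subset_topspace[of "zariski n"] by simp
  have orb: "orbit n d m x \<subseteq> proj_space n" using orbit_space[OF assms(1), of x] assms(2) by blast
  have sub: "orbit n d m x \<subseteq> ?Z" using orb by (intro closure_of_subset) simp
  have cl: "closedin (zariski n) ?Z" by simp
  have top: "topspace (subtopology (zariski n) ?Z) = ?Z"
    using Zs by auto
  have "proj_pt (orbit_vec n d m x (prime_pt d)) \<in> orbit n d m x"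
    by (auto simp: orbit_def)
  then have "?Z \<noteq> {}" using sub by blast
  moreover have "A = ?Z \<or> B = ?Z"
    if AB: "closedin (subtopology (zariski n) ?Z) A" "closedin (subtopology (zariski n) ?Z) B" "A \<union> B = ?Z"
    for A B
  proof (rule ccontr)
    assume neq: "\<not> (A = ?Z \<or> B = ?Z)"
    have cAB: "closedin (zariski n) A" "closedin (zariski n) B"
      using AB closedin_trans_full[OF _ cl] by auto
    have "\<exists>e f t. hpoly n e f \<and> vanishes f A \<and> t \<in> tor d \<and> f (orbit_vec n d m x t) \<noteq> 0"
      if A: "closedin (zariski n) A" "A \<noteq> ?Z" "A \<subseteq> ?Z" for A
    proof -
      have "A \<subset> ?Z" using A by blast
      then obtain e f where "hpoly n e f" "vanishes f A" "\<not> vanishes f ?Z"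
        by (rule closed_vanish_strict[OF A(1) cl])
      then show ?thesis using vanishes_orbit_closure[OF _ orb] by blast
    qed
    then obtain e f t e' g s where *: "hpoly n e f" "vanishes f A" "t \<in> tor d" "f (orbit_vec n d m x t) \<noteq> 0"
      "hpoly n e' g" "vanishes g B" "s \<in> tor d" "g (orbit_vec n d m x s) \<noteq> 0"
      using cAB neq AB(3) by (metis Un_upper1 Un_upper2)
    then obtain u where u: "u \<in> tor d" "f (orbit_vec n d m x u) \<noteq> 0" "g (orbit_vec n d m x u) \<noteq> 0"
      using laurent_nonzero_prod[OF hpoly_orbit[OF *(1)] hpoly_orbit[OF *(5)]] by metis
    have "proj_pt (orbit_vec n d m x u) \<in> A \<union> B"
      using u(1) sub unfolding AB(3) by (auto simp: orbit_def)
    then show False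
      using u *(2,6) unfolding vanishes_def by (metis UnE mem_proj_pt)
  qed
  ultimately show ?thesis
    unfolding irreducible_space_def top by blast
qed

text \<open>Otherwise the zero sets of the two factors would cut \<open>Z\<close> into two closed
  pieces. In other words, the homogeneous ideal of an irreducible set is prime.\<close>

lemma irreducible_mult_nonvanishing:
  assumes Z: "closedin (zariski n) Z" "irreducible_space (subtopology (zariski n) Z)"
    and f: "hpoly n e f" "\<not> vanishes f Z" and g: "hpoly n e' g" "\<not> vanishes g Z"
  shows "\<not> vanishes (\<lambda>v. f v * g v) Z"
proof
  assume van: "vanishes (\<lambda>v. f v * g v) Z"
  have Zs: "Z \<subseteq> proj_space n" using closedin_subset[OF Z(1)] by simp
  define V where "V = (\<lambda>f. {p \<in> proj_space n. \<forall>v\<in>p. f v = (0::complex)})"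
  have cl: "closedin (zariski n) (V f)" "closedin (zariski n) (V g)"
    unfolding V_def using closedin_hzero f g by blast+
  have "Z \<subseteq> V f \<union> V g"
  proof
    fix p assume p: "p \<in> Z"
    then obtain v where v: "v \<in> carrier_vec n" "p = proj_pt v" using Zs by (metis proj_space_cases subsetD)
    then have "f v * g v = 0" using van p mem_proj_pt unfolding vanishes_def by blast
    then have "f v = 0 \<or> g v = 0" by simp
    then have "(\<forall>w\<in>p. f w = 0) \<or> (\<forall>w\<in>p. g w = 0)"
      using hpoly_proj_pt_0[OF f(1) v(1)] hpoly_proj_pt_0[OF g(1) v(1)] v(2) by blast
    then show "p \<in> V f \<union> V g"
      using p Zs unfolding V_def by blast
  qed
  then have "Z \<inter> V f \<union> Z \<inter> V g = Z" by blast
  moreover have "closedin (subtopology (zariski n) Z) (Z \<inter> V f)" "closedin (subtopology (zariski n) Z) (Z \<inter> V g)"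
    using cl by (auto simp: closedin_subtopology)
  moreover have "topspace (subtopology (zariski n) Z) = Z" using Zs by auto
  ultimately have "Z \<inter> V f = Z \<or> Z \<inter> V g = Z"
    using Z(2) unfolding irreducible_space_def by metis
  then show False using f g by (auto simp: V_def vanishes_def)
qed

section \<open>Krull dimension\<close>

text \<open>A lower bound \<open>h\<close> for the Hilbert function of \<open>Z\<close> in degree
  \<open>e\<close>, stated without forming quotients of polynomial rings.\<close>

definition indep_forms :: "nat \<Rightarrow> nat \<Rightarrow> nat \<Rightarrow> complex vec set set \<Rightarrow> bool" where
  "indep_forms n e h Z \<longleftrightarrow> (\<exists>b :: nat \<Rightarrow> complex vec \<Rightarrow> complex. (\<forall>i<h. hpoly n e (b i)) \<and>
    (\<forall>c. vanishes (\<lambda>v. \<Sum>i<h. c i * b i v) Z \<longrightarrow> (\<forall>i<h. c i = 0)))"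

lemma indep_forms_less:
  assumes "indep_forms n e h Z" "h' \<le> h" shows "indep_forms n e h' Z"
proof -
  obtain b where b: "\<And>i. i < h \<Longrightarrow> hpoly n e (b i)"
    "\<And>c i. vanishes (\<lambda>v. \<Sum>i<h. c i * b i v) Z \<Longrightarrow> i < h \<Longrightarrow> c i = (0::complex)"
    using assms(1) unfolding indep_forms_def by blast
  have "c i = 0" if c: "vanishes (\<lambda>v. \<Sum>i<h'. c i * b i v) Z" "i < h'" for c i
  proof -
    have "(\<Sum>i<h. (if i < h' then c i else 0) * b i v) = (\<Sum>i<h'. c i * b i v)" for v
      using assms(2) by (intro sum.mono_neutral_cong_right) auto
    then show ?thesis using b(2)[of "\<lambda>i. if i < h' then c i else 0" i] c assms(2) by simp
  qed
  then show ?thesis unfolding indep_forms_def using b(1) assms(2) by (intro exI[of _ b]) auto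
qed

lemma indep_forms_mono:
  assumes "indep_forms n e h Z" "Z \<subseteq> Z'" shows "indep_forms n e h Z'"
  using assms vanishes_mono[OF _ assms(2)] unfolding indep_forms_def by blast

lemma sum_lessThan_plus: "(\<Sum>i<a + b. f i) = (\<Sum>i<a. f i) + (\<Sum>i<b. f (a + i))"
  for f :: "nat \<Rightarrow> 'a::comm_monoid_add"
  by (induction b) (auto simp: add.assoc)

text \<open>The exact sequence for multiplication by \<open>f\<close>: the multiples of
  \<open>f\<close> die on \<open>Z\<close> and stay independent on the irreducible
  \<open>Z'\<close>, while the forms independent on \<open>Z\<close> account for the rest.\<close>

lemma indep_forms_step:
  assumes Z': "closedin (zariski n) Z'" "irreducible_space (subtopology (zariski n) Z')" and sub: "Z \<subseteq> Z'"
    and f: "hpoly n E f" "vanishes f Z" "\<not> vanishes f Z'"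
    and ind: "indep_forms n (e + E) h Z" "indep_forms n e h' Z'"
  shows "indep_forms n (e + E) (h + h') Z'"
proof -
  obtain b where b: "\<And>i. i < h \<Longrightarrow> hpoly n (e + E) (b i)"
    "\<And>c i. vanishes (\<lambda>v. \<Sum>i<h. c i * b i v) Z \<Longrightarrow> i < h \<Longrightarrow> c i = (0::complex)"
    using ind(1) unfolding indep_forms_def by blast
  obtain b' where b': "\<And>i. i < h' \<Longrightarrow> hpoly n e (b' i)"
    "\<And>c i. vanishes (\<lambda>v. \<Sum>i<h'. c i * b' i v) Z' \<Longrightarrow> i < h' \<Longrightarrow> c i = (0::complex)"
    using ind(2) unfolding indep_forms_def by blast
  define B where "B = (\<lambda>i v. if i < h then b i v else f v * b' (i - h) v)"
  have hB: "hpoly n (e + E) (B i)" if "i < h + h'" for i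
  proof (cases "i < h")
    case True
    then show ?thesis using b(1)[of i] by (simp add: B_def[abs_def])
  next
    case False
    then have "hpoly n (E + e) (\<lambda>v. f v * b' (i - h) v)"
      using that by (intro hpoly_mult f(1) b'(1)) auto
    then show ?thesis using False by (simp add: B_def[abs_def] add.commute)
  qed
  have "c i = 0" if c: "vanishes (\<lambda>v. \<Sum>i<h + h'. c i * B i v) Z'" and i: "i < h + h'" for c i
  proof -
    have split: "(\<Sum>i<h + h'. c i * B i v) = (\<Sum>i<h. c i * b i v) + f v * (\<Sum>i<h'. c (h + i) * b' i v)" for v
      unfolding sum_lessThan_plus by (simp add: B_def sum_distrib_left mult_ac)
    have "vanishes (\<lambda>v. \<Sum>i<h. c i * b i v) Z"
      using vanishes_mono[OF c sub] f(2) unfolding split vanishes_def by simp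
    then have c0: "c i = 0" if "i < h" for i
      using b(2) that by blast
    then have "vanishes (\<lambda>v. f v * (\<Sum>i<h'. c (h + i) * b' i v)) Z'"
      using c unfolding split by simp
    moreover have "hpoly n e (\<lambda>v. \<Sum>i<h'. c (h + i) * b' i v)"
      by (intro hpoly_sum hpoly_cmult b'(1)) auto
    ultimately have "vanishes (\<lambda>v. \<Sum>i<h'. c (h + i) * b' i v) Z'"
      using irreducible_mult_nonvanishing[OF Z' f(1,3)] by blast
    then have c1: "c (h + i) = 0" if "i < h'" for i
      using b'(2)[of "\<lambda>i. c (h + i)" i] that by blast
    show ?thesis using c0 c1[of "i - h"] i by (cases "i < h") auto
  qed
  then show ?thesis unfolding indep_forms_def using hB by blast
qed

lemma nonvanishing_coord:
  assumes "Z \<noteq> {}" "Z \<subseteq> proj_space n"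
  obtains i where "i < n" "\<not> vanishes (\<lambda>v. v $ i) Z"
proof -
  obtain p where p: "p \<in> Z" using assms by blast
  then obtain v where v: "v \<in> carrier_vec n" "v \<noteq> 0\<^sub>v n" "p = proj_pt v"
    using assms(2) by (metis proj_space_cases subsetD)
  then obtain i where i: "i < n" "v $ i \<noteq> 0"
    by (metis carrier_vecD eq_vecI index_zero_vec(1) index_zero_vec(2))
  then have "\<not> vanishes (\<lambda>v. v $ i) Z"
    using p v(3) mem_proj_pt unfolding vanishes_def by blast
  then show ?thesis using that i by blast
qed

lemma vanishes_power: "vanishes (\<lambda>v. f v ^ k) Z \<Longrightarrow> vanishes f Z"
  by (auto simp: vanishes_def)

text \<open>Each step of the chain adds up the previous lower bounds, as in Pascal's triangle.
  Degrees are restricted to multiples of some \<open>E\<close> so that the bounds of consecutive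
  steps fit together.\<close>

lemma chain_indep_forms:
  assumes Z: "\<And>i. i \<le> k \<Longrightarrow> closedin (zariski n) (Z i) \<and> irreducible_space (subtopology (zariski n) (Z i))"
    and strict: "\<And>i. i < k \<Longrightarrow> Z i \<subset> Z (Suc i)"
    and "j \<le> k"
  shows "\<exists>E>0. \<forall>q. indep_forms n (E * q) (q choose j) (Z j)"
  using \<open>j \<le> k\<close>
proof (induction j)
  case 0
  have ne: "Z 0 \<noteq> {}" "Z 0 \<subseteq> proj_space n"
    using Z[of 0] closedin_subset[of "zariski n" "Z 0"] by (auto simp: irreducible_space_def)
  then obtain i where i: "i < n" "\<not> vanishes (\<lambda>v. v $ i) (Z 0)"
    using nonvanishing_coord by blast
  \<comment> \<open>A power of a coordinate that does not vanish identically supplies one form in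
    every degree.\<close>
  have "indep_forms n q 1 (Z 0)" for q
  proof -
    obtain p v where pv: "p \<in> Z 0" "v \<in> p" "v $ i \<noteq> 0" using i(2) by (auto simp: vanishes_def)
    have "hpoly n (q * 1) (\<lambda>v. v $ i ^ q)" using i(1) by (intro hpoly_power hpoly_coord)
    then show ?thesis unfolding indep_forms_def
      using pv by (intro exI[of _ "\<lambda>_ v. v $ i ^ q"]) (auto simp: vanishes_def)
  qed
  then show ?case by (intro exI[of _ 1]) auto
next
  case (Suc j)
  then obtain E where E: "E > 0" "\<And>q. indep_forms n (E * q) (q choose j) (Z j)" by auto
  have Z': "closedin (zariski n) (Z (Suc j))" "irreducible_space (subtopology (zariski n) (Z (Suc j)))"
    using Z Suc.prems by auto
  have sub: "Z j \<subset> Z (Suc j)" using strict Suc.prems by auto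
  obtain e f where f: "hpoly n e f" "vanishes f (Z j)" "\<not> vanishes f (Z (Suc j))"
    using closed_vanish_strict[OF _ Z'(1) sub] Z[of j] Suc.prems by auto
  have "Z (Suc j) \<noteq> {}" "Z (Suc j) \<subseteq> proj_space n"
    using sub closedin_subset[OF Z'(1)] by auto
  then obtain i where i: "i < n" "\<not> vanishes (\<lambda>v. v $ i) (Z (Suc j))"
    using nonvanishing_coord by blast
  \<comment> \<open>The separating form is raised to the power \<open>E\<close>, so that its degree
    is a multiple of \<open>E\<close> and the bounds for \<open>Z j\<close> apply. The extra factor
    \<open>v $ i\<close> makes the degree positive whatever \<open>e\<close> is.\<close>
  define E' where "E' = E * (e + 1)"
  define g where "g = (\<lambda>v. (f v * v $ i) ^ E)"
  have g: "hpoly n E' g" "vanishes g (Z j)" "\<not> vanishes g (Z (Suc j))"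
  proof -
    show "hpoly n E' g" unfolding E'_def g_def by (intro hpoly_power hpoly_mult hpoly_coord f i)
    show "vanishes g (Z j)" using f(2) E(1) by (auto simp: g_def vanishes_def)
    have "\<not> vanishes (\<lambda>v. f v * v $ i) (Z (Suc j))"
      using irreducible_mult_nonvanishing[OF Z' f(1,3) hpoly_coord[OF i(1)] i(2)] .
    then show "\<not> vanishes g (Z (Suc j))" unfolding g_def using vanishes_power[of "\<lambda>v. f v * v $ i" E] by blast
  qed
  have "indep_forms n (E' * q) (q choose Suc j) (Z (Suc j))" for q
  proof (induction q)
    case 0
    then show ?case by (simp add: indep_forms_def)
  next
    case (Suc q)
    \<comment> \<open>In degree \<open>E' * (q + 1)\<close> the bound for \<open>Z j\<close> is
      larger than needed; \<open>q choose j\<close> forms are kept to match Pascal's rule.\<close>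
    have "indep_forms n (E * ((e + 1) * (q + 1))) (((e + 1) * (q + 1)) choose j) (Z j)"
      by (rule E(2))
    moreover have "q choose j \<le> ((e + 1) * (q + 1)) choose j"
      by (rule binomial_right_mono) simp
    ultimately have "indep_forms n (E * ((e + 1) * (q + 1))) (q choose j) (Z j)"
      by (rule indep_forms_less)
    moreover have "E * ((e + 1) * (q + 1)) = E' * q + E'"
      by (simp add: E'_def algebra_simps)
    ultimately have "indep_forms n (E' * q + E') (q choose j) (Z j)" by simp
    from indep_forms_step[OF Z' _ g this Suc] sub
    have "indep_forms n (E' * q + E') ((q choose j) + (q choose Suc j)) (Z (Suc j))" by blast
    then show ?case by (simp add: add.commute)
  qed
  moreover have "E' > 0" using E(1) by (simp add: E'_def)
  ultimately show ?case by blast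
qed

section \<open>Upper bound for the dimension: counting lattice points\<close>

lemma forms_dependent_on_orbit:
  assumes "finite I" "\<And>i. i \<in> I \<Longrightarrow> hpoly n e (b i)" "card (supp_chars n d e m) < card I"
  shows "\<exists>c. (\<exists>i\<in>I. c i \<noteq> 0) \<and> (\<forall>t\<in>tor d. (\<Sum>i\<in>I. c i * b i (orbit_vec n d m x t)) = 0)"
proof -
  have "\<forall>i\<in>I. \<exists>a. \<forall>t\<in>tor d. b i (orbit_vec n d m x t) = (\<Sum>\<mu>\<in>supp_chars n d e m. a \<mu> * character d \<mu> t)"
    using hpoly_orbit[OF assms(2), of _ d m x] unfolding laurent_on_def by blast
  then obtain a where a: "\<And>i t. i \<in> I \<Longrightarrow> t \<in> tor d \<Longrightarrow>
      b i (orbit_vec n d m x t) = (\<Sum>\<mu>\<in>supp_chars n d e m. a i \<mu> * character d \<mu> t)"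
    by (auto dest!: bchoice)
  obtain c where c: "\<exists>i\<in>I. c i \<noteq> 0" "\<And>\<mu>. \<mu> \<in> supp_chars n d e m \<Longrightarrow> (\<Sum>i\<in>I. c i * a i \<mu>) = 0"
    using underdetermined_system[OF finite_supp_chars assms(1,3), of a] by auto
  have "(\<Sum>i\<in>I. c i * b i (orbit_vec n d m x t)) = 0" if t: "t \<in> tor d" for t
  proof -
    have "(\<Sum>i\<in>I. c i * b i (orbit_vec n d m x t)) = (\<Sum>\<mu>\<in>supp_chars n d e m. (\<Sum>i\<in>I. c i * a i \<mu>) * character d \<mu> t)"
      using t by (simp add: a sum_distrib_left sum_distrib_right mult.assoc sum.swap[of _ I])
    then show ?thesis using c(2) by simp
  qed
  then show ?thesis using c(1) by blast
qed

lemma indep_forms_orbit_bound: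
  assumes "orbit n d m x \<subseteq> proj_space n" "indep_forms n e h (zariski n closure_of orbit n d m x)"
  shows "h \<le> card (supp_chars n d e m)"
proof (rule ccontr)
  assume "\<not> h \<le> card (supp_chars n d e m)"
  then have less: "card (supp_chars n d e m) < card {..<h}" by simp
  obtain b where b: "\<And>i. i < h \<Longrightarrow> hpoly n e (b i)"
    "\<And>c i. vanishes (\<lambda>v. \<Sum>i<h. c i * b i v) (zariski n closure_of orbit n d m x) \<Longrightarrow> i < h \<Longrightarrow> c i = (0::complex)"
    using assms(2) unfolding indep_forms_def by blast
  obtain c where c: "\<exists>i\<in>{..<h}. c i \<noteq> 0" "\<forall>t\<in>tor d. (\<Sum>i<h. c i * b i (orbit_vec n d m x t)) = 0"
    using forms_dependent_on_orbit[of "{..<h}" n e b d m x] b(1) less by auto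
  have "hpoly n e (\<lambda>v. \<Sum>i<h. c i * b i v)"
    by (intro hpoly_sum hpoly_cmult b(1)) auto
  then have "vanishes (\<lambda>v. \<Sum>i<h. c i * b i v) (zariski n closure_of orbit n d m x)"
    using c(2) vanishes_orbit_closure[OF _ assms(1)] by blast
  then show False using b(2) c(1) by blast
qed

definition int_box :: "nat \<Rightarrow> nat \<Rightarrow> int vec set" where
  "int_box d r = {v \<in> carrier_vec d. \<forall>l<d. \<bar>v $ l\<bar> \<le> int r}"

lemma card_int_box: "finite (int_box d r)" "card (int_box d r) \<le> (2 * r + 1) ^ d"
proof -
  have sub: "int_box d r \<subseteq> vec d ` ({..<d} \<rightarrow>\<^sub>E {- int r..int r})"
  proof
    fix v assume v: "v \<in> int_box d r"
    then have "v = vec d (restrict (($) v) {..<d})" "restrict (($) v) {..<d} \<in> {..<d} \<rightarrow>\<^sub>E {- int r..int r}"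
      by (auto simp: int_box_def abs_le_iff)
    then show "v \<in> vec d ` ({..<d} \<rightarrow>\<^sub>E {- int r..int r})" by blast
  qed
  have fin: "finite ({..<d} \<rightarrow>\<^sub>E {- int r..int r})" by (intro finite_PiE) auto
  show "finite (int_box d r)" using sub fin finite_subset by blast
  have "card (int_box d r) \<le> card ({..<d} \<rightarrow>\<^sub>E {- int r..int r})"
    using card_mono[OF finite_imageI[OF fin] sub] card_image_le[OF fin] le_trans by blast
  also have "\<dots> = (2 * r + 1) ^ d"
  proof -
    have "nat (1 + 2 * int r) = 2 * r + 1" by linarith
    then show ?thesis by (simp add: card_PiE add.commute)
  qed
  finally show "card (int_box d r) \<le> (2 * r + 1) ^ d" .
qed

text \<open>The weight of a monomial of degree \<open>e\<close> is a sum of \<open>e\<close>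
  weights, so its entries grow at most linearly; the number of weights is then polynomial in
  \<open>e\<close> of degree at most \<open>d\<close>.\<close>

lemma supp_chars_box:
  assumes "\<And>i l. i < n \<Longrightarrow> l < d \<Longrightarrow> \<bar>m i $ l\<bar> \<le> int b"
  shows "supp_chars n d e m \<subseteq> int_box d (b * e)"
proof
  fix \<mu> assume "\<mu> \<in> supp_chars n d e m"
  then obtain a where a: "a \<in> monomials n e" "\<mu> = wsum d n (\<lambda>i. int (Poly_Mapping.lookup a i)) m"
    by (auto simp: supp_chars_def)
  have "\<bar>\<mu> $ l\<bar> \<le> int (b * e)" if l: "l < d" for l
  proof -
    have "\<bar>\<mu> $ l\<bar> \<le> (\<Sum>i<n. \<bar>int (Poly_Mapping.lookup a i) * m i $ l\<bar>)"
      using a(2) l by simp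
    also have "\<dots> \<le> (\<Sum>i<n. int (Poly_Mapping.lookup a i) * int b)"
      using assms l by (intro sum_mono) (auto simp: abs_mult intro!: mult_left_mono)
    also have "\<dots> = int (b * (\<Sum>i<n. Poly_Mapping.lookup a i))"
      by (simp add: sum_distrib_left mult.commute)
    also have "(\<Sum>i<n. Poly_Mapping.lookup a i) = e" using a(1) by (simp add: monomials_def)
    finally show ?thesis .
  qed
  then show "\<mu> \<in> int_box d (b * e)" using a(2) by (auto simp: int_box_def)
qed

text \<open>At \<open>q = k * p\<close> the binomial coefficient is at least \<open>p ^ k\<close>,
  since \<open>n choose k\<close> is at least \<open>(n / k) ^ k\<close>.\<close>

lemma polynomial_growth_exponent:
  fixes k d K :: nat
  assumes "\<And>q. q choose k \<le> (K * q + 1) ^ d"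
  shows "k \<le> d"
proof (rule ccontr)
  assume "\<not> k \<le> d"
  then have kd: "Suc d \<le> k" by simp
  \<comment> \<open>\<open>L\<close> satisfies \<open>K * (k * p) + 1 \<le> L * p\<close> for
    positive \<open>p\<close>, and \<open>p\<close> is chosen larger than \<open>L ^ d\<close>,
    which contradicts \<open>p ^ Suc d \<le> L ^ d * p ^ d\<close>.\<close>
  define L where "L = K * k + 1"
  define p where "p = L ^ d + 1"
  have p: "p \<ge> 1" by (simp add: p_def)
  have kp: "k \<le> k * p" using p by simp
  have "(real p) ^ k = (real (k * p) / real k) ^ k" using kd by simp
  also have "\<dots> \<le> real ((k * p) choose k)"
    using binomial_ge_n_over_k_pow_k[OF kp, where ?'a = real] by simp
  finally have "p ^ k \<le> (k * p) choose k" by (simp flip: of_nat_power)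
  also have "\<dots> \<le> (K * (k * p) + 1) ^ d" by (rule assms)
  also have "\<dots> \<le> (L * p) ^ d"
    using p by (intro power_mono) (auto simp: L_def algebra_simps)
  finally have "p ^ k \<le> L ^ d * p ^ d" by (simp add: power_mult_distrib)
  moreover have "p ^ Suc d \<le> p ^ k" using kd p by (intro power_increasing) auto
  ultimately have "p * p ^ d \<le> L ^ d * p ^ d" by (metis order_trans power_Suc)
  moreover have "p ^ d > 0" using p by simp
  ultimately have "p \<le> L ^ d" by (meson mult_le_cancel2)
  then show False by (simp add: p_def)
qed

text \<open>A chain of length \<open>k\<close> forces at least \<open>q choose k\<close> independent
  forms in degree \<open>E * q\<close>; their number is at most that of the lattice points in a box
  of side proportional to \<open>q\<close>.\<close>

lemma krull_dim_orbit_le: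
  assumes orb: "orbit n d m x \<subseteq> proj_space n"
  shows "krull_dim (subtopology (zariski n) (zariski n closure_of orbit n d m x)) \<le> enat d"
  unfolding krull_dim_def
proof (rule SUP_least)
  let ?X = "zariski n closure_of orbit n d m x"
  fix k assume "k \<in> {k. \<exists>Z :: nat \<Rightarrow> complex vec set set.
      (\<forall>i\<le>k. closedin (subtopology (zariski n) ?X) (Z i) \<and>
        irreducible_space (subtopology (subtopology (zariski n) ?X) (Z i))) \<and> (\<forall>i<k. Z i \<subset> Z (Suc i))}"
  then obtain Z :: "nat \<Rightarrow> complex vec set set" where
    Z: "\<And>i. i \<le> k \<Longrightarrow> closedin (subtopology (zariski n) ?X) (Z i)"
    "\<And>i. i \<le> k \<Longrightarrow> irreducible_space (subtopology (subtopology (zariski n) ?X) (Z i))"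
    "\<And>i. i < k \<Longrightarrow> Z i \<subset> Z (Suc i)" by blast
  have clX: "closedin (zariski n) ?X" by simp
  have Zc: "closedin (zariski n) (Z i)" "Z i \<subseteq> ?X" if "i \<le> k" for i
    using Z(1)[OF that] unfolding closedin_closed_subtopology[OF clX] by auto
  have Zi: "irreducible_space (subtopology (zariski n) (Z i))" if "i \<le> k" for i
    using Z(2)[OF that] Zc(2)[OF that] by (simp add: subtopology_subtopology Int_absorb1)
  obtain E where E: "E > 0" "\<And>q. indep_forms n (E * q) (q choose k) (Z k)"
    using chain_indep_forms[of k n Z k] Zc(1) Zi Z(3) by auto
  obtain b where b: "\<And>i l. i < n \<Longrightarrow> l < d \<Longrightarrow> \<bar>m i $ l\<bar> \<le> int b"
  proof
    fix i l assume il: "i < n" "l < d"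
    have "nat \<bar>m i $ l\<bar> \<le> (\<Sum>l<d. nat \<bar>m i $ l\<bar>)"
      using il by (intro member_le_sum) auto
    also have "\<dots> \<le> (\<Sum>i<n. \<Sum>l<d. nat \<bar>m i $ l\<bar>)"
      using il by (intro member_le_sum[of i "{..<n}" "\<lambda>i. \<Sum>l<d. nat \<bar>m i $ l\<bar>"]) auto
    finally show "\<bar>m i $ l\<bar> \<le> int (\<Sum>i<n. \<Sum>l<d. nat \<bar>m i $ l\<bar>)" by linarith
  qed
  have "q choose k \<le> (2 * b * E * q + 1) ^ d" for q
  proof -
    have "q choose k \<le> card (supp_chars n d (E * q) m)"
      by (rule indep_forms_orbit_bound[OF orb indep_forms_mono[OF E(2) Zc(2)]]) simp
    also have "\<dots> \<le> card (int_box d (b * (E * q)))"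
      by (rule card_mono[OF card_int_box(1) supp_chars_box[OF b]])
    also have "\<dots> \<le> (2 * (b * (E * q)) + 1) ^ d" by (rule card_int_box(2))
    finally show ?thesis by (simp add: mult.assoc)
  qed
  then have "k \<le> d" by (rule polynomial_growth_exponent)
  then show "enat k \<le> enat d" by simp
qed

section \<open>Lower bound for the dimension: a chain of subtori\<close>

definition spans :: "nat \<Rightarrow> nat \<Rightarrow> (nat \<Rightarrow> int vec) \<Rightarrow> (nat \<Rightarrow> complex) \<Rightarrow> bool" where
  "spans n d m x \<longleftrightarrow> (\<forall>l<d. \<exists>\<beta> :: nat \<Rightarrow> int. (\<forall>i<n. x i = 0 \<longrightarrow> \<beta> i = 0) \<and>
    (\<Sum>i<n. \<beta> i) = 0 \<and> wsum d n \<beta> m = unit_vec d l)"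

lemma character_unit_vec:
  assumes "l < d" shows "character d (unit_vec d l) t = t $ l"
proof -
  have "character d (unit_vec d l) t = (\<Prod>i<d. if i = l then t $ l else 1)"
    unfolding character_def using assms by (intro prod.cong) auto
  then show ?thesis using assms by simp
qed

text \<open>Restricts a character to the subtorus on which the coordinates from \<open>j\<close> on
  are 1.\<close>

definition trunc_vec :: "nat \<Rightarrow> nat \<Rightarrow> int vec \<Rightarrow> int vec" where
  "trunc_vec d j v = vec d (\<lambda>l. if l < j then v $ l else 0)"

lemma character_trunc:
  "character d (trunc_vec d j v) t = character d v (vec d (\<lambda>l. if l < j then t $ l else 1))"
  by (auto simp: character_def trunc_vec_def intro!: prod.cong)

lemma wsum_trunc: "wsum d n a (\<lambda>i. trunc_vec d j (m i)) = trunc_vec d j (wsum d n a m)"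
  by (intro eq_vecI) (auto simp: trunc_vec_def)

lemma orbit_trunc_subset:
  assumes "i \<le> j" shows "orbit n d (\<lambda>k. trunc_vec d i (m k)) x \<subseteq> orbit n d (\<lambda>k. trunc_vec d j (m k)) x"
proof
  fix p assume "p \<in> orbit n d (\<lambda>k. trunc_vec d i (m k)) x"
  then obtain t where t: "t \<in> tor d" "p = proj_pt (orbit_vec n d (\<lambda>k. trunc_vec d i (m k)) x t)"
    by (auto simp: orbit_def)
  define s where "s = vec d (\<lambda>l. if l < i then t $ l else 1)"
  have s: "s \<in> tor d" using t(1) by (auto simp: s_def tor_iff)
  have "vec d (\<lambda>l. if l < j then s $ l else 1) = s" using assms by (auto simp: s_def)
  then have "orbit_vec n d (\<lambda>k. trunc_vec d i (m k)) x t = orbit_vec n d (\<lambda>k. trunc_vec d j (m k)) x s"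
    unfolding orbit_vec_def character_trunc s_def[symmetric] by simp
  then show "p \<in> orbit n d (\<lambda>k. trunc_vec d j (m k)) x"
    using s t(2) by (auto simp: orbit_def)
qed

text \<open>The positive and negative parts of \<open>\<beta>\<close> have equal degree, so their
  difference is a form. It depends only on \<open>x\<close> and \<open>\<beta>\<close>, hence the
  same form can be evaluated for the original and for the truncated weights.\<close>

lemma binomial_on_orbit:
  fixes \<beta> :: "nat \<Rightarrow> int"
  assumes "(\<Sum>i<n. \<beta> i) = 0" "\<And>i. i < n \<Longrightarrow> x i = 0 \<Longrightarrow> \<beta> i = 0"
  obtains e f where "hpoly n e f"
    "\<And>m t. t \<in> tor d \<Longrightarrow> f (orbit_vec n d m x t) = 0 \<longleftrightarrow> character d (wsum d n \<beta> m) t = 1"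
proof -
  define X where "X = (\<lambda>a. \<Prod>i<n. x i ^ a i)"
  define a where "a = (\<lambda>i. nat (\<beta> i))"
  define b where "b = (\<lambda>i. nat (- \<beta> i))"
  have X: "X a \<noteq> 0" "X b \<noteq> 0"
    using assms(2) by (force simp: X_def a_def b_def)+
  have \<beta>: "\<beta> i = int (a i) - int (b i)" for i by (simp add: a_def b_def)
  have "(\<Sum>i<n. int (a i)) = (\<Sum>i<n. int (b i))"
    using assms(1) by (simp add: \<beta> sum_subtractf)
  then have deg: "(\<Sum>i<n. a i) = (\<Sum>i<n. b i)" by (simp flip: of_nat_sum)
  define mon where "mon = (\<lambda>(a :: nat \<Rightarrow> nat) v. \<Prod>i<n. (v :: complex vec) $ i ^ a i)"
  have hmon: "hpoly n (\<Sum>i<n. a i) (mon a)" for a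
  proof -
    have "hpoly n (\<Sum>i<n. a i * 1) (mon a)" unfolding mon_def
      by (intro hpoly_prod hpoly_power hpoly_coord) auto
    then show ?thesis by simp
  qed
  \<comment> \<open>The crosswise factors \<open>X b\<close> and \<open>X a\<close> cancel the
    contribution of the base point \<open>x\<close>.\<close>
  define f where "f = (\<lambda>v. X b * mon a v - X a * mon b v)"
  have "hpoly n (\<Sum>i<n. a i) f"
    unfolding f_def using hmon[of b] by (intro hpoly_diff hpoly_cmult hmon) (simp add: deg)
  moreover have "f (orbit_vec n d m x t) = 0 \<longleftrightarrow> character d (wsum d n \<beta> m) t = 1" if t: "t \<in> tor d" for m t
  proof -
    have mon: "mon a (orbit_vec n d m x t) = X a * (\<Prod>i<n. character d (m i) t ^ a i)" for a
      by (simp add: mon_def X_def power_mult_distrib prod.distrib)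
    have nz: "(\<Prod>i<n. character d (m i) t ^ b i) \<noteq> 0"
      using character_nonzero[OF t] by simp
    have "character d (wsum d n \<beta> m) t = (\<Prod>i<n. character d (m i) t ^ a i / character d (m i) t ^ b i)"
      unfolding character_wsum[OF t] \<beta>
      by (intro prod.cong refl) (simp add: power_int_diff character_nonzero[OF t])
    also have "\<dots> = (\<Prod>i<n. character d (m i) t ^ a i) / (\<Prod>i<n. character d (m i) t ^ b i)"
      by (rule prod_dividef)
    finally show ?thesis using nz X by (auto simp: f_def mon)
  qed
  ultimately show ?thesis using that by blast
qed

text \<open>The orbit closures of the subtori of the first \<open>j\<close> coordinates form the
  chain. The binomial belonging to the torus coordinate \<open>l\<close> vanishes on step
  \<open>l\<close>, where this coordinate is 1, but not on the next step.\<close>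

lemma krull_dim_orbit_ge:
  assumes x: "i0 < n" "x i0 \<noteq> 0" and sp: "spans n d m x"
  shows "enat d \<le> krull_dim (subtopology (zariski n) (zariski n closure_of orbit n d m x))"
    (is "_ \<le> krull_dim (subtopology _ ?X)")
proof -
  define O' where "O' = (\<lambda>j. orbit n d (\<lambda>k. trunc_vec d j (m k)) x)"
  define Z where "Z = (\<lambda>j. zariski n closure_of O' j)"
  have osp: "O' j \<subseteq> proj_space n" for j unfolding O'_def by (rule orbit_space[where x = x, OF x])
  have trd: "character d (trunc_vec d d v) t = character d v t" for v t
    by (simp add: character_def trunc_vec_def)
  have "orbit_vec n d (\<lambda>k. trunc_vec d d (m k)) x t = orbit_vec n d m x t" for t
    by (intro eq_vecI) (auto simp: orbit_vec_def trd)
  then have Od: "O' d = orbit n d m x"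
    by (simp add: O'_def orbit_def)
  have mono: "Z i \<subseteq> Z j" if "i \<le> j" for i j
    unfolding Z_def O'_def by (intro closure_of_mono orbit_trunc_subset that)
  have strict: "Z l \<subset> Z (Suc l)" if l: "l < d" for l
  proof -
    obtain \<beta> where \<beta>: "\<And>i. i < n \<Longrightarrow> x i = 0 \<Longrightarrow> \<beta> i = 0" "(\<Sum>i<n. \<beta> i) = 0" "wsum d n \<beta> m = unit_vec d l"
      using sp l unfolding spans_def by blast
    obtain e f where f: "hpoly n e f"
      "\<And>m t. t \<in> tor d \<Longrightarrow> f (orbit_vec n d m x t) = 0 \<longleftrightarrow> character d (wsum d n \<beta> m) t = 1"
      using binomial_on_orbit[OF \<beta>(2,1)] by metis
    have "vanishes f (Z l)"
    proof -
      have "trunc_vec d l (unit_vec d l) = 0\<^sub>v d"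
        using l by (intro eq_vecI) (auto simp: trunc_vec_def)
      then show ?thesis
        unfolding Z_def O'_def vanishes_orbit_closure[OF f(1) osp[unfolded O'_def]]
        by (auto simp: f(2) wsum_trunc \<beta>(3) character_0)
    qed
    \<comment> \<open>The point with all torus coordinates equal to 2 witnesses that coordinate
      \<open>l\<close> is no longer constantly 1.\<close>
    moreover have "\<not> vanishes f (Z (Suc l))"
    proof -
      have "trunc_vec d (Suc l) (unit_vec d l) = unit_vec d l"
        using l by (intro eq_vecI) (auto simp: trunc_vec_def)
      then show ?thesis
        unfolding Z_def O'_def vanishes_orbit_closure[OF f(1) osp[unfolded O'_def]]
        by (auto simp: f(2) wsum_trunc \<beta>(3) character_unit_vec[OF l] l intro!: bexI[of _ "vec d (\<lambda>_. 2)"])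
    qed
    ultimately show ?thesis using mono[of l "Suc l"] by auto
  qed
  have "closedin (subtopology (zariski n) ?X) (Z i) \<and>
      irreducible_space (subtopology (subtopology (zariski n) ?X) (Z i))" if "i \<le> d" for i
  proof -
    have sub: "Z i \<subseteq> ?X" using mono[OF that] by (simp add: Z_def Od)
    moreover have "irreducible_space (subtopology (zariski n) (Z i))"
      unfolding Z_def O'_def using irreducible_orbit_closure[where x = x] x by blast
    moreover have "closedin (zariski n) (Z i)" by (simp add: Z_def)
    moreover have "closedin (zariski n) ?X" by simp
    ultimately show ?thesis
      by (simp add: closedin_closed_subtopology subtopology_subtopology Int_absorb1)
  qed
  then show ?thesis
    unfolding krull_dim_def using strict by (intro SUP_upper) blast
qed

lemma krull_dim_orbit:
  assumes "i0 < n" "x i0 \<noteq> 0" "spans n d m x"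
  shows "krull_dim (subtopology (zariski n) (zariski n closure_of orbit n d m x)) = enat d"
  using krull_dim_orbit_le orbit_space[where x = x] krull_dim_orbit_ge[where x = x, OF assms] assms(1,2)
  by (meson order.antisym)

section \<open>Projective invariance of the dimension\<close>

lemma krull_dim_act_le:
  assumes A: "A \<in> carrier (GL TYPE(complex) n)" and X: "closedin (zariski n) X"
  shows "krull_dim (subtopology (zariski n) X) \<le> krull_dim (subtopology (zariski n) (act A ` X))"
  unfolding krull_dim_def
proof (rule SUP_subset_mono[OF _ order.refl], rule Set.subsetI)
  fix k assume "k \<in> {k. \<exists>Z :: nat \<Rightarrow> complex vec set set.
      (\<forall>i\<le>k. closedin (subtopology (zariski n) X) (Z i) \<and>
        irreducible_space (subtopology (subtopology (zariski n) X) (Z i))) \<and> (\<forall>i<k. Z i \<subset> Z (Suc i))}"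
  then obtain Z :: "nat \<Rightarrow> complex vec set set" where
    Z: "\<And>i. i \<le> k \<Longrightarrow> closedin (subtopology (zariski n) X) (Z i)"
    "\<And>i. i \<le> k \<Longrightarrow> irreducible_space (subtopology (subtopology (zariski n) X) (Z i))"
    "\<And>i. i < k \<Longrightarrow> Z i \<subset> Z (Suc i)" by blast
  obtain B where B: "A \<in> carrier_mat n n" "B \<in> carrier_mat n n" "A * B = 1\<^sub>m n" "B * A = 1\<^sub>m n"
    using A by (auto simp: GL_iff)
  then have BG: "B \<in> carrier (GL TYPE(complex) n)" by (auto simp: GL_iff)
  have Zc: "closedin (zariski n) (Z i)" "Z i \<subseteq> X" if "i \<le> k" for i
    using Z(1)[OF that] unfolding closedin_closed_subtopology[OF X] by auto
  have Zs: "Z i \<subseteq> proj_space n" if "i \<le> k" for i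
    using closedin_subset[OF Zc(1)[OF that]] by simp
  have AX: "closedin (zariski n) (act A ` X)" by (rule closedin_act[OF A X])
  have "irreducible_space (subtopology (zariski n) (act A ` Z i))" if i: "i \<le> k" for i
  proof -
    have top: "topspace (subtopology (zariski n) W) = W" if "W \<subseteq> proj_space n" for W
      using that by auto
    have irr: "irreducible_space (subtopology (zariski n) (Z i))"
      using Z(2)[OF i] Zc(2)[OF i] by (simp add: subtopology_subtopology Int_absorb1)
    have cl: "closedin (zariski n) (act A ` Z i)" by (rule closedin_act[OF A Zc(1)[OF i]])
    have inv: "act B ` act A ` Z i = Z i" by (rule act_image_inverse[OF B(1,2,4) Zs[OF i]])
    have split: "P = act A ` Z i \<or> Q = act A ` Z i"
      if PQ: "closedin (zariski n) P" "closedin (zariski n) Q" "P \<union> Q = act A ` Z i" for P Q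
    proof -
      have sp: "P \<subseteq> proj_space n" "Q \<subseteq> proj_space n"
        using closedin_subset[OF PQ(1)] closedin_subset[OF PQ(2)] by simp_all
      have "act B ` P \<union> act B ` Q = Z i" using PQ(3) inv by (metis image_Un)
      moreover have "closedin (zariski n) (act B ` P)" "closedin (zariski n) (act B ` Q)"
        using PQ closedin_act[OF BG] by blast+
      ultimately have "act B ` P = Z i \<or> act B ` Q = Z i"
        using irr unfolding irreducible_space_def top[OF Zs[OF i]] closedin_closed_subtopology[OF Zc(1)[OF i]]
        by (metis Un_upper1 Un_upper2)
      then show ?thesis
        using act_image_inverse[OF B(2,1,3) sp(1)] act_image_inverse[OF B(2,1,3) sp(2)] by auto
    qed
    have ne: "Z i \<noteq> {}" using irr by (auto simp: irreducible_space_def)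
    show ?thesis
      unfolding irreducible_space_def top[OF act_GL_space[OF A Zs[OF i]]] closedin_closed_subtopology[OF cl]
    proof (intro conjI allI impI)
      show "act A ` Z i \<noteq> {}" using ne by simp
    next
      fix P Q
      assume "(closedin (zariski n) P \<and> P \<subseteq> act A ` Z i) \<and>
        (closedin (zariski n) Q \<and> Q \<subseteq> act A ` Z i) \<and> P \<union> Q = act A ` Z i"
      then show "P = act A ` Z i \<or> Q = act A ` Z i" by (intro split) auto
    qed
  qed
  moreover have "act A ` Z i \<subset> act A ` Z (Suc i)" if i: "i < k" for i
  proof -
    have "act A ` Z i \<noteq> act A ` Z (Suc i)"
      using act_image_inverse[OF B(1,2,4) Zs[of i]] act_image_inverse[OF B(1,2,4) Zs[of "Suc i"]] Z(3)[OF i] i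
      by (metis less_imp_le_nat less_irrefl psubset_eq Suc_leI)
    then show ?thesis using Z(3)[OF i] by blast
  qed
  moreover have "closedin (zariski n) (act A ` Z i)" "act A ` Z i \<subseteq> act A ` X" if "i \<le> k" for i
    using closedin_act[OF A Zc(1)[OF that]] Zc(2)[OF that] by auto
  ultimately have "(\<forall>i\<le>k. closedin (subtopology (zariski n) (act A ` X)) (act A ` Z i) \<and>
        irreducible_space (subtopology (subtopology (zariski n) (act A ` X)) (act A ` Z i))) \<and>
        (\<forall>i<k. act A ` Z i \<subset> act A ` Z (Suc i))"
    by (simp add: closedin_closed_subtopology[OF AX] subtopology_subtopology Int_absorb1)
  then show "k \<in> {k. \<exists>Z :: nat \<Rightarrow> complex vec set set.
      (\<forall>i\<le>k. closedin (subtopology (zariski n) (act A ` X)) (Z i) \<and>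
        irreducible_space (subtopology (subtopology (zariski n) (act A ` X)) (Z i))) \<and> (\<forall>i<k. Z i \<subset> Z (Suc i))}"
    by (intro CollectI exI[of _ "\<lambda>i. act A ` Z i"])
qed

lemma krull_dim_act:
  assumes A: "A \<in> carrier (GL TYPE(complex) n)" and X: "closedin (zariski n) X"
  shows "krull_dim (subtopology (zariski n) (act A ` X)) = krull_dim (subtopology (zariski n) X)"
proof (rule antisym)
  obtain B where B: "A \<in> carrier_mat n n" "B \<in> carrier_mat n n" "A * B = 1\<^sub>m n" "B * A = 1\<^sub>m n"
    using A by (auto simp: GL_iff)
  then have BG: "B \<in> carrier (GL TYPE(complex) n)" by (auto simp: GL_iff)
  have "X \<subseteq> proj_space n" using closedin_subset[OF X] by simp
  then show "krull_dim (subtopology (zariski n) (act A ` X)) \<le> krull_dim (subtopology (zariski n) X)"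
    using krull_dim_act_le[OF BG closedin_act[OF A X]] act_image_inverse[OF B(1,2,4)] by simp
qed (rule krull_dim_act_le[OF A X])

section \<open>Change of exponents\<close>

lemma GL_of_injective:
  assumes A: "A \<in> carrier_mat n n"
    and inj: "\<And>v. v \<in> carrier_vec n \<Longrightarrow> A *\<^sub>v v = 0\<^sub>v n \<Longrightarrow> v = 0\<^sub>v n"
  shows "A \<in> carrier (GL TYPE(complex) n)"
proof -
  have "det A \<noteq> 0" using det_0_iff_vec_prod_zero[OF A] inj by blast
  then show ?thesis
    using det_non_zero_imp_unit[OF A, of "()"] by (simp add: GL_def units_of_def)
qed

text \<open>Coordinates of the base point of \<open>X(S)\<close>: \<open>k\<close> ones followed by
  zeros.\<close>

definition wt :: "nat \<Rightarrow> nat \<Rightarrow> complex" where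
  "wt k i = (if i < k then 1 else 0)"

lemma wt_simps [simp]: "i < k \<Longrightarrow> wt k i = 1" "\<not> i < k \<Longrightarrow> wt k i = 0"
  by (auto simp: wt_def)

text \<open>Coordinates with the same weight \<open>m'\<close> stay proportional along the orbit and
  coordinates with \<open>x i = 0\<close> stay zero, so one coordinate per distinct weight is
  enough. The two hypotheses on \<open>t\<close> and \<open>s\<close> allow a change of torus and a
  common scalar \<open>c\<close>, which is invisible projectively.\<close>

lemma collapse_orbit:
  fixes m m' :: "nat \<Rightarrow> int vec" and x :: "nat \<Rightarrow> complex"
  assumes ms: "distinct ms" "set ms = m' ` {i. i < n \<and> x i \<noteq> 0}"
    and fwd: "\<And>t. t \<in> tor d \<Longrightarrow> \<exists>s\<in>tor d'. \<exists>c. c \<noteq> 0 \<and>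
      (\<forall>i<n. x i \<noteq> 0 \<longrightarrow> character d (m i) t = c * character d' (m' i) s)"
    and bwd: "\<And>s. s \<in> tor d' \<Longrightarrow> \<exists>t\<in>tor d. \<exists>c. c \<noteq> 0 \<and>
      (\<forall>i<n. x i \<noteq> 0 \<longrightarrow> character d (m i) t = c * character d' (m' i) s)"
  shows "\<exists>g \<in> carrier (GL TYPE(complex) n). act g ` orbit n d' ((!) ms) (wt (length ms)) = orbit n d m x"
proof -
  define k where "k = length ms"
  have "\<forall>j\<in>{..<k}. \<exists>i. i < n \<and> x i \<noteq> 0 \<and> m' i = ms ! j"
  proof
    fix j assume "j \<in> {..<k}"
    then have "ms ! j \<in> m' ` {i. i < n \<and> x i \<noteq> 0}" using ms(2) by (auto simp: k_def simp flip: ms(2))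
    then show "\<exists>i. i < n \<and> x i \<noteq> 0 \<and> m' i = ms ! j" by auto
  qed
  \<comment> \<open>\<open>r j\<close> is one original coordinate carrying the weight
    \<open>ms ! j\<close>.\<close>
  then obtain r where r: "\<And>j. j < k \<Longrightarrow> r j < n \<and> x (r j) \<noteq> 0 \<and> m' (r j) = ms ! j"
    by (auto dest!: bchoice)
  have ms_eq: "ms ! i = ms ! j \<longleftrightarrow> i = j" if "i < k" "j < k" for i j
    using that ms(1) by (simp add: k_def nth_eq_iff_index_eq)
  have inj: "inj_on r {..<k}"
    by (rule inj_onI) (metis lessThan_iff ms_eq r)
  have rsub: "r ` {..<k} \<subseteq> {..<n}" using r by auto
  have kn: "k \<le> n" using card_inj_on_le[OF inj rsub] by simp
  have "card ({..<n} - r ` {..<k}) = card {k..<n}"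
    using rsub card_image[OF inj] by (subst card_Diff_subset) auto
  \<comment> \<open>The columns beyond \<open>k\<close> are sent to the rows not chosen by
    \<open>r\<close>, to complete the matrix to an invertible one.\<close>
  then obtain p where p: "bij_betw p {k..<n} ({..<n} - r ` {..<k})"
    using finite_same_card_bij[of "{k..<n}" "{..<n} - r ` {..<k}"] by auto
  have pn: "p j < n" "p j \<notin> r ` {..<k}" if "k \<le> j" "j < n" for j
    using bij_betwE[OF p] that by auto
  have pinj: "p i = p j \<longleftrightarrow> i = j" if "k \<le> i" "i < n" "k \<le> j" "j < n" for i j
    using bij_betw_imp_inj_on[OF p] that by (auto simp: inj_on_def)
  \<comment> \<open>Column \<open>j < k\<close> spreads the coordinate of weight
    \<open>ms ! j\<close> over all indices of that weight, scaled by \<open>x\<close>. Row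
    \<open>r j\<close> has no other nonzero entry, so a kernel vector vanishes first on
    \<open>{..<k}\<close> and then, by the rows \<open>p j\<close>, everywhere.\<close>
  define g :: "complex mat" where "g = Matrix.mat n n (\<lambda>(i, j). if j < k
     then (if x i \<noteq> 0 \<and> m' i = ms ! j then x i else 0) else if p j = i then 1 else 0)"
  have gc: "g \<in> carrier_mat n n" by (simp add: g_def)
  have gv: "(g *\<^sub>v v) $ i = (\<Sum>j<n. g $$ (i, j) * v $ j)" if "v \<in> carrier_vec n" "i < n" for v i
    using gc that by (auto simp: scalar_prod_def atLeast0LessThan intro!: sum.cong)
  have G: "g \<in> carrier (GL TYPE(complex) n)"
  proof (rule GL_of_injective[OF gc])
    fix v :: "complex vec" assume v: "v \<in> carrier_vec n" "g *\<^sub>v v = 0\<^sub>v n"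
    have v1: "v $ j = 0" if j: "j < k" for j
    proof -
      have "0 = (\<Sum>l<n. g $$ (r j, l) * v $ l)"
        using gv[OF v(1), of "r j"] v(2) r[OF j] by simp
      also have "\<dots> = (\<Sum>l<n. if l = j then x (r j) * v $ j else 0)"
      proof (intro sum.cong refl)
        fix l assume "l \<in> {..<n}"
        then show "g $$ (r j, l) * v $ l = (if l = j then x (r j) * v $ j else 0)"
          using r[OF j] j ms_eq[of j l] pn(2)[of l] by (auto simp: g_def)
      qed
      also have "\<dots> = x (r j) * v $ j" using j kn by simp
      finally show ?thesis using r[OF j] by simp
    qed
    have v2: "v $ j = 0" if j: "k \<le> j" "j < n" for j
    proof -
      have "0 = (\<Sum>l<n. g $$ (p j, l) * v $ l)"
        using gv[OF v(1), of "p j"] v(2) pn[OF j] by simp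
      also have "\<dots> = (\<Sum>l<n. if l = j then v $ j else 0)"
      proof (intro sum.cong refl)
        fix l assume "l \<in> {..<n}"
        then show "g $$ (p j, l) * v $ l = (if l = j then v $ j else 0)"
          using j pn[OF j] v1[of l] pinj[OF j, of l] by (cases "l < k") (auto simp: g_def)
      qed
      also have "\<dots> = v $ j" using j by simp
      finally show ?thesis by simp
    qed
    show "v = 0\<^sub>v n"
      using v1 v2 v(1) by (intro eq_vecI) (auto simp: not_less[symmetric])
  qed
  have key: "orbit_vec n d m x t = c \<cdot>\<^sub>v (g *\<^sub>v orbit_vec n d' ((!) ms) (wt k) s)"
    if c: "\<forall>i<n. x i \<noteq> 0 \<longrightarrow> character d (m i) t = c * character d' (m' i) s" for t s c
  proof (intro eq_vecI)
    fix i assume "i < dim_vec (c \<cdot>\<^sub>v (g *\<^sub>v orbit_vec n d' ((!) ms) (wt k) s))"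
    then have i: "i < n" using gc by simp
    have "(g *\<^sub>v orbit_vec n d' ((!) ms) (wt k) s) $ i
        = (\<Sum>j<n. g $$ (i, j) * orbit_vec n d' ((!) ms) (wt k) s $ j)"
      by (rule gv) (simp_all add: i)
    also have "\<dots> = (\<Sum>j<n. if j < k \<and> x i \<noteq> 0 \<and> m' i = ms ! j then x i * character d' (m' i) s else 0)"
      using i by (intro sum.cong) (auto simp: g_def)
    also have "\<dots> = x i * character d' (m' i) s"
    proof (cases "x i = 0")
      case False
      then have "m' i \<in> set ms" using ms(2) i by auto
      then obtain j where j: "j < k" "ms ! j = m' i" by (auto simp: in_set_conv_nth k_def)
      have "(\<Sum>l<n. if l < k \<and> x i \<noteq> 0 \<and> m' i = ms ! l then x i * character d' (m' i) s else 0)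
        = (\<Sum>l<n. if l = j then x i * character d' (m' i) s else 0)"
        using j False ms_eq[of j] by (intro sum.cong) auto
      then show ?thesis using j kn by simp
    qed simp
    finally show "orbit_vec n d m x t $ i = (c \<cdot>\<^sub>v (g *\<^sub>v orbit_vec n d' ((!) ms) (wt k) s)) $ i"
      using c i gc by auto
  qed (use gc in auto)
  have key': "act g (proj_pt (orbit_vec n d' ((!) ms) (wt k) s)) = proj_pt (orbit_vec n d m x t)"
    if c: "c \<noteq> 0" "\<forall>i<n. x i \<noteq> 0 \<longrightarrow> character d (m i) t = c * character d' (m' i) s" for t s c
    using key[OF c(2)] c(1) by (simp add: act_proj_pt[OF gc])
  have "act g ` orbit n d' ((!) ms) (wt k) = orbit n d m x"
  proof (rule Set.equalityI; rule Set.subsetI)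
    fix q assume "q \<in> act g ` orbit n d' ((!) ms) (wt k)"
    then obtain s where s: "s \<in> tor d'" "q = act g (proj_pt (orbit_vec n d' ((!) ms) (wt k) s))"
      by (auto simp: orbit_def)
    then show "q \<in> orbit n d m x"
      using bwd[OF s(1)] key' by (auto simp: orbit_def)
  next
    fix q assume "q \<in> orbit n d m x"
    then obtain t where t: "t \<in> tor d" "q = proj_pt (orbit_vec n d m x t)" by (auto simp: orbit_def)
    then obtain s c where s: "s \<in> tor d'" "c \<noteq> 0"
      "\<forall>i<n. x i \<noteq> 0 \<longrightarrow> character d (m i) t = c * character d' (m' i) s"
      using fwd[OF t(1)] by blast
    then have "q = act g (proj_pt (orbit_vec n d' ((!) ms) (wt k) s))"
      using key'[OF s(2,3)] t(2) by simp
    then show "q \<in> act g ` orbit n d' ((!) ms) (wt k)"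
      using s(1) by (auto simp: orbit_def)
  qed
  then show ?thesis using G by (auto simp: k_def)
qed

section \<open>Affinely generating sets\<close>

lemma group_monoid_vec: "group (monoid_vec TYPE(int) d)"
  by (rule groupI) (auto simp: monoid_vec_simps intro!: bexI[of _ "- _"])

lemma inv_monoid_vec:
  assumes "v \<in> carrier_vec d" shows "inv\<^bsub>monoid_vec TYPE(int) d\<^esub> v = - v"
  by (rule group.inv_equality[OF group_monoid_vec]) (use assms in \<open>auto simp: monoid_vec_simps\<close>)

lemma generated_smult:
  assumes G: "G \<subseteq> carrier_vec d" and v: "v \<in> generate (monoid_vec TYPE(int) d) G"
  shows "c \<cdot>\<^sub>v v \<in> generate (monoid_vec TYPE(int) d) G"
proof -
  let ?M = "monoid_vec TYPE(int) d"
  have sub: "subgroup (generate ?M G) ?M"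
    using G by (intro group.generate_is_subgroup[OF group_monoid_vec]) (simp add: monoid_vec_simps)
  have car: "v \<in> carrier_vec d"
    using subgroup.mem_carrier[OF sub v] by (simp add: monoid_vec_simps)
  have nat: "int k \<cdot>\<^sub>v v \<in> generate ?M G" for k
  proof (induction k)
    case 0
    have "int 0 \<cdot>\<^sub>v v = \<one>\<^bsub>?M\<^esub>" using car by (auto simp: monoid_vec_simps)
    then show ?case using subgroup.one_closed[OF sub] by metis
  next
    case (Suc k)
    have "int (Suc k) \<cdot>\<^sub>v v = v \<otimes>\<^bsub>?M\<^esub> (int k \<cdot>\<^sub>v v)"
      using car by (simp add: monoid_vec_simps add_smult_distrib_vec)
    then show ?case using subgroup.m_closed[OF sub v Suc] by simp
  qed
  show ?thesis
  proof (cases "c \<ge> 0")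
    case True
    then show ?thesis using nat[of "nat c"] by simp
  next
    case False
    then have "c \<cdot>\<^sub>v v = - (int (nat (- c)) \<cdot>\<^sub>v v)" by (intro eq_vecI) auto
    also have "\<dots> = inv\<^bsub>?M\<^esub> (int (nat (- c)) \<cdot>\<^sub>v v)"
      using car by (intro inv_monoid_vec[symmetric]) auto
    finally show ?thesis using subgroup.m_inv_closed[OF sub nat] by (simp only:)
  qed
qed

text \<open>The subgroup generated by differences, in the explicit form of integer combinations with
  coefficient sum zero.\<close>

definition diff_combos :: "nat \<Rightarrow> int vec set \<Rightarrow> int vec set" where
  "diff_combos d S = {vec d (\<lambda>l. \<Sum>s\<in>S. \<beta> s * s $ l) | \<beta>. (\<Sum>s\<in>S. \<beta> s) = 0}"

lemma generate_differences:
  assumes S: "S \<subseteq> carrier_vec d" "finite S" "S \<noteq> {}"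
  shows "generate (monoid_vec TYPE(int) d) {m - m' | m m'. m \<in> S \<and> m' \<in> S} = diff_combos d S"
    (is "generate ?M ?D = _")
proof (rule Set.equalityI; rule Set.subsetI)
  have D: "?D \<subseteq> carrier_vec d"
    by (auto intro!: minus_carrier_vec dest: subsetD[OF S(1)])
  have mem: "m - m' \<in> diff_combos d S" if "m \<in> S" "m' \<in> S" for m m'
  proof -
    define \<beta> :: "int vec \<Rightarrow> int" where "\<beta> = (\<lambda>s. (if s = m then 1 else 0) - (if s = m' then 1 else 0))"
    have "(\<Sum>s\<in>S. \<beta> s) = 0" using that S(2) by (simp add: \<beta>_def sum_subtractf)
    moreover have "(\<Sum>s\<in>S. \<beta> s * s $ l) = m $ l - m' $ l" for l
    proof -
      have "(\<Sum>s\<in>S. \<beta> s * s $ l) = (\<Sum>s\<in>S. (if s = m then m $ l else 0) - (if s = m' then m' $ l else 0))"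
        by (intro sum.cong) (auto simp: \<beta>_def)
      then show ?thesis using that S(2) by (simp add: sum_subtractf)
    qed
    then have "m - m' = vec d (\<lambda>l. \<Sum>s\<in>S. \<beta> s * s $ l)"
      using that S(1) by (intro eq_vecI) auto
    ultimately show ?thesis unfolding diff_combos_def by blast
  qed
  fix v
  {
    assume "v \<in> generate ?M ?D"
    then show "v \<in> diff_combos d S"
    proof (induction rule: generate.induct)
      case one
      then show ?case
        unfolding diff_combos_def by (intro CollectI exI[of _ "\<lambda>_. 0"]) (auto simp: monoid_vec_simps)
    next
      case (incl h)
      then show ?case using mem by auto
    next
      case (inv h)
      then obtain m m' where m: "m \<in> S" "m' \<in> S" "h = m - m'" by auto
      then have car: "m \<in> carrier_vec d" "m' \<in> carrier_vec d" using S(1) by auto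
      then have "inv\<^bsub>?M\<^esub> h = m' - m"
        unfolding m(3) by (subst inv_monoid_vec) (auto intro!: eq_vecI minus_carrier_vec)
      then show ?case using mem m by auto
    next
      case (eng h1 h2)
      then obtain \<beta>1 \<beta>2 where "h1 = vec d (\<lambda>l. \<Sum>s\<in>S. \<beta>1 s * s $ l)" "(\<Sum>s\<in>S. \<beta>1 s) = 0"
        "h2 = vec d (\<lambda>l. \<Sum>s\<in>S. \<beta>2 s * s $ l)" "(\<Sum>s\<in>S. \<beta>2 s) = 0"
        unfolding diff_combos_def by blast
      then show ?case
        unfolding diff_combos_def
        by (intro CollectI exI[of _ "\<lambda>s. \<beta>1 s + \<beta>2 s"])
          (auto simp: monoid_vec_simps distrib_right sum.distrib)
    qed
  }
  assume "v \<in> diff_combos d S"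
  then obtain \<beta> where \<beta>: "v = vec d (\<lambda>l. \<Sum>s\<in>S. \<beta> s * s $ l)" "(\<Sum>s\<in>S. \<beta> s) = 0"
    unfolding diff_combos_def by blast
  obtain s0 where s0: "s0 \<in> S" using S(3) by blast
  have sub: "subgroup (generate ?M ?D) ?M"
    using D by (intro group.generate_is_subgroup[OF group_monoid_vec]) (simp add: monoid_vec_simps)
  \<comment> \<open>Subtracting \<open>s0\<close> leaves the full sum unchanged because the
    coefficients add up to 0, but turns every partial sum into a combination of differences.\<close>
  have "vec d (\<lambda>l. \<Sum>s\<in>F. \<beta> s * (s $ l - s0 $ l)) \<in> generate ?M ?D" if "finite F" "F \<subseteq> S" for F
    using that
  proof (induction rule: finite_induct)
    case empty
    have "vec d (\<lambda>l. \<Sum>s\<in>{}. \<beta> s * (s $ l - s0 $ l)) = \<one>\<^bsub>?M\<^esub>"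
      by (auto simp: monoid_vec_simps)
    then show ?case using subgroup.one_closed[OF sub] by metis
  next
    case (insert s F)
    have "vec d (\<lambda>l. \<Sum>s\<in>insert s F. \<beta> s * (s $ l - s0 $ l))
      = (\<beta> s \<cdot>\<^sub>v (s - s0)) \<otimes>\<^bsub>?M\<^esub> vec d (\<lambda>l. \<Sum>s\<in>F. \<beta> s * (s $ l - s0 $ l))"
      using insert.hyps insert.prems S(1) s0 by (intro eq_vecI) (auto simp: monoid_vec_simps)
    moreover have "\<beta> s \<cdot>\<^sub>v (s - s0) \<in> generate ?M ?D"
      using insert.prems s0 by (intro generated_smult[OF D] generate.incl) auto
    ultimately show ?case using subgroup.m_closed[OF sub] insert by auto
  qed
  from this[OF S(2)] have "vec d (\<lambda>l. \<Sum>s\<in>S. \<beta> s * (s $ l - s0 $ l)) \<in> generate ?M ?D" by simp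
  moreover have "(\<Sum>s\<in>S. \<beta> s * (s $ l - s0 $ l)) = (\<Sum>s\<in>S. \<beta> s * s $ l)" for l
  proof -
    have "(\<Sum>s\<in>S. \<beta> s * (s $ l - s0 $ l)) = (\<Sum>s\<in>S. \<beta> s * s $ l) - (\<Sum>s\<in>S. \<beta> s) * s0 $ l"
      by (simp add: right_diff_distrib sum_subtractf sum_distrib_right)
    then show ?thesis using \<beta>(2) by simp
  qed
  ultimately show "v \<in> generate ?M ?D" using \<beta>(1) by simp
qed

lemma sum_nth_distinct:
  assumes "distinct ms" shows "(\<Sum>i<length ms. f (ms ! i)) = (\<Sum>s\<in>set ms. f s)"
  using sum.reindex_bij_betw[OF bij_betw_nth[OF assms refl refl], of f] by simp

lemma affinely_generating_imp_spans:
  assumes ms: "distinct ms" "set ms \<subseteq> carrier_vec d" "ms \<noteq> []" "length ms \<le> n"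
    and gen: "affinely_generating d (set ms)"
  shows "spans n d ((!) ms) (wt (length ms))"
  unfolding spans_def
proof (intro allI impI)
  fix l assume l: "l < d"
  have "unit_vec d l \<in> diff_combos d (set ms)"
    using gen generate_differences[of "set ms" d] ms by (auto simp: affinely_generating_def)
  then obtain \<beta> where \<beta>: "unit_vec d l = vec d (\<lambda>l. \<Sum>s\<in>set ms. \<beta> s * s $ l)" "(\<Sum>s\<in>set ms. \<beta> s) = 0"
    unfolding diff_combos_def by blast
  define \<gamma> where "\<gamma> = (\<lambda>i. if i < length ms then \<beta> (ms ! i) else 0)"
  have restr: "(\<Sum>i<n. \<gamma> i * f i) = (\<Sum>i<length ms. \<beta> (ms ! i) * f i)" for f :: "nat \<Rightarrow> int"
    using ms(4) by (intro sum.mono_neutral_cong_right) (auto simp: \<gamma>_def)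
  have "(\<Sum>i<n. \<gamma> i) = 0"
    using restr[of "\<lambda>_. 1"] \<beta>(2) sum_nth_distinct[OF ms(1), of \<beta>] by simp
  moreover have "wsum d n \<gamma> ((!) ms) = unit_vec d l"
    unfolding \<beta>(1) using restr sum_nth_distinct[OF ms(1), of "\<lambda>s. \<beta> s * s $ _"] by (auto simp: wsum_def)
  ultimately show "\<exists>\<beta>. (\<forall>i<n. wt (length ms) i = 0 \<longrightarrow> \<beta> i = 0) \<and> (\<Sum>i<n. \<beta> i) = 0
      \<and> wsum d n \<beta> ((!) ms) = unit_vec d l"
    by (intro exI[of _ \<gamma>]) (auto simp: \<gamma>_def wt_def)
qed

lemma generating_set_list:
  assumes "S \<in> generating_sets d N" "distinct ms" "set ms = S"
  shows "set ms \<subseteq> carrier_vec d" "ms \<noteq> []" "length ms \<le> Suc N"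
    "spans (Suc N) d ((!) ms) (wt (length ms))"
proof -
  have S: "S \<subseteq> carrier_vec d" "S \<noteq> {}" "card S \<le> N + 1" "affinely_generating d S"
    using assms(1) by (auto simp: generating_sets_def)
  show *: "set ms \<subseteq> carrier_vec d" "ms \<noteq> []" using S assms(3) by auto
  show len: "length ms \<le> Suc N" using S(3) assms(2,3) distinct_card by fastforce
  show "spans (Suc N) d ((!) ms) (wt (length ms))"
    using affinely_generating_imp_spans[OF assms(2) * len] S(4) assms(3) by simp
qed

section \<open>The varieties \<open>X(S)\<close> are toric\<close>

lemma toric_of_orbit:
  assumes "ms \<noteq> []"
  shows "toric_of d N ms = zariski (Suc N) closure_of orbit (Suc N) d ((!) ms) (wt (length ms))"
proof -
  let ?n = "Suc N"
  let ?b = "vec ?n (\<lambda>i. if i < length ms then 1 else 0) :: complex vec"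
  have b: "?b \<noteq> 0\<^sub>v ?n"
  proof
    assume "?b = 0\<^sub>v ?n"
    then have "?b $ 0 = 0" by simp
    then show False using assms by simp
  qed
  have "PGL_act (PGL_class ?n (mat_diag ?n (\<lambda>i. if i < length ms then character d (ms ! i) t else 1)))
      (toric_base_pt N ms) = proj_pt (orbit_vec ?n d ((!) ms) (wt (length ms)) t)" for t
  proof -
    let ?D = "mat_diag ?n (\<lambda>i. if i < length ms then character d (ms ! i) t else 1)"
    have "?D *\<^sub>v ?b = orbit_vec ?n d ((!) ms) (wt (length ms)) t"
      by (intro eq_vecI) (auto simp: mat_diag_def scalar_prod_def orbit_vec_def if_distrib[of "\<lambda>c. c * _"] cong: if_cong)
    then show ?thesis
      using b by (simp add: toric_base_pt_def PGL_act_class proj_pt_in_space act_proj_pt[where n = ?n and k = ?n])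
  qed
  then show ?thesis
    by (simp add: toric_of_def toric_torus_def image_image orbit_def)
qed

lemma closedin_common_zeros:
  assumes "\<And>f. f \<in> F \<Longrightarrow> \<exists>e. hpoly n e f"
  shows "closedin (zariski n) {p \<in> proj_space n. \<forall>f\<in>F. \<forall>v\<in>p. f v = 0}"
proof -
  have "closedin (zariski n) (\<Inter> (insert (proj_space n) ((\<lambda>f. {p \<in> proj_space n. \<forall>v\<in>p. f v = 0}) ` F)))"
    using closedin_topspace[of "zariski n"] assms by (intro closedin_Inter) (auto intro: closedin_hzero)
  moreover have "\<Inter> (insert (proj_space n) ((\<lambda>f. {p \<in> proj_space n. \<forall>v\<in>p. f v = 0}) ` F))
      = {p \<in> proj_space n. \<forall>f\<in>F. \<forall>v\<in>p. f v = 0}" by auto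
  ultimately show ?thesis by simp
qed

lemma scalars_normal: "scalars n \<lhd> GL TYPE(complex) n"
proof -
  interpret group "GL TYPE(complex) n" by (rule group_GL)
  have sc: "c \<cdot>\<^sub>m 1\<^sub>m n \<in> carrier (GL TYPE(complex) n)" if "c \<noteq> 0" for c
    unfolding GL_iff using that
    by (intro conjI bexI[of _ "inverse c \<cdot>\<^sub>m 1\<^sub>m n"])
       (auto simp: mult_smult_assoc_mat[of _ n n] mult_smult_distrib[of _ n n])
  have one: "\<one>\<^bsub>GL TYPE(complex) n\<^esub> = 1\<^sub>m n" by (simp add: GL_def units_of_def ring_mat_def)
  have mul: "(a \<cdot>\<^sub>m 1\<^sub>m n) * (b \<cdot>\<^sub>m 1\<^sub>m n) = (a * b) \<cdot>\<^sub>m (1\<^sub>m n :: complex mat)" for a b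
    by (subst mult_smult_assoc_mat[of _ n n]) (auto intro!: eq_matI)
  have sub: "subgroup (scalars n) (GL TYPE(complex) n)"
  proof (rule subgroupI)
    show "scalars n \<subseteq> carrier (GL TYPE(complex) n)" using sc by (auto simp: scalars_def)
    show "scalars n \<noteq> {}" by (auto simp: scalars_def intro: exI[of _ 1])
    fix a assume "a \<in> scalars n"
    then obtain c where c: "c \<noteq> 0" "a = c \<cdot>\<^sub>m 1\<^sub>m n" by (auto simp: scalars_def)
    have "inv\<^bsub>GL TYPE(complex) n\<^esub> a = inverse c \<cdot>\<^sub>m 1\<^sub>m n"
      using c sc by (intro inv_equality) (auto simp: mul one)
    then show "inv\<^bsub>GL TYPE(complex) n\<^esub> a \<in> scalars n"
      using c by (auto simp: scalars_def)
    fix b assume "b \<in> scalars n"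
    then obtain c' where c': "c' \<noteq> 0" "b = c' \<cdot>\<^sub>m 1\<^sub>m n" by (auto simp: scalars_def)
    then show "a \<otimes>\<^bsub>GL TYPE(complex) n\<^esub> b \<in> scalars n"
      using c mul[of c c'] by (auto simp: scalars_def)
  qed
  show ?thesis
  proof (rule normalI[OF sub], rule ballI)
    fix A assume "A \<in> carrier (GL TYPE(complex) n)"
    then have A: "A \<in> carrier_mat n n" by (simp add: GL_iff)
    have "(c \<cdot>\<^sub>m 1\<^sub>m n) * A = A * (c \<cdot>\<^sub>m 1\<^sub>m n)" for c
    proof -
      have "(c \<cdot>\<^sub>m 1\<^sub>m n) * A = c \<cdot>\<^sub>m A"
        using A by (subst mult_smult_assoc_mat[of _ n n]) auto
      moreover have "A * (c \<cdot>\<^sub>m 1\<^sub>m n) = c \<cdot>\<^sub>m A"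
        using A by (subst mult_smult_distrib[of _ n n]) auto
      ultimately show ?thesis by simp
    qed
    then show "scalars n #>\<^bsub>GL TYPE(complex) n\<^esub> A = A <#\<^bsub>GL TYPE(complex) n\<^esub> scalars n"
      by (auto simp: r_coset_def l_coset_def scalars_def)
  qed
qed

lemma group_PGL: "group (PGL n)"
  unfolding PGL_def by (rule normal.factorgroup_is_group[OF scalars_normal])

lemma PGL_mult:
  assumes "A \<in> carrier (GL TYPE(complex) n)" "B \<in> carrier (GL TYPE(complex) n)"
  shows "PGL_class n A \<otimes>\<^bsub>PGL n\<^esub> PGL_class n B = PGL_class n (A * B)"
  using normal.rcos_sum[OF scalars_normal assms] by (simp add: PGL_def FactGroup_def PGL_class_def)

definition flat :: "nat \<Rightarrow> complex mat \<Rightarrow> complex vec" where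
  "flat n A = vec (n * n) (\<lambda>k. A $$ (k div n, k mod n))"

lemma flat_index:
  "i < n \<Longrightarrow> j < n \<Longrightarrow> i * n + j < n * n" "i < n \<Longrightarrow> j < n \<Longrightarrow> flat n A $ (i * n + j) = A $$ (i, j)"
proof -
  assume ij: "i < n" "j < n"
  have "i * n + j < (i + 1) * n" using ij by simp
  also have "\<dots> \<le> n * n" using ij by (intro mult_right_mono) auto
  finally show *: "i * n + j < n * n" .
  then show "flat n A $ (i * n + j) = A $$ (i, j)" using ij by (simp add: flat_def)
qed

lemma div_mod_less: "k < n * n \<Longrightarrow> k div n < n" "k < n * n \<Longrightarrow> k mod n < n" for k n :: nat
  by (auto simp: less_mult_imp_div_less) (metis mod_less_divisor mult_is_0 not_less_zero neq0_conv)

lemma flat_smult: "A \<in> carrier_mat n n \<Longrightarrow> flat n (c \<cdot>\<^sub>m A) = c \<cdot>\<^sub>v flat n A"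
  by (intro eq_vecI) (auto simp: flat_def div_mod_less)

lemma PGL_pt_class:
  assumes "A \<in> carrier_mat n n" shows "PGL_pt n (PGL_class n A) = proj_pt (flat n A)"
proof -
  have "PGL_pt n (PGL_class n A) = flat n ` {c \<cdot>\<^sub>m A | c. c \<noteq> 0}"
    by (simp add: PGL_pt_def PGL_class_eq[OF assms] flat_def[abs_def])
  then show ?thesis
    by (simp add: proj_pt_def setcompr_eq_image image_image flat_smult[OF assms])
qed

lemma flat_nonzero:
  assumes "A \<in> carrier (GL TYPE(complex) n)" "n > 0" shows "flat n A \<noteq> 0\<^sub>v (n * n)"
proof
  assume 0: "flat n A = 0\<^sub>v (n * n)"
  have A: "A \<in> carrier_mat n n" using assms by (simp add: GL_iff)
  have "A $$ (i, j) = 0" if "i < n" "j < n" for i j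
    using flat_index[OF that] 0 by (metis index_zero_vec(1))
  then have "A = 0\<^sub>m n n" using A by (intro eq_matI) auto
  then have "A *\<^sub>v unit_vec n 0 = 0\<^sub>v n" by auto
  moreover have "(unit_vec n 0 :: complex vec) \<noteq> 0\<^sub>v n"
    using assms(2) by (metis index_unit_vec(1) index_zero_vec(1) zero_neq_one)
  ultimately show False using GL_mult_vec_nonzero[OF assms(1), of "unit_vec n 0"] by simp
qed

lemma flat_carrier [simp]: "flat n A \<in> carrier_vec (n * n)" by (simp add: flat_def)

lemma dim_flat [simp]: "dim_vec (flat n A) = n * n" by (simp add: flat_def)

lemma PGL_pt_space:
  assumes "A \<in> carrier (GL TYPE(complex) n)" "n > 0"
  shows "PGL_pt n (PGL_class n A) \<in> proj_space (n * n)"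
  using assms flat_nonzero[OF assms] by (auto simp: PGL_pt_class GL_iff intro!: proj_pt_in_space)

lemma mat_diag_GL:
  assumes "\<And>i. i < n \<Longrightarrow> f i \<noteq> 0" shows "mat_diag n f \<in> carrier (GL TYPE(complex) n)"
proof -
  have "mat_diag n (\<lambda>i. f i * inverse (f i)) = 1\<^sub>m n" "mat_diag n (\<lambda>i. inverse (f i) * f i) = 1\<^sub>m n"
    using assms by (auto simp: mat_diag_def intro!: eq_matI)
  then show ?thesis
    unfolding GL_iff by (intro conjI bexI[of _ "mat_diag n (\<lambda>i. inverse (f i))"]) auto
qed

text \<open>The vector \<open>\<beta> l\<close> describes a degree zero Laurent monomial in the
  diagonal entries whose value is the torus coordinate \<open>l\<close>. It yields injectivity, the
  regular inverse and the reconstruction of \<open>t\<close> from a matrix.\<close>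

locale toric_param =
  fixes n d :: nat and \<mu> :: "nat \<Rightarrow> int vec" and \<beta> :: "nat \<Rightarrow> nat \<Rightarrow> int"
  assumes n: "n > 0" and \<mu>: "\<And>i. \<mu> i \<in> carrier_vec d"
    and \<beta>0: "\<And>l. l < d \<Longrightarrow> (\<Sum>i<n. \<beta> l i) = 0"
    and \<beta>: "\<And>l. l < d \<Longrightarrow> wsum d n (\<beta> l) \<mu> = unit_vec d l"
begin

definition "D t = mat_diag n (\<lambda>i. character d (\<mu> i) t)"
definition "\<phi> t = PGL_class n (D t)"
definition "T = \<phi> ` tor d"

lemma D_carrier: "D t \<in> carrier_mat n n" by (simp add: D_def)

lemma D_GL: "t \<in> tor d \<Longrightarrow> D t \<in> carrier (GL TYPE(complex) n)"
  unfolding D_def by (intro mat_diag_GL character_nonzero)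

lemma D_index: "i < n \<Longrightarrow> j < n \<Longrightarrow> D t $$ (i, j) = (if i = j then character d (\<mu> i) t else 0)"
  by (auto simp: D_def mat_diag_def)

lemma prod_character_\<beta>:
  assumes "t \<in> tor d" "l < d" shows "(\<Prod>i<n. character d (\<mu> i) t powi \<beta> l i) = t $ l"
  using character_wsum[OF assms(1), of n "\<beta> l" \<mu>] \<beta>[OF assms(2)] character_unit_vec[OF assms(2), of t]
  by simp

lemma \<phi>_PGL: "t \<in> tor d \<Longrightarrow> \<phi> t \<in> carrier (PGL n)"
  unfolding \<phi>_def carrier_PGL using D_GL by blast

lemma \<phi>_mult:
  assumes "s \<in> tor d" "t \<in> tor d" shows "\<phi> (s \<otimes>\<^bsub>torus d\<^esub> t) = \<phi> s \<otimes>\<^bsub>PGL n\<^esub> \<phi> t"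
proof -
  have eq: "s \<otimes>\<^bsub>torus d\<^esub> t = tmul s t"
    using assms(1) by (auto simp: torus_def tmul_def)
  show ?thesis unfolding eq \<phi>_def PGL_mult[OF D_GL[OF assms(1)] D_GL[OF assms(2)]]
    using assms by (simp add: D_def character_tmul)
qed

lemma \<phi>_inj: "inj_on \<phi> (tor d)"
proof (rule inj_onI)
  fix s t assume st: "s \<in> tor d" "t \<in> tor d" "\<phi> s = \<phi> t"
  have "D s \<in> \<phi> s"
    unfolding \<phi>_def PGL_class_eq[OF D_carrier] by (intro CollectI exI[of _ 1]) auto
  then obtain c where c: "c \<noteq> 0" "D s = c \<cdot>\<^sub>m D t"
    using st(3) unfolding \<phi>_def PGL_class_eq[OF D_carrier] by auto
  have ch: "character d (\<mu> i) s = c * character d (\<mu> i) t" if "i < n" for i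
  proof -
    have "D s $$ (i, i) = (c \<cdot>\<^sub>m D t) $$ (i, i)" using c by simp
    then show ?thesis using that D_carrier[of t] D_index[OF that that] by simp
  qed
  have "s $ l = t $ l" if l: "l < d" for l
  proof -
    have "s $ l = (\<Prod>i<n. c powi \<beta> l i * character d (\<mu> i) t powi \<beta> l i)"
      unfolding prod_character_\<beta>[OF st(1) l, symmetric] by (simp add: ch power_int_mult_distrib)
    also have "\<dots> = c powi (\<Sum>i<n. \<beta> l i) * t $ l"
      using c(1) by (simp add: prod.distrib prod_character_\<beta>[OF st(2) l] power_int_sum)
    finally show ?thesis using \<beta>0[OF l] by simp
  qed
  then show "s = t" using st by (intro eq_vecI) (auto simp: tor_iff)
qed

lemma torus_group: "group (torus d)"
proof (rule groupI)
  fix t assume t: "t \<in> tor d"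
  show "\<exists>s\<in>tor d. s \<otimes>\<^bsub>torus d\<^esub> t = \<one>\<^bsub>torus d\<^esub>"
    using t by (intro bexI[of _ "vec d (\<lambda>i. inverse (t $ i))"]) (auto simp: torus_def)
qed (auto simp: torus_def mult.assoc)

lemma T_subgroup: "subgroup T (PGL n)"
proof -
  have "group_hom (torus d) (PGL n) \<phi>"
    using torus_group group_PGL \<phi>_PGL \<phi>_mult
    by (auto simp: group_hom_def group_hom_axioms_def hom_def)
  then show ?thesis
    unfolding T_def by (rule group_hom.img_is_subgroup)
qed

lemma exponent_bound:
  fixes f :: "'i \<Rightarrow> 'j \<Rightarrow> int"
  assumes "finite I" "finite J"
  obtains b :: nat where "\<And>i j. i \<in> I \<Longrightarrow> j \<in> J \<Longrightarrow> \<bar>f i j\<bar> \<le> int b"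
proof -
  have "\<bar>f i j\<bar> \<le> int (\<Sum>p\<in>I \<times> J. nat \<bar>f (fst p) (snd p)\<bar>)" if "i \<in> I" "j \<in> J" for i j
  proof -
    have "nat \<bar>f i j\<bar> \<le> (\<Sum>p\<in>I \<times> J. nat \<bar>f (fst p) (snd p)\<bar>)"
      using that assms member_le_sum[of "(i, j)" "I \<times> J" "\<lambda>p. nat \<bar>f (fst p) (snd p)\<bar>"] by auto
    then show ?thesis by linarith
  qed
  then show ?thesis using that by blast
qed

text \<open>A common monomial factor clears the denominators of all entries, and powers of the
  coordinate 0 make the degrees equal; one global chart is enough.\<close>

lemma \<phi>_regular: "regular_map (Suc d) torus_pt (tor d) (n * n) (PGL_pt n) T \<phi>"
proof -
  obtain b where b: "\<And>i l. i \<in> {..<n} \<Longrightarrow> l \<in> {..<d} \<Longrightarrow> \<bar>\<mu> i $ l\<bar> \<le> int b"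
    using exponent_bound[of "{..<n}" "{..<d}" "\<lambda>i l. \<mu> i $ l"] by blast
  \<comment> \<open>The shifted exponents lie between 0 and \<open>2 * b\<close>, so
    \<open>e = 2 * b * d\<close> leaves room for homogenization.\<close>
  define a where "a = (\<lambda>i l. nat (\<mu> i $ l + int b))"
  define e where "e = 2 * b * d"
  have a_le: "(\<Sum>l<d. a i l) \<le> e" if "i < n" for i
  proof -
    have "(\<Sum>l<d. a i l) \<le> (\<Sum>l<d. 2 * b)"
      using b[of i] that by (intro sum_mono) (force simp: a_def abs_le_iff)
    then show ?thesis by (simp add: e_def mult.commute)
  qed
  define f where "f = (\<lambda>k (v :: complex vec). if k div n = k mod n
      then v $ 0 ^ (e - (\<Sum>l<d. a (k div n) l)) * (\<Prod>l<d. v $ Suc l ^ a (k div n) l) else 0)"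
  have hf: "hpoly (Suc d) e (f k)" if "k < n * n" for k
  proof (cases "k div n = k mod n")
    case True
    let ?i = "k div n"
    have "hpoly (Suc d) ((e - (\<Sum>l<d. a ?i l)) * 1 + (\<Sum>l<d. a ?i l * 1))
      (\<lambda>v. v $ 0 ^ (e - (\<Sum>l<d. a ?i l)) * (\<Prod>l<d. v $ Suc l ^ a ?i l))"
      by (intro hpoly_mult hpoly_power hpoly_coord hpoly_prod) auto
    moreover have "(e - (\<Sum>l<d. a ?i l)) * 1 + (\<Sum>l<d. a ?i l * 1) = e"
      using a_le[of ?i] div_mod_less[OF that] by simp
    ultimately show ?thesis using True by (simp add: f_def)
  next
    case False
    then show ?thesis by (simp add: f_def hpoly_0)
  qed
  have "\<forall>k\<in>{..<n * n}. \<exists>F. homogeneous (Suc d) e F \<and> (\<forall>v\<in>carrier_vec (Suc d). f k v = poly_eval F v)"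
    using hf unfolding hpoly_def by blast
  then obtain F where F: "\<And>k. k < n * n \<Longrightarrow> homogeneous (Suc d) e (F k)"
    "\<And>k v. k < n * n \<Longrightarrow> v \<in> carrier_vec (Suc d) \<Longrightarrow> f k v = poly_eval (F k) v"
    by (auto dest!: bchoice)
  have "vec (n * n) (\<lambda>k. poly_eval (F k) v) \<in> PGL_pt n (\<phi> t)" if t: "t \<in> tor d" and v: "v \<in> torus_pt t" for t v
  proof -
    obtain c where c: "c \<noteq> 0" "v = c \<cdot>\<^sub>v vCons 1 t" using v by (auto simp: torus_pt_def proj_pt_def)
    have tc: "t \<in> carrier_vec d" "\<And>l. l < d \<Longrightarrow> t $ l \<noteq> 0" using t by (auto simp: tor_iff)
    have vc: "v \<in> carrier_vec (Suc d)" using c tc by simp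
    have v0: "v $ 0 = c" "\<And>l. l < d \<Longrightarrow> v $ Suc l = c * t $ l" using c tc by auto
    \<comment> \<open>The common factor of all entries: scaling of the representative times the
      cleared denominator.\<close>
    define C where "C = c ^ e * (\<Prod>l<d. t $ l ^ b)"
    have "f k v = C * D t $$ (k div n, k mod n)" if k: "k < n * n" for k
    proof (cases "k div n = k mod n")
      case True
      let ?i = "k div n"
      have i: "?i < n" using div_mod_less[OF k] by simp
      have "(\<Prod>l<d. v $ Suc l ^ a ?i l) = c ^ (\<Sum>l<d. a ?i l) * (\<Prod>l<d. t $ l ^ a ?i l)"
        by (simp add: v0 power_mult_distrib prod.distrib power_sum)
      moreover have "(\<Prod>l<d. t $ l ^ a ?i l) = (\<Prod>l<d. t $ l ^ b * t $ l powi (\<mu> ?i $ l))"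
      proof (intro prod.cong refl)
        fix l assume l: "l \<in> {..<d}"
        have "\<mu> ?i $ l + int b \<ge> 0" using b[of ?i l] i l by auto
        then have "t $ l ^ a ?i l = t $ l powi (\<mu> ?i $ l + int b)"
          unfolding a_def by (simp add: power_int_def)
        then show "t $ l ^ a ?i l = t $ l ^ b * t $ l powi (\<mu> ?i $ l)"
          using tc(2) l by (simp add: power_int_add)
      qed
      moreover have "c ^ (e - (\<Sum>l<d. a ?i l)) * c ^ (\<Sum>l<d. a ?i l) = c ^ e"
        using a_le[OF i] by (simp flip: power_add)
      ultimately have "f k v = c ^ e * (\<Prod>l<d. t $ l ^ b * t $ l powi (\<mu> ?i $ l))"
        using True by (simp add: f_def v0 flip: mult.assoc)
      then show ?thesis
        using True i D_index[of ?i ?i t] by (simp add: C_def character_def prod.distrib mult.assoc)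
    next
      case False
      then show ?thesis using div_mod_less[OF k] by (simp add: f_def D_index)
    qed
    then have "vec (n * n) (\<lambda>k. poly_eval (F k) v) = C \<cdot>\<^sub>v flat n (D t)"
      using F(2) vc by (intro eq_vecI) (auto simp: flat_def)
    moreover have "C \<noteq> 0" using c(1) tc(2) by (simp add: C_def)
    ultimately show ?thesis
      unfolding \<phi>_def PGL_pt_class[OF D_carrier] by (auto simp: proj_pt_def)
  qed
  moreover have "torus_pt t \<in> proj_space (Suc d)" if "t \<in> tor d" for t
    using that unfolding torus_pt_def
    by (intro proj_pt_in_space) (auto simp: tor_iff dest: arg_cong[of _ _ "\<lambda>v. v $ 0"])
  moreover have "openin (zariski (Suc d)) (proj_space (Suc d))"
    using openin_topspace[of "zariski (Suc d)"] by simp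
  ultimately show ?thesis
    unfolding regular_map_def T_def using F(1) by (auto intro!: exI[of _ "proj_space (Suc d)"] exI[of _ e] exI[of _ F])
qed

text \<open>The monomials \<open>\<beta> l\<close> in the diagonal entries recover the coordinates
  of \<open>t\<close>; multiplying each of them by the power \<open>b\<close> of all diagonal
  entries makes the exponents natural.\<close>

lemma \<phi>_inverse_regular:
  "regular_map (n * n) (PGL_pt n) T (Suc d) torus_pt (tor d) (inv_into (tor d) \<phi>)"
proof -
  obtain b where b: "\<And>l i. l \<in> {..<d} \<Longrightarrow> i \<in> {..<n} \<Longrightarrow> \<bar>\<beta> l i\<bar> \<le> int b"
    using exponent_bound[of "{..<d}" "{..<n}" "\<lambda>l i. \<beta> l i"] by blast
  \<comment> \<open>Coordinate 0 of the embedding is 1 and contributes only the shift. All degrees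
    equal \<open>n * b\<close> because each \<open>\<beta> l\<close> has sum zero.\<close>
  define a where "a = (\<lambda>k i. case k of 0 \<Rightarrow> b | Suc l \<Rightarrow> nat (\<beta> l i + int b))"
  define e where "e = n * b"
  have deg: "(\<Sum>i<n. a k i) = e" if "k < Suc d" for k
  proof (cases k)
    case (Suc l)
    then have l: "l < d" using that by simp
    have nn: "\<beta> l i + int b \<ge> 0" if "i < n" for i
      using b[of l i] l that by auto
    have "int (\<Sum>i<n. a k i) = (\<Sum>i<n. \<beta> l i + int b)"
      unfolding of_nat_sum Suc a_def using nn by (intro sum.cong) auto
    also have "\<dots> = int e" using \<beta>0[OF l] by (simp add: sum.distrib e_def)
    finally show ?thesis by (simp only: of_nat_eq_iff)
  qed (simp add: a_def e_def)
  define f where "f = (\<lambda>k (v :: complex vec). \<Prod>i<n. v $ (i * n + i) ^ a k i)"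
  have hf: "hpoly (n * n) e (f k)" if "k < Suc d" for k
  proof -
    have "hpoly (n * n) (\<Sum>i<n. a k i * 1) (f k)"
      unfolding f_def by (intro hpoly_prod hpoly_power hpoly_coord flat_index(1)) auto
    then show ?thesis using deg[OF that] by simp
  qed
  have "\<forall>k\<in>{..<Suc d}. \<exists>F. homogeneous (n * n) e F \<and> (\<forall>v\<in>carrier_vec (n * n). f k v = poly_eval F v)"
    using hf unfolding hpoly_def by blast
  then obtain F where F: "\<And>k. k < Suc d \<Longrightarrow> homogeneous (n * n) e (F k)"
    "\<And>k v. k < Suc d \<Longrightarrow> v \<in> carrier_vec (n * n) \<Longrightarrow> f k v = poly_eval (F k) v"
    by (auto dest!: bchoice)
  have "vec (Suc d) (\<lambda>k. poly_eval (F k) v) \<in> torus_pt t" if t: "t \<in> tor d" and v: "v \<in> PGL_pt n (\<phi> t)" for t v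
  proof -
    obtain c where c: "c \<noteq> 0" "v = c \<cdot>\<^sub>v flat n (D t)"
      using v unfolding \<phi>_def PGL_pt_class[OF D_carrier] by (auto simp: proj_pt_def)
    have vc: "v \<in> carrier_vec (n * n)" using c by simp
    have vi: "v $ (i * n + i) = c * character d (\<mu> i) t" if "i < n" for i
      using c flat_index[OF that that] D_index[OF that that] by simp
    have f: "f k v = c ^ e * (\<Prod>i<n. character d (\<mu> i) t ^ a k i)" if "k < Suc d" for k
    proof -
      have "f k v = (\<Prod>i<n. c ^ a k i * character d (\<mu> i) t ^ a k i)"
        unfolding f_def by (intro prod.cong) (auto simp: vi power_mult_distrib)
      then show ?thesis using deg[OF that] by (simp add: prod.distrib flip: power_sum)
    qed
    define C where "C = c ^ e * (\<Prod>i<n. character d (\<mu> i) t ^ b)"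
    have f0: "f 0 v = C" by (simp add: f C_def a_def)
    have fS: "f (Suc l) v = C * t $ l" if l: "l < d" for l
    proof -
      have "(\<Prod>i<n. character d (\<mu> i) t ^ a (Suc l) i)
          = (\<Prod>i<n. character d (\<mu> i) t ^ b * character d (\<mu> i) t powi \<beta> l i)"
      proof (intro prod.cong refl)
        fix i assume i: "i \<in> {..<n}"
        have "\<beta> l i + int b \<ge> 0" using b[of l i] i l by auto
        then have "character d (\<mu> i) t ^ a (Suc l) i = character d (\<mu> i) t powi (\<beta> l i + int b)"
          unfolding a_def by (simp add: power_int_def)
        then show "character d (\<mu> i) t ^ a (Suc l) i = character d (\<mu> i) t ^ b * character d (\<mu> i) t powi \<beta> l i"
          using character_nonzero[OF t] by (simp add: power_int_add)
      qed
      then show ?thesis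
        using l by (simp add: f C_def prod.distrib prod_character_\<beta>[OF t l])
    qed
    have "vec (Suc d) (\<lambda>k. poly_eval (F k) v) = C \<cdot>\<^sub>v vCons 1 t"
    proof (intro eq_vecI)
      fix k assume "k < dim_vec (C \<cdot>\<^sub>v vCons 1 t)"
      then have k: "k < Suc d" using t by (auto simp: tor_iff)
      have "vec (Suc d) (\<lambda>k. poly_eval (F k) v) $ k = f k v" using k F(2)[OF k vc] by simp
      also have "\<dots> = (C \<cdot>\<^sub>v vCons 1 t) $ k"
        using k t by (cases k) (auto simp: f0 fS tor_iff)
      finally show "vec (Suc d) (\<lambda>k. poly_eval (F k) v) $ k = (C \<cdot>\<^sub>v vCons 1 t) $ k" .
    qed (use t in \<open>auto simp: tor_iff\<close>)
    moreover have "C \<noteq> 0" using c(1) character_nonzero[OF t] by (simp add: C_def)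
    ultimately show ?thesis
      unfolding torus_pt_def by (auto simp: proj_pt_def)
  qed
  then have reg: "vec (Suc d) (\<lambda>k. poly_eval (F k) v) \<in> torus_pt (inv_into (tor d) \<phi> g)"
    if "g \<in> T" "v \<in> PGL_pt n g" for g v
    using that \<phi>_inj by (auto simp: T_def inv_into_f_f)
  have "PGL_pt n g \<in> proj_space (n * n)" if "g \<in> T" for g
    using that PGL_pt_space[OF D_GL n] by (auto simp: T_def \<phi>_def)
  moreover have "openin (zariski (n * n)) (proj_space (n * n))"
    using openin_topspace[of "zariski (n * n)"] by simp
  moreover have "inv_into (tor d) \<phi> \<in> T \<rightarrow> tor d"
    by (auto simp: T_def intro: inv_into_into)
  ultimately show ?thesis
    unfolding regular_map_def using F(1) reg
    by (auto intro!: exI[of _ "proj_space (n * n)"] exI[of _ e] exI[of _ F])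
qed

text \<open>The off-diagonal entries and the binomials of all degree zero relations between the
  weights cut out the torus: a diagonal matrix satisfying every relation is reconstructed from its
  values under the monomials \<open>\<beta> l\<close>.\<close>

lemma T_closed: "closedin (subtopology (zariski (n * n)) (PGL_pt n ` carrier (PGL n))) (PGL_pt n ` T)"
proof -
  define rels where "rels = {\<gamma> :: nat \<Rightarrow> int. (\<Sum>i<n. \<gamma> i) = 0 \<and> wsum d n \<gamma> \<mu> = 0\<^sub>v d}"
  define mon where "mon = (\<lambda>(a :: nat \<Rightarrow> nat) v. \<Prod>i<n. (v :: complex vec) $ (i * n + i) ^ a i)"
  define bin where "bin = (\<lambda>(\<gamma> :: nat \<Rightarrow> int) v. mon (\<lambda>i. nat (\<gamma> i)) v - mon (\<lambda>i. nat (- \<gamma> i)) v)"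
  define F where "F = {\<lambda>v. v $ k | k. k < n * n \<and> k div n \<noteq> k mod n} \<union> bin ` rels"
  define Z where "Z = {p \<in> proj_space (n * n). \<forall>f\<in>F. \<forall>v\<in>p. f v = 0}"
  have hmon: "hpoly (n * n) (\<Sum>i<n. a i) (mon a)" for a
  proof -
    have "hpoly (n * n) (\<Sum>i<n. a i * 1) (mon a)"
      unfolding mon_def by (intro hpoly_prod hpoly_power hpoly_coord flat_index(1)) auto
    then show ?thesis by simp
  qed
  have hbin: "\<exists>e. hpoly (n * n) e (bin \<gamma>)" if "\<gamma> \<in> rels" for \<gamma>
  proof -
    have "(\<Sum>i<n. \<gamma> i) = (\<Sum>i<n. int (nat (\<gamma> i)) - int (nat (- \<gamma> i)))"
      by (intro sum.cong) auto
    moreover have "(\<Sum>i<n. \<gamma> i) = 0" using that by (simp add: rels_def)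
    ultimately have "(\<Sum>i<n. int (nat (\<gamma> i))) = (\<Sum>i<n. int (nat (- \<gamma> i)))"
      by (simp only: sum_subtractf)
    then have "(\<Sum>i<n. nat (\<gamma> i)) = (\<Sum>i<n. nat (- \<gamma> i))"
      by (simp only: of_nat_sum[symmetric] of_nat_eq_iff)
    then show ?thesis
      unfolding bin_def using hmon[of "\<lambda>i. nat (- \<gamma> i)"]
      by (intro exI[of _ "\<Sum>i<n. nat (\<gamma> i)"] hpoly_diff hmon) simp
  qed
  have "closedin (zariski (n * n)) Z"
    unfolding Z_def
  proof (rule closedin_common_zeros)
    fix f assume "f \<in> F"
    then show "\<exists>e. hpoly (n * n) e f"
      unfolding F_def using hpoly_coord hbin by blast
  qed
  moreover have "PGL_pt n ` T = Z \<inter> PGL_pt n ` carrier (PGL n)"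
  proof (rule Set.equalityI; rule Set.subsetI)
    fix p assume "p \<in> PGL_pt n ` T"
    then obtain t where t: "t \<in> tor d" "p = PGL_pt n (\<phi> t)" by (auto simp: T_def)
    have ps: "p \<in> proj_space (n * n)" using PGL_pt_space[OF D_GL[OF t(1)] n] t(2) by (simp add: \<phi>_def)
    have "f v = 0" if f: "f \<in> F" and v: "v \<in> p" for f v
    proof -
      obtain c where c: "c \<noteq> 0" "v = c \<cdot>\<^sub>v flat n (D t)"
        using v t(2) unfolding \<phi>_def PGL_pt_class[OF D_carrier] by (auto simp: proj_pt_def)
      have vi: "v $ (i * n + i) = c * character d (\<mu> i) t" if "i < n" for i
        using c flat_index[OF that that] D_index[OF that that] by simp
      consider k where "k < n * n" "k div n \<noteq> k mod n" "f = (\<lambda>v. v $ k)" | \<gamma> where "\<gamma> \<in> rels" "f = bin \<gamma>"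
        using f by (auto simp: F_def)
      then show ?thesis
      proof cases
        case 1
        then show ?thesis using c div_mod_less[OF 1(1)] by (simp add: flat_def D_index)
      next
        case 2
        have "\<gamma> i = int (nat (\<gamma> i)) - int (nat (- \<gamma> i))" for i by simp
        have "(\<Prod>i<n. v $ (i * n + i) powi \<gamma> i) = c powi (\<Sum>i<n. \<gamma> i) * character d (wsum d n \<gamma> \<mu>) t"
          unfolding character_wsum[OF t(1)] using c(1)
          by (simp add: vi power_int_mult_distrib prod.distrib power_int_sum)
        also have "\<dots> = 1" using 2(1) by (simp add: rels_def character_0)
        finally have one: "(\<Prod>i<n. v $ (i * n + i) powi \<gamma> i) = 1" .
        have nz: "v $ (i * n + i) \<noteq> 0" if "i < n" for i
          using vi[OF that] c(1) character_nonzero[OF t(1)] by simp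
        have "mon (\<lambda>i. nat (\<gamma> i)) v = (\<Prod>i<n. v $ (i * n + i) powi \<gamma> i * v $ (i * n + i) ^ nat (- \<gamma> i))"
          unfolding mon_def
        proof (intro prod.cong refl)
          fix i assume "i \<in> {..<n}"
          then have "v $ (i * n + i) \<noteq> 0" using nz by simp
          then show "v $ (i * n + i) ^ nat (\<gamma> i) = v $ (i * n + i) powi \<gamma> i * v $ (i * n + i) ^ nat (- \<gamma> i)"
            by (cases "\<gamma> i \<ge> 0") (auto simp: power_int_def power_inverse)
        qed
        then show ?thesis using one 2(2) by (simp add: bin_def mon_def prod.distrib)
      qed
    qed
    then have "p \<in> Z" using ps by (auto simp: Z_def)
    moreover have "p \<in> PGL_pt n ` carrier (PGL n)" using t \<phi>_PGL by blast
    ultimately show "p \<in> Z \<inter> PGL_pt n ` carrier (PGL n)" by blast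
  next
    fix p assume "p \<in> Z \<inter> PGL_pt n ` carrier (PGL n)"
    then obtain A where p: "p \<in> Z" and A: "A \<in> carrier (GL TYPE(complex) n)" "p = PGL_pt n (PGL_class n A)"
      by (auto simp: carrier_PGL)
    have Ac: "A \<in> carrier_mat n n" using A by (simp add: GL_iff)
    have "flat n A \<in> p" unfolding A(2) PGL_pt_class[OF Ac] by simp
    then have zero: "f (flat n A) = 0" if "f \<in> F" for f using p that by (auto simp: Z_def)
    have off: "A $$ (i, j) = 0" if ij: "i < n" "j < n" "i \<noteq> j" for i j
    proof -
      have "(\<lambda>v :: complex vec. v $ (i * n + j)) \<in> F"
        unfolding F_def using ij flat_index(1)[OF ij(1,2)] by (intro UnI1 CollectI exI[of _ "i * n + j"]) auto
      then show ?thesis using zero flat_index(2)[OF ij(1,2)] by metis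
    qed
    define \<alpha> where "\<alpha> = (\<lambda>i. A $$ (i, i))"
    have \<alpha>0: "\<alpha> i \<noteq> 0" if i: "i < n" for i
    proof
      assume "\<alpha> i = 0"
      then have "A *\<^sub>v unit_vec n i = 0\<^sub>v n"
      proof (intro eq_vecI)
        fix j assume "j < dim_vec (0\<^sub>v n :: complex vec)"
        then show "(A *\<^sub>v unit_vec n i) $ j = 0\<^sub>v n $ j"
          using Ac i off[of j i] \<open>\<alpha> i = 0\<close> by (cases "j = i") (auto simp: \<alpha>_def)
      qed (use Ac in auto)
      moreover have "(unit_vec n i :: complex vec) \<noteq> 0\<^sub>v n"
        using i by (metis index_unit_vec(1) index_zero_vec(1) zero_neq_one)
      ultimately show False using GL_mult_vec_nonzero[OF A(1), of "unit_vec n i"] by simp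
    qed
    have rel: "(\<Prod>i<n. \<alpha> i powi \<gamma> i) = 1" if "(\<Sum>i<n. \<gamma> i) = 0" "wsum d n \<gamma> \<mu> = 0\<^sub>v d" for \<gamma>
    proof -
      have "bin \<gamma> (flat n A) = 0" using that by (intro zero) (auto simp: F_def rels_def)
      then have eq: "(\<Prod>i<n. \<alpha> i ^ nat (\<gamma> i)) = (\<Prod>i<n. \<alpha> i ^ nat (- \<gamma> i))"
        by (simp add: bin_def mon_def flat_index(2) \<alpha>_def)
      have "(\<Prod>i<n. \<alpha> i powi \<gamma> i) = (\<Prod>i<n. \<alpha> i ^ nat (\<gamma> i) / \<alpha> i ^ nat (- \<gamma> i))"
        using \<alpha>0 by (intro prod.cong refl) (auto simp: power_int_def power_inverse divide_inverse)
      also have "\<dots> = 1"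
        unfolding prod_dividef eq using \<alpha>0 by simp
      finally show ?thesis .
    qed
    \<comment> \<open>The candidate preimage, with coordinates read off through
      \<open>\<beta>\<close>.\<close>
    define t where "t = vec d (\<lambda>l. \<Prod>i<n. \<alpha> i powi \<beta> l i)"
    have t: "t \<in> tor d" using \<alpha>0 by (auto simp: t_def)
    have quot: "\<alpha> i * character d (\<mu> 0) t = \<alpha> 0 * character d (\<mu> i) t" if i: "i < n" for i
    proof -
      define q where "q = \<mu> i - \<mu> 0"
      have qc: "q \<in> carrier_vec d" using \<mu> by (auto simp: q_def intro!: minus_carrier_vec)
      \<comment> \<open>\<open>\<gamma>0\<close> writes \<open>\<mu> i - \<mu> 0\<close> through the
        generators \<open>\<beta>\<close>. Comparing this with the obvious expression gives the
        relation \<open>\<gamma>\<close>, which forces the ratio of two diagonal entries to be a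
        character value of \<open>t\<close>.\<close>
      define \<gamma>0 where "\<gamma>0 = (\<lambda>j. \<Sum>l<d. q $ l * \<beta> l j)"
      define \<gamma> where "\<gamma> = (\<lambda>j. \<gamma>0 j - (if j = i then 1 else 0) + (if j = 0 then 1 else 0))"
      have "(\<Sum>j<n. \<gamma>0 j) = 0"
        unfolding \<gamma>0_def by (subst sum.swap) (simp add: \<beta>0 flip: sum_distrib_left)
      then have s0: "(\<Sum>j<n. \<gamma> j) = 0" using i n by (simp add: \<gamma>_def sum.distrib sum_subtractf)
      have "wsum d n \<gamma> \<mu> = 0\<^sub>v d"
      proof (intro eq_vecI)
        fix k assume "k < dim_vec (0\<^sub>v d :: int vec)"
        then have k: "k < d" by simp
        have "(\<Sum>j<n. \<gamma>0 j * \<mu> j $ k) = (\<Sum>l<d. q $ l * (\<Sum>j<n. \<beta> l j * \<mu> j $ k))"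
          unfolding \<gamma>0_def sum_distrib_left sum_distrib_right by (subst sum.swap) (simp add: mult.assoc)
        also have "\<dots> = (\<Sum>l<d. if l = k then q $ k else 0)"
        proof (intro sum.cong refl)
          fix l assume l: "l \<in> {..<d}"
          have "(\<Sum>j<n. \<beta> l j * \<mu> j $ k) = unit_vec d l $ k"
            using \<beta>[of l] l k by (metis lessThan_iff wsum_index)
          then show "q $ l * (\<Sum>j<n. \<beta> l j * \<mu> j $ k) = (if l = k then q $ k else 0)"
            using l k by simp
        qed
        also have "\<dots> = q $ k" using k by simp
        finally have 1: "(\<Sum>j<n. \<gamma>0 j * \<mu> j $ k) = \<mu> i $ k - \<mu> 0 $ k"
          using k carrier_vecD[OF \<mu>, of 0] by (simp add: q_def)
        have "(\<Sum>j<n. \<gamma> j * \<mu> j $ k) = (\<Sum>j<n. \<gamma>0 j * \<mu> j $ k - (if j = i then \<mu> i $ k else 0) + (if j = 0 then \<mu> 0 $ k else 0))"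
          by (intro sum.cong) (auto simp: \<gamma>_def algebra_simps)
        also have "\<dots> = 0" using i n 1 by (simp add: sum.distrib sum_subtractf)
        finally show "wsum d n \<gamma> \<mu> $ k = 0\<^sub>v d $ k" using k by simp
      qed simp
      from rel[OF s0 this] have "(\<Prod>j<n. \<alpha> j powi \<gamma> j) = 1" .
      moreover have "(\<Prod>j<n. \<alpha> j powi \<gamma> j)
          = (\<Prod>j<n. \<alpha> j powi \<gamma>0 j / (if j = i then \<alpha> i else 1) * (if j = 0 then \<alpha> 0 else 1))"
        using \<alpha>0 by (intro prod.cong refl) (auto simp: \<gamma>_def power_int_add power_int_diff)
      moreover have "\<dots> = (\<Prod>j<n. \<alpha> j powi \<gamma>0 j) / \<alpha> i * \<alpha> 0"
        using i n by (simp add: prod.distrib prod_dividef)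
      moreover have "(\<Prod>j<n. \<alpha> j powi \<gamma>0 j) = character d q t"
      proof -
        have "(\<Prod>j<n. \<alpha> j powi \<gamma>0 j) = (\<Prod>j<n. \<Prod>l<d. (\<alpha> j powi \<beta> l j) powi (q $ l))"
          using \<alpha>0 by (intro prod.cong refl) (simp add: \<gamma>0_def power_int_sum mult.commute flip: power_int_mult)
        also have "\<dots> = character d q t"
          by (subst prod.swap) (simp add: character_def t_def power_int_prod)
        finally show ?thesis .
      qed
      moreover have "character d q t = character d (\<mu> i) t / character d (\<mu> 0) t"
        unfolding q_def by (rule character_diff[OF t \<mu> \<mu>])
      ultimately show ?thesis
        using \<alpha>0[OF i] character_nonzero[OF t, of "\<mu> 0"] by (simp add: field_simps)
    qed
    define c where "c = \<alpha> 0 / character d (\<mu> 0) t"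
    have c: "c \<noteq> 0" using \<alpha>0[OF n] character_nonzero[OF t] by (simp add: c_def)
    have "A = c \<cdot>\<^sub>m D t"
    proof (intro eq_matI)
      fix i j assume "i < dim_row (c \<cdot>\<^sub>m D t)" "j < dim_col (c \<cdot>\<^sub>m D t)"
      then have ij: "i < n" "j < n" using D_carrier[of t] by auto
      show "A $$ (i, j) = (c \<cdot>\<^sub>m D t) $$ (i, j)"
      proof (cases "i = j")
        case True
        then have "A $$ (i, j) = \<alpha> i" by (simp add: \<alpha>_def)
        also have "\<dots> = c * character d (\<mu> i) t"
          using quot[OF ij(1)] character_nonzero[OF t, of "\<mu> 0"] by (simp add: c_def field_simps)
        finally show ?thesis using True ij D_carrier[of t] by (simp add: D_index)
      next
        case False
        then show ?thesis using ij D_carrier[of t] by (simp add: D_index off)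
      qed
    qed (use Ac D_carrier[of t] in auto)
    then have "p = PGL_pt n (\<phi> t)"
      unfolding A(2) \<phi>_def PGL_pt_class[OF Ac] PGL_pt_class[OF D_carrier]
      using c by (simp add: flat_smult[OF D_carrier])
    then show "p \<in> PGL_pt n ` T" using t by (auto simp: T_def)
  qed
  ultimately show ?thesis by (auto simp: closedin_subtopology)
qed

lemma T_subtorus: "subtorus n T"
proof -
  have "\<phi> \<in> iso (torus d) (PGL n\<lparr>carrier := T\<rparr>)"
    using \<phi>_inj \<phi>_mult by (auto simp: iso_def hom_def bij_betw_def T_def)
  then show ?thesis
    unfolding subtorus_def using T_subgroup T_closed \<phi>_regular \<phi>_inverse_regular by blast
qed

end

lemma toric_of_in_toric_subvarieties:
  assumes S: "S \<in> generating_sets d N" "distinct ms" "set ms = S"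
  shows "toric_of d N ms \<in> toric_subvarieties d N"
proof -
  note L = generating_set_list[OF S]
  \<comment> \<open>The ones on the diagonal of \<open>toric_torus\<close> are the trivial
    character, hence weight 0 beyond the list; the coefficients \<open>\<beta>\<close> vanish
    there.\<close>
  define \<mu> where "\<mu> = (\<lambda>i. if i < length ms then ms ! i else 0\<^sub>v d)"
  have \<mu>: "\<mu> i \<in> carrier_vec d" for i using L(1) by (auto simp: \<mu>_def)
  obtain \<beta> where \<beta>: "\<And>l. l < d \<Longrightarrow> (\<forall>i<Suc N. wt (length ms) i = 0 \<longrightarrow> \<beta> l i = 0) \<and>
    (\<Sum>i<Suc N. \<beta> l i) = 0 \<and> wsum d (Suc N) (\<beta> l) ((!) ms) = unit_vec d l"
    using L(4) unfolding spans_def by metis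
  have "\<beta> l i * \<mu> i $ k = \<beta> l i * ms ! i $ k" if "l < d" "i < Suc N" for l i k
    using \<beta>[OF that(1)] that(2) by (auto simp: \<mu>_def wt_def)
  then have "wsum d (Suc N) (\<beta> l) \<mu> = wsum d (Suc N) (\<beta> l) ((!) ms)" if "l < d" for l
    unfolding wsum_def using that by (intro arg_cong[of _ _ "vec d"] ext sum.cong) auto
  then interpret toric_param "Suc N" d \<mu> \<beta>
    using \<beta> \<mu> by unfold_locales auto
  have T: "toric_torus d N ms = T"
    unfolding toric_torus_def T_def \<phi>_def D_def
    by (intro image_cong refl arg_cong[of _ _ "PGL_class (Suc N)"] arg_cong[of _ _ "mat_diag (Suc N)"] ext)
       (auto simp: \<mu>_def character_0)
  have len: "0 < length ms" using L(2) by simp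
  have "toric_base_pt N ms \<in> proj_space (Suc N)"
    unfolding toric_base_pt_def using len
    by (intro proj_pt_in_space) (auto dest: arg_cong[of _ _ "\<lambda>v. v $ 0"])
  then have "toric N (toric_of d N ms)"
    unfolding toric_def using T_subtorus T by (auto simp: toric_of_def)
  moreover have "krull_dim (subtopology (zariski (Suc N)) (toric_of d N ms)) = enat d"
    unfolding toric_of_orbit[OF L(2)]
  proof (rule krull_dim_orbit[OF _ _ L(4)])
    show "0 < Suc N" "wt (length ms) 0 \<noteq> 0" using len by auto
  qed
  ultimately show ?thesis by (simp add: toric_subvarieties_def)
qed

section \<open>Diagonalizing subtori\<close>

lemma dedekind_independence:
  fixes h :: "'i \<Rightarrow> complex vec \<Rightarrow> complex"
  assumes "finite I"
    and mult: "\<And>i s t. i \<in> I \<Longrightarrow> s \<in> tor d \<Longrightarrow> t \<in> tor d \<Longrightarrow> h i (tmul s t) = h i s * h i t"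
    and nz: "\<And>i t. i \<in> I \<Longrightarrow> t \<in> tor d \<Longrightarrow> h i t \<noteq> 0"
    and dist: "\<And>i j. i \<in> I \<Longrightarrow> j \<in> I \<Longrightarrow> i \<noteq> j \<Longrightarrow> \<exists>t\<in>tor d. h i t \<noteq> h j t"
    and eq: "\<And>t. t \<in> tor d \<Longrightarrow> (\<Sum>i\<in>I. c i * h i t) = 0"
  shows "\<forall>i\<in>I. c i = 0"
  using assms
proof (induction I arbitrary: c rule: finite_induct)
  case (insert k I)
  have c0: "c i = 0" if i: "i \<in> I" for i
  proof -
    obtain s where s: "s \<in> tor d" "h i s \<noteq> h k s"
      using insert.prems(3)[of i k] insert.hyps i by auto
    have "(\<Sum>i\<in>I. c i * (h i s - h k s) * h i t) = 0" if t: "t \<in> tor d" for t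
    proof -
      have "(\<Sum>i\<in>insert k I. c i * h i (tmul s t)) - h k s * (\<Sum>i\<in>insert k I. c i * h i t) = 0"
        using insert.prems(4) tmul_tor[OF s(1) t] t by simp
      moreover have "h i (tmul s t) = h i s * h i t" if "i \<in> insert k I" for i
        using insert.prems(1) that s(1) t by blast
      ultimately show ?thesis
        using insert.hyps by (simp add: sum_distrib_left algebra_simps flip: sum_subtractf)
    qed
    then have "\<forall>i\<in>I. c i * (h i s - h k s) = 0"
      using insert.prems by (intro insert.IH) auto
    then show ?thesis using i s(2) by auto
  qed
  then have "c k * h k (vec d (\<lambda>_. 1)) = 0"
    using insert.prems(4)[of "vec d (\<lambda>_. 1)"] insert.hyps by simp
  then show ?case using c0 insert.prems(2)[of k "vec d (\<lambda>_. 1)"] by auto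
qed simp

lemma character_inj:
  assumes "m \<in> carrier_vec d" "m' \<in> carrier_vec d" "m \<noteq> m'"
  shows "\<exists>t\<in>tor d. character d m t \<noteq> character d m' t"
  using assms prime_val_inj[of d]
  by (intro bexI[of _ "prime_pt d"]) (auto simp: character_prime_pt inj_on_def)

text \<open>If \<open>\<chi>\<close> were no character, the functions \<open>\<chi>\<close> times a
  character of \<open>M\<close> and the characters of \<open>M'\<close> would be pairwise distinct
  homomorphisms. Their independence then kills all coefficients of \<open>A\<close>.\<close>

lemma rational_homomorphism_is_character:
  assumes mult: "\<And>s t. s \<in> tor d \<Longrightarrow> t \<in> tor d \<Longrightarrow> \<chi> (tmul s t) = \<chi> s * \<chi> t"
    and nz: "\<And>t. t \<in> tor d \<Longrightarrow> \<chi> t \<noteq> 0"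
    and A: "laurent_on d M A" and B: "laurent_on d M' B" and "t0 \<in> tor d" "A t0 \<noteq> 0"
    and eq: "\<And>t. t \<in> tor d \<Longrightarrow> \<chi> t * A t = B t"
  obtains m where "m \<in> carrier_vec d" "\<And>t. t \<in> tor d \<Longrightarrow> \<chi> t = character d m t"
proof -
  obtain a where a: "finite M" "M \<subseteq> carrier_vec d" "\<And>t. t \<in> tor d \<Longrightarrow> A t = (\<Sum>m\<in>M. a m * character d m t)"
    using A unfolding laurent_on_def by blast
  obtain b where b: "finite M'" "M' \<subseteq> carrier_vec d" "\<And>t. t \<in> tor d \<Longrightarrow> B t = (\<Sum>m\<in>M'. b m * character d m t)"
    using B unfolding laurent_on_def by blast
  have "\<exists>m\<in>carrier_vec d. \<forall>t\<in>tor d. \<chi> t = character d m t"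
  proof (rule ccontr)
    assume neg: "\<not> ?thesis"
    \<comment> \<open>The disjoint sum keeps the two families apart even when \<open>M\<close> and
      \<open>M'\<close> overlap.\<close>
    define I where "I = Inl ` M \<union> Inr ` M'"
    define h where "h = (\<lambda>i t. case i of Inl m \<Rightarrow> \<chi> t * character d m t | Inr m \<Rightarrow> character d m t)"
    define c where "c = (\<lambda>i. case i of Inl m \<Rightarrow> a m | Inr m \<Rightarrow> - b m)"
    have mixed: "\<exists>t\<in>tor d. \<chi> t * character d m t \<noteq> character d m' t" if m: "m \<in> M" "m' \<in> M'" for m m'
    proof -
      have mc: "m \<in> carrier_vec d" "m' \<in> carrier_vec d" using m a(2) b(2) by auto
      then have "m' - m \<in> carrier_vec d" by simp
      then obtain t where "t \<in> tor d" "\<chi> t \<noteq> character d (m' - m) t" using neg by blast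
      then show ?thesis
        using character_nonzero[of t d m] by (auto simp: character_diff[OF _ mc(2,1)] field_simps)
    qed
    have "\<forall>i\<in>I. c i = 0"
    proof (rule dedekind_independence[of I d h])
      show "finite I" using a(1) b(1) by (simp add: I_def)
      fix i assume i: "i \<in> I"
      show "h i (tmul s t) = h i s * h i t" if "s \<in> tor d" "t \<in> tor d" for s t
        using that by (auto simp: h_def mult character_tmul split: sum.split)
      show "h i t \<noteq> 0" if "t \<in> tor d" for t
        using that by (auto simp: h_def nz character_nonzero split: sum.split)
      fix j assume j: "j \<in> I" "i \<noteq> j"
      show "\<exists>t\<in>tor d. h i t \<noteq> h j t"
      proof (cases i; cases j)
        fix m m' assume ij: "i = Inl m" "j = Inl m'"
        then obtain t where "t \<in> tor d" "character d m t \<noteq> character d m' t"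
          using i j a(2) character_inj[of m d m'] by (auto simp: I_def)
        then show ?thesis using nz ij by (intro bexI[of _ t]) (auto simp: h_def)
      next
        fix m m' assume ij: "i = Inr m" "j = Inr m'"
        then obtain t where "t \<in> tor d" "character d m t \<noteq> character d m' t"
          using i j b(2) character_inj[of m d m'] by (auto simp: I_def)
        then show ?thesis using ij by (intro bexI[of _ t]) (auto simp: h_def)
      next
        fix m m' assume "i = Inl m" "j = Inr m'"
        then show ?thesis using mixed[of m m'] i j by (auto simp: h_def I_def)
      next
        fix m m' assume "i = Inr m" "j = Inl m'"
        then show ?thesis using mixed[of m' m] i j by (auto simp: h_def I_def) metis
      qed
    next
      fix t assume t: "t \<in> tor d"
      have "(\<Sum>i\<in>I. c i * h i t) = (\<Sum>m\<in>M. a m * (\<chi> t * character d m t)) + (\<Sum>m\<in>M'. - b m * character d m t)"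
        unfolding I_def using a(1) b(1)
        by (subst sum.union_disjoint) (auto simp: sum.reindex c_def h_def)
      also have "(\<Sum>m\<in>M. a m * (\<chi> t * character d m t)) = \<chi> t * A t"
        using a(3)[OF t] by (simp add: sum_distrib_left mult_ac)
      also have "(\<Sum>m\<in>M'. - b m * character d m t) = - B t"
        using b(3)[OF t] by (simp add: sum_negf)
      finally show "(\<Sum>i\<in>I. c i * h i t) = 0" using eq[OF t] by simp
    qed
    then have "a m = 0" if "m \<in> M" for m using that by (force simp: I_def c_def)
    then show False using a(3)[OF \<open>t0 \<in> tor d\<close>] \<open>A t0 \<noteq> 0\<close> by simp
  qed
  then show ?thesis using that by blast
qed

section \<open>Powers of Jordan matrices\<close>

lemma diag_block_mat_Cons_index:
  assumes "i < sum_list (map dim_row (A # As))" "j < sum_list (map dim_col (A # As))"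
  shows "diag_block_mat (A # As) $$ (i, j) =
    (if i < dim_row A then if j < dim_col A then A $$ (i, j) else 0
     else if j < dim_col A then 0 else diag_block_mat As $$ (i - dim_row A, j - dim_col A))"
  using assms by (auto simp: Let_def dim_diag_block_mat)

lemma jordan_matrix_pow_Cons:
  "jordan_matrix (na # n_as) ^\<^sub>m r = diag_block_mat ((jordan_block (fst na) (snd na) ^\<^sub>m r) #
    map (\<lambda>(n, a). jordan_block n a ^\<^sub>m r) n_as)"
  by (simp add: jordan_matrix_pow case_prod_beta del: diag_block_mat.simps)

lemma sum_list_dims_jordan_pow:
  "sum_list (map dim_row (map (\<lambda>(n, a). jordan_block n a ^\<^sub>m r) n_as)) = sum_list (map fst n_as)"
  "sum_list (map dim_col (map (\<lambda>(n, a). jordan_block n a ^\<^sub>m r) n_as)) = sum_list (map fst n_as)"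
  by (induction n_as) auto

text \<open>The first row of a block of size at least 2 shows the linear factor \<open>r\<close>.
  The position \<open>i\<close> is the same for all powers, which allows the two entries to be
  compared as sequences in \<open>r\<close>.\<close>

lemma jordan_matrix_pow_superdiagonal:
  fixes n_as :: "(nat \<times> complex) list"
  assumes "(s, a) \<in> set n_as" "s \<ge> 2"
  shows "\<exists>i. Suc i < sum_list (map fst n_as) \<and> (\<forall>r. (jordan_matrix n_as ^\<^sub>m r) $$ (i, i) = a ^ r \<and>
    (jordan_matrix n_as ^\<^sub>m r) $$ (i, Suc i) = of_nat r * a ^ (r - 1))"
  using assms(1)
proof (induction n_as)
  case (Cons na n_as)
  show ?case
  proof (cases "na = (s, a)")
    case True
    have "(jordan_matrix (na # n_as) ^\<^sub>m r) $$ (0, 0) = a ^ r \<and>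
      (jordan_matrix (na # n_as) ^\<^sub>m r) $$ (0, Suc 0) = of_nat r * a ^ (r - 1)" for r
      unfolding jordan_matrix_pow_Cons using assms(2) True
      by (subst (1 2) diag_block_mat_Cons_index) (auto simp: jordan_block_pow simp del: map_map)
    then show ?thesis using True assms(2) by (intro exI[of _ 0]) auto
  next
    case False
    then obtain i where i: "Suc i < sum_list (map fst n_as)"
      "\<And>r. (jordan_matrix n_as ^\<^sub>m r) $$ (i, i) = a ^ r"
      "\<And>r. (jordan_matrix n_as ^\<^sub>m r) $$ (i, Suc i) = of_nat r * a ^ (r - 1)"
      using Cons by auto
    obtain n b where na: "na = (n, b)" by force
    have "(jordan_matrix (na # n_as) ^\<^sub>m r) $$ (n + i, n + i) = a ^ r \<and>
      (jordan_matrix (na # n_as) ^\<^sub>m r) $$ (n + i, Suc (n + i)) = of_nat r * a ^ (r - 1)" for r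
    proof -
      have 1: "(jordan_matrix (na # n_as) ^\<^sub>m r) $$ (n + i, n + j) = (jordan_matrix n_as ^\<^sub>m r) $$ (i, j)"
        if "j < sum_list (map fst n_as)" for j
        unfolding jordan_matrix_pow_Cons using i(1) that
        by (subst diag_block_mat_Cons_index)
           (simp_all add: na sum_list_dims_jordan_pow jordan_matrix_pow del: diag_block_mat.simps map_map)
      show ?thesis using 1[of i] 1[of "Suc i"] i by simp
    qed
    then show ?thesis using i(1) na by (intro exI[of _ "n + i"]) auto
  qed
qed simp

lemma jordan_matrix_pow_diagonal:
  fixes n_as :: "(nat \<times> complex) list"
  assumes "\<forall>na\<in>set n_as. fst na = 1" "i < length n_as" "j < length n_as" "i \<noteq> j"
  shows "(jordan_matrix n_as ^\<^sub>m r) $$ (i, j) = 0"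
  using assms
proof (induction n_as arbitrary: i j)
  case (Cons na n_as)
  have len: "sum_list (map fst n_as) = length n_as"
    using Cons.prems(1) by (induction n_as) auto
  show ?case
    unfolding jordan_matrix_pow_Cons using Cons.prems Cons.IH[of "i - 1" "j - 1"] len
    by (subst diag_block_mat_Cons_index)
       (auto simp: sum_list_dims_jordan_pow jordan_matrix_pow simp del: diag_block_mat.simps map_map)
qed simp

lemma laurent_on_lincomb:
  assumes "finite M" "M \<subseteq> carrier_vec d" "\<And>i. i \<in> I \<Longrightarrow> laurent_on d M (f i)"
  shows "laurent_on d M (\<lambda>t. \<Sum>i\<in>I. c i * f i t)"
proof -
  obtain a where a: "\<And>i t. i \<in> I \<Longrightarrow> t \<in> tor d \<Longrightarrow> f i t = (\<Sum>m\<in>M. a i m * character d m t)"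
    using assms(3) unfolding laurent_on_def by metis
  have "(\<Sum>i\<in>I. c i * f i t) = (\<Sum>m\<in>M. (\<Sum>i\<in>I. c i * a i m) * character d m t)" if "t \<in> tor d" for t
  proof -
    have "(\<Sum>i\<in>I. c i * f i t) = (\<Sum>i\<in>I. \<Sum>m\<in>M. c i * a i m * character d m t)"
      using that by (intro sum.cong) (auto simp: a sum_distrib_left mult.assoc)
    also have "\<dots> = (\<Sum>m\<in>M. \<Sum>i\<in>I. c i * a i m * character d m t)" by (rule sum.swap)
    finally show ?thesis by (simp add: sum_distrib_right)
  qed
  then show ?thesis
    using assms(1,2) unfolding laurent_on_def
    by (intro conjI exI[of _ "\<lambda>m. \<Sum>i\<in>I. c i * a i m"]) auto
qed

text \<open>Entries of a conjugate are fixed linear combinations of the entries of \<open>H\<close>,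
  so they stay Laurent polynomials over the same set of characters.\<close>

lemma mat_sandwich_index:
  fixes Q H P :: "complex mat"
  assumes "Q \<in> carrier_mat n n" "H \<in> carrier_mat n n" "P \<in> carrier_mat n n" "i < n" "j < n"
  shows "(Q * H * P) $$ (i, j) = (\<Sum>p\<in>{..<n} \<times> {..<n}. Q $$ (i, fst p) * P $$ (snd p, j) * H $$ p)"
proof -
  have "(Q * H * P) $$ (i, j) = (\<Sum>b<n. (\<Sum>a<n. Q $$ (i, a) * H $$ (a, b)) * P $$ (b, j))"
    using assms by (simp add: scalar_prod_def atLeast0LessThan del: assoc_mult_mat)
  also have "\<dots> = (\<Sum>a<n. \<Sum>b<n. Q $$ (i, a) * P $$ (b, j) * H $$ (a, b))"
    unfolding sum_distrib_right by (subst sum.swap) (intro sum.cong refl, simp add: mult_ac)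
  finally show ?thesis by (simp add: sum.cartesian_product case_prod_beta)
qed

lemma PGL_of_mem:
  assumes "g \<in> carrier (PGL n)" "A \<in> g"
  shows "A \<in> carrier (GL TYPE(complex) n)" "g = PGL_class n A"
proof -
  obtain B where B: "B \<in> carrier (GL TYPE(complex) n)" "g = PGL_class n B"
    using assms(1) by (auto simp: carrier_PGL)
  then have Bc: "B \<in> carrier_mat n n" by (simp add: GL_iff)
  obtain C where C: "C \<in> carrier_mat n n" "B * C = 1\<^sub>m n" "C * B = 1\<^sub>m n" using B by (auto simp: GL_iff)
  obtain c where c: "c \<noteq> 0" "A = c \<cdot>\<^sub>m B" using assms(2) B(2) PGL_class_eq[OF Bc] by auto
  have "(c \<cdot>\<^sub>m B) * (inverse c \<cdot>\<^sub>m C) = 1\<^sub>m n" "(inverse c \<cdot>\<^sub>m C) * (c \<cdot>\<^sub>m B) = 1\<^sub>m n"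
    using c(1) Bc C
    by (simp_all add: mult_smult_assoc_mat[where nr = n and n = n and nc = n]
        mult_smult_distrib[where nr = n and n = n and nc = n]) (auto intro!: eq_matI)
  then show "A \<in> carrier (GL TYPE(complex) n)"
    unfolding GL_iff using c Bc C by (intro conjI bexI[of _ "inverse c \<cdot>\<^sub>m C"]) auto
  have "{a \<cdot>\<^sub>m A | a. a \<noteq> 0} = {a \<cdot>\<^sub>m B | a. a \<noteq> 0}"
  proof (rule Set.equalityI; rule Set.subsetI)
    fix M assume "M \<in> {a \<cdot>\<^sub>m A | a. a \<noteq> 0}"
    then obtain a where "a \<noteq> 0" "M = a \<cdot>\<^sub>m A" by auto
    then show "M \<in> {a \<cdot>\<^sub>m B | a. a \<noteq> 0}" using c by (intro CollectI exI[of _ "a * c"]) (auto intro!: eq_matI)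
  next
    fix M assume "M \<in> {a \<cdot>\<^sub>m B | a. a \<noteq> 0}"
    then obtain a where "a \<noteq> 0" "M = a \<cdot>\<^sub>m B" by auto
    then show "M \<in> {a \<cdot>\<^sub>m A | a. a \<noteq> 0}" using c by (intro CollectI exI[of _ "a / c"]) (auto intro!: eq_matI)
  qed
  then show "g = PGL_class n A"
    using c Bc unfolding B(2) by (simp add: PGL_class_eq)
qed

lemma mem_PGL_class: "A \<in> carrier_mat n n \<Longrightarrow> A \<in> PGL_class n A"
  unfolding PGL_class_eq by (intro CollectI exI[of _ 1]) auto


section \<open>Projective representations of a torus\<close>

locale torus_rep =
  fixes n k :: nat and \<phi> :: "complex vec \<Rightarrow> complex mat set" and T :: "complex mat set set"
  assumes n: "n > 0"
    and \<phi>_PGL: "\<And>t. t \<in> tor k \<Longrightarrow> \<phi> t \<in> carrier (PGL n)"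
    and \<phi>_mult: "\<And>s t. s \<in> tor k \<Longrightarrow> t \<in> tor k \<Longrightarrow> \<phi> (tmul s t) = \<phi> s \<otimes>\<^bsub>PGL n\<^esub> \<phi> t"
    and \<phi>_reg: "regular_map (Suc k) torus_pt (tor k) (n * n) (PGL_pt n) T \<phi>"
begin

text \<open>Near every point, \<open>\<phi>\<close> is given by a matrix of Laurent polynomials, here multiplied by a
  Laurent polynomial so that it vanishes where the local description fails.\<close>

lemma chart:
  assumes t0: "t0 \<in> tor k"
  obtains H M where "finite M" "M \<subseteq> carrier_vec k" "\<And>t. H t \<in> carrier_mat n n"
    "\<And>i j. i < n \<Longrightarrow> j < n \<Longrightarrow> laurent_on k M (\<lambda>t. H t $$ (i, j))"
    "\<And>t. t \<in> tor k \<Longrightarrow> H t = 0\<^sub>m n n \<or> H t \<in> \<phi> t" "H t0 \<in> \<phi> t0"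
proof -
  have "\<exists>U e F. openin (zariski (Suc k)) U \<and> torus_pt t0 \<in> U \<and> (\<forall>j<n * n. homogeneous (Suc k) e (F j)) \<and>
      (\<forall>t\<in>tor k. torus_pt t \<in> U \<longrightarrow> (\<forall>v\<in>torus_pt t. vec (n * n) (\<lambda>j. poly_eval (F j) v) \<in> PGL_pt n (\<phi> t)))"
    using \<phi>_reg unfolding regular_map_def by (elim conjE) (erule bspec[OF _ t0])
  then obtain U e F where "openin (zariski (Suc k)) U \<and> torus_pt t0 \<in> U \<and> (\<forall>j<n * n. homogeneous (Suc k) e (F j)) \<and>
      (\<forall>t\<in>tor k. torus_pt t \<in> U \<longrightarrow> (\<forall>v\<in>torus_pt t. vec (n * n) (\<lambda>j. poly_eval (F j) v) \<in> PGL_pt n (\<phi> t)))"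
    by (elim exE)
  then have U: "openin (zariski (Suc k)) U" "torus_pt t0 \<in> U"
    "\<And>j. j < n * n \<Longrightarrow> homogeneous (Suc k) e (F j)"
    "\<And>t v. t \<in> tor k \<Longrightarrow> torus_pt t \<in> U \<Longrightarrow> v \<in> torus_pt t \<Longrightarrow>
       vec (n * n) (\<lambda>j. poly_eval (F j) v) \<in> PGL_pt n (\<phi> t)"
    by simp_all
  obtain G where G: "\<And>f. f \<in> G \<Longrightarrow> \<exists>e. homogeneous (Suc k) e f" "U = proj_space (Suc k) - zero_locus (Suc k) G"
    using U(1) unfolding openin_zariski by blast
  have one: "vCons 1 t \<in> carrier_vec (Suc k)" "vCons 1 t \<noteq> 0\<^sub>v (Suc k)" if "t \<in> tor k" for t :: "complex vec"
    using that by (auto simp: tor_iff dest: arg_cong[of _ _ "\<lambda>v. v $ 0"])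
  have inU: "torus_pt t \<in> U \<longleftrightarrow> (\<exists>g\<in>G. poly_eval g (vCons 1 t) \<noteq> 0)" if t: "t \<in> tor k" for t
  proof -
    have "(\<forall>v\<in>torus_pt t. poly_eval g v = 0) \<longleftrightarrow> poly_eval g (vCons 1 t) = 0" if g: "g \<in> G" for g
    proof -
      obtain e where "homogeneous (Suc k) e g" using G(1)[OF g] by blast
      then show ?thesis
        using hpoly_proj_pt_0[OF hpoly_poly_eval one(1)[OF t], of e g] mem_proj_pt[of "vCons 1 t"]
        unfolding torus_pt_def by blast
    qed
    moreover have "torus_pt t \<in> proj_space (Suc k)"
      unfolding torus_pt_def by (intro proj_pt_in_space one[OF t])
    ultimately show ?thesis unfolding G(2) zero_locus_def by blast
  qed
  obtain g e' where g: "g \<in> G" "poly_eval g (vCons 1 t0) \<noteq> 0" "homogeneous (Suc k) e' g"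
    using inU[OF t0] U(2) G(1) by blast
  define H where "H = (\<lambda>t. Matrix.mat n n (\<lambda>(i, j). poly_eval g (vCons 1 t) * poly_eval (F (i * n + j)) (vCons 1 t)))"
  have mem: "H t \<in> \<phi> t" if t: "t \<in> tor k" "poly_eval g (vCons 1 t) \<noteq> 0" for t
  proof -
    have "torus_pt t \<in> U" using inU t g(1) by blast
    then have v: "vec (n * n) (\<lambda>j. poly_eval (F j) (vCons 1 t)) \<in> PGL_pt n (\<phi> t)"
      using U(4)[OF t(1)] by (simp add: torus_pt_def)
    obtain A where A: "A \<in> carrier (GL TYPE(complex) n)" "\<phi> t = PGL_class n A"
      using \<phi>_PGL[OF t(1)] by (auto simp: carrier_PGL)
    have Ac: "A \<in> carrier_mat n n" using A by (simp add: GL_iff)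
    obtain c where c: "c \<noteq> 0" "vec (n * n) (\<lambda>j. poly_eval (F j) (vCons 1 t)) = c \<cdot>\<^sub>v flat n A"
      using v unfolding A(2) PGL_pt_class[OF Ac] by (auto simp: proj_pt_def)
    have "poly_eval (F (i * n + j)) (vCons 1 t) = c * A $$ (i, j)" if "i < n" "j < n" for i j
    proof -
      have "poly_eval (F (i * n + j)) (vCons 1 t) = vec (n * n) (\<lambda>j. poly_eval (F j) (vCons 1 t)) $ (i * n + j)"
        using flat_index(1)[OF that] by simp
      then show ?thesis unfolding c(2) using flat_index[OF that] by simp
    qed
    then have "H t = (poly_eval g (vCons 1 t) * c) \<cdot>\<^sub>m A"
      using Ac by (intro eq_matI) (auto simp: H_def)
    then show ?thesis unfolding A(2) PGL_class_eq[OF Ac] using c(1) t(2) by auto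
  qed
  \<comment> \<open>With weight 0 and the unit vectors, the orbit of the all-ones point is the
    embedding \<open>torus_pt\<close>, so forms in the chart restrict to Laurent
    polynomials.\<close>
  define m where "m = (\<lambda>i. case i of 0 \<Rightarrow> 0\<^sub>v k | Suc l \<Rightarrow> (unit_vec k l :: int vec))"
  have orb: "orbit_vec (Suc k) k m (\<lambda>_. 1) t = vCons 1 t" if "t \<in> tor k" for t
  proof (intro eq_vecI)
    fix i assume "i < dim_vec (vCons 1 t)"
    then show "orbit_vec (Suc k) k m (\<lambda>_. 1) t $ i = vCons 1 t $ i"
      using that by (cases i) (auto simp: m_def character_0 character_unit_vec tor_iff)
  qed (use that in \<open>auto simp: orbit_vec_def tor_iff\<close>)
  have lau: "laurent_on k (supp_chars (Suc k) k (e' + e) m) (\<lambda>t. H t $$ (i, j))" if ij: "i < n" "j < n" for i j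
  proof -
    have "hpoly (Suc k) (e' + e) (\<lambda>v. poly_eval g v * poly_eval (F (i * n + j)) v)"
      using ij by (intro hpoly_mult hpoly_poly_eval g(3) U(3) flat_index(1))
    from hpoly_orbit[OF this, of k m "\<lambda>_. 1"] show ?thesis
      unfolding laurent_on_def using ij by (auto simp: orb H_def)
  qed
  show ?thesis
  proof (rule that[OF finite_supp_chars supp_chars_carrier _ lau])
    show "H t \<in> carrier_mat n n" for t by (simp add: H_def)
    show "H t0 \<in> \<phi> t0" using mem[OF t0 g(2)] .
    show "H t = 0\<^sub>m n n \<or> H t \<in> \<phi> t" if "t \<in> tor k" for t
    proof (cases "poly_eval g (vCons 1 t) = 0")
      case True
      then have "H t = 0\<^sub>m n n" by (intro eq_matI) (auto simp: H_def)
      then show ?thesis ..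
    qed (use mem that in blast)
  qed
qed

lemma \<phi>_one: "1\<^sub>m n \<in> \<phi> (vec k (\<lambda>_. 1))"
proof -
  let ?e = "vec k (\<lambda>_. 1 :: complex)"
  have e: "?e \<in> tor k" by simp
  have "tmul ?e ?e = ?e" by (auto simp: tmul_def)
  then have "\<phi> ?e \<otimes>\<^bsub>PGL n\<^esub> \<phi> ?e = \<phi> ?e" using \<phi>_mult[OF e e] by simp
  then have "\<phi> ?e = \<one>\<^bsub>PGL n\<^esub>"
    using group.l_cancel_one'[OF group_PGL \<phi>_PGL[OF e] \<phi>_PGL[OF e]] by simp
  also have "\<dots> = scalars n" by (simp add: PGL_def FactGroup_def)
  finally have "\<phi> ?e = scalars n" .
  moreover have "1\<^sub>m n = (1 :: complex) \<cdot>\<^sub>m 1\<^sub>m n" by (intro eq_matI) auto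
  ultimately show ?thesis unfolding scalars_def by (auto intro!: exI[of _ 1])
qed

lemma \<phi>_tpow:
  assumes "t \<in> tor k" "B \<in> \<phi> t" shows "B ^\<^sub>m r \<in> \<phi> (tpow t r)"
proof (induction r)
  case 0
  have B: "B \<in> carrier_mat n n" using PGL_of_mem(1)[OF \<phi>_PGL[OF assms(1)] assms(2)] by (simp add: GL_iff)
  have "tpow t 0 = vec k (\<lambda>_. 1)" using assms(1) by (auto simp: tpow_def tor_iff)
  then show ?case using \<phi>_one B by simp
next
  case (Suc r)
  note tr = tpow_tor[OF assms(1), of r]
  have "tpow t (Suc r) = tmul (tpow t r) t" by (auto simp: tpow_def tmul_def mult.commute)
  then have *: "\<phi> (tpow t (Suc r)) = \<phi> (tpow t r) \<otimes>\<^bsub>PGL n\<^esub> \<phi> t"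
    using \<phi>_mult[OF tr assms(1)] by simp
  note 1 = PGL_of_mem[OF \<phi>_PGL[OF tr] Suc] and 2 = PGL_of_mem[OF \<phi>_PGL[OF assms(1)] assms(2)]
  have "B ^\<^sub>m r * B \<in> carrier_mat n n" using 1(1) 2(1) by (auto simp: GL_iff)
  then show ?case
    unfolding * unfolding 1(2) 2(2) PGL_mult[OF 1(1) 2(1)] by (simp add: mem_PGL_class)
qed

text \<open>One matrix \<open>B\<close> above the prime point determines the eigenbasis. Its powers
  lie above the powers of that point, where every chart is therefore a multiple of
  \<open>B ^\<^sub>m r\<close>; these points suffice to detect nonzero Laurent polynomials, so
  whatever holds at all of them holds on the whole torus.\<close>

lemma diagonalization:
  obtains P Q where "P \<in> carrier_mat n n" "Q \<in> carrier_mat n n" "P * Q = 1\<^sub>m n" "Q * P = 1\<^sub>m n"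
    "\<And>t0. t0 \<in> tor k \<Longrightarrow> \<exists>H M. (\<forall>t\<in>tor k. H t = 0\<^sub>m n n \<or> H t \<in> \<phi> t) \<and> H t0 \<in> \<phi> t0 \<and>
      (\<forall>i<n. \<forall>j<n. laurent_on k M (\<lambda>t. (Q * H t * P) $$ (i, j))) \<and>
      (\<forall>t\<in>tor k. \<forall>i<n. \<forall>j<n. i \<noteq> j \<longrightarrow> (Q * H t * P) $$ (i, j) = 0)"
proof -
  let ?s = "prime_pt k"
  obtain B where B: "B \<in> carrier (GL TYPE(complex) n)" "\<phi> ?s = PGL_class n B"
    using \<phi>_PGL[OF prime_pt_tor] unfolding carrier_PGL by blast
  then have B: "B \<in> \<phi> ?s" "B \<in> carrier (GL TYPE(complex) n)"
    using mem_PGL_class[of B n] by (simp_all add: GL_iff)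
  have Bc: "B \<in> carrier_mat n n" using B(2) by (simp add: GL_iff)
  obtain as where "char_poly B = (\<Prod>a\<leftarrow>as. [:- a, 1:])" using char_poly_factorized[OF Bc] by blast
  then obtain n_as where jnf: "jordan_nf B n_as" using jordan_nf_exists[OF Bc] by blast
  define J where "J = jordan_matrix n_as"
  obtain P Q where PQ: "similar_mat_wit B J P Q"
    using jnf unfolding jordan_nf_def similar_mat_def J_def by blast
  have cP: "P \<in> carrier_mat n n" "Q \<in> carrier_mat n n" "J \<in> carrier_mat n n"
    and inv: "P * Q = 1\<^sub>m n" "Q * P = 1\<^sub>m n" and BJ: "B = P * J * Q"
    using PQ Bc unfolding similar_mat_wit_def Let_def by auto
  have Jn: "sum_list (map fst n_as) = n" using cP(3) unfolding J_def by (metis carrier_matD(1) jordan_matrix_dim(1))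
  have BP: "Q * (B ^\<^sub>m r) * P = J ^\<^sub>m r" for r
  proof -
    have "B ^\<^sub>m r = P * (J ^\<^sub>m r) * Q"
      using similar_mat_wit_pow[OF PQ, of r] unfolding similar_mat_wit_def Let_def by blast
    moreover define X where "X = J ^\<^sub>m r"
    ultimately have B: "B ^\<^sub>m r = P * X * Q" by simp
    have X: "X \<in> carrier_mat n n" "X * Q \<in> carrier_mat n n" using cP by (auto simp: X_def)
    have "Q * (P * X * Q) = (Q * P) * (X * Q)"
      using cP X by (simp add: assoc_mult_mat[of _ n n _ n _ n])
    then have "Q * (P * X * Q) * P = X * Q * P" using inv X by simp
    also have "\<dots> = X * (Q * P)" using cP X by (intro assoc_mult_mat)
    finally show ?thesis using inv right_mult_one_mat[OF X(1)] unfolding B X_def by simp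
  qed
  have detJ: "det J \<noteq> 0"
  proof -
    obtain C where C: "C \<in> carrier_mat n n" "B * C = 1\<^sub>m n" using B(2) by (auto simp: GL_iff)
    then have "det B * det C = 1" using det_mult[OF Bc C(1)] by simp
    moreover have "det B = det J" using det_similar[of B J] PQ unfolding similar_mat_def by blast
    ultimately show ?thesis by auto
  qed
  \<comment> \<open>A chart determines only the class in \<open>PGL\<close>, hence the unknown
    factor \<open>q r\<close>; it is 0 only where the chart degenerates.\<close>
  have multiple: "\<exists>q. \<forall>r. Q * H (tpow ?s r) * P = q r \<cdot>\<^sub>m (J ^\<^sub>m r) \<and> (H (tpow ?s r) \<noteq> 0\<^sub>m n n \<longrightarrow> q r \<noteq> 0)"
    if H: "\<And>t. t \<in> tor k \<Longrightarrow> H t = 0\<^sub>m n n \<or> H t \<in> \<phi> t" for H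
  proof -
    have "\<exists>q. Q * H (tpow ?s r) * P = q \<cdot>\<^sub>m (J ^\<^sub>m r) \<and> (H (tpow ?s r) \<noteq> 0\<^sub>m n n \<longrightarrow> q \<noteq> 0)" for r
    proof -
      note sr = tpow_tor[OF prime_pt_tor[of k], of r]
      note Br = PGL_of_mem[OF \<phi>_PGL[OF sr] \<phi>_tpow[OF prime_pt_tor B(1), of r]]
      have Brc: "B ^\<^sub>m r \<in> carrier_mat n n" using Br(1) by (simp add: GL_iff)
      from H[OF sr] show ?thesis
      proof
        assume 0: "H (tpow ?s r) = 0\<^sub>m n n"
        have "Q * 0\<^sub>m n n * P = 0 \<cdot>\<^sub>m (J ^\<^sub>m r)"
        proof -
          have "0 \<cdot>\<^sub>m X = 0\<^sub>m n n" if "X \<in> carrier_mat n n" for X :: "complex mat"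
            using that by (intro eq_matI) auto
          then show ?thesis using cP by simp
        qed
        then show ?thesis using 0 by auto
      next
        assume "H (tpow ?s r) \<in> \<phi> (tpow ?s r)"
        then obtain c where c: "c \<noteq> 0" "H (tpow ?s r) = c \<cdot>\<^sub>m (B ^\<^sub>m r)"
          unfolding Br(2) PGL_class_eq[OF Brc] by auto
        have "Q * H (tpow ?s r) * P = c \<cdot>\<^sub>m (Q * (B ^\<^sub>m r) * P)"
          unfolding c(2) using cP Brc
          by (simp add: mult_smult_assoc_mat[where nr = n and n = n and nc = n]
            mult_smult_distrib[where nr = n and n = n and nc = n] del: assoc_mult_mat)
        then show ?thesis using c(1) unfolding BP by blast
      qed
    qed
    then show ?thesis by metis
  qed
  have lau: "laurent_on k M (\<lambda>t. (Q * H t * P) $$ (i, j))"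
    if "finite M" "M \<subseteq> carrier_vec k" "\<And>t. H t \<in> carrier_mat n n"
      "\<And>i j. i < n \<Longrightarrow> j < n \<Longrightarrow> laurent_on k M (\<lambda>t. H t $$ (i, j))" "i < n" "j < n" for H M i j
    unfolding mat_sandwich_index[OF cP(2) that(3) cP(1) that(5,6)]
    by (rule laurent_on_lincomb[OF that(1,2)]) (use that(4) in auto)
  have blocks: "\<forall>na\<in>set n_as. fst na = 1"
  proof (rule ccontr)
    assume "\<not> ?thesis"
    then obtain s a where sa: "(s, a) \<in> set n_as" "s \<noteq> 1" by auto
    moreover have "s \<noteq> 0" using jnf sa(1) unfolding jordan_nf_def by force
    ultimately have "s \<ge> 2" by simp
    then obtain i where i: "Suc i < n" "\<And>r. (J ^\<^sub>m r) $$ (i, i) = a ^ r"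
      "\<And>r. (J ^\<^sub>m r) $$ (i, Suc i) = of_nat r * a ^ (r - 1)"
      using jordan_matrix_pow_superdiagonal[OF sa(1)] unfolding Jn J_def by blast
    have a0: "a \<noteq> 0"
    proof
      assume "a = 0"
      have "upper_triangular J"
        using jordan_matrix_upper_triangular[of _ n_as] Jn cP(3) unfolding J_def by auto
      then have "det J = prod_list (diag_mat J)" by (rule det_upper_triangular[OF _ cP(3)])
      moreover have "J $$ (i, i) = 0" using i(2)[of 1] \<open>a = 0\<close> cP(3) by simp
      then have "0 \<in> set (diag_mat J)" using i(1) cP(3) unfolding diag_mat_def by force
      ultimately show False using detJ by (simp add: prod_list_zero_iff)
    qed
    obtain H M where H: "finite M" "M \<subseteq> carrier_vec k" "\<And>t. H t \<in> carrier_mat n n"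
      "\<And>i j. i < n \<Longrightarrow> j < n \<Longrightarrow> laurent_on k M (\<lambda>t. H t $$ (i, j))"
      "\<And>t. t \<in> tor k \<Longrightarrow> H t = 0\<^sub>m n n \<or> H t \<in> \<phi> t" "H ?s \<in> \<phi> ?s"
      by (rule chart[OF prime_pt_tor]) (rule that)
    obtain q where q: "\<And>r. Q * H (tpow ?s r) * P = q r \<cdot>\<^sub>m (J ^\<^sub>m r)"
      "\<And>r. H (tpow ?s r) \<noteq> 0\<^sub>m n n \<Longrightarrow> q r \<noteq> 0"
      using multiple[OF H(5)] by blast
    obtain c where c: "\<And>t. t \<in> tor k \<Longrightarrow> (Q * H t * P) $$ (i, i) = (\<Sum>m\<in>M. c m * character k m t)"
      using lau[OF H(1-4), of i i] i(1) unfolding laurent_on_def by auto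
    obtain c' where c': "\<And>t. t \<in> tor k \<Longrightarrow> (Q * H t * P) $$ (i, Suc i) = (\<Sum>m\<in>M. c' m * character k m t)"
      using lau[OF H(1-4), of i "Suc i"] i(1) unfolding laurent_on_def by auto
    have qJ: "(q r \<cdot>\<^sub>m (J ^\<^sub>m r)) $$ (i, j) = q r * (J ^\<^sub>m r) $$ (i, j)" if "i < n" "j < n" for i j r
      by (rule index_smult_mat) (use cP(3) that in \<open>simp_all del: pow_mat_dim\<close>)
    have 1: "(\<Sum>m\<in>M. c m * of_real (prime_val k m) ^ r) = q r * a ^ r" for r
      using laurent_on_prime_powers[OF H(1,2) c, of r] i(1,2) by (simp add: q(1) qJ)
    have 2: "(\<Sum>m\<in>M. c' m * of_real (prime_val k m) ^ r) = q r * (of_nat r * a ^ (r - 1))" for r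
      using laurent_on_prime_powers[OF H(1,2) c', of r] i(1,3) by (simp add: q(1) qJ)
    \<comment> \<open>The two entries are \<open>q r * a ^ r\<close> and
      \<open>q r * r * a ^ (r - 1)\<close>, so \<open>a\<close> times the second is \<open>r\<close>
      times the first. The unknown \<open>q r\<close> drops out of this comparison of exponential
      sums.\<close>
    have "c m = 0" if "m \<in> M" for m
    proof (rule exponential_sum_times_n[OF H(1) inj_on_subset[OF prime_val_inj H(2)] prime_val_pos _ that,
          of _ "\<lambda>m. a * c' m"])
      fix r
      have "(\<Sum>m\<in>M. a * c' m * of_real (prime_val k m) ^ r) = a * (q r * (of_nat r * a ^ (r - 1)))"
        unfolding 2[symmetric] by (simp add: sum_distrib_left mult.assoc)
      also have "\<dots> = of_nat r * (q r * a ^ r)" by (cases r) auto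
      finally show "of_nat r * (\<Sum>m\<in>M. c m * of_real (prime_val k m) ^ r)
          = (\<Sum>m\<in>M. a * c' m * of_real (prime_val k m) ^ r)" unfolding 1 by simp
    qed
    then have "q r = 0" for r using 1[of r] a0 by simp
    then have "H (tpow ?s r) = 0\<^sub>m n n" for r using q(2) by blast
    moreover have "tpow ?s 1 = ?s" by (intro eq_vecI) (auto simp: tpow_def)
    ultimately have "H ?s = 0\<^sub>m n n" by metis
    then have "0\<^sub>m n n \<in> carrier (GL TYPE(complex) n)"
      using PGL_of_mem(1)[OF \<phi>_PGL[OF prime_pt_tor] H(6)] by simp
    then have "det (0\<^sub>m n n :: complex mat) \<noteq> 0"
      using det_mult[of "0\<^sub>m n n :: complex mat" n] unfolding GL_iff by (metis det_one mult_zero_left zero_neq_one zero_carrier_mat)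
    then show False using n by simp
  qed
  have len: "length n_as = n" using blocks Jn
    by (metis (no_types, lifting) length_map map_eq_conv sum_list_triv[of 1 n_as] mult.right_neutral of_nat_id)
  show ?thesis
  proof (rule that[OF cP(1,2) inv])
    fix t0 assume t0: "t0 \<in> tor k"
    obtain H M where H: "finite M" "M \<subseteq> carrier_vec k" "\<And>t. H t \<in> carrier_mat n n"
      "\<And>i j. i < n \<Longrightarrow> j < n \<Longrightarrow> laurent_on k M (\<lambda>t. H t $$ (i, j))"
      "\<And>t. t \<in> tor k \<Longrightarrow> H t = 0\<^sub>m n n \<or> H t \<in> \<phi> t" "H t0 \<in> \<phi> t0"
      by (rule chart[OF t0]) (rule that)
    obtain q where q: "\<And>r. Q * H (tpow ?s r) * P = q r \<cdot>\<^sub>m (J ^\<^sub>m r)"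
      using multiple[OF H(5)] by blast
    \<comment> \<open>Powers of a diagonal matrix have no off-diagonal entries, and a Laurent
      polynomial vanishing at all powers of the prime point is zero.\<close>
    have off: "(Q * H t * P) $$ (i, j) = 0" if "t \<in> tor k" "i < n" "j < n" "i \<noteq> j" for t i j
    proof (rule ccontr)
      assume "(Q * H t * P) $$ (i, j) \<noteq> 0"
      then have "\<forall>\<^sub>F r in sequentially. (Q * H (tpow ?s r) * P) $$ (i, j) \<noteq> 0"
        using laurent_eventually_nonzero[OF lau[OF H(1-4) that(2,3)] that(1)] by simp
      moreover have "(Q * H (tpow ?s r) * P) $$ (i, j) = 0" for r
      proof -
        have "(q r \<cdot>\<^sub>m (J ^\<^sub>m r)) $$ (i, j) = q r * (J ^\<^sub>m r) $$ (i, j)"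
          by (rule index_smult_mat) (use cP(3) that in \<open>simp_all del: pow_mat_dim\<close>)
        moreover have "(J ^\<^sub>m r) $$ (i, j) = 0"
          unfolding J_def using jordan_matrix_pow_diagonal[OF blocks] that len by simp
        ultimately show ?thesis unfolding q by simp
      qed
      ultimately show False by simp
    qed
    show "\<exists>H M. (\<forall>t\<in>tor k. H t = 0\<^sub>m n n \<or> H t \<in> \<phi> t) \<and> H t0 \<in> \<phi> t0 \<and>
      (\<forall>i<n. \<forall>j<n. laurent_on k M (\<lambda>t. (Q * H t * P) $$ (i, j))) \<and>
      (\<forall>t\<in>tor k. \<forall>i<n. \<forall>j<n. i \<noteq> j \<longrightarrow> (Q * H t * P) $$ (i, j) = 0)"
      using H(5,6) lau[OF H(1-4)] off by blast
  qed
qed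

end

lemma conjugate_mult:
  fixes P Q A B :: "complex mat"
  assumes "P \<in> carrier_mat n n" "Q \<in> carrier_mat n n" "Q * P = 1\<^sub>m n"
    "A \<in> carrier_mat n n" "B \<in> carrier_mat n n"
  shows "(P * A * Q) * (P * B * Q) = P * (A * B) * Q"
proof -
  have c: "P * A \<in> carrier_mat n n" "P * B \<in> carrier_mat n n" "B * Q \<in> carrier_mat n n" "P * B * Q \<in> carrier_mat n n"
    using assms by (metis mult_carrier_mat)+
  have "Q * (P * B * Q) = (Q * P) * (B * Q)"
    unfolding assoc_mult_mat[OF assms(1,5,2)] assoc_mult_mat[OF assms(2,1) c(3)] ..
  then have *: "Q * (P * B * Q) = B * Q" using assms(3) left_mult_one_mat[OF c(3)] by simp
  have "(P * A * Q) * (P * B * Q) = (P * A) * (B * Q)"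
    unfolding assoc_mult_mat[OF c(1) assms(2) c(4)] * ..
  also have "\<dots> = P * A * B * Q"
    by (rule assoc_mult_mat[OF c(1) assms(5,2), symmetric])
  also have "P * A * B = P * (A * B)"
    by (rule assoc_mult_mat[OF assms(1,4,5)])
  finally show ?thesis .
qed

context torus_rep
begin

text \<open>Diagonal matrices representing \<open>\<phi> t\<close> are determined up to a scalar.
  Quotients of their entries are genuine homomorphisms and quotients of Laurent polynomials, hence
  characters.\<close>

lemma diagonal_form:
  obtains P Q m where "P \<in> carrier (GL TYPE(complex) n)" "Q \<in> carrier_mat n n" "P * Q = 1\<^sub>m n" "Q * P = 1\<^sub>m n"
    "\<And>i. i < n \<Longrightarrow> m i \<in> carrier_vec k"
    "\<And>t. t \<in> tor k \<Longrightarrow> \<phi> t = PGL_class n (P * mat_diag n (\<lambda>i. character k (m i) t) * Q)"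
proof -
  obtain P Q where PQ: "P \<in> carrier_mat n n" "Q \<in> carrier_mat n n" "P * Q = 1\<^sub>m n" "Q * P = 1\<^sub>m n"
    and chart: "\<And>t0. t0 \<in> tor k \<Longrightarrow> \<exists>H M. (\<forall>t\<in>tor k. H t = 0\<^sub>m n n \<or> H t \<in> \<phi> t) \<and> H t0 \<in> \<phi> t0 \<and>
      (\<forall>i<n. \<forall>j<n. laurent_on k M (\<lambda>t. (Q * H t * P) $$ (i, j))) \<and>
      (\<forall>t\<in>tor k. \<forall>i<n. \<forall>j<n. i \<noteq> j \<longrightarrow> (Q * H t * P) $$ (i, j) = 0)"
    by (rule diagonalization) (rule that)
  have PG: "P \<in> carrier (GL TYPE(complex) n)" "Q \<in> carrier (GL TYPE(complex) n)"
    unfolding GL_iff using PQ by blast+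
  note assoc = assoc_mult_mat[of _ n n _ n _ n]
  have unconj: "P * (Q * A * P) * Q = A" "Q * (P * A * Q) * P = A" if A: "A \<in> carrier_mat n n" for A
  proof -
    have "P * (Q * A * P) * Q = (P * Q) * A * (P * Q)"
      using PQ(1,2) A by (simp add: assoc)
    then show "P * (Q * A * P) * Q = A" using PQ A by simp
    have "Q * (P * A * Q) * P = (Q * P) * A * (Q * P)"
      using PQ(1,2) A by (simp add: assoc)
    then show "Q * (P * A * Q) * P = A" using PQ A by simp
  qed
  have "\<forall>t\<in>tor k. \<exists>\<delta>. (\<forall>i<n. \<delta> i \<noteq> 0) \<and> \<phi> t = PGL_class n (P * mat_diag n \<delta> * Q)"
  proof
    fix t assume t: "t \<in> tor k"
    obtain H where H: "H t \<in> \<phi> t" "\<And>i j. i < n \<Longrightarrow> j < n \<Longrightarrow> i \<noteq> j \<Longrightarrow> (Q * H t * P) $$ (i, j) = 0"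
      using chart[OF t] t by (elim exE conjE) metis
    note HG = PGL_of_mem[OF \<phi>_PGL[OF t] H(1)]
    have Hc: "H t \<in> carrier_mat n n" using HG(1) by (simp add: GL_iff)
    define \<delta> where "\<delta> = (\<lambda>i. (Q * H t * P) $$ (i, i))"
    have D: "Q * H t * P = mat_diag n \<delta>"
      using PQ(1,2) Hc H(2) by (intro eq_matI) (auto simp: mat_diag_def \<delta>_def simp del: assoc_mult_mat)
    have "Q * H t * P \<in> carrier (GL TYPE(complex) n)"
      using group.is_monoid[OF group_GL] PG HG(1) by (metis GL_mult monoid.m_closed)
    then have DG: "mat_diag n \<delta> \<in> carrier (GL TYPE(complex) n)" unfolding D .
    have "\<delta> i \<noteq> 0" if i: "i < n" for i
    proof
      assume "\<delta> i = 0"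
      then have "mat_diag n \<delta> *\<^sub>v unit_vec n i = 0\<^sub>v n"
        using i by (intro eq_vecI) (auto simp: mat_diag_def scalar_prod_def if_distrib cong: if_cong)
      moreover have "(unit_vec n i :: complex vec) \<noteq> 0\<^sub>v n"
        using i by (metis index_unit_vec(1) index_zero_vec(1) zero_neq_one)
      ultimately show False using GL_mult_vec_nonzero[OF DG, of "unit_vec n i"] by simp
    qed
    moreover have "\<phi> t = PGL_class n (P * mat_diag n \<delta> * Q)"
      using HG(2) unconj(1)[OF Hc] unfolding D by simp
    ultimately show "\<exists>\<delta>. (\<forall>i<n. \<delta> i \<noteq> 0) \<and> \<phi> t = PGL_class n (P * mat_diag n \<delta> * Q)" by blast
  qed
  then obtain \<delta> where \<delta>: "\<And>t i. t \<in> tor k \<Longrightarrow> i < n \<Longrightarrow> \<delta> t i \<noteq> 0"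
    "\<And>t. t \<in> tor k \<Longrightarrow> \<phi> t = PGL_class n (P * mat_diag n (\<delta> t) * Q)"
    by (auto dest!: bchoice)
  have Dc: "P * mat_diag n f * Q \<in> carrier_mat n n" for f
    using PQ(1,2) by (metis mat_diag_dim mult_carrier_mat)
  have DG: "P * mat_diag n (\<delta> t) * Q \<in> carrier (GL TYPE(complex) n)" if "t \<in> tor k" for t
    using PGL_of_mem(1)[OF \<phi>_PGL[OF that]] \<delta>(2)[OF that] mem_PGL_class[OF Dc] by simp
  have diag_unique: "\<exists>c. \<forall>i<n. f i = c * g i"
    if mem: "P * mat_diag n f * Q \<in> PGL_class n (P * mat_diag n g * Q)" for f g
  proof -
    obtain c where c: "P * mat_diag n f * Q = c \<cdot>\<^sub>m (P * mat_diag n g * Q)"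
      using mem unfolding PGL_class_eq[OF Dc] by blast
    have "mat_diag n f = Q * (c \<cdot>\<^sub>m (P * mat_diag n g * Q)) * P"
      using unconj(2)[of "mat_diag n f"] c by simp
    also have "\<dots> = c \<cdot>\<^sub>m (Q * (P * mat_diag n g * Q) * P)"
      using PQ(1,2) Dc[of g]
      by (simp add: mult_smult_assoc_mat[where nr = n and n = n and nc = n]
          mult_smult_distrib[where nr = n and n = n and nc = n] del: assoc_mult_mat)
    also have "\<dots> = c \<cdot>\<^sub>m mat_diag n g" using unconj(2)[of "mat_diag n g"] by simp
    finally have eq: "mat_diag n f = c \<cdot>\<^sub>m mat_diag n g" .
    have "f i = c * g i" if "i < n" for i
      using arg_cong[OF eq, of "\<lambda>A. A $$ (i, i)"] that by (simp add: mat_diag_def)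
    then show ?thesis by blast
  qed
  have multc: "\<exists>c. \<forall>i<n. \<delta> (tmul s t) i = c * (\<delta> s i * \<delta> t i)" if st: "s \<in> tor k" "t \<in> tor k" for s t
  proof -
    have "(P * mat_diag n (\<delta> s) * Q) * (P * mat_diag n (\<delta> t) * Q) = P * mat_diag n (\<lambda>i. \<delta> s i * \<delta> t i) * Q"
      using conjugate_mult[OF PQ(1,2,4) mat_diag_dim mat_diag_dim] by simp
    then have "\<phi> (tmul s t) = PGL_class n (P * mat_diag n (\<lambda>i. \<delta> s i * \<delta> t i) * Q)"
      using \<phi>_mult[OF st] \<delta>(2)[OF st(1)] \<delta>(2)[OF st(2)] PGL_mult[OF DG[OF st(1)] DG[OF st(2)]] by simp
    then show ?thesis
      using diag_unique[of "\<delta> (tmul s t)" "\<lambda>i. \<delta> s i * \<delta> t i"] \<delta>(2)[OF tmul_tor[OF st]] mem_PGL_class[OF Dc] by metis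
  qed
  \<comment> \<open>Dividing by entry 0 removes the scalar ambiguity of \<open>\<delta> t\<close>,
    and with it the factor \<open>c\<close> that spoils multiplicativity.\<close>
  define \<chi> where "\<chi> = (\<lambda>i t. \<delta> t i / \<delta> t 0)"
  have \<chi>_mult: "\<chi> i (tmul s t) = \<chi> i s * \<chi> i t" if st: "s \<in> tor k" "t \<in> tor k" and i: "i < n" for s t i
  proof -
    obtain c where c: "\<And>i. i < n \<Longrightarrow> \<delta> (tmul s t) i = c * (\<delta> s i * \<delta> t i)" using multc[OF st] by blast
    then have "c \<noteq> 0" using \<delta>(1)[OF tmul_tor[OF st] n] n by auto
    then show ?thesis by (simp add: \<chi>_def c[OF i] c[OF n])
  qed
  obtain H M where H: "\<forall>t\<in>tor k. H t = 0\<^sub>m n n \<or> H t \<in> \<phi> t" "H (prime_pt k) \<in> \<phi> (prime_pt k)"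
      "\<forall>i<n. \<forall>j<n. laurent_on k M (\<lambda>t. (Q * H t * P) $$ (i, j))"
    using chart[OF prime_pt_tor] by blast
  have HD: "\<exists>c. (\<forall>i<n. (Q * H t * P) $$ (i, i) = c * \<delta> t i) \<and> (H t \<in> \<phi> t \<longrightarrow> c \<noteq> 0)" if t: "t \<in> tor k" for t
  proof (cases "H t \<in> \<phi> t")
    case True
    then obtain c where c: "c \<noteq> 0" "H t = c \<cdot>\<^sub>m (P * mat_diag n (\<delta> t) * Q)"
      unfolding \<delta>(2)[OF t] PGL_class_eq[OF Dc] by auto
    have "Q * H t * P = c \<cdot>\<^sub>m (Q * (P * mat_diag n (\<delta> t) * Q) * P)"
      unfolding c(2) using PQ(1,2) Dc[of "\<delta> t"]
      by (simp add: mult_smult_assoc_mat[where nr = n and n = n and nc = n]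
          mult_smult_distrib[where nr = n and n = n and nc = n] del: assoc_mult_mat)
    also have "\<dots> = c \<cdot>\<^sub>m mat_diag n (\<delta> t)" using unconj(2)[of "mat_diag n (\<delta> t)"] by simp
    finally show ?thesis using c(1) by (intro exI[of _ c]) (simp add: mat_diag_def)
  next
    case False
    then have "H t = 0\<^sub>m n n" using H(1) t by blast
    then have "Q * H t * P = 0\<^sub>m n n" using PQ(1,2) by simp
    then show ?thesis using False by (intro exI[of _ 0]) simp
  qed
  have "\<forall>i\<in>{..<n}. \<exists>m. m \<in> carrier_vec k \<and> (\<forall>t\<in>tor k. \<chi> i t = character k m t)"
  proof
    fix i assume "i \<in> {..<n}"
    then have i: "i < n" by simp
    have nz: "(Q * H (prime_pt k) * P) $$ (0, 0) \<noteq> 0"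
      using HD[OF prime_pt_tor] H(2) \<delta>(1)[OF prime_pt_tor n] n by auto
    \<comment> \<open>The factor between chart and \<open>\<delta>\<close> cancels; where the chart
      is zero both sides vanish, so the equation holds on the whole torus.\<close>
    have eq: "\<chi> i t * (Q * H t * P) $$ (0, 0) = (Q * H t * P) $$ (i, i)" if t: "t \<in> tor k" for t
    proof -
      obtain c where "\<And>i. i < n \<Longrightarrow> (Q * H t * P) $$ (i, i) = c * \<delta> t i" using HD[OF t] by blast
      then show ?thesis using i n \<delta>(1)[OF t n] by (simp add: \<chi>_def)
    qed
    have nz\<chi>: "\<chi> i t \<noteq> 0" if "t \<in> tor k" for t using \<delta>(1)[OF that] i n by (simp add: \<chi>_def)
    obtain m where "m \<in> carrier_vec k" "\<And>t. t \<in> tor k \<Longrightarrow> \<chi> i t = character k m t"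
      by (rule rational_homomorphism_is_character[of k "\<chi> i" M _ M _ "prime_pt k", OF \<chi>_mult[OF _ _ i] nz\<chi>
            H(3)[rule_format, OF n n] H(3)[rule_format, OF i i] prime_pt_tor nz eq]) blast+
    then show "\<exists>m. m \<in> carrier_vec k \<and> (\<forall>t\<in>tor k. \<chi> i t = character k m t)" by blast
  qed
  then obtain m where m: "\<And>i. i < n \<Longrightarrow> m i \<in> carrier_vec k"
    "\<And>i t. i < n \<Longrightarrow> t \<in> tor k \<Longrightarrow> \<chi> i t = character k (m i) t"
    by (auto dest!: bchoice)
  show ?thesis
  proof (rule that[OF PG(1) PQ(2-4) m(1)])
    fix t assume t: "t \<in> tor k"
    have "mat_diag n (\<delta> t) = \<delta> t 0 \<cdot>\<^sub>m mat_diag n (\<lambda>i. character k (m i) t)"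
      using \<delta>(1)[OF t n] by (intro eq_matI) (auto simp: mat_diag_def m(2)[OF _ t, symmetric] \<chi>_def)
    then have "P * mat_diag n (\<delta> t) * Q = \<delta> t 0 \<cdot>\<^sub>m (P * mat_diag n (\<lambda>i. character k (m i) t) * Q)"
      using PQ(1,2)
      by (simp add: mult_smult_assoc_mat[where nr = n and n = n and nc = n]
          mult_smult_distrib[where nr = n and n = n and nc = n] del: assoc_mult_mat)
    then have "P * mat_diag n (\<lambda>i. character k (m i) t) * Q = inverse (\<delta> t 0) \<cdot>\<^sub>m (P * mat_diag n (\<delta> t) * Q)"
      using \<delta>(1)[OF t n] Dc[of "\<lambda>i. character k (m i) t"] by (intro eq_matI) auto
    then have "P * mat_diag n (\<lambda>i. character k (m i) t) * Q \<in> \<phi> t"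
      unfolding \<delta>(2)[OF t] PGL_class_eq[OF Dc] using \<delta>(1)[OF t n] by auto
    then show "\<phi> t = PGL_class n (P * mat_diag n (\<lambda>i. character k (m i) t) * Q)"
      by (rule PGL_of_mem(2)[OF \<phi>_PGL[OF t]])
  qed
qed

end

section \<open>Sublattices of \<open>\<int>\<^sup>k\<close>\<close>

lemma complex_root_powi:
  assumes "a \<noteq> 0" "g \<noteq> (0::int)" obtains z :: complex where "z \<noteq> 0" "z powi g = a"
proof -
  have root: "\<exists>z. z \<noteq> 0 \<and> z ^ n = b" if "b \<noteq> 0" "n > 0" for b :: complex and n :: nat
  proof -
    have "rcis (root n (cmod b)) (Arg b / real n) ^ n = b"
      using that by (simp add: DeMoivre2 rcis_cmod_Arg)
    then show ?thesis using that by (intro exI[of _ "rcis (root n (cmod b)) (Arg b / real n)"]) auto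
  qed
  show ?thesis
  proof (cases "g > 0")
    case True
    then obtain z where "z \<noteq> 0" "z ^ nat g = a" using root[of a "nat g"] assms by auto
    then show ?thesis using True by (intro that[of z]) (auto simp: power_int_def)
  next
    case False
    then obtain z where "z \<noteq> 0" "z ^ nat (- g) = inverse a" using root[of "inverse a" "nat (- g)"] assms by auto
    then show ?thesis using False assms by (intro that[of z]) (auto simp: power_int_def power_inverse)
  qed
qed

text \<open>A basis in echelon form, found by induction on the last position that may be nonzero.
  The final conjunct says that the torus of the ambient lattice maps onto that of the sublattice; in
  echelon form this needs one root extraction per basis vector.\<close>

lemma lattice_basis:
  fixes \<Lambda> :: "int vec set"
  assumes \<Lambda>: "\<Lambda> \<subseteq> carrier_vec k" "0\<^sub>v k \<in> \<Lambda>" "\<And>v w c. v \<in> \<Lambda> \<Longrightarrow> w \<in> \<Lambda> \<Longrightarrow> v - c \<cdot>\<^sub>v w \<in> \<Lambda>"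
  shows "\<exists>d b. (\<forall>l<d. b l \<in> \<Lambda>) \<and> (\<forall>v\<in>\<Lambda>. \<exists>c. v = wsum k d c b) \<and>
    (\<forall>c. wsum k d c b = 0\<^sub>v k \<longrightarrow> (\<forall>l<d. c l = 0)) \<and>
    (\<forall>s\<in>tor d. \<exists>t\<in>tor k. \<forall>l<d. character k (b l) t = s $ l)"
proof -
  define L where "L = (\<lambda>j. {v \<in> \<Lambda>. \<forall>i<k. j \<le> i \<longrightarrow> v $ i = 0})"
  have "\<exists>d b. (\<forall>l<d. b l \<in> L j) \<and> (\<forall>v\<in>L j. \<exists>c. v = wsum k d c b) \<and>
    (\<forall>c. wsum k d c b = 0\<^sub>v k \<longrightarrow> (\<forall>l<d. c l = 0)) \<and>
    (\<forall>s\<in>tor d. \<exists>t\<in>tor k. \<forall>l<d. character k (b l) t = s $ l)" if "j \<le> k" for j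
    using that
  proof (induction j)
    case 0
    have "v = wsum k 0 (\<lambda>_. 0) b" if "v \<in> L 0" for v b
    proof (rule eq_vecI)
      have "v \<in> carrier_vec k" using that \<Lambda>(1) by (auto simp: L_def)
      then show "dim_vec v = dim_vec (wsum k 0 (\<lambda>_. 0) b)" by (simp add: wsum_def)
    qed (use that in \<open>auto simp: L_def wsum_def\<close>)
    moreover have "vec k (\<lambda>_. 1) \<in> tor k" by simp
    ultimately show ?case by (intro exI[of _ 0]) blast
  next
    case (Suc j)
    then obtain d b where H: "(\<forall>l<d. b l \<in> L j) \<and> (\<forall>v\<in>L j. \<exists>c. v = wsum k d c b) \<and>
      (\<forall>c. wsum k d c b = 0\<^sub>v k \<longrightarrow> (\<forall>l<d. c l = 0)) \<and>
      (\<forall>s\<in>tor d. \<exists>t\<in>tor k. \<forall>l<d. character k (b l) t = s $ l)"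
      using Suc_leD by blast
    note b = H[THEN conjunct1, rule_format] H[THEN conjunct2, THEN conjunct1, rule_format]
      H[THEN conjunct2, THEN conjunct2, THEN conjunct1, rule_format]
      H[THEN conjunct2, THEN conjunct2, THEN conjunct2, rule_format]
    have j: "j < k" using Suc.prems by simp
    have L_Suc: "v \<in> L j \<longleftrightarrow> v \<in> L (Suc j) \<and> v $ j = 0" for v
      using j by (auto simp: L_def) (metis le_antisym not_less_eq_eq)
    show ?case
    proof (cases "\<forall>v\<in>L (Suc j). v $ j = 0")
      case True
      then have "L (Suc j) = L j" using L_Suc by blast
      then show ?thesis using b by (intro exI[of _ d] exI[of _ b]) auto
    next
      case False
      then obtain w0 where "w0 \<in> L (Suc j) \<and> w0 $ j \<noteq> 0" by blast
      \<comment> \<open>The entries at position \<open>j\<close> form an ideal of the integers,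
        generated by a nonzero entry of least absolute value; division with remainder reduces every
        vector to the previous stage.\<close>
      from ex_has_least_nat[of "\<lambda>v. v \<in> L (Suc j) \<and> v $ j \<noteq> 0", OF this, of "\<lambda>v. nat \<bar>v $ j\<bar>"]
      obtain w where w: "w \<in> L (Suc j)" "w $ j \<noteq> 0"
        "\<And>v. v \<in> L (Suc j) \<Longrightarrow> v $ j \<noteq> 0 \<Longrightarrow> nat \<bar>w $ j\<bar> \<le> nat \<bar>v $ j\<bar>"
        by blast
      have wk: "w \<in> carrier_vec k" using w(1) \<Lambda>(1) by (auto simp: L_def)
      define b' where "b' = b(d := w)"
      have ws: "wsum k (Suc d) c b' = wsum k d c b + c d \<cdot>\<^sub>v w" for c
      proof (intro eq_vecI)
        fix i assume "i < dim_vec (wsum k d c b + c d \<cdot>\<^sub>v w)"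
        then have "i < k" using wk by simp
        moreover have "(\<Sum>l<d. c l * b' l $ i) = (\<Sum>l<d. c l * b l $ i)"
          by (intro sum.cong) (auto simp: b'_def)
        ultimately show "wsum k (Suc d) c b' $ i = (wsum k d c b + c d \<cdot>\<^sub>v w) $ i"
          using wk by (simp add: b'_def)
      qed (use wk in simp)
      show ?thesis
      proof (intro exI[of _ "Suc d"] exI[of _ b'] conjI allI ballI impI)
        fix l assume "l < Suc d"
        then show "b' l \<in> L (Suc j)" using w(1) b(1)[of l] L_Suc by (auto simp: b'_def less_Suc_eq)
      next
        fix v assume v: "v \<in> L (Suc j)"
        have vk: "v \<in> carrier_vec k" using v \<Lambda>(1) by (auto simp: L_def)
        define q where "q = v $ j div w $ j"
        define u where "u = v - q \<cdot>\<^sub>v w"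
        have ui: "u $ i = v $ i - q * w $ i" if "i < k" for i using that vk wk by (simp add: u_def)
        have uL: "u \<in> L (Suc j)"
          using v w(1) \<Lambda>(3)[of v w q] ui unfolding L_def u_def[symmetric] by auto
        have "u $ j = v $ j mod w $ j" using ui[OF j] by (simp add: q_def minus_div_mult_eq_mod)
        then have "\<bar>u $ j\<bar> < \<bar>w $ j\<bar>" using w(2) by (simp add: abs_mod_less)
        then have "u $ j = 0" using w(3)[OF uL] by force
        then obtain c where c: "u = wsum k d c b" using b(2)[of u] uL L_Suc by blast
        have "v = wsum k (Suc d) (c(d := q)) b'"
        proof -
          have "wsum k d (c(d := q)) b = wsum k d c b"
            unfolding wsum_def by (intro arg_cong[of _ _ "vec k"] ext sum.cong) auto
          then have "wsum k (Suc d) (c(d := q)) b' = u + q \<cdot>\<^sub>v w"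
            unfolding ws c by simp
          also have "\<dots> = v"
            using vk wk ui by (intro eq_vecI) (auto simp: u_def)
          finally show ?thesis ..
        qed
        then show "\<exists>c. v = wsum k (Suc d) c b'" by blast
      next
        fix c l assume c: "wsum k (Suc d) c b' = 0\<^sub>v k" and l: "l < Suc d"
        have bj: "b i $ j = 0" if "i < d" for i using b(1)[OF that] L_Suc by blast
        have "0 = wsum k (Suc d) c b' $ j" using c j by simp
        also have "\<dots> = c d * w $ j" unfolding ws using j wk bj by simp
        finally have cd: "c d = 0" using w(2) by simp
        then have "wsum k d c b = 0\<^sub>v k"
        proof (intro eq_vecI)
          fix i assume "i < dim_vec (0\<^sub>v k :: int vec)"
          then show "wsum k d c b $ i = 0\<^sub>v k $ i"
            using arg_cong[OF c[unfolded ws], of "\<lambda>v. v $ i"] wk cd by simp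
        qed (simp add: wsum_def)
        then show "c l = 0" using b(3) cd l by (auto simp: less_Suc_eq)
      next
        fix s assume s: "s \<in> tor (Suc d)"
        then have "vec d (\<lambda>l. s $ l) \<in> tor d" by (auto simp: tor_iff)
        then obtain t where t: "t \<in> tor k" "\<And>l. l < d \<Longrightarrow> character k (b l) t = s $ l"
          using b(4) by fastforce
        \<comment> \<open>Earlier basis vectors vanish at \<open>j\<close>, so changing coordinate
          \<open>j\<close> of \<open>t\<close> affects only the character of \<open>w\<close>;
          \<open>A\<close> is what the other coordinates contribute to it.\<close>
        define A where "A = (\<Prod>i\<in>{..<k} - {j}. t $ i powi w $ i)"
        have A: "A \<noteq> 0" using t(1) by (auto simp: A_def tor_iff)
        have "s $ d / A \<noteq> 0" using s A by (auto simp: tor_iff)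
        then obtain z where z: "z \<noteq> 0" "z powi (w $ j) = s $ d / A" using complex_root_powi w(2) by metis
        define t' where "t' = vec k (\<lambda>i. if i = j then z else t $ i)"
        have t': "t' \<in> tor k" using t(1) z(1) by (auto simp: t'_def tor_iff)
        have "character k (b l) t' = character k (b l) t" if "l < d" for l
          unfolding character_def using b(1)[OF that] L_Suc by (intro prod.cong) (auto simp: t'_def)
        moreover have "character k w t' = z powi (w $ j) * A"
          unfolding character_def A_def using j
          by (subst prod.remove[of _ j]) (auto simp: t'_def intro!: prod.cong)
        ultimately have "\<forall>l<Suc d. character k (b' l) t' = s $ l"
          using t(2) z(2) A by (auto simp: b'_def less_Suc_eq)
        then show "\<exists>t\<in>tor k. \<forall>l<Suc d. character k (b' l) t = s $ l" using t' by blast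
      qed
    qed
  qed
  from this[of k] show ?thesis by (simp add: L_def)
qed

section \<open>Every toric subvariety is projectively equivalent to some \<open>X(S)\<close>\<close>

lemma wsum_combine:
  assumes "\<And>l. l < d \<Longrightarrow> b l = wsum k n (\<gamma> l) m"
  shows "wsum k d c b = wsum k n (\<lambda>i. \<Sum>l<d. c l * \<gamma> l i) m"
proof (intro eq_vecI)
  fix j assume "j < dim_vec (wsum k n (\<lambda>i. \<Sum>l<d. c l * \<gamma> l i) m)"
  then have j: "j < k" by (simp add: wsum_def)
  have "(\<Sum>l<d. c l * b l $ j) = (\<Sum>l<d. \<Sum>i<n. c l * \<gamma> l i * m i $ j)"
    using assms j by (intro sum.cong) (auto simp: sum_distrib_left mult.assoc)
  also have "\<dots> = (\<Sum>i<n. (\<Sum>l<d. c l * \<gamma> l i) * m i $ j)"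
    by (subst sum.swap) (simp add: sum_distrib_right)
  finally show "wsum k d c b $ j = wsum k n (\<lambda>i. \<Sum>l<d. c l * \<gamma> l i) m $ j" using j by simp
qed (simp add: wsum_def)

lemma affinely_generating_image:
  fixes \<nu> :: "nat \<Rightarrow> int vec"
  assumes I: "finite I" "I \<noteq> {}" and \<nu>: "\<And>i. i \<in> I \<Longrightarrow> \<nu> i \<in> carrier_vec d"
    and gen: "\<And>v. v \<in> carrier_vec d \<Longrightarrow> \<exists>\<gamma>. (\<Sum>i\<in>I. \<gamma> i) = 0 \<and> (\<forall>l<d. v $ l = (\<Sum>i\<in>I. \<gamma> i * \<nu> i $ l))"
  shows "affinely_generating d (\<nu> ` I)"
proof -
  have "v \<in> diff_combos d (\<nu> ` I)" if v: "v \<in> carrier_vec d" for v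
  proof -
    obtain \<gamma> where \<gamma>: "(\<Sum>i\<in>I. \<gamma> i) = 0" "\<And>l. l < d \<Longrightarrow> v $ l = (\<Sum>i\<in>I. \<gamma> i * \<nu> i $ l)"
      using gen[OF v] by blast
    define \<beta> where "\<beta> = (\<lambda>s. \<Sum>i\<in>{i\<in>I. \<nu> i = s}. \<gamma> i)"
    have "(\<Sum>s\<in>\<nu> ` I. \<beta> s * s $ l) = (\<Sum>i\<in>I. \<gamma> i * \<nu> i $ l)" for l
    proof -
      have "(\<Sum>i\<in>I. \<gamma> i * \<nu> i $ l) = (\<Sum>s\<in>\<nu> ` I. \<Sum>i\<in>{i\<in>I. \<nu> i = s}. \<gamma> i * \<nu> i $ l)"
        by (rule sum.image_gen[OF I(1)])
      also have "\<dots> = (\<Sum>s\<in>\<nu> ` I. \<beta> s * s $ l)"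
        unfolding \<beta>_def sum_distrib_right by (intro sum.cong) auto
      finally show ?thesis ..
    qed
    moreover have "(\<Sum>s\<in>\<nu> ` I. \<beta> s) = 0"
      using sum.image_gen[OF I(1), of \<gamma> \<nu>] \<gamma>(1) by (simp add: \<beta>_def)
    moreover have "v = vec d (\<lambda>l. \<Sum>i\<in>I. \<gamma> i * \<nu> i $ l)"
      using v \<gamma>(2) by (intro eq_vecI) auto
    ultimately show ?thesis unfolding diff_combos_def by (intro CollectI exI[of _ \<beta>]) simp
  qed
  then have "diff_combos d (\<nu> ` I) = carrier_vec d"
    by (auto simp: diff_combos_def)
  then show ?thesis
    unfolding affinely_generating_def using I \<nu> by (subst generate_differences) auto
qed

text \<open>Only differences of weights on the support of \<open>y\<close> matter projectively. In a
  basis of the lattice they span, their coordinate vectors are affinely generating by construction,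
  and the torus is replaced by its image.\<close>

lemma orbit_reduction:
  fixes m :: "nat \<Rightarrow> int vec" and y :: "nat \<Rightarrow> complex"
  assumes i0: "i0 < n" "y i0 \<noteq> 0" and m: "\<And>i. i < n \<Longrightarrow> m i \<in> carrier_vec k"
  shows "\<exists>d ms. \<exists>g\<in>carrier (GL TYPE(complex) n). distinct ms \<and> ms \<noteq> [] \<and> length ms \<le> n \<and>
    set ms \<subseteq> carrier_vec d \<and> affinely_generating d (set ms) \<and>
    act g ` orbit n d ((!) ms) (wt (length ms)) = orbit n k m y"
proof -
  define I where "I = {i. i < n \<and> y i \<noteq> 0}"
  \<comment> \<open>Coefficient sum zero makes a combination one of differences; coefficients off
    the support of \<open>y\<close> must vanish.\<close>
  define adm where "adm = (\<lambda>\<gamma> :: nat \<Rightarrow> int. (\<forall>i<n. y i = 0 \<longrightarrow> \<gamma> i = 0) \<and> (\<Sum>i<n. \<gamma> i) = 0)"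
  define \<Lambda> where "\<Lambda> = {wsum k n \<gamma> m | \<gamma>. adm \<gamma>}"
  have zero: "wsum k n (\<lambda>_. 0) m = 0\<^sub>v k" by (auto simp: wsum_def)
  have diff: "v - c \<cdot>\<^sub>v w \<in> \<Lambda>" if vw: "v \<in> \<Lambda>" "w \<in> \<Lambda>" for v w c
  proof -
    obtain \<gamma> \<delta> where *: "v = wsum k n \<gamma> m" "adm \<gamma>" "w = wsum k n \<delta> m" "adm \<delta>"
      using vw unfolding \<Lambda>_def by blast
    have "v - c \<cdot>\<^sub>v w = wsum k n (\<lambda>i. \<gamma> i - c * \<delta> i) m"
      unfolding * by (intro eq_vecI)
        (auto simp: wsum_def sum_subtractf sum_distrib_left algebra_simps)
    moreover have "adm (\<lambda>i. \<gamma> i - c * \<delta> i)"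
      using * by (auto simp: adm_def sum_subtractf simp flip: sum_distrib_left)
    ultimately show ?thesis unfolding \<Lambda>_def by blast
  qed
  have "\<Lambda> \<subseteq> carrier_vec k" by (auto simp: \<Lambda>_def)
  moreover have "0\<^sub>v k \<in> \<Lambda>"
    unfolding \<Lambda>_def using zero by (intro CollectI exI[of _ "\<lambda>_. 0"]) (auto simp: adm_def)
  ultimately obtain d b where H: "(\<forall>l<d. b l \<in> \<Lambda>) \<and> (\<forall>v\<in>\<Lambda>. \<exists>c. v = wsum k d c b) \<and>
      (\<forall>c. wsum k d c b = 0\<^sub>v k \<longrightarrow> (\<forall>l<d. c l = 0)) \<and>
      (\<forall>s\<in>tor d. \<exists>t\<in>tor k. \<forall>l<d. character k (b l) t = s $ l)"
    using lattice_basis[of \<Lambda> k, OF _ _ diff] by blast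
  note b = H[THEN conjunct1, rule_format] H[THEN conjunct2, THEN conjunct1, rule_format]
    H[THEN conjunct2, THEN conjunct2, THEN conjunct1, rule_format]
    H[THEN conjunct2, THEN conjunct2, THEN conjunct2, rule_format]
  have mdiff: "m i - m i0 \<in> \<Lambda>" if i: "i \<in> I" for i
  proof -
    define \<gamma> :: "nat \<Rightarrow> int" where "\<gamma> = (\<lambda>j. (if j = i then 1 else 0) - (if j = i0 then 1 else 0))"
    have "adm \<gamma>" using i i0 by (auto simp: adm_def \<gamma>_def I_def sum_subtractf)
    moreover have "m i - m i0 = wsum k n \<gamma> m"
    proof (intro eq_vecI)
      fix l assume "l < dim_vec (wsum k n \<gamma> m)"
      then have l: "l < k" by (simp add: wsum_def)
      have "(\<Sum>j<n. \<gamma> j * m j $ l) = (\<Sum>j<n. (if j = i then m i $ l else 0) - (if j = i0 then m i0 $ l else 0))"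
        by (intro sum.cong) (auto simp: \<gamma>_def)
      then show "(m i - m i0) $ l = wsum k n \<gamma> m $ l"
        using l i i0 m[of i0] by (simp add: I_def sum_subtractf)
    qed (use m[of i0] i0 in \<open>simp add: wsum_def\<close>)
    ultimately show ?thesis unfolding \<Lambda>_def by blast
  qed
  have "\<forall>i\<in>I. \<exists>c. m i - m i0 = wsum k d c b" using b(2)[OF mdiff] by blast
  then obtain c where c: "\<And>i. i \<in> I \<Longrightarrow> m i - m i0 = wsum k d (c i) b"
    by (auto dest!: bchoice)
  \<comment> \<open>New weights: coordinates of \<open>m i - m i0\<close> in the basis
    \<open>b\<close>. The dropped translation \<open>m i0\<close> is a common scalar along the
    orbit.\<close>
  define \<nu> where "\<nu> = (\<lambda>i. vec d (c i))"
  have I: "finite I" "i0 \<in> I" using i0 by (auto simp: I_def)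
  obtain ms where ms: "distinct ms" "set ms = \<nu> ` I"
    using finite_distinct_list[of "\<nu> ` I"] I(1) by auto
  have ch: "character k (m i) t = character k (m i0) t * character d (\<nu> i) s"
    if i: "i \<in> I" and t: "t \<in> tor k" and s: "\<And>l. l < d \<Longrightarrow> s $ l = character k (b l) t" for i t s
  proof -
    have "character k (m i - m i0) t = (\<Prod>l<d. character k (b l) t powi c i l)"
      unfolding c[OF i] by (rule character_wsum[OF t])
    also have "\<dots> = character d (\<nu> i) s"
      unfolding character_def[of d] using s by (intro prod.cong) (auto simp: \<nu>_def)
    finally show ?thesis
      using i i0 m character_nonzero[OF t, of "m i0"] by (simp add: I_def character_diff[OF t] field_simps)
  qed
  have "\<exists>g \<in> carrier (GL TYPE(complex) n). act g ` orbit n d ((!) ms) (wt (length ms)) = orbit n k m y"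
  proof (rule collapse_orbit[OF ms(1), of \<nu>])
    show "set ms = \<nu> ` {i. i < n \<and> y i \<noteq> 0}" using ms(2) by (simp add: I_def)
  next
    fix t assume t: "t \<in> tor k"
    then show "\<exists>s\<in>tor d. \<exists>c. c \<noteq> 0 \<and> (\<forall>i<n. y i \<noteq> 0 \<longrightarrow> character k (m i) t = c * character d (\<nu> i) s)"
      using ch[OF _ t, of _ "vec d (\<lambda>l. character k (b l) t)"] character_nonzero[OF t]
      by (intro bexI[of _ "vec d (\<lambda>l. character k (b l) t)"] exI[of _ "character k (m i0) t"]) (auto simp: I_def)
  next
    fix s assume "s \<in> tor d"
    then obtain t where t: "t \<in> tor k" "\<And>l. l < d \<Longrightarrow> character k (b l) t = s $ l" using b(4) by blast
    then show "\<exists>t\<in>tor k. \<exists>c. c \<noteq> 0 \<and> (\<forall>i<n. y i \<noteq> 0 \<longrightarrow> character k (m i) t = c * character d (\<nu> i) s)"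
      using ch[OF _ t(1), of _ s] character_nonzero[OF t(1)]
      by (intro bexI[of _ t] exI[of _ "character k (m i0) t"]) (auto simp: I_def)
  qed
  moreover have "affinely_generating d (\<nu> ` I)"
  proof (rule affinely_generating_image)
    show "finite I" "I \<noteq> {}" using I by auto
    show "\<nu> i \<in> carrier_vec d" for i by (simp add: \<nu>_def)
    fix v :: "int vec" assume v: "v \<in> carrier_vec d"
    have "\<forall>l\<in>{..<d}. \<exists>\<gamma>. adm \<gamma> \<and> b l = wsum k n \<gamma> m" using b(1) unfolding \<Lambda>_def by blast
    then obtain \<gamma> where \<gamma>: "\<And>l. l < d \<Longrightarrow> adm (\<gamma> l)" "\<And>l. l < d \<Longrightarrow> b l = wsum k n (\<gamma> l) m"
      by (auto dest!: bchoice)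
    \<comment> \<open>A given \<open>v\<close> is expanded in the basis \<open>b\<close>, and each
      basis vector in the weights \<open>m\<close>. Freeness of \<open>b\<close> turns the resulting
      identity of weights back into one for \<open>v\<close> itself.\<close>
    define \<eta> where "\<eta> = (\<lambda>i. \<Sum>l<d. v $ l * \<gamma> l i)"
    have "(\<Sum>i<n. \<eta> i) = (\<Sum>l<d. v $ l * (\<Sum>i<n. \<gamma> l i))"
      unfolding \<eta>_def sum_distrib_left by (rule sum.swap)
    then have \<eta>: "(\<Sum>i<n. \<eta> i) = 0" "\<And>i. i < n \<Longrightarrow> y i = 0 \<Longrightarrow> \<eta> i = 0"
      using \<gamma>(1) by (auto simp: adm_def \<eta>_def)
    have restr: "(\<Sum>i<n. \<eta> i * f i) = (\<Sum>i\<in>I. \<eta> i * f i)" for f :: "nat \<Rightarrow> int"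
      using \<eta>(2) by (intro sum.mono_neutral_right) (auto simp: I_def)
    have s0: "(\<Sum>i\<in>I. \<eta> i) = 0" using restr[of "\<lambda>_. 1"] \<eta>(1) by simp
    have "wsum k d (\<lambda>l. v $ l - (\<Sum>i\<in>I. \<eta> i * \<nu> i $ l)) b = 0\<^sub>v k"
    proof (intro eq_vecI)
      fix j assume "j < dim_vec (0\<^sub>v k :: int vec)"
      then have j: "j < k" by simp
      have "(\<Sum>l<d. (\<Sum>i\<in>I. \<eta> i * \<nu> i $ l) * b l $ j) = (\<Sum>i\<in>I. \<eta> i * (\<Sum>l<d. c i l * b l $ j))"
        unfolding sum_distrib_left sum_distrib_right
        by (subst sum.swap) (auto simp: \<nu>_def mult.assoc intro!: sum.cong)
      also have "\<dots> = (\<Sum>i\<in>I. \<eta> i * (m i $ j - m i0 $ j))"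
      proof (intro sum.cong refl)
        fix i assume i: "i \<in> I"
        have "(\<Sum>l<d. c i l * b l $ j) = (m i - m i0) $ j" unfolding c[OF i] using j by simp
        then show "\<eta> i * (\<Sum>l<d. c i l * b l $ j) = \<eta> i * (m i $ j - m i0 $ j)"
          using j m[OF i0(1)] by simp
      qed
      also have "\<dots> = (\<Sum>i\<in>I. \<eta> i * m i $ j) - (\<Sum>i\<in>I. \<eta> i) * m i0 $ j"
        by (simp add: right_diff_distrib sum_subtractf sum_distrib_right)
      also have "\<dots> = wsum k n \<eta> m $ j" using s0 j restr by simp
      also have "wsum k n \<eta> m = wsum k d (\<lambda>l. v $ l) b"
        unfolding \<eta>_def by (rule wsum_combine[OF \<gamma>(2), symmetric])
      finally have "(\<Sum>l<d. (\<Sum>i\<in>I. \<eta> i * \<nu> i $ l) * b l $ j) = (\<Sum>l<d. v $ l * b l $ j)"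
        using j by simp
      then show "wsum k d (\<lambda>l. v $ l - (\<Sum>i\<in>I. \<eta> i * \<nu> i $ l)) b $ j = 0\<^sub>v k $ j"
        using j by (simp add: left_diff_distrib sum_subtractf)
    qed (simp add: wsum_def)
    then have "\<forall>l<d. v $ l = (\<Sum>i\<in>I. \<eta> i * \<nu> i $ l)" using b(3) by force
    then show "\<exists>\<gamma>. (\<Sum>i\<in>I. \<gamma> i) = 0 \<and> (\<forall>l<d. v $ l = (\<Sum>i\<in>I. \<gamma> i * \<nu> i $ l))"
      using s0 by blast
  qed
  moreover have "length ms \<le> n"
  proof -
    have "length ms = card (\<nu> ` I)" using distinct_card[OF ms(1)] ms(2) by simp
    also have "\<dots> \<le> card I" using I(1) by (rule card_image_le)
    also have "\<dots> \<le> card {..<n}" by (intro card_mono) (auto simp: I_def)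
    finally show ?thesis by simp
  qed
  moreover have "ms \<noteq> []" using ms(2) I by auto
  moreover have "set ms \<subseteq> carrier_vec d" using ms(2) by (auto simp: \<nu>_def)
  ultimately show ?thesis using ms by metis
qed

lemma toric_is_toric_of:
  assumes "toric N X"
  shows "\<exists>d ms. \<exists>g\<in>carrier (GL TYPE(complex) (Suc N)). distinct ms \<and> set ms \<in> generating_sets d N \<and>
    X = act g ` toric_of d N ms"
proof -
  let ?n = "Suc N"
  obtain T x where T: "subtorus ?n T" and x: "x \<in> proj_space ?n"
    and X: "X = zariski ?n closure_of ((\<lambda>g. PGL_act g x) ` T)"
    using assms unfolding toric_def by blast
  obtain k \<phi> where \<phi>: "\<phi> \<in> iso (torus k) (PGL ?n\<lparr>carrier := T\<rparr>)"
    "regular_map (Suc k) torus_pt (tor k) (?n * ?n) (PGL_pt ?n) T \<phi>"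
    using T unfolding subtorus_def by blast
  have TP: "T \<subseteq> carrier (PGL ?n)" using T subgroup.subset unfolding subtorus_def by blast
  have bij: "\<phi> ` tor k = T" using \<phi>(1) by (auto simp: iso_def bij_betw_def)
  interpret torus_rep ?n k \<phi> T
  proof
    fix s t assume st: "s \<in> tor k" "t \<in> tor k"
    have "tmul s t = s \<otimes>\<^bsub>torus k\<^esub> t" using st(1) by (auto simp: tmul_def torus_def)
    then show "\<phi> (tmul s t) = \<phi> s \<otimes>\<^bsub>PGL ?n\<^esub> \<phi> t"
      using \<phi>(1) st by (simp add: iso_def hom_def)
  qed (use bij TP \<phi>(2) in auto)
  obtain P Q m where PQ: "P \<in> carrier (GL TYPE(complex) ?n)" "Q \<in> carrier_mat ?n ?n" "P * Q = 1\<^sub>m ?n" "Q * P = 1\<^sub>m ?n"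
    and m: "\<And>i. i < ?n \<Longrightarrow> m i \<in> carrier_vec k"
    and D: "\<And>t. t \<in> tor k \<Longrightarrow> \<phi> t = PGL_class ?n (P * mat_diag ?n (\<lambda>i. character k (m i) t) * Q)"
    by (rule diagonal_form) (rule that)
  have Pc: "P \<in> carrier_mat ?n ?n" using PQ(1) by (simp add: GL_iff)
  have QG: "Q \<in> carrier (GL TYPE(complex) ?n)" unfolding GL_iff using PQ(2-4) Pc by blast
  obtain v where v: "v \<in> carrier_vec ?n" "v \<noteq> 0\<^sub>v ?n" "x = proj_pt v" using x by (rule proj_space_cases)
  \<comment> \<open>Coordinates of the base point in the eigenbasis, where the torus acts
    diagonally.\<close>
  define y where "y = Q *\<^sub>v v"
  have y: "y \<in> carrier_vec ?n" "y \<noteq> 0\<^sub>v ?n"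
    using v PQ(2) GL_mult_vec_nonzero[OF QG v(1,2)] by (auto simp: y_def)
  then obtain i0 where i0: "i0 < ?n" "y $ i0 \<noteq> 0"
    by (metis carrier_vecD eq_vecI index_zero_vec(1) index_zero_vec(2))
  have "PGL_act (\<phi> t) x = act P (proj_pt (orbit_vec ?n k m (($) y) t))" if t: "t \<in> tor k" for t
  proof -
    let ?D = "mat_diag ?n (\<lambda>i. character k (m i) t)"
    have c: "P * ?D \<in> carrier_mat ?n ?n" "P * ?D * Q \<in> carrier_mat ?n ?n"
      using Pc PQ(2) by (metis mat_diag_dim mult_carrier_mat)+
    have "?D *\<^sub>v y = orbit_vec ?n k m (($) y) t"
      using y(1) by (intro eq_vecI)
        (auto simp: mat_diag_def scalar_prod_def orbit_vec_def if_distrib[of "\<lambda>c. c * _"] sum.delta atLeast0LessThan cong: if_cong)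
    moreover have "(P * ?D * Q) *\<^sub>v v = P *\<^sub>v (?D *\<^sub>v y)"
      unfolding y_def using assoc_mult_mat_vec[OF c(1) PQ(2) v(1)]
        assoc_mult_mat_vec[OF Pc mat_diag_dim, of "Q *\<^sub>v v"] PQ(2) v(1) by simp
    ultimately show ?thesis
      unfolding D[OF t] PGL_act_class[OF c(2) x] unfolding v(3)
      by (simp add: act_proj_pt[OF c(2) v(1)] act_proj_pt[OF Pc])
  qed
  then have "(\<lambda>g. PGL_act g x) ` T = act P ` orbit ?n k m (($) y)"
    unfolding bij[symmetric] orbit_def by (simp add: image_image)
  moreover obtain d ms g where g: "g \<in> carrier (GL TYPE(complex) ?n)" and ms: "distinct ms" "ms \<noteq> []"
    "length ms \<le> ?n" "set ms \<subseteq> carrier_vec d" "affinely_generating d (set ms)"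
    and og: "act g ` orbit ?n d ((!) ms) (wt (length ms)) = orbit ?n k m (($) y)"
    using orbit_reduction[of i0 ?n "($) y" m k, OF i0 m] by blast
  ultimately have X': "X = zariski ?n closure_of (act P ` act g ` orbit ?n d ((!) ms) (wt (length ms)))"
    using X by simp
  have os: "orbit ?n d ((!) ms) (wt (length ms)) \<subseteq> proj_space ?n"
    using ms(2) by (intro orbit_space[of 0]) auto
  have gc: "g \<in> carrier_mat ?n ?n" using g by (simp add: GL_iff)
  have "act P ` act g ` Y = act (P * g) ` Y" if "Y \<subseteq> proj_space ?n" for Y
    using that act_mult[OF Pc gc] by (force simp: image_image)
  then have "X = zariski ?n closure_of (act (P * g) ` orbit ?n d ((!) ms) (wt (length ms)))"
    using X' os by simp
  moreover have Pg: "P * g \<in> carrier (GL TYPE(complex) ?n)"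
    using monoid.m_closed[OF group.is_monoid[OF group_GL] PQ(1) g] by simp
  ultimately have "X = act (P * g) ` toric_of d N ms"
    using closure_act[OF Pg os] toric_of_orbit[OF ms(2)] by simp
  moreover have "set ms \<in> generating_sets d N"
    using ms distinct_card[OF ms(1)] by (auto simp: generating_sets_def)
  ultimately show ?thesis using Pg ms(1) by blast
qed

section \<open>Affine equivalence implies projective equivalence\<close>

text \<open>A linear map of exponents corresponds to the transposed monomial substitution on the
  torus.\<close>

lemma character_mult_mat_vec:
  assumes "t \<in> tor d" "A \<in> carrier_mat d d" "v \<in> carrier_vec d"
  shows "character d (A *\<^sub>v v) t = character d v (vec d (\<lambda>j. \<Prod>i<d. t $ i powi A $$ (i, j)))"
proof -
  have "character d (A *\<^sub>v v) t = (\<Prod>i<d. \<Prod>j<d. (t $ i powi A $$ (i, j)) powi v $ j)"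
    unfolding character_def
  proof (intro prod.cong refl)
    fix i assume i: "i \<in> {..<d}"
    then have "(A *\<^sub>v v) $ i = (\<Sum>j<d. A $$ (i, j) * v $ j)"
      using assms(2,3) by (auto simp: scalar_prod_def atLeast0LessThan intro!: sum.cong)
    then show "t $ i powi (A *\<^sub>v v) $ i = (\<Prod>j<d. (t $ i powi A $$ (i, j)) powi v $ j)"
      using assms(1) i by (simp add: tor_iff power_int_sum power_int_mult)
  qed
  then show ?thesis
    by (subst (asm) prod.swap) (simp add: character_def power_int_prod)
qed

text \<open>The translation \<open>b\<close> only multiplies all coordinates by one character, the
  matrix \<open>A\<close> is absorbed by a monomial automorphism of the torus, and the change of
  enumeration by \<open>collapse_orbit\<close>.\<close>

lemma affine_equiv_imp_orbits:
  assumes ms: "distinct ms" "set ms \<subseteq> carrier_vec d" and ms': "distinct ms'" "length ms' \<le> n"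
    and eq: "affine_equiv d (set ms) (set ms')"
  shows "\<exists>g\<in>carrier (GL TYPE(complex) n). act g ` orbit n d ((!) ms) (wt (length ms)) = orbit n d ((!) ms') (wt (length ms'))"
proof -
  obtain A b where A: "A \<in> carrier (GL TYPE(int) d)" and b: "b \<in> carrier_vec d"
    and img: "set ms' = (\<lambda>m. A *\<^sub>v m + b) ` set ms"
    using eq unfolding affine_equiv_def by blast
  obtain B where B: "A \<in> carrier_mat d d" "B \<in> carrier_mat d d" "A * B = 1\<^sub>m d" "B * A = 1\<^sub>m d"
    using A by (auto simp: GL_iff)
  define m' where "m' = (\<lambda>i. B *\<^sub>v (ms' ! i - b))"
  have inv: "B *\<^sub>v ((A *\<^sub>v m + b) - b) = m" if m: "m \<in> carrier_vec d" for m
  proof -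
    have "(A *\<^sub>v m + b) - b = A *\<^sub>v m" using B m b by (intro eq_vecI) auto
    then show ?thesis using B m assoc_mult_mat_vec[of B d d A d m] by simp
  qed
  have idx: "{i. i < n \<and> wt (length ms') i \<noteq> 0} = {..<length ms'}" using ms'(2) by (auto simp: wt_def)
  have nth': "\<exists>m\<in>set ms. ms' ! i = A *\<^sub>v m + b \<and> m' i = m" if i: "i < length ms'" for i
  proof -
    obtain m where "m \<in> set ms" "ms' ! i = A *\<^sub>v m + b" using nth_mem[OF i] img by auto
    then show ?thesis using inv[of m] ms(2) by (auto simp: m'_def)
  qed
  have ch: "character d (ms' ! i) t = character d b t * character d (A *\<^sub>v m' i) t"
    and m'c: "m' i \<in> carrier_vec d" if t: "t \<in> tor d" and i: "i < length ms'" for i t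
  proof -
    obtain m where m: "m \<in> set ms" "ms' ! i = A *\<^sub>v m + b" "m' i = m" using nth'[OF i] by blast
    then show "m' i \<in> carrier_vec d" using ms(2) by auto
    then have "A *\<^sub>v m \<in> carrier_vec d" using B(1) m(3) by simp
    then show "character d (ms' ! i) t = character d b t * character d (A *\<^sub>v m' i) t"
      unfolding m(2,3) using character_add[OF t _ b] by (simp add: mult.commute)
  qed
  show ?thesis
  proof (rule collapse_orbit[OF ms(1), of m'])
    show "set ms = m' ` {i. i < n \<and> wt (length ms') i \<noteq> 0}"
      unfolding idx
    proof (rule Set.equalityI; rule Set.subsetI)
      fix m assume m: "m \<in> set ms"
      then have "A *\<^sub>v m + b \<in> set ms'" using img by blast
      then obtain i where "i < length ms'" "ms' ! i = A *\<^sub>v m + b" by (auto simp: in_set_conv_nth)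
      moreover have "B *\<^sub>v ((A *\<^sub>v m + b) - b) = m" using inv m ms(2) by blast
      ultimately show "m \<in> m' ` {..<length ms'}" unfolding m'_def by (intro image_eqI[of _ _ i]) auto
    next
      fix m assume "m \<in> m' ` {..<length ms'}"
      then show "m \<in> set ms" using nth' by auto
    qed
  next
    fix t assume t: "t \<in> tor d"
    define s where "s = vec d (\<lambda>j. \<Prod>i<d. t $ i powi A $$ (i, j))"
    have "s \<in> tor d" using t by (auto simp: s_def tor_iff)
    moreover have "character d (ms' ! i) t = character d b t * character d (m' i) s"
      if "i < length ms'" for i
      using ch[OF t that] character_mult_mat_vec[OF t B(1) m'c[OF t that]] by (simp add: s_def)
    ultimately show "\<exists>s\<in>tor d. \<exists>c. c \<noteq> 0 \<and> (\<forall>i<n. wt (length ms') i \<noteq> 0 \<longrightarrow>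
        character d (ms' ! i) t = c * character d (m' i) s)"
      using character_nonzero[OF t, of b] by (intro bexI[of _ s] exI[of _ "character d b t"]) (auto simp: wt_def)
  next
    fix s assume s: "s \<in> tor d"
    define t where "t = vec d (\<lambda>j. \<Prod>i<d. s $ i powi B $$ (i, j))"
    have t: "t \<in> tor d" using s by (auto simp: t_def tor_iff)
    have "character d (ms' ! i) t = character d b t * character d (m' i) s"
      if i: "i < length ms'" for i
    proof -
      have "character d (A *\<^sub>v m' i) t = character d (B *\<^sub>v (A *\<^sub>v m' i)) s"
        unfolding t_def using B m'c[OF t i] by (intro character_mult_mat_vec[symmetric, OF s]) auto
      moreover have "B *\<^sub>v (A *\<^sub>v m' i) = m' i"
        using B m'c[OF t i] assoc_mult_mat_vec[of B d d A d "m' i"] by simp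
      ultimately show ?thesis using ch[OF t i] by simp
    qed
    then show "\<exists>t\<in>tor d. \<exists>c. c \<noteq> 0 \<and> (\<forall>i<n. wt (length ms') i \<noteq> 0 \<longrightarrow>
        character d (ms' ! i) t = c * character d (m' i) s)"
      using t character_nonzero[OF t, of b] by (intro bexI[of _ t] exI[of _ "character d b t"]) (auto simp: wt_def)
  qed
qed

section \<open>Polynomial families of matrices\<close>

definition polyfun :: "(complex \<Rightarrow> complex) \<Rightarrow> bool" where
  "polyfun f \<longleftrightarrow> (\<exists>p. \<forall>z. f z = poly p z)"

lemma polyfun_const: "polyfun (\<lambda>_. c)"
  unfolding polyfun_def by (intro exI[of _ "[:c:]"]) auto

lemma polyfun_affine: "polyfun (\<lambda>z. a * (1 - z) + b * z)"
  unfolding polyfun_def by (intro exI[of _ "[:a, b - a:]"]) (auto simp: algebra_simps)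

lemma polyfun_add: "polyfun f \<Longrightarrow> polyfun g \<Longrightarrow> polyfun (\<lambda>z. f z + g z)"
  unfolding polyfun_def by (metis poly_add)

lemma polyfun_mult: "polyfun f \<Longrightarrow> polyfun g \<Longrightarrow> polyfun (\<lambda>z. f z * g z)"
  unfolding polyfun_def by (metis poly_mult)

lemma polyfun_sum: "(\<And>i. i \<in> I \<Longrightarrow> polyfun (f i)) \<Longrightarrow> polyfun (\<lambda>z. \<Sum>i\<in>I. f i z)"
  by (induction I rule: infinite_finite_induct) (auto intro: polyfun_const polyfun_add)

lemma polyfun_prod: "(\<And>i. i \<in> I \<Longrightarrow> polyfun (f i)) \<Longrightarrow> polyfun (\<lambda>z. \<Prod>i\<in>I. f i z)"
  by (induction I rule: infinite_finite_induct) (auto intro: polyfun_const polyfun_mult)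

lemma polyfun_power: "polyfun f \<Longrightarrow> polyfun (\<lambda>z. f z ^ n)"
  by (induction n) (auto intro: polyfun_const polyfun_mult)

lemma polyfun_finite_zeros:
  assumes "polyfun f" "f a \<noteq> 0" shows "finite {z. f z = 0}"
proof -
  obtain p where p: "f = poly p" using assms(1) unfolding polyfun_def by blast
  then have "p \<noteq> 0" using assms(2) by auto
  then show ?thesis unfolding p by (rule poly_roots_finite)
qed

lemma polyfun_tendsto:
  assumes "polyfun f" "(z \<longlongrightarrow> a) F" shows "((\<lambda>x. f (z x)) \<longlongrightarrow> f a) F"
proof -
  obtain p where "\<And>z. f z = poly p z" using assms(1) unfolding polyfun_def by blast
  then show ?thesis using tendsto_poly[OF assms(2), of p] by simp
qed

lemma polyfun_det:
  assumes "\<And>z. M z \<in> carrier_mat n n" "\<And>i j. i < n \<Longrightarrow> j < n \<Longrightarrow> polyfun (\<lambda>z. M z $$ (i, j))"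
  shows "polyfun (\<lambda>z. det (M z))"
proof -
  have "polyfun (\<lambda>z. \<Sum>p\<in>{p. p permutes {0..<n}}. signof p * (\<Prod>i = 0..<n. M z $$ (i, p i)))"
    by (intro polyfun_sum polyfun_mult polyfun_const polyfun_prod assms(2)) (auto simp: permutes_in_image)
  then show ?thesis using det_def'[OF assms(1)] by simp
qed

lemma polyfun_matrix:
  assumes "\<And>z. M z \<in> carrier_mat n n" "\<And>i j. i < n \<Longrightarrow> j < n \<Longrightarrow> polyfun (\<lambda>z. M z $$ (i, j))"
  obtains A where "A \<in> carrier_mat n n" "\<And>z. M z = map_mat (\<lambda>p. poly p z) A"
proof -
  have "\<forall>i j. \<exists>p. i < n \<longrightarrow> j < n \<longrightarrow> (\<forall>z. M z $$ (i, j) = poly p z)"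
    using assms(2) unfolding polyfun_def by blast
  then obtain p where p: "\<And>i j z. i < n \<Longrightarrow> j < n \<Longrightarrow> M z $$ (i, j) = poly (p i j) z"
    by metis
  show ?thesis
  proof (rule that[of "Matrix.mat n n (\<lambda>(i, j). p i j)"])
    show "M z = map_mat (\<lambda>p. poly p z) (Matrix.mat n n (\<lambda>(i, j). p i j))" for z
      using assms(1)[of z] p by (intro eq_matI) auto
  qed simp
qed

lemma polyfun_char_poly:
  assumes "\<And>z. M z \<in> carrier_mat n n" "\<And>i j. i < n \<Longrightarrow> j < n \<Longrightarrow> polyfun (\<lambda>z. M z $$ (i, j))"
  shows "polyfun (\<lambda>z. poly (char_poly (M z)) x)"
proof -
  obtain A where A: "A \<in> carrier_mat n n" "\<And>z. M z = map_mat (\<lambda>p. poly p z) A"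
    using polyfun_matrix[OF assms] by blast
  have "poly (char_poly (M z)) x = (\<Sum>i\<le>n. poly (coeff (char_poly A) i) z * x ^ i)" for z
  proof -
    have "char_poly (M z) = map_poly (\<lambda>p. poly p z) (char_poly A)"
      unfolding A(2) by (rule poly_hom.char_poly_hom[OF A(1)])
    moreover have "degree (char_poly (M z)) = n" using degree_monic_char_poly[OF assms(1)] by blast
    ultimately show ?thesis unfolding poly_altdef by (simp add: coeff_map_poly)
  qed
  moreover have "polyfun (\<lambda>z. \<Sum>i\<le>n. poly (coeff (char_poly A) i) z * x ^ i)"
    by (intro polyfun_sum polyfun_mult polyfun_const) (auto simp: polyfun_def)
  ultimately show ?thesis by simp
qed

section \<open>Simple spectra in polynomial families\<close>

definition eigen_labelling :: "nat \<Rightarrow> complex mat \<Rightarrow> (nat \<Rightarrow> complex) \<Rightarrow> bool" where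
  "eigen_labelling n M ev \<longleftrightarrow> inj_on ev {..<n} \<and> char_poly M = (\<Prod>i<n. [:- ev i, 1:])"

lemma labelling_roots:
  assumes "eigen_labelling n M ev" shows "poly (char_poly M) x = (\<Prod>i<n. x - ev i)"
  using assms by (simp add: eigen_labelling_def poly_prod)

text \<open>A common root of a polynomial and its derivative is a multiple root; with
  \<open>coprime_labelling\<close>, this turns simplicity of the spectrum into a condition on a
  resultant.\<close>

lemma labelling_coprime:
  assumes "eigen_labelling n M ev"
  shows "degree (gcd (char_poly M) (pderiv (char_poly M))) = 0"
proof (rule ccontr)
  let ?p = "char_poly M" and ?g = "gcd (char_poly M) (pderiv (char_poly M))"
  assume "degree ?g \<noteq> 0"
  then obtain x where "poly ?g x = 0" using fundamental_theorem_of_algebra_alt[of ?g] by (metis degree_pCons_0)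
  then have x: "poly ?p x = 0" "poly (pderiv ?p) x = 0"
    using dvdE[OF gcd_dvd1[of ?p "pderiv ?p"]] dvdE[OF gcd_dvd2[of ?p "pderiv ?p"]]
    by (metis mult_zero_left poly_mult)+
  then obtain i where i: "i < n" "x = ev i"
    unfolding labelling_roots[OF assms] by (auto simp: prod_zero_iff)
  have "?p = [:- ev i, 1:] * (\<Prod>j\<in>{..<n} - {i}. [:- ev j, 1:])"
    using assms i(1) unfolding eigen_labelling_def by (simp add: prod.remove[of "{..<n}" i])
  then have "poly (pderiv ?p) x = (\<Prod>j\<in>{..<n} - {i}. ev i - ev j)"
    unfolding i(2) by (simp add: pderiv_mult pderiv_pCons poly_prod del: mult_pCons_left)
  then obtain j where "j < n" "j \<noteq> i" "ev i = ev j" using x(2) by (auto simp: prod_zero_iff)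
  then show False using assms i(1) by (auto simp: eigen_labelling_def inj_on_def)
qed

lemma coprime_labelling:
  assumes M: "M \<in> carrier_mat n n" and deg: "degree (gcd (char_poly M) (pderiv (char_poly M))) = 0"
  obtains ev where "eigen_labelling n M ev"
proof -
  obtain as where as: "char_poly M = (\<Prod>a\<leftarrow>as. [:- a, 1:])" "length as = n"
    using char_poly_factorized[OF M] by blast
  have prod: "char_poly M = (\<Prod>i<n. [:- (as ! i), 1:])"
    unfolding as(1) prod.list_conv_set_nth using as(2) by (simp add: atLeast0LessThan)
  have "inj_on ((!) as) {..<n}"
  proof (rule inj_onI, rule ccontr)
    fix i j assume ij: "i \<in> {..<n}" "j \<in> {..<n}" "as ! i = as ! j" "i \<noteq> j"
    define x where "x = as ! i"
    define r where "r = (\<Prod>l\<in>{..<n} - {i} - {j}. [:- (as ! l), 1:])"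
    have "char_poly M = [:- x, 1:] * ([:- x, 1:] * r)"
      unfolding prod r_def x_def using ij by (simp add: prod.remove[of "{..<n}" i] prod.remove[of "{..<n} - {i}" j])
    then have "[:- x, 1:] dvd char_poly M" "[:- x, 1:] dvd pderiv (char_poly M)"
      by (simp_all only: pderiv_mult dvd_add dvd_mult dvd_mult2 dvd_triv_left)
    then have "[:- x, 1:] dvd gcd (char_poly M) (pderiv (char_poly M))" by (rule gcd_greatest)
    moreover have "gcd (char_poly M) (pderiv (char_poly M)) \<noteq> 0"
      using degree_monic_char_poly[OF M] by auto
    ultimately have "degree [:- x, 1:] \<le> degree (gcd (char_poly M) (pderiv (char_poly M)))"
      by (intro dvd_imp_degree_le) auto
    then show False using deg by simp
  qed
  then show ?thesis using prod by (intro that[of "(!) as"]) (simp add: eigen_labelling_def)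
qed

text \<open>The resultant of the characteristic polynomial and its derivative is a polynomial in the
  parameter, and it is nonzero at \<open>a\<close>.\<close>

lemma labelling_cofinite:
  assumes M: "\<And>z. M z \<in> carrier_mat n n" "\<And>i j. i < n \<Longrightarrow> j < n \<Longrightarrow> polyfun (\<lambda>z. M z $$ (i, j))"
    and lab: "eigen_labelling n (M a) ev" and n: "n > 0"
  shows "finite {z. \<not> (\<exists>ev. eigen_labelling n (M z) ev)}"
proof -
  obtain A where A: "A \<in> carrier_mat n n" "\<And>z. M z = map_mat (\<lambda>p. poly p z) A"
    using polyfun_matrix[OF M] by blast
  define R where "R = resultant (char_poly A) (pderiv (char_poly A))"
  have R: "poly R z = 0 \<longleftrightarrow> degree (gcd (char_poly (M z)) (pderiv (char_poly (M z)))) \<noteq> 0" for z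
  proof -
    have cp: "map_poly (\<lambda>p. poly p z) (char_poly A) = char_poly (M z)"
      unfolding A(2) by (rule poly_hom.char_poly_hom[OF A(1), symmetric])
    have pd: "map_poly (\<lambda>p. poly p z) (pderiv (char_poly A)) = pderiv (char_poly (M z))"
      unfolding cp[symmetric] by (rule poly_hom.map_poly_pderiv)
    \<comment> \<open>Characteristic polynomials are monic, so neither degree drops under evaluation
      and the resultant commutes with it.\<close>
    have "degree (char_poly A) = n" "degree (char_poly (M z)) = n"
      using degree_monic_char_poly[OF A(1)] degree_monic_char_poly[OF M(1)] by blast+
    moreover from this have "degree (pderiv (char_poly A)) = n - 1" "degree (pderiv (char_poly (M z))) = n - 1"
      by (simp_all add: degree_pderiv)
    ultimately have "resultant (map_poly (\<lambda>p. poly p z) (char_poly A)) (map_poly (\<lambda>p. poly p z) (pderiv (char_poly A))) = poly R z"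
      unfolding R_def by (intro poly_hom.resultant_map_poly) (simp_all add: cp pd)
    then have "resultant (char_poly (M z)) (pderiv (char_poly (M z))) = poly R z"
      unfolding cp pd .
    then show ?thesis using resultant_0_gcd by metis
  qed
  have "poly R a \<noteq> 0" using R labelling_coprime[OF lab] by blast
  then have "finite {z. poly R z = 0}" by (intro poly_roots_finite) auto
  moreover have "{z. \<not> (\<exists>ev. eigen_labelling n (M z) ev)} \<subseteq> {z. poly R z = 0}"
    using R coprime_labelling[OF M(1)] by blast
  ultimately show ?thesis by (rule rev_finite_subset)
qed

lemma labelling_permute:
  assumes "eigen_labelling n M ev" "\<pi> permutes {..<n}" shows "eigen_labelling n M (ev \<circ> \<pi>)"
proof -
  have "inj_on (ev \<circ> \<pi>) {..<n}"
    using assms by (intro comp_inj_on) (auto simp: eigen_labelling_def permutes_image permutes_inj_on)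
  moreover have "(\<Prod>i<n. [:- ev i, 1:]) = (\<Prod>i<n. [:- (ev \<circ> \<pi>) i, 1:])"
    using prod.permute[OF assms(2), of "\<lambda>i. [:- ev i, 1:]"] by (simp add: o_def)
  ultimately show ?thesis using assms(1) by (simp add: eigen_labelling_def)
qed

text \<open>Roots depend continuously on the matrix: the nearest eigenvalue to a root of the limit is
  controlled by the value of the characteristic polynomial at that root.\<close>

lemma labelling_converges:
  assumes M: "\<And>z. M z \<in> carrier_mat n n" "\<And>i j. i < n \<Longrightarrow> j < n \<Longrightarrow> polyfun (\<lambda>z. M z $$ (i, j))" and n: "n > 0"
    and lab0: "eigen_labelling n (M a) ev0" and z: "z \<longlonglongrightarrow> a"
    and lab: "\<And>r :: nat. eigen_labelling n (M (z r)) (ev r)"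
  obtains \<pi> where "\<And>i. i < n \<Longrightarrow> (\<lambda>r. ev r (\<pi> r i)) \<longlonglongrightarrow> ev0 i"
    "\<forall>\<^sub>F r in sequentially. \<pi> r permutes {..<n}"
proof -
  \<comment> \<open>The eigenvalue nearest to \<open>ev0 i\<close>; the identity outside
    \<open>{..<n}\<close> makes it eligible as a permutation of that set.\<close>
  define \<pi> where "\<pi> = (\<lambda>r i. if i < n then arg_min_on (\<lambda>j. dist (ev0 i) (ev r j)) {..<n} else i)"
  have ne: "{..<n} \<noteq> {}" using n by auto
  have \<pi>n: "\<pi> r i < n" if "i < n" for r i
    using arg_min_if_finite(1)[of "{..<n}"] ne that by (auto simp: \<pi>_def)
  have min: "dist (ev0 i) (ev r (\<pi> r i)) \<le> dist (ev0 i) (ev r j)" if "i < n" "j < n" for r i j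
    using arg_min_least[of "{..<n}" j "\<lambda>j. dist (ev0 i) (ev r j)"] that ne by (simp add: \<pi>_def)
  have conv: "(\<lambda>r. ev r (\<pi> r i)) \<longlonglongrightarrow> ev0 i" if i: "i < n" for i
  proof -
    have "(\<lambda>r. poly (char_poly (M (z r))) (ev0 i)) \<longlonglongrightarrow> poly (char_poly (M a)) (ev0 i)"
      by (rule polyfun_tendsto[OF polyfun_char_poly[OF M] z])
    also have "poly (char_poly (M a)) (ev0 i) = 0"
      unfolding labelling_roots[OF lab0] using i by (auto simp: prod_zero_iff)
    finally have "(\<lambda>r. root n (norm (poly (char_poly (M (z r))) (ev0 i)))) \<longlonglongrightarrow> root n (norm (0 :: complex))"
      by (intro tendsto_intros)
    then have lim: "(\<lambda>r. root n (norm (poly (char_poly (M (z r))) (ev0 i)))) \<longlonglongrightarrow> 0" by simp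
    \<comment> \<open>The value of the characteristic polynomial is the product of all
      \<open>n\<close> distances, each at least the smallest; hence the \<open>n\<close>-th
      root.\<close>
    have "dist (ev r (\<pi> r i)) (ev0 i) \<le> root n (norm (poly (char_poly (M (z r))) (ev0 i)))" for r
    proof -
      have "dist (ev r (\<pi> r i)) (ev0 i) ^ n = (\<Prod>j<n. dist (ev0 i) (ev r (\<pi> r i)))"
        by (simp add: dist_commute)
      also have "\<dots> \<le> (\<Prod>j<n. dist (ev0 i) (ev r j))"
        using min[OF i] by (intro prod_mono) auto
      also have "\<dots> = norm (poly (char_poly (M (z r))) (ev0 i))"
        unfolding labelling_roots[OF lab] by (simp add: dist_norm prod_norm)
      finally have "root n (dist (ev r (\<pi> r i)) (ev0 i) ^ n) \<le> root n (norm (poly (char_poly (M (z r))) (ev0 i)))"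
        by (rule real_root_le_mono[OF n])
      then show ?thesis by (subst (asm) real_root_power_cancel[OF n zero_le_dist])
    qed
    then have "\<forall>\<^sub>F r in sequentially. dist (ev r (\<pi> r i)) (ev0 i) \<le> root n (norm (poly (char_poly (M (z r))) (ev0 i)))"
      by (rule always_eventually[OF allI])
    from tendsto_sandwich[OF always_eventually[OF allI[OF zero_le_dist]] this tendsto_const lim]
    show ?thesis unfolding tendsto_dist_iff[of _ "ev0 i"] .
  qed
  \<comment> \<open>Nearest choices converging to distinct limits are eventually distinct, so the
    selection becomes injective.\<close>
  have "\<forall>\<^sub>F r in sequentially. ev r (\<pi> r i) \<noteq> ev r (\<pi> r j)" if ij: "i < n" "j < n" "i \<noteq> j" for i j
  proof -
    have "ev0 i - ev0 j \<noteq> 0" using lab0 ij by (auto simp: eigen_labelling_def inj_on_def)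
    then have "\<forall>\<^sub>F r in sequentially. ev r (\<pi> r i) - ev r (\<pi> r j) \<noteq> 0"
      by (intro tendsto_imp_eventually_ne[OF tendsto_diff[OF conv[OF ij(1)] conv[OF ij(2)]]])
    then show ?thesis by eventually_elim auto
  qed
  then have "\<forall>\<^sub>F r in sequentially. \<forall>p\<in>{p \<in> {..<n} \<times> {..<n}. fst p \<noteq> snd p}. ev r (\<pi> r (fst p)) \<noteq> ev r (\<pi> r (snd p))"
    by (intro eventually_ball_finite) auto
  then have "\<forall>\<^sub>F r in sequentially. \<pi> r permutes {..<n}"
  proof eventually_elim
    case (elim r)
    have "inj_on (\<pi> r) {..<n}"
      using elim by (auto simp: inj_on_def) (metis)
    moreover have "\<pi> r ` {..<n} \<subseteq> {..<n}" using \<pi>n by auto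
    ultimately have "bij_betw (\<pi> r) {..<n} {..<n}"
      by (simp add: bij_betw_def endo_inj_surj)
    then show ?case by (rule bij_imp_permutes) (simp add: \<pi>_def)
  qed
  with conv show ?thesis by (rule that)
qed

text \<open>Left eigenvectors are used because linear forms are pulled back: the rows of
  \<open>W\<close> are coordinates in which \<open>M\<close> acts by scaling.\<close>

lemma left_eigenbasis:
  assumes M: "M \<in> carrier_mat n n" and lab: "eigen_labelling n M ev"
  obtains W V where "W \<in> carrier_mat n n" "V \<in> carrier_mat n n" "W * V = 1\<^sub>m n" "V * W = 1\<^sub>m n"
    "\<And>v i. v \<in> carrier_vec n \<Longrightarrow> i < n \<Longrightarrow> (W *\<^sub>v (M *\<^sub>v v)) $ i = ev i * (W *\<^sub>v v) $ i"
proof -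
  have "\<forall>i\<in>{..<n}. \<exists>w. w \<in> carrier_vec n \<and> w \<noteq> 0\<^sub>v n \<and> transpose_mat M *\<^sub>v w = ev i \<cdot>\<^sub>v w"
  proof
    fix i assume i: "i \<in> {..<n}"
    have "poly (char_poly (transpose_mat M)) (ev i) = 0"
      unfolding char_poly_transpose_mat[OF M] labelling_roots[OF lab] using i by (auto simp: prod_zero_iff)
    then have "eigenvalue (transpose_mat M) (ev i)"
      using M by (subst eigenvalue_root_char_poly[of _ n]) auto
    then show "\<exists>w. w \<in> carrier_vec n \<and> w \<noteq> 0\<^sub>v n \<and> transpose_mat M *\<^sub>v w = ev i \<cdot>\<^sub>v w"
      using M unfolding eigenvalue_def eigenvector_def by auto
  qed
  then obtain w where w: "\<And>i. i < n \<Longrightarrow> w i \<in> carrier_vec n" "\<And>i. i < n \<Longrightarrow> w i \<noteq> 0\<^sub>v n"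
    "\<And>i. i < n \<Longrightarrow> transpose_mat M *\<^sub>v w i = ev i \<cdot>\<^sub>v w i"
    by (auto dest!: bchoice)
  have w_eq: "(\<Sum>e<n. M $$ (e, c) * w i $ e) = ev i * w i $ c" if "i < n" "c < n" for i c
  proof -
    have "(transpose_mat M *\<^sub>v w i) $ c = (\<Sum>e<n. M $$ (e, c) * w i $ e)"
      using M w(1)[OF that(1)] that by (auto simp: scalar_prod_def atLeast0LessThan intro!: sum.cong)
    then show ?thesis using w(1,3)[OF that(1)] that(2) by simp
  qed
  define W where "W = Matrix.mat n n (\<lambda>(i, j). w i $ j)"
  have Wc: "W \<in> carrier_mat n n" by (simp add: W_def)
  have Wv: "(W *\<^sub>v v) $ i = (\<Sum>e<n. w i $ e * v $ e)" if "v \<in> carrier_vec n" "i < n" for v i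
    using that by (auto simp: W_def scalar_prod_def atLeast0LessThan)
  have "det (transpose_mat W) \<noteq> 0"
  proof
    assume "det (transpose_mat W) = 0"
    then obtain y where y: "y \<in> carrier_vec n" "y \<noteq> 0\<^sub>v n" "transpose_mat W *\<^sub>v y = 0\<^sub>v n"
      using det_0_iff_vec_prod_zero[of "transpose_mat W" n] Wc by auto
    have base: "(\<Sum>i<n. y $ i * w i $ c) = 0" if "c < n" for c
    proof -
      have "(transpose_mat W *\<^sub>v y) $ c = (\<Sum>i<n. w i $ c * y $ i)"
        using y(1) that by (auto simp: W_def scalar_prod_def atLeast0LessThan)
      then show ?thesis using y(3) that by (simp add: mult.commute)
    qed
    \<comment> \<open>Each application of \<open>M\<close> to a relation among left eigenvectors
      multiplies its terms by the eigenvalues, and the Vandermonde lemma separates them.\<close>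
    have pow: "(\<Sum>i<n. ev i ^ j * (y $ i * w i $ c)) = 0" if "c < n" for j c
      using that
    proof (induction j arbitrary: c)
      case (Suc j)
      have "(\<Sum>i<n. ev i ^ Suc j * (y $ i * w i $ c)) = (\<Sum>i<n. ev i ^ j * y $ i * (\<Sum>e<n. M $$ (e, c) * w i $ e))"
        using w_eq[OF _ Suc.prems] by (intro sum.cong) (auto simp: mult_ac)
      also have "\<dots> = (\<Sum>e<n. M $$ (e, c) * (\<Sum>i<n. ev i ^ j * (y $ i * w i $ e)))"
        unfolding sum_distrib_left by (subst sum.swap) (simp add: mult_ac)
      finally show ?case using Suc.IH by simp
    qed (use base in simp)
    have "y $ i = 0" if i: "i < n" for i
    proof -
      obtain c where c: "c < n" "w i $ c \<noteq> 0"
        using w(1,2)[OF i] by (metis carrier_vecD eq_vecI index_zero_vec(1) index_zero_vec(2))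
      have "y $ i * w i $ c = 0"
        by (rule vandermonde_independent[of "{..<n}" ev "\<lambda>i. y $ i * w i $ c"])
           (use lab pow[OF c(1)] i in \<open>auto simp: eigen_labelling_def\<close>)
      then show ?thesis using c(2) by simp
    qed
    then show False using y(1,2) by (metis carrier_vecD eq_vecI index_zero_vec(1) index_zero_vec(2))
  qed
  then have "det W \<noteq> 0" using det_transpose[OF Wc] by simp
  then have "W \<in> carrier (GL TYPE(complex) n)"
    using det_non_zero_imp_unit[OF Wc, of "()"] by (simp add: GL_def units_of_def)
  then obtain V where V: "V \<in> carrier_mat n n" "W * V = 1\<^sub>m n" "V * W = 1\<^sub>m n" by (auto simp: GL_iff)
  show ?thesis
  proof (rule that[OF Wc V])
    fix v :: "complex vec" and i assume v: "v \<in> carrier_vec n" and i: "i < n"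
    have "(W *\<^sub>v (M *\<^sub>v v)) $ i = (\<Sum>e<n. w i $ e * (\<Sum>c<n. M $$ (e, c) * v $ c))"
      using M v i by (subst Wv) (auto simp: scalar_prod_def atLeast0LessThan intro!: sum.cong)
    also have "\<dots> = (\<Sum>c<n. (\<Sum>e<n. M $$ (e, c) * w i $ e) * v $ c)"
      unfolding sum_distrib_left sum_distrib_right by (subst sum.swap) (simp add: mult_ac)
    also have "\<dots> = (\<Sum>c<n. ev i * w i $ c * v $ c)"
      using w_eq[OF i] by (intro sum.cong) auto
    also have "\<dots> = ev i * (W *\<^sub>v v) $ i"
      using v i by (simp add: Wv sum_distrib_left mult.assoc)
    finally show "(W *\<^sub>v (M *\<^sub>v v)) $ i = ev i * (W *\<^sub>v v) $ i" .
  qed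
qed

text \<open>Connectedness of the interval, by the supremum of the parameters reached. Openness is
  required only on \<open>{0..<1}\<close>, and only for some term of each convergent sequence, since
  no counting is available at 1.\<close>

lemma unit_interval_induct:
  fixes P :: "real \<Rightarrow> bool"
  assumes "P 0"
    and closed: "\<And>x s. (\<And>r :: nat. s r \<in> {0..1} \<and> P (s r)) \<Longrightarrow> s \<longlonglongrightarrow> x \<Longrightarrow> x \<in> {0..1} \<Longrightarrow> P x"
    and opn: "\<And>x s. x \<in> {0..<1} \<Longrightarrow> P x \<Longrightarrow> (\<And>r :: nat. s r \<in> {0..<1}) \<Longrightarrow> s \<longlonglongrightarrow> x \<Longrightarrow> \<exists>r. P (s r)"
  shows "P 1"
proof -
  define E where "E = {x \<in> {0..1}. P x}"
  have E: "E \<noteq> {}" "bdd_above E" using assms(1) by (auto simp: E_def intro!: bdd_aboveI[of _ 1] exI[of _ 0])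
  define x where "x = Sup E"
  have x01: "x \<in> {0..1}"
    using E assms(1) by (auto simp: x_def E_def intro!: cSup_upper cSup_least)
  have "\<exists>y\<in>E. x - 1 / real (Suc r) < y" for r
    unfolding x_def using E by (intro less_cSupD) auto
  then obtain s where s: "\<And>r. s r \<in> E" "\<And>r. x - 1 / real (Suc r) < s r" by metis
  have "s \<longlonglongrightarrow> x"
  proof (rule tendsto_sandwich[of "\<lambda>r. x - 1 / real (Suc r)" _ _ "\<lambda>_. x"])
    show "(\<lambda>r. x - 1 / real (Suc r)) \<longlonglongrightarrow> x"
      using tendsto_diff[OF tendsto_const[of x] LIMSEQ_inverse_real_of_nat] by (simp add: inverse_eq_divide)
    show "\<forall>\<^sub>F r in sequentially. s r \<le> x"
      using s(1) E by (auto simp: x_def intro!: cSup_upper always_eventually)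
  qed (use s(2) in \<open>auto intro: always_eventually less_imp_le\<close>)
  then have Px: "P x" using closed[of s x] s(1) x01 by (auto simp: E_def)
  show ?thesis
  proof (cases "x = 1")
    case False
    \<comment> \<open>A sequence in the open interval decreasing to \<open>x\<close>; reaching any
      of its terms contradicts the supremum.\<close>
    define s where "s = (\<lambda>r :: nat. x + (1 - x) / real (Suc (Suc r)))"
    have lt: "x < s r" "s r < 1" for r
    proof -
      show "x < s r" using False x01 by (simp add: s_def)
      have "(1 - x) / real (Suc (Suc r)) < (1 - x) / 1"
        using False x01 by (intro divide_strict_left_mono) auto
      then show "s r < 1" by (simp add: s_def)
    qed
    have "s \<longlonglongrightarrow> x + (1 - x) * 0"
    proof -
      have "(\<lambda>r. inverse (real (Suc (Suc r)))) \<longlonglongrightarrow> 0"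
        using LIMSEQ_Suc[OF LIMSEQ_inverse_real_of_nat] .
      then show ?thesis unfolding s_def divide_inverse by (intro tendsto_intros)
    qed
    then obtain r where "P (s r)"
      using opn[of x s] Px x01 False lt(2) order_trans[OF _ less_imp_le[OF lt(1)]] by force
    then have "s r \<in> E" using lt[of r] x01 by (auto simp: E_def)
    then have "s r \<le> x" using E by (auto simp: x_def intro: cSup_upper)
    then show ?thesis using lt(1)[of r] by simp
  qed (use Px in simp)
qed

section \<open>Cones over orbits and their projective symmetries\<close>

text \<open>Distinct weights give independent characters, so the cone lies in no hyperplane.\<close>

lemma linear_form_on_orbit:
  fixes k :: nat
  assumes "inj_on m {..<k}" "\<And>i. i < k \<Longrightarrow> m i \<in> carrier_vec d"
    "\<And>t. t \<in> tor d \<Longrightarrow> (\<Sum>j<k. c j * character d (m j) t) = 0" "j < k"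
  shows "c j = 0"
proof -
  have "(c \<circ> the_inv_into {..<k} m) (m j) = 0"
  proof (rule characters_independent[of "m ` {..<k}" d])
    fix t assume "t \<in> tor d"
    have "(\<Sum>\<mu>\<in>m ` {..<k}. (c \<circ> the_inv_into {..<k} m) \<mu> * character d \<mu> t) = (\<Sum>j<k. c j * character d (m j) t)"
      unfolding sum.reindex[OF assms(1)] using assms(1) by (intro sum.cong) (auto simp: the_inv_into_f_f)
    then show "(\<Sum>\<mu>\<in>m ` {..<k}. (c \<circ> the_inv_into {..<k} m) \<mu> * character d \<mu> t) = 0"
      using assms(3)[OF \<open>t \<in> tor d\<close>] by simp
  qed (use assms in auto)
  then show ?thesis using assms(1,4) by (simp add: the_inv_into_f_f)
qed

lemma mat_diag_vec:
  "v \<in> carrier_vec k \<Longrightarrow> mat_diag k g *\<^sub>v v = vec k (\<lambda>i. g i * (v $ i :: complex))"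
  by (intro eq_vecI) (auto simp: mat_diag_def scalar_prod_def atLeast0LessThan if_distrib[of "\<lambda>x. x * _"] sum.delta cong: if_cong)

lemma eigen_labelling_diag:
  assumes "inj_on g {..<n}" shows "eigen_labelling n (mat_diag n g) g"
proof -
  have "upper_triangular (mat_diag n g)" by (auto simp: mat_diag_def)
  moreover have "diag_mat (mat_diag n g) = map g [0..<n]" by (auto simp: mat_diag_def diag_mat_def)
  ultimately have "char_poly (mat_diag n g) = (\<Prod>i\<leftarrow>[0..<n]. [:- g i, 1:])"
    using char_poly_upper_triangular[of "mat_diag n g" n] by (simp add: o_def)
  also have "\<dots> = (\<Prod>i<n. [:- g i, 1:])"
    by (simp add: prod.list_conv_set_nth atLeast0LessThan)
  finally show ?thesis using assms by (simp add: eigen_labelling_def)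
qed

text \<open>The factor by which the monomial \<open>a\<close> is multiplied when the coordinates are
  scaled by \<open>ev\<close>.\<close>

definition pw :: "nat \<Rightarrow> (nat \<Rightarrow> complex) \<Rightarrow> (nat \<Rightarrow>\<^sub>0 nat) \<Rightarrow> complex" where
  "pw k ev a = (\<Prod>i<k. ev i ^ Poly_Mapping.lookup a i)"

lemma mono_eval_eigen:
  assumes "\<And>i. i < k \<Longrightarrow> w' $ i = ev i * w $ i" "w' \<in> carrier_vec k" "w \<in> carrier_vec k"
  shows "mono_eval a w' = pw k ev a * mono_eval a w"
  using assms by (simp add: mono_eval_carrier pw_def power_mult_distrib prod.distrib)

lemma hpoly_polyfun:
  assumes "hpoly k e u" "\<And>z. w z \<in> carrier_vec k" "\<And>i. i < k \<Longrightarrow> polyfun (\<lambda>z. w z $ i)"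
  shows "polyfun (\<lambda>z. u (w z))"
proof -
  obtain c where c: "\<And>v. v \<in> carrier_vec k \<Longrightarrow> u v = (\<Sum>a\<in>monomials k e. c a * mono_eval a v)"
    using hpoly_expand[OF assms(1)] by blast
  have "polyfun (\<lambda>z. \<Sum>a\<in>monomials k e. c a * (\<Prod>i<k. w z $ i ^ Poly_Mapping.lookup a i))"
    by (intro polyfun_sum polyfun_mult polyfun_const polyfun_prod polyfun_power assms(3)) auto
  then show ?thesis by (simp add: c[OF assms(2)] mono_eval_carrier[OF assms(2)])
qed

section \<open>Counting values of monomials in eigenvalues\<close>

locale cone =
  fixes k d q :: nat and m :: "nat \<Rightarrow> int vec"
  assumes k_pos: "k > 0"
    and m_carrier: "\<And>i. i < k \<Longrightarrow> m i \<in> carrier_vec d" and m_inj: "inj_on m {..<k}"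
begin

abbreviation Y :: "complex vec \<Rightarrow> complex vec" where
  "Y \<equiv> orbit_vec k d m (\<lambda>_. 1)"

definition null :: "(complex vec \<Rightarrow> complex) \<Rightarrow> bool" where
  "null f \<longleftrightarrow> (\<forall>t\<in>tor d. f (Y t) = 0)"

text \<open>Says on the level of the ideal that \<open>A\<close> maps the cone into its
  closure.\<close>

definition preserves :: "complex mat \<Rightarrow> bool" where
  "preserves A \<longleftrightarrow> (\<forall>e f. hpoly k e f \<longrightarrow> null f \<longrightarrow> null (\<lambda>v. f (A *\<^sub>v v)))"

abbreviation supp :: "int vec set" where
  "supp \<equiv> supp_chars k d q m"

abbreviation wgt :: "(nat \<Rightarrow>\<^sub>0 nat) \<Rightarrow> int vec" where
  "wgt a \<equiv> wsum d k (\<lambda>i. int (Poly_Mapping.lookup a i)) m"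

text \<open>Monomials in the eigencoordinates are eigenvectors of pullback by \<open>A\<close>,
  which acts on the coordinate ring of the cone. For distinct eigenvalues they are independent
  there, since none of them vanishes on the cone; so the Hilbert function bounds the number of
  values.\<close>

lemma eigenvalue_monomials_le:
  assumes A: "A \<in> carrier_mat k k" "preserves A" and lab: "eigen_labelling k A ev"
  shows "card (pw k ev ` monomials k q) \<le> card supp"
proof (rule ccontr)
  assume less: "\<not> ?thesis"
  obtain W V where W: "W \<in> carrier_mat k k" "V \<in> carrier_mat k k" "W * V = 1\<^sub>m k" "V * W = 1\<^sub>m k"
    "\<And>v i. v \<in> carrier_vec k \<Longrightarrow> i < k \<Longrightarrow> (W *\<^sub>v (A *\<^sub>v v)) $ i = ev i * (W *\<^sub>v v) $ i"
    using left_eigenbasis[OF A(1) lab] by blast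
  \<comment> \<open>One monomial for each value.\<close>
  obtain R where R: "R \<subseteq> monomials k q" "inj_on (pw k ev) R" "pw k ev ` monomials k q = pw k ev ` R"
    using subset_image_inj[of "pw k ev ` monomials k q" "pw k ev" "monomials k q"] by auto
  have finR: "finite R" using R(1) finite_monomials by (rule finite_subset)
  define f where "f = (\<lambda>a v. mono_eval a (W *\<^sub>v v))"
  have hf: "hpoly k q (f a)" if "a \<in> R" for a
    unfolding f_def using hpoly_mat_comp[OF hpoly_mono_eval W(1)] R(1) that by blast
  have "card supp < card R" using less R card_image[OF R(2)] by simp
  from forms_dependent_on_orbit[of R k q f d m "\<lambda>_. 1", OF finR hf this]
  obtain c where c: "\<exists>a\<in>R. c a \<noteq> 0" "\<forall>t\<in>tor d. (\<Sum>a\<in>R. c a * f a (Y t)) = 0" by blast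
  have fA: "f a (A *\<^sub>v v) = pw k ev a * f a v" if "v \<in> carrier_vec k" for a v
    unfolding f_def by (rule mono_eval_eigen) (use W that A in auto)
  \<comment> \<open>Repeated pullback of one relation by \<open>A\<close> gives the Vandermonde
    system that isolates a single monomial.\<close>
  have iter: "null (\<lambda>v. \<Sum>a\<in>R. (pw k ev a ^ j * c a) * f a v)" for j
  proof (induction j)
    case 0 then show ?case using c(2) by (simp add: null_def)
  next
    case (Suc j)
    have "hpoly k q (\<lambda>v. \<Sum>a\<in>R. (pw k ev a ^ j * c a) * f a v)"
      by (intro hpoly_sum hpoly_cmult hf)
    from A(2)[unfolded preserves_def, rule_format, OF this Suc] show ?case
      by (simp add: null_def fA mult_ac)
  qed
  obtain a where a: "a \<in> R" "c a \<noteq> 0" using c(1) by blast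
  have fa0: "f a (Y t) = 0" if t: "t \<in> tor d" for t
  proof -
    have "c a * f a (Y t) = 0"
      by (rule vandermonde_independent[OF finR R(2) _ a(1)])
         (use iter t in \<open>simp add: null_def mult.assoc\<close>)
    then show ?thesis using a(2) by simp
  qed
  \<comment> \<open>No eigencoordinate vanishes identically on the cone, so at a large power of the
    prime point all are nonzero at once, and with them every monomial.\<close>
  have "\<forall>\<^sub>F n in sequentially. (W *\<^sub>v Y (tpow (prime_pt d) n)) $ i \<noteq> 0" if i: "i < k" for i
  proof -
    have form: "(W *\<^sub>v Y t) $ i = (\<Sum>j<k. W $$ (i, j) * character d (m j) t)" for t
      using W(1) i by (auto simp: scalar_prod_def atLeast0LessThan intro!: sum.cong)
    have "\<exists>t\<in>tor d. (W *\<^sub>v Y t) $ i \<noteq> 0"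
    proof (rule ccontr)
      assume "\<not> ?thesis"
      then have "W $$ (i, j) = 0" if "j < k" for j
        using linear_form_on_orbit[OF m_inj m_carrier, of "\<lambda>j. W $$ (i, j)" j] that form by simp
      then have "(W * V) $$ (i, i) = 0" using W(1,2) i by (simp add: scalar_prod_def)
      then show False using W(3) i by simp
    qed
    then obtain t where "t \<in> tor d" "(W *\<^sub>v Y t) $ i \<noteq> 0" by blast
    then show ?thesis
      using laurent_eventually_nonzero[OF hpoly_orbit[OF hpoly_mat_comp[OF hpoly_coord[OF i] W(1)]]] by blast
  qed
  then have "\<forall>\<^sub>F n in sequentially. \<forall>i\<in>{..<k}. (W *\<^sub>v Y (tpow (prime_pt d) n)) $ i \<noteq> 0"
    by (intro eventually_ball_finite) auto
  then obtain n where n: "\<forall>i\<in>{..<k}. (W *\<^sub>v Y (tpow (prime_pt d) n)) $ i \<noteq> 0"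
    using eventually_happens'[OF sequentially_bot] by blast
  have "W *\<^sub>v Y (tpow (prime_pt d) n) \<in> carrier_vec k" using W(1) by simp
  then have "f a (Y (tpow (prime_pt d) n)) \<noteq> 0"
    using n by (simp add: f_def mono_eval_carrier del: index_mult_mat_vec)
  then show False using fa0[OF tpow_tor[OF prime_pt_tor]] by blast
qed

text \<open>Along iterates of \<open>A\<close> the form \<open>u\<close> is a combination of powers
  of the occurring values. With fewer than \<open>h\<close> values, a nonzero polynomial of degree
  less than \<open>h\<close> vanishing at all of them yields a linear relation between the rows of
  the matrix.\<close>

lemma eigenvalue_monomials_ge:
  assumes A: "A \<in> carrier_mat k k" and lab: "eigen_labelling k A ev" and u: "hpoly k q u"
    and y: "\<And>r. r < h \<Longrightarrow> y r \<in> carrier_vec k"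
    and det: "det (Matrix.mat h h (\<lambda>(j, r). u (((\<lambda>v. A *\<^sub>v v) ^^ j) (y r)))) \<noteq> 0"
  shows "h \<le> card (pw k ev ` monomials k q)"
proof (rule ccontr)
  assume less: "\<not> ?thesis"
  obtain W V where W: "W \<in> carrier_mat k k" "V \<in> carrier_mat k k" "W * V = 1\<^sub>m k" "V * W = 1\<^sub>m k"
    "\<And>v i. v \<in> carrier_vec k \<Longrightarrow> i < k \<Longrightarrow> (W *\<^sub>v (A *\<^sub>v v)) $ i = ev i * (W *\<^sub>v v) $ i"
    using left_eigenbasis[OF A(1) lab] by blast
  obtain c where c: "\<And>v. v \<in> carrier_vec k \<Longrightarrow> u (V *\<^sub>v v) = (\<Sum>a\<in>monomials k q. c a * mono_eval a v)"
    using hpoly_expand[OF hpoly_mat_comp[OF u W(2)]] by blast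
  have u_eq: "u v = (\<Sum>a\<in>monomials k q. c a * mono_eval a (W *\<^sub>v v))" if v: "v \<in> carrier_vec k" for v
  proof -
    have "V *\<^sub>v (W *\<^sub>v v) = v" using assoc_mult_mat_vec[OF W(2,1) v] W(4) v by simp
    then show ?thesis using c[of "W *\<^sub>v v"] W(1) v by simp
  qed
  have power: "((\<lambda>v. A *\<^sub>v v) ^^ j) v \<in> carrier_vec k \<and>
      mono_eval a (W *\<^sub>v ((\<lambda>v. A *\<^sub>v v) ^^ j) v) = pw k ev a ^ j * mono_eval a (W *\<^sub>v v)" if v: "v \<in> carrier_vec k" for a j v
  proof (induction j)
    case (Suc j)
    then have "mono_eval a (W *\<^sub>v (A *\<^sub>v ((\<lambda>v. A *\<^sub>v v) ^^ j) v)) = pw k ev a * mono_eval a (W *\<^sub>v ((\<lambda>v. A *\<^sub>v v) ^^ j) v)"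
      by (intro mono_eval_eigen W(5)) (use W A in auto)
    then show ?case using Suc A by simp
  qed (use v in simp)
  have "finite (pw k ev ` monomials k q)" "card (pw k ev ` monomials k q) < card {..<h}"
    using less finite_monomials by auto
  \<comment> \<open>The unknowns \<open>b\<close> are the coefficients of that polynomial.\<close>
  from underdetermined_system[OF this(1) finite_lessThan this(2), of "\<lambda>j z. z ^ j"]
  obtain b where b: "\<exists>j<h. b j \<noteq> 0" "\<And>a. a \<in> monomials k q \<Longrightarrow> (\<Sum>j<h. b j * pw k ev a ^ j) = 0" by auto
  define K where "K = Matrix.mat h h (\<lambda>(j, r). u (((\<lambda>v. A *\<^sub>v v) ^^ j) (y r)))"
  have "transpose_mat K *\<^sub>v vec h b = 0\<^sub>v h"
  proof (rule eq_vecI)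
    fix r assume "r < dim_vec (0\<^sub>v h :: complex vec)"
    then have r: "r < h" by simp
    have "(transpose_mat K *\<^sub>v vec h b) $ r = (\<Sum>j<h. b j * u (((\<lambda>v. A *\<^sub>v v) ^^ j) (y r)))"
      using r by (simp add: K_def scalar_prod_def atLeast0LessThan mult.commute)
    also have "\<dots> = (\<Sum>j<h. \<Sum>a\<in>monomials k q. b j * pw k ev a ^ j * (c a * mono_eval a (W *\<^sub>v y r)))"
      using power[OF y[OF r]] by (simp add: u_eq sum_distrib_left mult_ac)
    also have "\<dots> = (\<Sum>a\<in>monomials k q. (\<Sum>j<h. b j * pw k ev a ^ j) * (c a * mono_eval a (W *\<^sub>v y r)))"
      unfolding sum_distrib_right by (rule sum.swap)
    also have "\<dots> = 0" using b(2) by simp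
    finally show "(transpose_mat K *\<^sub>v vec h b) $ r = 0\<^sub>v h $ r" using r by simp
  qed (simp add: K_def)
  moreover have "vec h b \<noteq> 0\<^sub>v h" using b(1) by (metis index_vec index_zero_vec(1))
  moreover have K: "K \<in> carrier_mat h h" by (simp add: K_def)
  ultimately have "det (transpose_mat K) = 0"
    using det_0_iff_vec_prod_zero[of "transpose_mat K" h] by (metis transpose_carrier_mat vec_carrier)
  then show False using det det_transpose[OF K] by (simp add: K_def)
qed

definition rel :: "(nat \<Rightarrow> complex) \<Rightarrow> bool" where
  "rel ev \<longleftrightarrow> (\<forall>a\<in>monomials k q. \<forall>b\<in>monomials k q. wgt a = wgt b \<longrightarrow> pw k ev a = pw k ev b)"

definition rep :: "int vec \<Rightarrow> (nat \<Rightarrow>\<^sub>0 nat)" where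
  "rep = inv_into (monomials k q) wgt"

lemma rep: "\<mu> \<in> supp \<Longrightarrow> rep \<mu> \<in> monomials k q" "\<mu> \<in> supp \<Longrightarrow> wgt (rep \<mu>) = \<mu>"
  unfolding rep_def supp_chars_def by (rule inv_into_into, assumption) (rule f_inv_into_f)

lemma wgt_supp: "a \<in> monomials k q \<Longrightarrow> wgt a \<in> supp"
  by (auto simp: supp_chars_def)

lemma rel_image:
  assumes "rel ev" shows "pw k ev ` monomials k q = (\<lambda>\<mu>. pw k ev (rep \<mu>)) ` supp"
proof
  show "pw k ev ` monomials k q \<subseteq> (\<lambda>\<mu>. pw k ev (rep \<mu>)) ` supp"
  proof
    fix x assume "x \<in> pw k ev ` monomials k q"
    then obtain a where a: "a \<in> monomials k q" "x = pw k ev a" by blast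
    then have "x = pw k ev (rep (wgt a))"
      using assms rep[OF wgt_supp[OF a(1)]] unfolding rel_def by metis
    then show "x \<in> (\<lambda>\<mu>. pw k ev (rep \<mu>)) ` supp" using wgt_supp[OF a(1)] by blast
  qed
qed (use rep in blast)

text \<open>If distinct weights give distinct values at the limit and no more than \<open>card supp\<close> values occur
  nearby, then nearby values depend only on the weight.\<close>

lemma rel_open:
  assumes conv: "\<And>i. i < k \<Longrightarrow> (\<lambda>r. ev r i) \<longlonglongrightarrow> ev0 i" and "rel ev0"
    and ge: "card supp \<le> card (pw k ev0 ` monomials k q)"
    and le: "\<forall>\<^sub>F r in sequentially. card (pw k (ev r) ` monomials k q) \<le> card supp"
  shows "\<forall>\<^sub>F r in sequentially. rel (ev r)"
proof -
  \<comment> \<open>All values come from the representatives \<open>rep \<mu>\<close>, and there are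
    at least \<open>card supp\<close> of them, so distinct weights have distinct values in the
    limit.\<close>
  have inj: "inj_on (\<lambda>\<mu>. pw k ev0 (rep \<mu>)) supp"
    using ge rel_image[OF assms(2)] card_image_le[OF finite_supp_chars] by (metis eq_card_imp_inj_on finite_supp_chars antisym)
  have pw_conv: "(\<lambda>r. pw k (ev r) a) \<longlonglongrightarrow> pw k ev0 a" for a
    unfolding pw_def by (intro tendsto_intros conv) auto
  have "\<forall>\<^sub>F r in sequentially. pw k (ev r) a \<noteq> pw k (ev r) (rep \<nu>)"
    if a: "a \<in> monomials k q" "\<nu> \<in> supp" "wgt a \<noteq> \<nu>" for a \<nu>
  proof -
    have "pw k ev0 a = pw k ev0 (rep (wgt a))"
      using assms(2) a(1) rep[OF wgt_supp[OF a(1)]] unfolding rel_def by metis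
    also have "\<dots> \<noteq> pw k ev0 (rep \<nu>)" using inj a wgt_supp[OF a(1)] by (auto simp: inj_on_def)
    finally have "pw k ev0 a - pw k ev0 (rep \<nu>) \<noteq> 0" by simp
    from tendsto_imp_eventually_ne[OF tendsto_diff[OF pw_conv pw_conv] this]
    show ?thesis by eventually_elim auto
  qed
  then have "\<forall>\<^sub>F r in sequentially. \<forall>p\<in>{p\<in>monomials k q \<times> supp. wgt (fst p) \<noteq> snd p}.
      pw k (ev r) (fst p) \<noteq> pw k (ev r) (rep (snd p))"
    by (intro eventually_ball_finite) (auto simp: finite_monomials finite_supp_chars)
  with le show ?thesis
  proof eventually_elim
    case (elim r)
    have ne: "pw k (ev r) a \<noteq> pw k (ev r) (rep \<nu>)" if "a \<in> monomials k q" "\<nu> \<in> supp" "wgt a \<noteq> \<nu>" for a \<nu>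
      using elim(2) that by auto
    have inj': "inj_on (\<lambda>\<mu>. pw k (ev r) (rep \<mu>)) supp"
      using ne rep by (intro inj_onI) metis
    have img: "(\<lambda>\<mu>. pw k (ev r) (rep \<mu>)) ` supp = pw k (ev r) ` monomials k q"
      using elim(1) card_image[OF inj'] rep by (intro card_seteq) (auto simp: finite_monomials)
    have "pw k (ev r) a = pw k (ev r) (rep (wgt a))" if a: "a \<in> monomials k q" for a
    proof -
      have "pw k (ev r) a \<in> (\<lambda>\<mu>. pw k (ev r) (rep \<mu>)) ` supp" unfolding img using a by blast
      then obtain \<nu> where "\<nu> \<in> supp" "pw k (ev r) a = pw k (ev r) (rep \<nu>)" by blast
      then show ?thesis using ne[OF a] by blast
    qed
    then show ?case unfolding rel_def by metis
  qed
qed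

lemma rel_closed:
  assumes conv: "\<And>i. i < k \<Longrightarrow> (\<lambda>r. ev r i) \<longlonglongrightarrow> ev0 i" and "\<And>r. rel (ev r)"
  shows "rel ev0"
  unfolding rel_def
proof (intro ballI impI)
  fix a b assume ab: "a \<in> monomials k q" "b \<in> monomials k q" "wgt a = wgt b"
  have pw_conv: "(\<lambda>r. pw k (ev r) a) \<longlonglongrightarrow> pw k ev0 a" for a
    unfolding pw_def by (intro tendsto_intros conv) auto
  have "(\<lambda>r. pw k (ev r) a) = (\<lambda>r. pw k (ev r) b)" using assms(2) ab unfolding rel_def by blast
  then show "pw k ev0 a = pw k ev0 b" using pw_conv[of a] pw_conv[of b] LIMSEQ_unique by simp
qed

\<comment> \<open>The path between the two tori\<close>
end

text \<open>A character times the power \<open>b\<close> of the product of all coordinates. It is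
  polynomial in \<open>s\<close>, and on the torus the extra factor is the same for all weights,
  hence a scalar matrix.\<close>

definition shifted :: "nat \<Rightarrow> nat \<Rightarrow> int vec \<Rightarrow> complex vec \<Rightarrow> complex" where
  "shifted d b \<mu> s = (\<Prod>l<d. s $ l ^ nat (\<mu> $ l + int b))"

lemma shifted_tor:
  assumes "s \<in> tor d" "\<And>l. l < d \<Longrightarrow> 0 \<le> \<mu> $ l + int b"
  shows "shifted d b \<mu> s = (\<Prod>l<d. s $ l) ^ b * character d \<mu> s"
proof -
  have "s $ l ^ nat (\<mu> $ l + int b) = s $ l ^ b * s $ l powi \<mu> $ l" if "l < d" for l
  proof -
    have "s $ l ^ nat (\<mu> $ l + int b) = s $ l powi (\<mu> $ l + int b)"
      using assms(2)[OF that] by (metis int_nat_eq power_int_of_nat)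
    then show ?thesis using assms(1) that by (simp add: power_int_add tor_iff)
  qed
  then show ?thesis unfolding shifted_def character_def by (simp add: prod_power_distrib prod.distrib)
qed

lemma shifted_prime_pt:
  assumes "\<And>l. l < d \<Longrightarrow> 0 \<le> \<mu> $ l + int b"
  shows "shifted d b \<mu> (prime_pt d) = (\<Prod>l<d. prime_pt d $ l) ^ b * of_real (prime_val d \<mu>)"
  using shifted_tor[OF prime_pt_tor assms] by (simp add: character_prime_pt)

lemma prod_prime_pt_nonzero: "(\<Prod>l<d. prime_pt d $ l) \<noteq> 0"
  using prime_pt_tor[of d] by (simp add: tor_iff)

lemma diag_shifted_orbit_vec:
  assumes "s \<in> tor d" "t \<in> tor d" "\<And>i l. i < k \<Longrightarrow> l < d \<Longrightarrow> 0 \<le> m i $ l + int b"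
  shows "mat_diag k (\<lambda>i. shifted d b (m i) s) *\<^sub>v orbit_vec k d m x t =
    ((\<Prod>l<d. s $ l) ^ b) \<cdot>\<^sub>v orbit_vec k d m x (tmul s t)"
  by (subst mat_diag_vec) (use assms in \<open>auto intro!: eq_vecI simp: orbit_vec_def shifted_tor character_tmul\<close>)

text \<open>Affine lines run in opposite directions, so that the matrices depend polynomially on
  \<open>z\<close> and at each end one of the two tori contributes the identity.\<close>

definition path1 :: "nat \<Rightarrow> complex \<Rightarrow> complex vec" where
  "path1 d z = vec d (\<lambda>l. of_nat (nthprime l) * (1 - z) + 1 * z)"

definition path2 :: "nat \<Rightarrow> complex \<Rightarrow> complex vec" where
  "path2 d z = vec d (\<lambda>l. 1 * (1 - z) + of_nat (nthprime l) * z)"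

lemma path_ends: "path1 d 0 = prime_pt d" "path2 d 0 = vec d (\<lambda>_. 1)"
  "path1 d 1 = vec d (\<lambda>_. 1)" "path2 d 1 = prime_pt d"
  by (auto simp: path1_def path2_def prime_pt_def)

lemma shifted_ones: "shifted d b \<mu> (vec d (\<lambda>_. 1)) = 1"
  by (simp add: shifted_def)

lemma polyfun_shifted_path:
  "polyfun (\<lambda>z. shifted d b \<mu> (path1 d z))" "polyfun (\<lambda>z. shifted d b \<mu> (path2 d z))"
proof -
  have "polyfun (\<lambda>z. path1 d z $ l)" "polyfun (\<lambda>z. path2 d z $ l)" if "l < d" for l
    using that polyfun_affine[of "of_nat (nthprime l)" 1] polyfun_affine[of 1 "of_nat (nthprime l)"]
    by (simp_all add: path1_def path2_def)
  then show "polyfun (\<lambda>z. shifted d b \<mu> (path1 d z))" "polyfun (\<lambda>z. shifted d b \<mu> (path2 d z))"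
    unfolding shifted_def by (auto intro!: polyfun_prod polyfun_power)
qed

text \<open>Through each point with real part strictly between 0 and 1 passes exactly one arc of
  this family, so finitely many points exclude finitely many \<open>c\<close>. All arcs start at 0
  and end at 1.\<close>

lemma avoiding_arc:
  assumes "finite (B :: complex set)" "0 \<notin> B"
  obtains c :: real where "\<And>x. x \<in> {0..<1} \<Longrightarrow> Complex x (c * x * (1 - x)) \<notin> B"
proof -
  have "finite ((\<lambda>z. Im z / (Re z * (1 - Re z))) ` B)" using assms(1) by simp
  then obtain c where c: "c \<notin> (\<lambda>z. Im z / (Re z * (1 - Re z))) ` B"
    using ex_new_if_finite[OF infinite_UNIV_char_0] by blast
  show ?thesis
  proof (rule that[of c])
    fix x :: real assume x: "x \<in> {0..<1}"
    show "Complex x (c * x * (1 - x)) \<notin> B"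
    proof (cases "x = 0")
      case True
      then show ?thesis using assms(2) by (simp add: Complex_eq_0 zero_complex.code)
    next
      case False
      then have "c = (c * x * (1 - x)) / (x * (1 - x))" using x by simp
      show ?thesis
      proof
        assume "Complex x (c * x * (1 - x)) \<in> B"
        from imageI[OF this, of "\<lambda>z. Im z / (Re z * (1 - Re z))"] show False
          using c \<open>c = _\<close> by simp
      qed
    qed
  qed
qed

text \<open>The hypothesis \<open>equiv\<close> states through vanishing forms that \<open>G\<close>
  carries the cone of \<open>m'\<close> onto that of \<open>m\<close> up to closure;
  \<open>b\<close> makes all shifted exponents natural.\<close>

locale cone_equiv = cone +
  fixes b :: nat and m' :: "nat \<Rightarrow> int vec" and G Gi :: "complex mat"
  assumes m'_carrier: "\<And>i. i < k \<Longrightarrow> m' i \<in> carrier_vec d" and m'_inj: "inj_on m' {..<k}"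
    and bound: "\<And>i l. i < k \<Longrightarrow> l < d \<Longrightarrow> 0 \<le> m i $ l + int b" "\<And>i l. i < k \<Longrightarrow> l < d \<Longrightarrow> 0 \<le> m' i $ l + int b"
    and G: "G \<in> carrier_mat k k" "Gi \<in> carrier_mat k k" "G * Gi = 1\<^sub>m k" "Gi * G = 1\<^sub>m k"
    and equiv: "\<And>e f. hpoly k e f \<Longrightarrow> null f \<longleftrightarrow> (\<forall>t\<in>tor d. f (G *\<^sub>v orbit_vec k d m' (\<lambda>_. 1) t) = 0)"
begin

abbreviation D1 :: "complex vec \<Rightarrow> complex mat" where
  "D1 s \<equiv> mat_diag k (\<lambda>i. shifted d b (m i) s)"

abbreviation D2 :: "complex vec \<Rightarrow> complex mat" where
  "D2 s \<equiv> mat_diag k (\<lambda>i. shifted d b (m' i) s)"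

definition F :: "complex \<Rightarrow> complex mat" where
  "F z = D1 (path1 d z) * (G * (D2 (path2 d z) * Gi))"

lemma F_carrier [simp]: "F z \<in> carrier_mat k k"
  unfolding F_def by (intro mult_carrier_mat[of _ k k _ k] G) (simp_all add: mat_diag_def)

lemma F_vec:
  assumes "v \<in> carrier_vec k"
  shows "F z *\<^sub>v v = D1 (path1 d z) *\<^sub>v (G *\<^sub>v (D2 (path2 d z) *\<^sub>v (Gi *\<^sub>v v)))"
proof -
  have D: "D1 (path1 d z) \<in> carrier_mat k k" "D2 (path2 d z) \<in> carrier_mat k k" by (simp_all add: mat_diag_def)
  have 1: "D2 (path2 d z) * Gi \<in> carrier_mat k k" "G * (D2 (path2 d z) * Gi) \<in> carrier_mat k k"
    by (intro mult_carrier_mat[of _ k k _ k] D G)+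
  show ?thesis
    unfolding F_def assoc_mult_mat_vec[OF D(1) 1(2) assms] assoc_mult_mat_vec[OF G(1) 1(1) assms]
      assoc_mult_mat_vec[OF D(2) G(2) assms] ..
qed

text \<open>A form vanishing on the cone is pulled back through \<open>D1\<close>, transferred to
  the cone of \<open>m'\<close>, pulled back through \<open>D2\<close> there and transferred back.
  Both diagonal factors move orbit points within their orbit up to a scalar.\<close>

lemma preserves_F:
  assumes "path1 d z \<in> tor d" "path2 d z \<in> tor d" shows "preserves (F z)"
  unfolding preserves_def
proof (intro allI impI)
  fix e f assume f: "hpoly k e f" "null f"
  let ?D1 = "D1 (path1 d z)" and ?D2 = "D2 (path2 d z)" and ?Y' = "orbit_vec k d m' (\<lambda>_. 1)"
  define f1 where "f1 = (\<lambda>v. f (?D1 *\<^sub>v v))"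
  have f1: "hpoly k e f1" unfolding f1_def by (rule hpoly_mat_comp[OF f(1)]) simp
  have "null f1"
    using f assms(1) bound(1) tmul_tor[OF assms(1)]
    by (simp add: null_def f1_def diag_shifted_orbit_vec hpoly_smult[OF f(1)])
  then have f1_null: "\<And>t. t \<in> tor d \<Longrightarrow> f1 (G *\<^sub>v ?Y' t) = 0" using equiv[OF f1] by blast
  define f2 where "f2 = (\<lambda>v. f1 (G *\<^sub>v (?D2 *\<^sub>v (Gi *\<^sub>v v))))"
  have f2: "hpoly k e f2"
    unfolding f2_def using hpoly_mat_comp[OF hpoly_mat_comp[OF hpoly_mat_comp[OF f1 G(1)]] G(2), of ?D2] by simp
  have "f2 (G *\<^sub>v ?Y' t) = 0" if t: "t \<in> tor d" for t
  proof -
    have "Gi *\<^sub>v (G *\<^sub>v ?Y' t) = ?Y' t"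
      using assoc_mult_mat_vec[OF G(2,1) orbit_vec_carrier] G(4) by (metis one_mult_mat_vec orbit_vec_carrier)
    then have "f2 (G *\<^sub>v ?Y' t) = f1 (G *\<^sub>v (((\<Prod>l<d. path2 d z $ l) ^ b) \<cdot>\<^sub>v ?Y' (tmul (path2 d z) t)))"
      using assms(2) t bound(2) by (simp add: f2_def diag_shifted_orbit_vec)
    also have "\<dots> = f1 (((\<Prod>l<d. path2 d z $ l) ^ b) \<cdot>\<^sub>v (G *\<^sub>v ?Y' (tmul (path2 d z) t)))"
      using mult_mat_vec[OF G(1) orbit_vec_carrier] by simp
    also have "\<dots> = 0"
      using hpoly_smult[OF f1 mult_mat_vec_carrier[OF G(1) orbit_vec_carrier]] f1_null[OF tmul_tor[OF assms(2) t]] by simp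
    finally show ?thesis .
  qed
  then have "null f2" using equiv[OF f2] by blast
  moreover have "f2 (Y t) = f (F z *\<^sub>v Y t)" for t
    by (simp add: f2_def f1_def F_vec)
  ultimately show "null (\<lambda>v. f (F z *\<^sub>v v))" by (simp add: null_def)
qed

lemma polyfun_F: "i < k \<Longrightarrow> j < k \<Longrightarrow> polyfun (\<lambda>z. F z $$ (i, j))"
proof -
  assume ij: "i < k" "j < k"
  have "F z $$ (i, j) = shifted d b (m i) (path1 d z) * (\<Sum>l<k. G $$ (i, l) * (shifted d b (m' l) (path2 d z) * Gi $$ (l, j)))" for z
    unfolding F_def using ij G
    by (auto simp: mat_diag_mult_left[of _ k k] scalar_prod_def atLeast0LessThan intro!: sum.cong)
  moreover have "polyfun (\<lambda>z. shifted d b (m i) (path1 d z) * (\<Sum>l<k. G $$ (i, l) * (shifted d b (m' l) (path2 d z) * Gi $$ (l, j))))"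
    by (intro polyfun_mult polyfun_sum polyfun_const polyfun_shifted_path)
  ultimately show ?thesis by simp
qed

text \<open>The scalar by which \<open>shifted\<close> exceeds the character at the prime
  point.\<close>

definition C :: complex where
  "C = (\<Prod>l<d. prime_pt d $ l) ^ b"

lemma C_nonzero: "C \<noteq> 0"
  using prod_prime_pt_nonzero by (simp add: C_def)

lemma F_0: "F 0 = mat_diag k (\<lambda>i. C * of_real (prime_val d (m i)))"
proof -
  have "D2 (path2 d 0) = 1\<^sub>m k" by (simp add: path_ends shifted_ones)
  then have "F 0 = D1 (path1 d 0)"
    using G right_mult_one_mat[of "D1 (path1 d 0)" k k] by (simp add: F_def mat_diag_def)
  also have "\<dots> = mat_diag k (\<lambda>i. C * of_real (prime_val d (m i)))"
    using bound(1) by (auto intro!: eq_matI simp: mat_diag_def path_ends shifted_prime_pt C_def)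
  finally show ?thesis .
qed

lemma F_1: "F 1 = G * mat_diag k (\<lambda>i. C * of_real (prime_val d (m' i))) * Gi"
proof -
  have "D1 (path1 d 1) = 1\<^sub>m k" by (simp add: path_ends shifted_ones)
  then have "F 1 = G * (D2 (path2 d 1) * Gi)" using G by (simp add: F_def)
  also have "\<dots> = G * D2 (path2 d 1) * Gi" by (rule assoc_mult_mat[symmetric]) (use G in auto)
  also have "D2 (path2 d 1) = mat_diag k (\<lambda>i. C * of_real (prime_val d (m' i)))"
    using bound(2) by (auto intro!: eq_matI simp: mat_diag_def path_ends shifted_prime_pt C_def)
  finally show ?thesis .
qed

lemma prime_val_labels:
  assumes "\<And>i. i < k \<Longrightarrow> \<mu> i \<in> carrier_vec d" "inj_on \<mu> {..<k}"
  shows "inj_on (\<lambda>i. C * complex_of_real (prime_val d (\<mu> i))) {..<k}"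
  using assms prime_val_inj[of d] C_nonzero by (auto simp: inj_on_def)

lemma label_0: "eigen_labelling k (F 0) (\<lambda>i. C * of_real (prime_val d (m i)))"
  unfolding F_0 by (rule eigen_labelling_diag[OF prime_val_labels[OF m_carrier m_inj]])

lemma label_1: "eigen_labelling k (F 1) (\<lambda>i. C * of_real (prime_val d (m' i)))"
proof -
  let ?D = "mat_diag k (\<lambda>i. C * of_real (prime_val d (m' i)))"
  have "similar_mat_wit (F 1) ?D G Gi"
    by (rule similar_mat_witI[of _ _ k]) (use G F_1 in auto)
  then have "char_poly (F 1) = char_poly ?D"
    by (intro char_poly_similar) (auto simp: similar_mat_def)
  then show ?thesis
    using eigen_labelling_diag[OF prime_val_labels[OF m'_carrier m'_inj]] by (simp add: eigen_labelling_def)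
qed

lemma pw_prime_val:
  assumes "a \<in> monomials k q"
  shows "pw k (\<lambda>i. C * of_real (prime_val d (\<mu> i))) a =
    C ^ q * of_real (prime_val d (wsum d k (\<lambda>i. int (Poly_Mapping.lookup a i)) \<mu>))"
proof -
  have "pw k (\<lambda>i. C * of_real (prime_val d (\<mu> i))) a = C ^ (\<Sum>i<k. Poly_Mapping.lookup a i) *
      character d (wsum d k (\<lambda>i. int (Poly_Mapping.lookup a i)) \<mu>) (prime_pt d)"
    by (simp only: pw_def power_mult_distrib prod.distrib power_sum character_wsum_nat[OF prime_pt_tor]
        character_prime_pt[symmetric])
  then show ?thesis
    using assms by (simp add: monomials_def character_prime_pt)
qed

lemma rel_0: "rel (\<lambda>i. C * of_real (prime_val d (m i)))"
  unfolding rel_def by (simp add: pw_prime_val)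

text \<open>The matrix of \<open>eigenvalue_monomials_ge\<close> for \<open>F z\<close>, with one
  monomial per weight summed up as test form and powers of the prime point as test points. A nonzero
  determinant certifies at least \<open>card supp\<close> values.\<close>

definition K :: "complex \<Rightarrow> complex mat" where
  "K z = Matrix.mat (card supp) (card supp) (\<lambda>(j, r).
    (\<Sum>\<mu>\<in>supp. mono_eval (rep \<mu>) (((\<lambda>v. F z *\<^sub>v v) ^^ j) (Y (tpow (prime_pt d) r)))))"

text \<open>At 0 the iterates stay on the orbit up to powers of \<open>C\<close>, and up to row
  factors \<open>K 0\<close> is the product of a Vandermonde matrix in the prime values with its
  transpose.\<close>

lemma det_K_0: "det (K 0) \<noteq> 0"
proof
  assume "det (K 0) = 0"
  let ?h = "card supp"
  obtain x where x: "x \<in> carrier_vec ?h" "x \<noteq> 0\<^sub>v ?h" "K 0 *\<^sub>v x = 0\<^sub>v ?h"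
    using det_0_iff_vec_prod_zero[of "K 0" ?h] \<open>det (K 0) = 0\<close> by (auto simp: K_def)
  have pow: "((\<lambda>v. F 0 *\<^sub>v v) ^^ j) (Y (tpow (prime_pt d) r)) = orbit_vec k d m (\<lambda>_. C ^ j) (tpow (prime_pt d) (j + r))" for j r
  proof (induction j)
    case (Suc j)
    then show ?case
      by (auto simp: F_0 mat_diag_vec orbit_vec_def character_tpow character_prime_pt intro!: eq_vecI)
  qed simp
  have mono: "mono_eval (rep \<mu>) (((\<lambda>v. F 0 *\<^sub>v v) ^^ j) (Y (tpow (prime_pt d) r))) =
      (C ^ j) ^ q * (of_real (prime_val d \<mu>) ^ j * of_real (prime_val d \<mu>) ^ r)" if "\<mu> \<in> supp" for \<mu> j r
    using rep[OF that] tpow_tor[OF prime_pt_tor]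
    by (simp add: pow mono_eval_orbit_vec power_sum[symmetric] character_tpow character_prime_pt power_add monomials_def)
  \<comment> \<open>A kernel vector read as a polynomial. The rows of the system form a Vandermonde
    system for its values at the prime values, giving more roots than its degree allows.\<close>
  define p where "p = (\<Sum>r<?h. monom (x $ r) r)"
  have p: "poly p z = (\<Sum>r<?h. z ^ r * x $ r)" for z by (simp add: p_def poly_sum poly_monom mult.commute)
  have zero: "poly p (of_real (prime_val d \<mu>)) = 0" if \<mu>: "\<mu> \<in> supp" for \<mu>
    unfolding p
  proof (rule vandermonde_independent[OF finite_supp_chars _ _ \<mu>])
    show "inj_on (\<lambda>\<mu>. complex_of_real (prime_val d \<mu>)) supp"
      using prime_val_inj[of d] supp_chars_carrier[of k d q m] by (auto simp: inj_on_def subset_iff)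
    fix j assume j: "j < ?h"
    have "0 = (K 0 *\<^sub>v x) $ j" using x(3) j by simp
    also have "\<dots> = (\<Sum>r<?h. (\<Sum>\<mu>\<in>supp. (C ^ j) ^ q * (of_real (prime_val d \<mu>) ^ j * of_real (prime_val d \<mu>) ^ r)) * x $ r)"
      using j x(1) mono by (auto simp: K_def scalar_prod_def atLeast0LessThan intro!: sum.cong)
    also have "\<dots> = (C ^ j) ^ q * (\<Sum>\<mu>\<in>supp. of_real (prime_val d \<mu>) ^ j * (\<Sum>r<?h. of_real (prime_val d \<mu>) ^ r * x $ r))"
      unfolding sum_distrib_left sum_distrib_right by (subst sum.swap) (simp add: mult_ac)
    finally show "(\<Sum>\<mu>\<in>supp. of_real (prime_val d \<mu>) ^ j * (\<Sum>r<?h. of_real (prime_val d \<mu>) ^ r * x $ r)) = 0"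
      using C_nonzero by simp
  qed
  obtain r where r: "r < ?h" "x $ r \<noteq> 0"
    using x(1,2) by (metis carrier_vecD eq_vecI index_zero_vec(1) index_zero_vec(2))
  have coeff: "coeff p i = (if i < ?h then x $ i else 0)" for i
    by (simp add: p_def coeff_sum coeff_monom)
  have "p \<noteq> 0" using coeff[of r] r by auto
  have "degree p < ?h"
    using r(1) coeff by (intro le_less_trans[OF degree_le[of "?h - 1"]]) auto
  moreover have "?h \<le> card {z. poly p z = 0}"
  proof (rule card_inj_on_le)
    show "inj_on (\<lambda>\<mu>. complex_of_real (prime_val d \<mu>)) supp"
      using prime_val_inj[of d] supp_chars_carrier[of k d q m] by (auto simp: inj_on_def subset_iff)
  qed (use zero poly_roots_finite[OF \<open>p \<noteq> 0\<close>] in auto)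
  moreover have "card {z. poly p z = 0} \<le> degree p"
    using \<open>p \<noteq> 0\<close> by (rule poly_roots_degree)
  ultimately show False by simp
qed

lemma polyfun_det_K: "polyfun (\<lambda>z. det (K z))"
proof (rule polyfun_det)
  show "K z \<in> carrier_mat (card supp) (card supp)" for z by (simp add: K_def)
  fix j r assume jr: "j < card supp" "r < card supp"
  have power: "((\<lambda>v. F z *\<^sub>v v) ^^ j) (Y t) \<in> carrier_vec k" for j :: nat and z t
    by (induction j) (auto simp: mult_mat_vec_carrier[OF F_carrier])
  have poly: "polyfun (\<lambda>z. ((\<lambda>v. F z *\<^sub>v v) ^^ j) (Y t) $ i)" if "i < k" for i j t
    using that
  proof (induction j arbitrary: i)
    case (Suc j)
    have "(F z *\<^sub>v ((\<lambda>v. F z *\<^sub>v v) ^^ j) (Y t)) $ i = (\<Sum>l<k. F z $$ (i, l) * ((\<lambda>v. F z *\<^sub>v v) ^^ j) (Y t) $ l)" for z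
      using Suc.prems power[of j z t] carrier_matD[OF F_carrier[of z]] by (auto simp: scalar_prod_def atLeast0LessThan intro!: sum.cong)
    moreover have "polyfun (\<lambda>z. \<Sum>l<k. F z $$ (i, l) * ((\<lambda>v. F z *\<^sub>v v) ^^ j) (Y t) $ l)"
      using Suc by (intro polyfun_sum polyfun_mult polyfun_F) auto
    ultimately show ?case by simp
  qed (simp add: polyfun_const)
  have "polyfun (\<lambda>z. \<Sum>\<mu>\<in>supp. mono_eval (rep \<mu>) (((\<lambda>v. F z *\<^sub>v v) ^^ j) (Y (tpow (prime_pt d) r))))"
    by (rule polyfun_sum, rule hpoly_polyfun[OF hpoly_mono_eval[OF rep(1)]]) (use power poly in auto)
  then show "polyfun (\<lambda>z. K z $$ (j, r))" using jr by (simp add: K_def)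
qed

end

context cone_equiv
begin

text \<open>Every bad event is the vanishing of a polynomial in \<open>z\<close> that is nonzero
  somewhere. At 1 the torus conditions and the simple spectrum are checked separately, while the
  counting determinant is only claimed before 1.\<close>

lemma good_path:
  obtains \<gamma> :: "real \<Rightarrow> complex" where "\<gamma> 0 = 0" "\<gamma> 1 = 1"
    "\<And>s x. s \<longlonglongrightarrow> x \<Longrightarrow> (\<lambda>r :: nat. \<gamma> (s r)) \<longlonglongrightarrow> \<gamma> x"
    "\<And>x. x \<in> {0..1} \<Longrightarrow> preserves (F (\<gamma> x))"
    "\<And>x. x \<in> {0..1} \<Longrightarrow> \<exists>ev. eigen_labelling k (F (\<gamma> x)) ev"
    "\<And>x. x \<in> {0..<1} \<Longrightarrow> det (K (\<gamma> x)) \<noteq> 0"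
proof -
  define B where "B = (\<Union>l<d. {z. path1 d z $ l = 0}) \<union> (\<Union>l<d. {z. path2 d z $ l = 0}) \<union>
    {z. \<not> (\<exists>ev. eigen_labelling k (F z) ev)} \<union> {z. det (K z) = 0}"
  have "finite {z. path1 d z $ l = 0}" "finite {z. path2 d z $ l = 0}" if "l < d" for l
  proof -
    have "finite {z. of_nat (nthprime l) * (1 - z) + 1 * z = (0 :: complex)}"
      using polyfun_finite_zeros[OF polyfun_affine[of "of_nat (nthprime l)" 1], of 1] by simp
    then show "finite {z. path1 d z $ l = 0}" using that by (simp add: path1_def)
    have "finite {z. 1 * (1 - z) + of_nat (nthprime l) * z = (0 :: complex)}"
      using polyfun_finite_zeros[OF polyfun_affine[of 1 "of_nat (nthprime l)"], of 0] by simp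
    then show "finite {z. path2 d z $ l = 0}" using that by (simp add: path2_def)
  qed
  then have fin: "finite B"
    using labelling_cofinite[OF F_carrier polyfun_F label_0 k_pos] polyfun_finite_zeros[OF polyfun_det_K det_K_0]
    by (auto simp: B_def)
  have "path1 d 0 \<in> tor d" "path2 d 0 \<in> tor d" "path1 d 1 \<in> tor d" "path2 d 1 \<in> tor d"
    by (simp_all add: path_ends)
  then have B0: "0 \<notin> B" using label_0 det_K_0 by (auto simp: B_def tor_iff)
  obtain c where c: "\<And>x. x \<in> {0..<1} \<Longrightarrow> Complex x (c * x * (1 - x)) \<notin> B"
    by (rule avoiding_arc[OF fin B0]) (rule that)
  define \<gamma> where "\<gamma> = (\<lambda>x. Complex x (c * x * (1 - x)))"
  have ends: "\<gamma> 0 = 0" "\<gamma> 1 = 1" by (simp_all add: \<gamma>_def complex_eq_iff)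
  have tor: "path1 d (\<gamma> x) \<in> tor d" "path2 d (\<gamma> x) \<in> tor d" if "x \<in> {0..1}" for x
  proof -
    have "path1 d (\<gamma> x) \<in> tor d \<and> path2 d (\<gamma> x) \<in> tor d"
    proof (cases "x = 1")
      case False
      then have "\<gamma> x \<notin> B" using c[of x] that by (simp add: \<gamma>_def)
      then show ?thesis by (auto simp: B_def tor_iff path1_def path2_def)
    qed (simp add: ends path_ends)
    then show "path1 d (\<gamma> x) \<in> tor d" "path2 d (\<gamma> x) \<in> tor d" by auto
  qed
  show ?thesis
  proof (rule that[of \<gamma>])
    show "(\<lambda>r. \<gamma> (s r)) \<longlonglongrightarrow> \<gamma> x" if "s \<longlonglongrightarrow> x" for s :: "nat \<Rightarrow> real" and x
      unfolding \<gamma>_def by (intro tendsto_Complex tendsto_intros that)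
    show "preserves (F (\<gamma> x))" if "x \<in> {0..1}" for x
      by (intro preserves_F tor that)
    show "\<exists>ev. eigen_labelling k (F (\<gamma> x)) ev" if x: "x \<in> {0..1}" for x
    proof (cases "x = 1")
      case False
      then have "\<gamma> x \<notin> B" using c[of x] x by (simp add: \<gamma>_def)
      then show ?thesis by (simp add: B_def)
    qed (use ends label_1 in auto)
    show "det (K (\<gamma> x)) \<noteq> 0" if "x \<in> {0..<1}" for x
      using c[OF that] by (simp add: B_def \<gamma>_def)
  qed (use ends in auto)
qed

text \<open>Propagation along the path. Relations pass to limits because the eigenvalues converge,
  and they spread to nearby parameters because the two counts of eigenvalue monomials agree before
  the end.\<close>

lemma rel_1: "\<exists>ev. eigen_labelling k (F 1) ev \<and> rel ev"
proof -
  obtain \<gamma> :: "real \<Rightarrow> complex" where \<gamma>: "\<gamma> 0 = 0" "\<gamma> 1 = 1"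
    "\<And>s x. s \<longlonglongrightarrow> x \<Longrightarrow> (\<lambda>r :: nat. \<gamma> (s r)) \<longlonglongrightarrow> \<gamma> x"
    "\<And>x. x \<in> {0..1} \<Longrightarrow> preserves (F (\<gamma> x))"
    "\<And>x. x \<in> {0..1} \<Longrightarrow> \<exists>ev. eigen_labelling k (F (\<gamma> x)) ev"
    "\<And>x. x \<in> {0..<1} \<Longrightarrow> det (K (\<gamma> x)) \<noteq> 0"
    using good_path by blast
  define P where "P = (\<lambda>x. \<exists>ev. eigen_labelling k (F (\<gamma> x)) ev \<and> rel ev)"
  have "P 1"
  proof (rule unit_interval_induct)
    show "P 0" using label_0 rel_0 by (auto simp: P_def \<gamma>)
  next
    fix x :: real and s :: "nat \<Rightarrow> real"
    assume s: "\<And>r. s r \<in> {0..1} \<and> P (s r)" "s \<longlonglongrightarrow> x" and x: "x \<in> {0..1}"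
    have "\<forall>r. \<exists>ev. eigen_labelling k (F (\<gamma> (s r))) ev \<and> rel ev" using s(1) by (simp add: P_def)
    then obtain ev where ev: "\<And>r. eigen_labelling k (F (\<gamma> (s r))) (ev r)" "\<And>r. rel (ev r)" by metis
    obtain ev0 where ev0: "eigen_labelling k (F (\<gamma> x)) ev0" using \<gamma>(5)[OF x] by blast
    obtain \<pi> where \<pi>: "\<And>i. i < k \<Longrightarrow> (\<lambda>r. ev r (\<pi> r i)) \<longlonglongrightarrow> ev0 i"
      "\<forall>\<^sub>F r in sequentially. \<pi> r permutes {..<k}"
      using labelling_converges[OF F_carrier polyfun_F k_pos ev0 \<gamma>(3)[OF s(2)] ev(1)] by blast
    obtain r0 where r0: "\<And>r. r \<ge> r0 \<Longrightarrow> \<pi> r permutes {..<k}"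
      using \<pi>(2) unfolding eventually_sequentially by blast
    have "\<pi> ` {r0..} \<subseteq> {p. p permutes {..<k}}" using r0 by auto
    then have "finite (\<pi> ` {r0..})" using finite_permutations[of "{..<k}"] finite_subset by blast
    \<comment> \<open>The matching with the limit may vary with \<open>r\<close>; as there are
      finitely many permutations, one of them occurs infinitely often.\<close>
    then obtain r1 where r1: "r1 \<ge> r0" "infinite {r \<in> {r0..}. \<pi> r = \<pi> r1}"
      using pigeonhole_infinite[of "{r0..}" \<pi>] infinite_Ici[of r0] by auto
    define S where "S = {r \<in> {r0..}. \<pi> r = \<pi> r1}"
    define p where "p = \<pi> r1"
    have p: "p permutes {..<k}" using r0 r1 by (simp add: p_def)
    have S: "\<pi> (enumerate S r) = p" for r
      using enumerate_in_set[of S r] r1 by (simp add: S_def p_def)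
    have "(\<lambda>r. ev (enumerate S r) i) \<longlonglongrightarrow> (ev0 \<circ> inv_into UNIV p) i" if i: "i < k" for i
    proof -
      have i': "inv_into UNIV p i < k" using permutes_in_image[OF permutes_inv[OF p], of i] i by simp
      have "strict_mono (enumerate S)" using strict_mono_enumerate r1(2) by (simp add: S_def)
      from LIMSEQ_subseq_LIMSEQ[OF \<pi>(1)[OF i'] this] show ?thesis
        using permutes_inverses(1)[OF p] by (simp add: o_def S)
    qed
    then have "rel (ev0 \<circ> inv_into UNIV p)" by (rule rel_closed) (use ev(2) in auto)
    moreover have "eigen_labelling k (F (\<gamma> x)) (ev0 \<circ> inv_into UNIV p)"
      by (rule labelling_permute[OF ev0 permutes_inv[OF p]])
    ultimately show "P x" unfolding P_def by blast
  next
    fix x :: real and s :: "nat \<Rightarrow> real"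
    assume x: "x \<in> {0..<1}" "P x" and s: "\<And>r. s r \<in> {0..<1}" "s \<longlonglongrightarrow> x"
    obtain ev0 where ev0: "eigen_labelling k (F (\<gamma> x)) ev0" "rel ev0" using x(2) by (auto simp: P_def)
    have s': "s r \<in> {0..1}" for r using s(1)[of r] by simp
    have "\<forall>r. \<exists>ev. eigen_labelling k (F (\<gamma> (s r))) ev" using \<gamma>(5)[OF s'] by blast
    then obtain ev where ev: "\<And>r. eigen_labelling k (F (\<gamma> (s r))) (ev r)" by metis
    obtain \<pi> where \<pi>: "\<And>i. i < k \<Longrightarrow> (\<lambda>r. ev r (\<pi> r i)) \<longlonglongrightarrow> ev0 i"
      "\<forall>\<^sub>F r in sequentially. \<pi> r permutes {..<k}"
      using labelling_converges[OF F_carrier polyfun_F k_pos ev0(1) \<gamma>(3)[OF s(2)] ev] by blast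
    \<comment> \<open>In this direction the labellings of the sequence are free and are reordered to
      converge to \<open>ev0\<close>.\<close>
    have ev': "\<forall>\<^sub>F r in sequentially. eigen_labelling k (F (\<gamma> (s r))) (ev r \<circ> \<pi> r)"
      using \<pi>(2) by eventually_elim (rule labelling_permute[OF ev])
    have "\<forall>\<^sub>F r in sequentially. rel (ev r \<circ> \<pi> r)"
    proof (rule rel_open[OF _ ev0(2)])
      show "(\<lambda>r. (ev r \<circ> \<pi> r) i) \<longlonglongrightarrow> ev0 i" if "i < k" for i using \<pi>(1)[OF that] by simp
      have "hpoly k q (\<lambda>v. \<Sum>\<mu>\<in>supp. mono_eval (rep \<mu>) v)"
        by (rule hpoly_sum, rule hpoly_mono_eval, rule rep(1))
      then show "card supp \<le> card (pw k ev0 ` monomials k q)"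
        by (rule eigenvalue_monomials_ge[OF F_carrier ev0(1) _ orbit_vec_carrier]) (use \<gamma>(6)[OF x(1)] in \<open>simp add: K_def\<close>)
      show "\<forall>\<^sub>F r in sequentially. card (pw k (ev r \<circ> \<pi> r) ` monomials k q) \<le> card supp"
        using ev' by eventually_elim (rule eigenvalue_monomials_le[OF F_carrier \<gamma>(4)[OF s']])
    qed
    with ev' have "\<forall>\<^sub>F r in sequentially. P (s r)"
      by eventually_elim (auto simp: P_def)
    then show "\<exists>r. P (s r)" using eventually_happens'[OF sequentially_bot] by blast
  qed
  then show ?thesis by (simp add: P_def \<gamma>)
qed

text \<open>The labelling carried along the path and the explicit one at the end label the same
  simple spectrum, so they differ by a permutation. Injectivity of \<open>prime_val\<close> turns
  multiplicative relations back into additive ones.\<close>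

lemma relations_transfer:
  obtains \<sigma> where "bij_betw \<sigma> {..<k} {..<k}"
    "\<And>a b. a \<in> monomials k q \<Longrightarrow> b \<in> monomials k q \<Longrightarrow> wgt a = wgt b \<Longrightarrow>
      wsum d k (\<lambda>i. int (Poly_Mapping.lookup a i)) (m' \<circ> \<sigma>) = wsum d k (\<lambda>i. int (Poly_Mapping.lookup b i)) (m' \<circ> \<sigma>)"
proof -
  obtain ev where ev: "eigen_labelling k (F 1) ev" "rel ev" using rel_1 by blast
  define L where "L = (\<lambda>i. C * complex_of_real (prime_val d (m' i)))"
  have L: "eigen_labelling k (F 1) L" using label_1 by (simp add: L_def)
  have "{x. poly (char_poly (F 1)) x = 0} = f ` {..<k}" if "eigen_labelling k (F 1) f" for f
    unfolding labelling_roots[OF that] by (auto simp: prod_zero_iff)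
  then have img: "ev ` {..<k} = L ` {..<k}" using ev(1) L by metis
  have inj: "inj_on ev {..<k}" "inj_on L {..<k}" using ev(1) L by (simp_all add: eigen_labelling_def)
  \<comment> \<open>Matches equal eigenvalues of the two labellings.\<close>
  define \<sigma> where "\<sigma> = the_inv_into {..<k} L \<circ> ev"
  have bij: "bij_betw \<sigma> {..<k} {..<k}"
    unfolding \<sigma>_def using inj img
    by (intro bij_betw_trans[of ev _ "L ` {..<k}"] bij_betw_the_inv_into) (auto simp: bij_betw_def)
  have L\<sigma>: "L (\<sigma> i) = ev i" if "i < k" for i
    using f_the_inv_into_f[OF inj(2), of "ev i"] img that by (auto simp: \<sigma>_def)
  have pw: "pw k ev a = C ^ q * of_real (prime_val d (wsum d k (\<lambda>i. int (Poly_Mapping.lookup a i)) (m' \<circ> \<sigma>)))"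
    if "a \<in> monomials k q" for a
  proof -
    have "pw k ev a = pw k (\<lambda>i. C * of_real (prime_val d ((m' \<circ> \<sigma>) i))) a"
      unfolding pw_def by (intro prod.cong) (auto simp: L\<sigma>[symmetric] L_def)
    then show ?thesis using pw_prime_val[OF that, of "m' \<circ> \<sigma>"] by simp
  qed
  show ?thesis
  proof (rule that[OF bij])
    fix a b assume ab: "a \<in> monomials k q" "b \<in> monomials k q" "wgt a = wgt b"
    then have "pw k ev a = pw k ev b" using ev(2) unfolding rel_def by blast
    then have "prime_val d (wsum d k (\<lambda>i. int (Poly_Mapping.lookup a i)) (m' \<circ> \<sigma>)) =
        prime_val d (wsum d k (\<lambda>i. int (Poly_Mapping.lookup b i)) (m' \<circ> \<sigma>))"
      using ab C_nonzero by (simp add: pw)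
    then show "wsum d k (\<lambda>i. int (Poly_Mapping.lookup a i)) (m' \<circ> \<sigma>) = wsum d k (\<lambda>i. int (Poly_Mapping.lookup b i)) (m' \<circ> \<sigma>)"
      using prime_val_inj[of d] by (auto simp: inj_on_def)
  qed
qed

end

section \<open>From relations between weights to an affine map\<close>

lemma monomial_of:
  assumes "(\<Sum>i<k. g i) = q"
  obtains a where "a \<in> monomials k q" "\<And>i. i < k \<Longrightarrow> Poly_Mapping.lookup a i = g i"
proof -
  define a where "a = (\<Sum>i<k. Poly_Mapping.single i (g i))"
  have lookup: "Poly_Mapping.lookup a i = (if i < k then g i else 0)" for i
    unfolding a_def by (simp add: lookup_sum lookup_single when_def sum.delta')
  then have "a \<in> monomials k q" using assms by (auto simp: monomials_def in_keys_iff split: if_splits)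
  then show ?thesis using lookup by (intro that[of a]) auto
qed

text \<open>A relation among the weights splits into its positive and negative part, which are padded
  to monomials of degree \<open>q\<close>.\<close>

lemma integer_relation_transfer:
  assumes "k > 0" "(\<Sum>i<k. c i) = 0" "(\<Sum>i<k. nat \<bar>c i\<bar>) \<le> q" "wsum d k c m = 0\<^sub>v d"
    and rel: "\<And>a b. a \<in> monomials k q \<Longrightarrow> b \<in> monomials k q \<Longrightarrow>
      wsum d k (\<lambda>i. int (Poly_Mapping.lookup a i)) m = wsum d k (\<lambda>i. int (Poly_Mapping.lookup b i)) m \<Longrightarrow>
      wsum d k (\<lambda>i. int (Poly_Mapping.lookup a i)) \<mu> = wsum d k (\<lambda>i. int (Poly_Mapping.lookup b i)) \<mu>"
  shows "wsum d k c \<mu> = 0\<^sub>v d"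
proof -
  define s where "s = (\<Sum>i<k. nat (c i))"
  have "int s - int (\<Sum>i<k. nat (- c i)) = (\<Sum>i<k. c i)"
    unfolding s_def of_nat_sum sum_subtractf[symmetric] by (intro sum.cong) auto
  then have "int (\<Sum>i<k. nat (- c i)) = int s" using assms(2) by linarith
  then have s': "(\<Sum>i<k. nat (- c i)) = s" by (simp only: of_nat_eq_iff)
  have "s \<le> (\<Sum>i<k. nat \<bar>c i\<bar>)" unfolding s_def by (intro sum_mono) auto
  then have sq: "s \<le> q" using assms(3) by simp
  have pad: "(\<Sum>i<k. f i + (if i = 0 then q - s else 0)) = q" if "(\<Sum>i<k. f i) = s" for f :: "nat \<Rightarrow> nat"
    using that assms(1) sq by (simp add: sum.distrib)
  obtain a where a: "a \<in> monomials k q" "\<And>i. i < k \<Longrightarrow> Poly_Mapping.lookup a i = nat (c i) + (if i = 0 then q - s else 0)"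
    using monomial_of[OF pad[of "\<lambda>i. nat (c i)"]] s_def by blast
  obtain b where b: "b \<in> monomials k q" "\<And>i. i < k \<Longrightarrow> Poly_Mapping.lookup b i = nat (- c i) + (if i = 0 then q - s else 0)"
    using monomial_of[OF pad[OF s']] by blast
  have diff: "wsum d k (\<lambda>i. int (Poly_Mapping.lookup a i)) m - wsum d k (\<lambda>i. int (Poly_Mapping.lookup b i)) m = wsum d k c m" for m
  proof (rule eq_vecI)
    fix l assume "l < dim_vec (wsum d k c m)"
    then have "l < d" by (simp add: wsum_def)
    then show "(wsum d k (\<lambda>i. int (Poly_Mapping.lookup a i)) m - wsum d k (\<lambda>i. int (Poly_Mapping.lookup b i)) m) $ l = wsum d k c m $ l"
      by (auto simp: carrier_vecD[OF wsum_carrier] sum_subtractf[symmetric] a(2) b(2) left_diff_distrib[symmetric] intro!: sum.cong)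
  qed (simp add: wsum_def)
  have eq_iff: "u = v" if "u - v = 0\<^sub>v d" "u \<in> carrier_vec d" "v \<in> carrier_vec d" for u v :: "int vec"
  proof (rule eq_vecI)
    fix l assume "l < dim_vec v"
    then have l: "l < d" using that by simp
    have "u $ l - v $ l = (u - v) $ l" using that l by (intro index_minus_vec(1)[symmetric]) simp
    also have "\<dots> = 0" using l by (simp add: that(1))
    finally show "u $ l = v $ l" by simp
  qed (use that in simp)
  have "wsum d k (\<lambda>i. int (Poly_Mapping.lookup a i)) m = wsum d k (\<lambda>i. int (Poly_Mapping.lookup b i)) m"
    using eq_iff[OF _ wsum_carrier wsum_carrier] diff[of m] assms(4) by simp
  then have "wsum d k (\<lambda>i. int (Poly_Mapping.lookup a i)) \<mu> = wsum d k (\<lambda>i. int (Poly_Mapping.lookup b i)) \<mu>"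
    using rel a(1) b(1) by blast
  then have "wsum d k c \<mu> = wsum d k (\<lambda>i. int (Poly_Mapping.lookup b i)) \<mu> - wsum d k (\<lambda>i. int (Poly_Mapping.lookup b i)) \<mu>"
    using diff[of \<mu>] by simp
  then show ?thesis by (auto intro!: eq_vecI simp: wsum_def)
qed

text \<open>A right inverse makes the determinant a unit, so a multiple of the adjugate is a
  two-sided inverse.\<close>

lemma int_GL_of_right_inverse:
  assumes A: "A \<in> carrier_mat n n" and B: "B \<in> carrier_mat n n" and AB: "A * B = 1\<^sub>m n"
  shows "A \<in> carrier (GL TYPE('a::comm_ring_1) n)"
proof -
  have det: "det A * det B = 1" using det_mult[OF A B] AB by simp
  have eq: "det B \<cdot>\<^sub>m (det A \<cdot>\<^sub>m 1\<^sub>m n) = 1\<^sub>m n"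
    using det by (intro eq_matI) (auto simp: mult.commute)
  have 1: "A * (det B \<cdot>\<^sub>m adj_mat A) = 1\<^sub>m n" "(det B \<cdot>\<^sub>m adj_mat A) * A = 1\<^sub>m n"
    using adj_mat[OF A] A eq by (simp_all add: mult_smult_distrib mult_smult_assoc_mat[of _ n n _ n])
  have "det B \<cdot>\<^sub>m adj_mat A \<in> carrier_mat n n" using adj_mat(1)[OF A] by simp
  with 1 A show ?thesis unfolding GL_iff by blast
qed

text \<open>Each weight difference \<open>m i - m 0\<close> is a combination of the fixed vectors
  \<open>\<beta> l\<close>. These finitely many relations persist for the permuted
  \<open>m'\<close>, which says that the permuted weights depend affinely on
  \<open>m\<close>.\<close>

lemma cone_affine_equiv:
  assumes k: "k > 0" and m: "\<And>i. i < k \<Longrightarrow> m i \<in> carrier_vec d" "inj_on m {..<k}" "spans k d m (\<lambda>_. 1)"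
    and m': "\<And>i. i < k \<Longrightarrow> m' i \<in> carrier_vec d" "inj_on m' {..<k}" "spans k d m' (\<lambda>_. 1)"
    and G: "G \<in> carrier_mat k k" "Gi \<in> carrier_mat k k" "G * Gi = 1\<^sub>m k" "Gi * G = 1\<^sub>m k"
    and equiv: "\<And>e f. hpoly k e f \<Longrightarrow> (\<forall>t\<in>tor d. f (orbit_vec k d m (\<lambda>_. 1) t) = 0) \<longleftrightarrow>
      (\<forall>t\<in>tor d. f (G *\<^sub>v orbit_vec k d m' (\<lambda>_. 1) t) = 0)"
  shows "affine_equiv d (m ` {..<k}) (m' ` {..<k})"
proof -
  have "\<forall>l. \<exists>\<beta> :: nat \<Rightarrow> int. l < d \<longrightarrow> (\<Sum>i<k. \<beta> i) = 0 \<and> wsum d k \<beta> m = unit_vec d l"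
    using m(3) by (auto simp: spans_def)
  then obtain \<beta> :: "nat \<Rightarrow> nat \<Rightarrow> int" where \<beta>: "\<And>l. l < d \<Longrightarrow> (\<Sum>i<k. \<beta> l i) = 0" "\<And>l. l < d \<Longrightarrow> wsum d k (\<beta> l) m = unit_vec d l"
    by metis
  have "\<forall>l. \<exists>\<beta> :: nat \<Rightarrow> int. l < d \<longrightarrow> (\<Sum>i<k. \<beta> i) = 0 \<and> wsum d k \<beta> m' = unit_vec d l"
    using m'(3) by (auto simp: spans_def)
  then obtain \<beta>' :: "nat \<Rightarrow> nat \<Rightarrow> int" where \<beta>': "\<And>l. l < d \<Longrightarrow> (\<Sum>i<k. \<beta>' l i) = 0" "\<And>l. l < d \<Longrightarrow> wsum d k (\<beta>' l) m' = unit_vec d l"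
    by metis
  \<comment> \<open>Coefficients of the relation equating \<open>m i - m 0\<close> with its
    expansion in unit vectors, each written through \<open>\<beta>\<close>.\<close>
  define c where "c = (\<lambda>i j. (if j = i then 1 else 0) - (if j = 0 then 1 else 0) - (\<Sum>l<d. (m i $ l - m 0 $ l) * \<beta> l j))"
  have sum_c: "(\<Sum>j<k. c i j * x j) = x i - x 0 - (\<Sum>l<d. (m i $ l - m 0 $ l) * (\<Sum>j<k. \<beta> l j * x j))"
    if "i < k" for i and x :: "nat \<Rightarrow> int"
  proof -
    have "(\<Sum>j<k. c i j * x j) = (\<Sum>j<k. (if j = i then x j else 0)) - (\<Sum>j<k. (if j = 0 then x j else 0)) -
        (\<Sum>j<k. \<Sum>l<d. (m i $ l - m 0 $ l) * (\<beta> l j * x j))"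
      unfolding c_def sum_subtractf[symmetric]
      by (intro sum.cong) (auto simp: left_diff_distrib sum_distrib_right mult.assoc)
    also have "(\<Sum>j<k. \<Sum>l<d. (m i $ l - m 0 $ l) * (\<beta> l j * x j)) = (\<Sum>l<d. (m i $ l - m 0 $ l) * (\<Sum>j<k. \<beta> l j * x j))"
      unfolding sum_distrib_left by (rule sum.swap)
    finally show ?thesis using that k by simp
  qed
  \<comment> \<open>Large enough for the positive and negative parts of every \<open>c i\<close> to
    fit into monomials of degree \<open>q\<close>.\<close>
  define q where "q = (\<Sum>i<k. \<Sum>j<k. nat \<bar>c i j\<bar>)"
  define b where "b = (\<Sum>i<k. \<Sum>l<d. nat \<bar>m i $ l\<bar> + nat \<bar>m' i $ l\<bar>)"
  have b: "nat \<bar>m i $ l\<bar> + nat \<bar>m' i $ l\<bar> \<le> b" if "i < k" "l < d" for i l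
  proof -
    have "nat \<bar>m i $ l\<bar> + nat \<bar>m' i $ l\<bar> \<le> (\<Sum>l<d. nat \<bar>m i $ l\<bar> + nat \<bar>m' i $ l\<bar>)"
      by (rule member_le_sum[of l "{..<d}" "\<lambda>l. nat \<bar>m i $ l\<bar> + nat \<bar>m' i $ l\<bar>"]) (use that in auto)
    also have "\<dots> \<le> b" unfolding b_def
      by (rule member_le_sum[of i "{..<k}" "\<lambda>i. \<Sum>l<d. nat \<bar>m i $ l\<bar> + nat \<bar>m' i $ l\<bar>"]) (use that in auto)
    finally show ?thesis .
  qed
  interpret cone k d q m by unfold_locales (use k m in auto)
  interpret cone_equiv k d q m b m' G Gi
  proof unfold_locales
    show "0 \<le> m i $ l + int b" "0 \<le> m' i $ l + int b" if "i < k" "l < d" for i l using b[OF that] by linarith+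
    show "null f \<longleftrightarrow> (\<forall>t\<in>tor d. f (G *\<^sub>v orbit_vec k d m' (\<lambda>_. 1) t) = 0)" if "hpoly k e f" for e f
      using equiv[OF that] by (simp add: null_def)
  qed (use m' G in auto)
  obtain \<sigma> where \<sigma>: "bij_betw \<sigma> {..<k} {..<k}"
    "\<And>a b. a \<in> monomials k q \<Longrightarrow> b \<in> monomials k q \<Longrightarrow> wgt a = wgt b \<Longrightarrow>
      wsum d k (\<lambda>i. int (Poly_Mapping.lookup a i)) (m' \<circ> \<sigma>) = wsum d k (\<lambda>i. int (Poly_Mapping.lookup b i)) (m' \<circ> \<sigma>)"
    using relations_transfer by blast
  define \<mu> where "\<mu> = m' \<circ> \<sigma>"
  have \<sigma>k: "\<sigma> i < k" if "i < k" for i using \<sigma>(1) that by (auto simp: bij_betw_def)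
  have \<mu>: "\<mu> i \<in> carrier_vec d" if "i < k" for i using m'(1) \<sigma>k that by (simp add: \<mu>_def)
  \<comment> \<open>Column \<open>l\<close> is what the combination \<open>\<beta> l\<close>, equal
    to a unit vector for \<open>m\<close>, becomes for \<open>\<mu>\<close>.\<close>
  define A where "A = Matrix.mat d d (\<lambda>(r, l). wsum d k (\<beta> l) \<mu> $ r)"
  have Ac: "A \<in> carrier_mat d d" by (simp add: A_def)
  have A_vec: "(A *\<^sub>v v) $ r = (\<Sum>l<d. v $ l * (\<Sum>j<k. \<beta> l j * \<mu> j $ r))" if "v \<in> carrier_vec d" "r < d" for v r
    using that by (auto simp: A_def scalar_prod_def atLeast0LessThan mult.commute intro!: sum.cong)
  have \<mu>_diff: "\<mu> i $ r - \<mu> 0 $ r = (A *\<^sub>v m i) $ r - (A *\<^sub>v m 0) $ r" if i: "i < k" and r: "r < d" for i r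
  proof -
    have "wsum d k (c i) \<mu> = 0\<^sub>v d"
    proof (rule integer_relation_transfer[OF k _ _ _ \<sigma>(2)[folded \<mu>_def]])
      show "(\<Sum>j<k. c i j) = 0" using sum_c[OF i, of "\<lambda>_. 1"] \<beta>(1) by simp
      show "(\<Sum>j<k. nat \<bar>c i j\<bar>) \<le> q"
        unfolding q_def by (rule member_le_sum[of i "{..<k}" "\<lambda>i. \<Sum>j<k. nat \<bar>c i j\<bar>"]) (use i in auto)
      show "wsum d k (c i) m = 0\<^sub>v d"
      proof (rule eq_vecI)
        fix r assume "r < dim_vec (0\<^sub>v d :: int vec)"
        then have r: "r < d" by simp
        have "(\<Sum>j<k. \<beta> l j * m j $ r) = (if l = r then 1 else 0)" if "l < d" for l
          using arg_cong[OF \<beta>(2)[OF that], of "\<lambda>v. v $ r"] r that by auto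
        then show "wsum d k (c i) m $ r = 0\<^sub>v d $ r"
          using r sum_c[OF i, of "\<lambda>j. m j $ r"] by (simp add: if_distrib[of "\<lambda>x. _ * x"] sum.delta cong: if_cong sum.cong_simp)
      qed (simp add: wsum_def)
    qed
    then have "(\<Sum>j<k. c i j * \<mu> j $ r) = 0" using r by (metis index_zero_vec(1) wsum_index)
    then have "\<mu> i $ r - \<mu> 0 $ r = (\<Sum>l<d. (m i $ l - m 0 $ l) * (\<Sum>j<k. \<beta> l j * \<mu> j $ r))"
      using sum_c[OF i, of "\<lambda>j. \<mu> j $ r"] by simp
    then show ?thesis using A_vec[OF m(1)[OF i] r] A_vec[OF m(1)[OF k] r]
      by (simp add: left_diff_distrib sum_subtractf)
  qed
  define b0 where "b0 = \<mu> 0 - A *\<^sub>v m 0"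
  have b0: "b0 \<in> carrier_vec d" using \<mu>[OF k] mult_mat_vec_carrier[OF Ac m(1)[OF k]] by (simp add: b0_def)
  have affine: "\<mu> i = A *\<^sub>v m i + b0" if i: "i < k" for i
  proof (rule eq_vecI)
    fix r assume "r < dim_vec (A *\<^sub>v m i + b0)"
    then have r: "r < d" using b0 by simp
    then show "\<mu> i $ r = (A *\<^sub>v m i + b0) $ r"
      using \<mu>_diff[OF i r] \<mu>[OF k] b0 Ac by (simp add: b0_def del: index_mult_mat_vec)
  qed (use \<mu>[OF i] b0 in simp)
  \<comment> \<open>The same construction backwards with \<open>\<beta>'\<close>. Coefficient sum
    zero cancels the translation \<open>b0\<close>, so \<open>A\<close> maps its columns to unit
    vectors.\<close>
  define B where "B = Matrix.mat d d (\<lambda>(r, l). \<Sum>i<k. \<beta>' l (\<sigma> i) * m i $ r)"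
  have Bc: "B \<in> carrier_mat d d" by (simp add: B_def)
  have "A * B = 1\<^sub>m d"
  proof (rule eq_matI)
    fix r l assume "r < dim_row (1\<^sub>m d :: int mat)" "l < dim_col (1\<^sub>m d :: int mat)"
    then have rl: "r < d" "l < d" by simp_all
    have "(A * B) $$ (r, l) = (\<Sum>s<d. A $$ (r, s) * (\<Sum>i<k. \<beta>' l (\<sigma> i) * m i $ s))"
      using rl Ac by (simp add: B_def scalar_prod_def atLeast0LessThan)
    also have "\<dots> = (\<Sum>i<k. \<beta>' l (\<sigma> i) * (\<Sum>s<d. A $$ (r, s) * m i $ s))"
      unfolding sum_distrib_left by (subst sum.swap) (simp add: mult_ac)
    also have "\<dots> = (\<Sum>i<k. \<beta>' l (\<sigma> i) * (\<mu> i $ r - b0 $ r))"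
    proof (intro sum.cong refl)
      fix i assume "i \<in> {..<k}"
      then have i: "i < k" by simp
      have "(\<Sum>s<d. A $$ (r, s) * m i $ s) = (A *\<^sub>v m i) $ r"
        using rl Ac m(1)[OF i] by (auto simp: scalar_prod_def atLeast0LessThan intro!: sum.cong)
      then show "\<beta>' l (\<sigma> i) * (\<Sum>s<d. A $$ (r, s) * m i $ s) = \<beta>' l (\<sigma> i) * (\<mu> i $ r - b0 $ r)"
        using affine[OF i] rl b0 Ac by (simp del: index_mult_mat_vec)
    qed
    also have "\<dots> = (\<Sum>i<k. \<beta>' l (\<sigma> i) * m' (\<sigma> i) $ r) - (\<Sum>i<k. \<beta>' l (\<sigma> i)) * b0 $ r"
      by (simp add: right_diff_distrib sum_subtractf sum_distrib_right \<mu>_def)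
    also have "\<dots> = (\<Sum>j<k. \<beta>' l j * m' j $ r) - (\<Sum>j<k. \<beta>' l j) * b0 $ r"
      using sum.reindex_bij_betw[OF \<sigma>(1), of "\<lambda>j. \<beta>' l j * m' j $ r"] sum.reindex_bij_betw[OF \<sigma>(1), of "\<beta>' l"] by simp
    also have "\<dots> = unit_vec d l $ r"
      using \<beta>'[OF rl(2)] rl by (metis diff_zero mult_zero_left wsum_index)
    finally show "(A * B) $$ (r, l) = 1\<^sub>m d $$ (r, l)" using rl by auto
  qed (use Ac Bc in auto)
  then have "A \<in> carrier (GL TYPE(int) d)" by (rule int_GL_of_right_inverse[OF Ac Bc])
  moreover have "m' ` {..<k} = (\<lambda>v. A *\<^sub>v v + b0) ` m ` {..<k}"
  proof -
    have "m' ` {..<k} = m' ` \<sigma> ` {..<k}" using \<sigma>(1) by (simp add: bij_betw_def)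
    also have "\<dots> = \<mu> ` {..<k}" by (simp add: \<mu>_def image_image)
    also have "\<dots> = (\<lambda>v. A *\<^sub>v v + b0) ` m ` {..<k}" unfolding image_image using affine by (intro image_cong) auto
    finally show ?thesis .
  qed
  ultimately show ?thesis using b0 unfolding affine_equiv_def by blast
qed

section \<open>Projectively equivalent orbit closures\<close>

text \<open>Equality of orbit closures is used only through their vanishing forms, pulled back by
  \<open>g\<close>.\<close>

lemma vanishing_transfer:
  assumes g: "g \<in> carrier (GL TYPE(complex) n)"
    and sub: "orbit n d m x \<subseteq> proj_space n" "orbit n d m' x' \<subseteq> proj_space n"
    and eq: "act g ` (zariski n closure_of orbit n d m' x') = zariski n closure_of orbit n d m x"
    and f: "hpoly n e f"
  shows "(\<forall>t\<in>tor d. f (orbit_vec n d m x t) = 0) \<longleftrightarrow> (\<forall>t\<in>tor d. f (g *\<^sub>v orbit_vec n d m' x' t) = 0)"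
proof -
  have gc: "g \<in> carrier_mat n n" using g by (simp add: GL_iff)
  have "zariski n closure_of orbit n d m' x' \<subseteq> proj_space n"
    using closure_of_subset_topspace[of "zariski n"] by simp
  then have "vanishes f (zariski n closure_of orbit n d m x) \<longleftrightarrow>
      vanishes (\<lambda>v. f (g *\<^sub>v v)) (zariski n closure_of orbit n d m' x')"
    using vanishes_act[OF gc] by (simp add: eq[symmetric])
  then show ?thesis
    using vanishes_orbit_closure[OF f sub(1)] vanishes_orbit_closure[OF hpoly_mat_comp[OF f gc] sub(2)] by simp
qed

lemma sum_wt:
  assumes "k \<le> n" shows "(\<Sum>j<n. f j * (wt k j * h j)) = (\<Sum>j<k. f j * h j)"
proof -
  have "(\<Sum>j<n. f j * (wt k j * h j)) = (\<Sum>j<n. if j < k then f j * h j else 0)"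
    by (intro sum.cong) auto
  also have "\<dots> = (\<Sum>j\<in>{..<n} \<inter> {j. j < k}. f j * h j)" by (subst sum.inter_restrict) auto
  also have "{..<n} \<inter> {j. j < k} = {..<k}" using assms by auto
  finally show ?thesis .
qed

lemma mat_orbit_vec:
  assumes "A \<in> carrier_mat l n" "k \<le> n" "i < l"
  shows "(A *\<^sub>v orbit_vec n d m (wt k) t) $ i = (\<Sum>j<k. A $$ (i, j) * character d (m j) t)"
proof -
  have "(A *\<^sub>v orbit_vec n d m (wt k) t) $ i = (\<Sum>j<n. A $$ (i, j) * (wt k j * character d (m j) t))"
    using assms by (auto simp: scalar_prod_def atLeast0LessThan carrier_vecD[OF orbit_vec_carrier] intro!: sum.cong)
  then show ?thesis using sum_wt[OF assms(2)] by simp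
qed

text \<open>The cone of \<open>m'\<close> spans the first \<open>k'\<close> coordinates, so
  vanishing on the cone forces vanishing of matrix entries. An injective map of that span into the
  first \<open>k\<close> coordinates then bounds \<open>k'\<close>.\<close>

lemma lower_block_zero:
  assumes g: "g \<in> carrier (GL TYPE(complex) n)"
    and k': "k' \<le> n" "inj_on m' {..<k'}" "\<And>i. i < k' \<Longrightarrow> m' i \<in> carrier_vec d"
    and low: "\<And>i t. i < n \<Longrightarrow> k \<le> i \<Longrightarrow> t \<in> tor d \<Longrightarrow> (g *\<^sub>v orbit_vec n d m' (wt k') t) $ i = 0"
  shows "\<And>i j. i < n \<Longrightarrow> k \<le> i \<Longrightarrow> j < k' \<Longrightarrow> g $$ (i, j) = 0" and "k' \<le> k"
proof -
  have gc: "g \<in> carrier_mat n n" using g by (simp add: GL_iff)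
  show zero: "g $$ (i, j) = 0" if ij: "i < n" "k \<le> i" "j < k'" for i j
  proof (rule linear_form_on_orbit[OF k'(2,3) _ ij(3)])
    fix t assume t: "t \<in> tor d"
    show "(\<Sum>j<k'. g $$ (i, j) * character d (m' j) t) = 0"
      using low[OF ij(1,2) t] by (simp only: mat_orbit_vec[OF gc k'(1) ij(1)])
  qed
  show "k' \<le> k"
  proof (rule ccontr)
    assume "\<not> k' \<le> k"
    then have "card {..<k} < card {..<k'}" by simp
    from underdetermined_system[OF finite_lessThan finite_lessThan this, of "\<lambda>j i. g $$ (i, j)"]
    obtain c where c: "\<exists>j<k'. c j \<noteq> 0" "\<And>i. i < k \<Longrightarrow> (\<Sum>j<k'. c j * g $$ (i, j)) = 0" by auto
    define v where "v = vec n (\<lambda>j. if j < k' then c j else 0)"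
    have v: "v \<in> carrier_vec n" by (simp add: v_def)
    have "v \<noteq> 0\<^sub>v n"
    proof
      assume "v = 0\<^sub>v n"
      obtain j where j: "j < k'" "c j \<noteq> 0" using c(1) by blast
      then have "v $ j = c j" using k'(1) by (simp add: v_def)
      then show False using \<open>v = 0\<^sub>v n\<close> j k'(1) by simp
    qed
    moreover have "g *\<^sub>v v = 0\<^sub>v n"
    proof (rule eq_vecI)
      fix i assume "i < dim_vec (0\<^sub>v n :: complex vec)"
      then have i: "i < n" by simp
      have "(g *\<^sub>v v) $ i = (\<Sum>j<n. g $$ (i, j) * (wt k' j * c j))"
        using gc i by (auto simp: v_def wt_def scalar_prod_def atLeast0LessThan intro!: sum.cong)
      also have "\<dots> = (\<Sum>j<k'. g $$ (i, j) * c j)" by (rule sum_wt[OF k'(1)])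
      also have "\<dots> = 0" using zero[OF i] c(2)[of i] by (cases "i < k") (auto simp: mult.commute)
      finally show "(g *\<^sub>v v) $ i = 0\<^sub>v n $ i" using i by simp
    qed (use gc in simp)
    ultimately show False using GL_mult_vec_nonzero[OF g v] by blast
  qed
qed

lemma spans_wt:
  assumes "spans n d m (wt k)" "k \<le> n" shows "spans k d m (\<lambda>_. 1)"
  unfolding spans_def
proof (intro allI impI)
  fix l assume "l < d"
  then obtain \<beta> :: "nat \<Rightarrow> int" where \<beta>: "\<forall>i<n. wt k i = 0 \<longrightarrow> \<beta> i = 0" "(\<Sum>i<n. \<beta> i) = 0" "wsum d n \<beta> m = unit_vec d l"
    using assms(1) unfolding spans_def by blast
  have restrict: "(\<Sum>i<n. \<beta> i * h i) = (\<Sum>i<k. \<beta> i * h i)" for h :: "nat \<Rightarrow> int"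
    using assms(2) \<beta>(1) by (intro sum.mono_neutral_right) auto
  have "(\<Sum>i<k. \<beta> i) = 0" using restrict[of "\<lambda>_. 1"] \<beta>(2) by simp
  moreover have "wsum d k \<beta> m = unit_vec d l"
    unfolding \<beta>(3)[symmetric] wsum_def restrict ..
  ultimately show "\<exists>\<beta> :: nat \<Rightarrow> int. (\<forall>i<k. (1 :: complex) = 0 \<longrightarrow> \<beta> i = 0) \<and> (\<Sum>i<k. \<beta> i) = 0 \<and> wsum d k \<beta> m = unit_vec d l"
    by auto
qed

text \<open>Both cones span coordinate subspaces, which the given map must match; so the two lists
  have equal length and the problem descends to that common span, where all coordinates of the base
  point are 1.\<close>

lemma orbit_closure_equiv_imp_affine_equiv:
  assumes ms: "distinct ms" "set ms \<subseteq> carrier_vec d" "ms \<noteq> []" "length ms \<le> n" "spans n d ((!) ms) (wt (length ms))"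
    and ms': "distinct ms'" "set ms' \<subseteq> carrier_vec d" "ms' \<noteq> []" "length ms' \<le> n" "spans n d ((!) ms') (wt (length ms'))"
    and g: "g \<in> carrier (GL TYPE(complex) n)"
    and eq: "act g ` (zariski n closure_of orbit n d ((!) ms') (wt (length ms'))) =
      zariski n closure_of orbit n d ((!) ms) (wt (length ms))"
  shows "affine_equiv d (set ms) (set ms')"
proof -
  let ?O = "orbit n d ((!) ms) (wt (length ms))" and ?O' = "orbit n d ((!) ms') (wt (length ms'))"
  obtain h where h: "g \<in> carrier_mat n n" "h \<in> carrier_mat n n" "g * h = 1\<^sub>m n" "h * g = 1\<^sub>m n"
    using g by (auto simp: GL_iff)
  then have hG: "h \<in> carrier (GL TYPE(complex) n)" by (auto simp: GL_iff)
  have "n > 0" using ms(3,4) by (cases ms) auto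
  then have sub: "?O \<subseteq> proj_space n" "?O' \<subseteq> proj_space n"
    using ms(3) ms'(3) orbit_space[of 0 n "wt (length ms)"] orbit_space[of 0 n "wt (length ms')"]
    by (simp_all add: Suc_le_eq)
  have "zariski n closure_of ?O' \<subseteq> proj_space n"
    using closure_of_subset_topspace[of "zariski n"] by simp
  then have eq': "act h ` (zariski n closure_of ?O) = zariski n closure_of ?O'"
    unfolding eq[symmetric] by (rule act_image_inverse[OF h(1,2,4)])
  have carr: "i < length ms \<Longrightarrow> ms ! i \<in> carrier_vec d" "i < length ms' \<Longrightarrow> ms' ! i \<in> carrier_vec d" for i
    using ms(2) ms'(2) by auto
  have inj: "inj_on ((!) ms) {..<length ms}" "inj_on ((!) ms') {..<length ms'}"
    using ms(1) ms'(1) by (simp_all add: inj_on_def nth_eq_iff_index_eq)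
  have low: "(g *\<^sub>v orbit_vec n d ((!) ms') (wt (length ms')) t) $ i = 0"
    if "i < n" "length ms \<le> i" "t \<in> tor d" for i t
  proof -
    have "\<forall>t\<in>tor d. orbit_vec n d ((!) ms) (wt (length ms)) t $ i = 0" using that by simp
    then show ?thesis using vanishing_transfer[OF g sub eq hpoly_coord[OF that(1)]] that(3) by blast
  qed
  have low': "(h *\<^sub>v orbit_vec n d ((!) ms) (wt (length ms)) t) $ i = 0"
    if "i < n" "length ms' \<le> i" "t \<in> tor d" for i t
  proof -
    have "\<forall>t\<in>tor d. orbit_vec n d ((!) ms') (wt (length ms')) t $ i = 0" using that by simp
    then show ?thesis using vanishing_transfer[OF hG sub(2,1) eq' hpoly_coord[OF that(1)]] that(3) by blast
  qed
  have le: "length ms' \<le> length ms" "length ms \<le> length ms'"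
    by (rule lower_block_zero(2)[OF g ms'(4) inj(2) carr(2) low];assumption)
      (rule lower_block_zero(2)[OF hG ms(4) inj(1) carr(1) low'];assumption)
  have g0: "g $$ (i, j) = 0" if "i < n" "length ms \<le> i" "j < length ms'" for i j
    by (rule lower_block_zero(1)[OF g ms'(4) inj(2) carr(2) low]) (use that in auto)
  have h0: "h $$ (i, j) = 0" if "i < n" "length ms' \<le> i" "j < length ms" for i j
    by (rule lower_block_zero(1)[OF hG ms(4) inj(1) carr(1) low']) (use that in auto)
  define k where "k = length ms"
  have k: "length ms' = k" "k > 0" "k \<le> n" using le ms(3,4) by (auto simp: k_def)
  \<comment> \<open>With a vanishing lower left block, the upper left blocks multiply like the whole
    matrices.\<close>
  have block: "Matrix.mat k k (\<lambda>(i, j). a $$ (i, j)) * Matrix.mat k k (\<lambda>(i, j). b $$ (i, j)) = 1\<^sub>m k"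
    if ab: "a \<in> carrier_mat n n" "b \<in> carrier_mat n n" "a * b = 1\<^sub>m n"
      "\<And>i j. i < n \<Longrightarrow> k \<le> i \<Longrightarrow> j < k \<Longrightarrow> b $$ (i, j) = 0" for a b :: "complex mat"
  proof (rule eq_matI)
    fix i j assume "i < dim_row (1\<^sub>m k :: complex mat)" "j < dim_col (1\<^sub>m k :: complex mat)"
    then have ij: "i < k" "j < k" by simp_all
    have "(a * b) $$ (i, j) = (\<Sum>l<n. a $$ (i, l) * b $$ (l, j))"
      using ab(1,2) ij k(3) by (auto simp: scalar_prod_def atLeast0LessThan intro!: sum.cong)
    also have "\<dots> = (\<Sum>l<k. a $$ (i, l) * b $$ (l, j))"
      using k(3) ab(4) ij by (intro sum.mono_neutral_right) auto
    finally have "(\<Sum>l<k. a $$ (i, l) * b $$ (l, j)) = (if i = j then 1 else 0)"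
      using ab(3) ij k(3) by simp
    then show "(Matrix.mat k k (\<lambda>(i, j). a $$ (i, j)) * Matrix.mat k k (\<lambda>(i, j). b $$ (i, j))) $$ (i, j) = 1\<^sub>m k $$ (i, j)"
      using ij by (simp add: scalar_prod_def atLeast0LessThan)
  qed auto
  define G where "G = Matrix.mat k k (\<lambda>(i, j). g $$ (i, j))"
  define Gi where "Gi = Matrix.mat k k (\<lambda>(i, j). h $$ (i, j))"
  \<comment> \<open>Projection to the first \<open>k\<close> coordinates, used to pull forms on the
    span back to the ambient space.\<close>
  define P where "P = Matrix.mat k n (\<lambda>(i, j). if i = j then 1 else 0 :: complex)"
  have P_vec: "P *\<^sub>v v = vec k (($) v)" if "v \<in> carrier_vec n" for v
    using that k(3) by (intro eq_vecI)
      (auto simp: P_def scalar_prod_def atLeast0LessThan if_distrib[of "\<lambda>x. x * _"] sum.delta cong: if_cong)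
  have "affine_equiv d ((!) ms ` {..<k}) ((!) ms' ` {..<k})"
  proof (rule cone_affine_equiv[of k _ d _ G Gi])
    show "spans k d ((!) ms) (\<lambda>_. 1)" "spans k d ((!) ms') (\<lambda>_. 1)"
      using spans_wt[OF ms(5,4)] spans_wt[OF ms'(5,4)] k(1) by (simp_all add: k_def)
    show "G * Gi = 1\<^sub>m k" "Gi * G = 1\<^sub>m k"
      unfolding G_def Gi_def using block[of g h] block[of h g] h g0 h0 k by (simp_all add: k_def)
    fix e f assume f: "hpoly k e f"
    have fP: "hpoly n e (\<lambda>v. f (P *\<^sub>v v))" by (rule hpoly_mat_comp[OF f]) (simp add: P_def)
    have "P *\<^sub>v orbit_vec n d ((!) ms) (wt k) t = orbit_vec k d ((!) ms) (\<lambda>_. 1) t" for t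
      using k(3) by (auto simp: P_vec orbit_vec_def)
    moreover have "P *\<^sub>v (g *\<^sub>v orbit_vec n d ((!) ms') (wt k) t) = G *\<^sub>v orbit_vec k d ((!) ms') (\<lambda>_. 1) t" for t
    proof (rule eq_vecI)
      fix i assume "i < dim_vec (G *\<^sub>v orbit_vec k d ((!) ms') (\<lambda>_. 1) t)"
      then have i: "i < k" by (simp add: G_def)
      have "g *\<^sub>v orbit_vec n d ((!) ms') (wt k) t \<in> carrier_vec n"
        by (rule mult_mat_vec_carrier[OF h(1) orbit_vec_carrier])
      then have "(P *\<^sub>v (g *\<^sub>v orbit_vec n d ((!) ms') (wt k) t)) $ i = (\<Sum>j<k. g $$ (i, j) * character d (ms' ! j) t)"
        using i k(3) mat_orbit_vec[OF h(1) k(3), of i] by (simp add: P_vec del: index_mult_mat_vec)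
      then show "(P *\<^sub>v (g *\<^sub>v orbit_vec n d ((!) ms') (wt k) t)) $ i = (G *\<^sub>v orbit_vec k d ((!) ms') (\<lambda>_. 1) t) $ i"
        using i by (simp add: G_def scalar_prod_def atLeast0LessThan carrier_vecD[OF orbit_vec_carrier] del: index_mult_mat_vec(1))
          (auto simp: scalar_prod_def atLeast0LessThan carrier_vecD[OF orbit_vec_carrier])
    qed (simp add: P_def G_def)
    ultimately show "(\<forall>t\<in>tor d. f (orbit_vec k d ((!) ms) (\<lambda>_. 1) t) = 0) \<longleftrightarrow>
        (\<forall>t\<in>tor d. f (G *\<^sub>v orbit_vec k d ((!) ms') (\<lambda>_. 1) t) = 0)"
      using vanishing_transfer[OF g sub eq fP] k(1) by (simp add: k_def)
  qed (use k carr inj in \<open>simp_all add: k_def G_def Gi_def\<close>)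
  moreover have "(!) ms ` {..<k} = set ms" "(!) ms' ` {..<k} = set ms'"
    using k(1) by (auto simp: k_def set_conv_nth)
  ultimately show ?thesis by simp
qed

section \<open>The bijection\<close>

lemma toric_subvarieties_space:
  "X \<in> toric_subvarieties d N \<Longrightarrow> closedin (zariski (Suc N)) X \<and> X \<subseteq> proj_space (Suc N)"
  using closedin_subset[of "zariski (Suc N)" X] by (auto simp: toric_subvarieties_def toric_def)

lemma proj_equiv_refl:
  assumes "X \<subseteq> proj_space (Suc N)" shows "proj_equiv N X X"
proof -
  have "act (1\<^sub>m (Suc N)) ` X = X" using act_one assms by force
  moreover have "1\<^sub>m (Suc N) \<in> carrier (GL TYPE(complex) (Suc N))" by (auto simp: GL_iff)
  ultimately show ?thesis unfolding proj_equiv_iff[OF assms] by blast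
qed

lemma proj_equiv_sym:
  assumes "proj_equiv N X Y" "X \<subseteq> proj_space (Suc N)" "Y \<subseteq> proj_space (Suc N)"
  shows "proj_equiv N Y X"
proof -
  obtain A where A: "A \<in> carrier (GL TYPE(complex) (Suc N))" "act A ` X = Y"
    using assms(1) proj_equiv_iff[OF assms(2)] by blast
  then obtain B where B: "A \<in> carrier_mat (Suc N) (Suc N)" "B \<in> carrier_mat (Suc N) (Suc N)"
    "A * B = 1\<^sub>m (Suc N)" "B * A = 1\<^sub>m (Suc N)"
    by (auto simp: GL_iff)
  then have "B \<in> carrier (GL TYPE(complex) (Suc N))" by (auto simp: GL_iff)
  moreover have "act B ` Y = X" using act_image_inverse[OF B(1,2,4) assms(2)] A(2) by simp
  ultimately show ?thesis unfolding proj_equiv_iff[OF assms(3)] by blast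
qed

lemma proj_equiv_trans:
  assumes "proj_equiv N X Y" "proj_equiv N Y Z" "X \<subseteq> proj_space (Suc N)" "Y \<subseteq> proj_space (Suc N)"
  shows "proj_equiv N X Z"
proof -
  obtain A where A: "A \<in> carrier (GL TYPE(complex) (Suc N))" "act A ` X = Y"
    using assms(1) proj_equiv_iff[OF assms(3)] by blast
  obtain B where B: "B \<in> carrier (GL TYPE(complex) (Suc N))" "act B ` Y = Z"
    using assms(2) proj_equiv_iff[OF assms(4)] by blast
  have "B * A \<in> carrier (GL TYPE(complex) (Suc N))"
    using monoid.m_closed[OF group.is_monoid[OF group_GL] B(1) A(1)] by simp
  moreover have "act (B * A) ` X = Z"
  proof -
    have "act (B * A) ` X = (\<lambda>p. act B (act A p)) ` X"
      using act_mult A(1) B(1) assms(3) by (intro image_cong) (auto simp: GL_iff)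
    then show ?thesis using A(2) B(2) by (simp add: image_image[symmetric])
  qed
  ultimately show ?thesis unfolding proj_equiv_iff[OF assms(3)] by blast
qed

lemma equiv_proj_rel: "equiv (toric_subvarieties d N) (proj_rel d N)"
proof (rule equivI)
  show "proj_rel d N \<subseteq> toric_subvarieties d N \<times> toric_subvarieties d N" by (auto simp: proj_rel_def)
  show "refl_on (toric_subvarieties d N) (proj_rel d N)"
    using proj_equiv_refl toric_subvarieties_space by (auto simp: refl_on_def proj_rel_def)
  show "sym (proj_rel d N)"
    using proj_equiv_sym toric_subvarieties_space by (auto simp: sym_def proj_rel_def)
  show "trans (proj_rel d N)"
    using proj_equiv_trans toric_subvarieties_space unfolding trans_def proj_rel_def by blast
qed

lemma affine_equiv_iff_proj_equiv:
  assumes S: "S \<in> generating_sets d N" "distinct ms" "set ms = S"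
    and S': "S' \<in> generating_sets d N" "distinct ms'" "set ms' = S'"
  shows "affine_equiv d S S' \<longleftrightarrow> proj_equiv N (toric_of d N ms) (toric_of d N ms')"
proof -
  note L = generating_set_list[OF S] and L' = generating_set_list[OF S']
  have sub: "orbit (Suc N) d ((!) ms) (wt (length ms)) \<subseteq> proj_space (Suc N)"
    using L(2) by (intro orbit_space[of 0]) auto
  have T: "toric_of d N ms \<subseteq> proj_space (Suc N)" "toric_of d N ms' \<subseteq> proj_space (Suc N)"
    using toric_of_in_toric_subvarieties[OF S] toric_of_in_toric_subvarieties[OF S'] toric_subvarieties_space by blast+
  show ?thesis
  proof
    assume "affine_equiv d S S'"
    then obtain g where g: "g \<in> carrier (GL TYPE(complex) (Suc N))"
      "act g ` orbit (Suc N) d ((!) ms) (wt (length ms)) = orbit (Suc N) d ((!) ms') (wt (length ms'))"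
      using affine_equiv_imp_orbits[OF S(2) L(1) S'(2) L'(3)] S(3) S'(3) by blast
    then have "act g ` toric_of d N ms = toric_of d N ms'"
      using closure_act[OF g(1) sub] toric_of_orbit[OF L(2)] toric_of_orbit[OF L'(2)] by simp
    then show "proj_equiv N (toric_of d N ms) (toric_of d N ms')"
      unfolding proj_equiv_iff[OF T(1)] using g(1) by blast
  next
    assume "proj_equiv N (toric_of d N ms) (toric_of d N ms')"
    \<comment> \<open>Reversed because the transfer of weights from \<open>ms\<close> to
      \<open>ms'\<close> starts from a matrix carrying the second variety to the first.\<close>
    then have "proj_equiv N (toric_of d N ms') (toric_of d N ms)" using T by (rule proj_equiv_sym)
    then obtain g where g: "g \<in> carrier (GL TYPE(complex) (Suc N))" "act g ` toric_of d N ms' = toric_of d N ms"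
      unfolding proj_equiv_iff[OF T(2)] by blast
    then have "affine_equiv d (set ms) (set ms')"
      using orbit_closure_equiv_imp_affine_equiv[OF S(2) L S'(2) L' g(1)]
      by (simp add: toric_of_orbit[OF L(2)] toric_of_orbit[OF L'(2)])
    then show "affine_equiv d S S'" using S(3) S'(3) by simp
  qed
qed

text \<open>The reduction yields a set in some lattice of rank \<open>d'\<close>; invariance of the
  Krull dimension identifies \<open>d'\<close> with \<open>d\<close>.\<close>

lemma toric_subvariety_is_toric_of:
  assumes "Y \<in> toric_subvarieties d N"
  obtains ms where "distinct ms" "set ms \<in> generating_sets d N" "proj_equiv N (toric_of d N ms) Y"
proof -
  have Y: "toric N Y" "krull_dim (subtopology (zariski (Suc N)) Y) = enat d"
    using assms by (simp_all add: toric_subvarieties_def)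
  obtain d' ms g where g: "g \<in> carrier (GL TYPE(complex) (Suc N))"
    and ms: "distinct ms" "set ms \<in> generating_sets d' N" and eq: "Y = act g ` toric_of d' N ms"
    using toric_is_toric_of[OF Y(1)] by blast
  have X: "toric_of d' N ms \<in> toric_subvarieties d' N"
    by (rule toric_of_in_toric_subvarieties[OF ms(2,1) refl])
  then have "krull_dim (subtopology (zariski (Suc N)) Y) = enat d'"
    unfolding eq using krull_dim_act[OF g] toric_subvarieties_space[OF X] by (simp add: toric_subvarieties_def)
  then have "d' = d" using Y(2) by simp
  moreover have "proj_equiv N (toric_of d' N ms) Y"
    using proj_equiv_iff toric_subvarieties_space[OF X] g eq by blast
  ultimately show ?thesis using that ms by blast
qed

lemma quotient_bijection:
  assumes eqv: "equiv B R'" and X: "\<And>a. a \<in> A \<Longrightarrow> X a \<in> B"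
    and surj: "\<And>y. y \<in> B \<Longrightarrow> \<exists>a\<in>A. (X a, y) \<in> R'"
    and R: "R = {(a, a') \<in> A \<times> A. (X a, X a') \<in> R'}"
  obtains \<Phi> where "bij_betw \<Phi> (A // R) (B // R')" "\<And>a. a \<in> A \<Longrightarrow> \<Phi> (R `` {a}) = R' `` {X a}"
proof -
  have refl: "(X a, X a) \<in> R'" if "a \<in> A" for a
    using equiv_class_self[OF eqv X[OF that]] by simp
  \<comment> \<open>Saturating the image of the whole class avoids choosing a
    representative.\<close>
  define \<Phi> where "\<Phi> = (\<lambda>C. R' `` (X ` C))"
  have \<Phi>: "\<Phi> (R `` {a}) = R' `` {X a}" if a: "a \<in> A" for a
  proof -
    have "R' `` {X b} = R' `` {X a}" if "b \<in> R `` {a}" for b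
      using equiv_class_eq[OF eqv, of "X a" "X b"] that R by auto
    moreover have "a \<in> R `` {a}" using refl[OF a] a R by auto
    ultimately show ?thesis unfolding \<Phi>_def by blast
  qed
  have "bij_betw \<Phi> (A // R) (B // R')"
  proof (rule bij_betw_imageI)
    show "inj_on \<Phi> (A // R)"
    proof (rule inj_onI)
      fix C C' assume "C \<in> A // R" "C' \<in> A // R" and eq: "\<Phi> C = \<Phi> C'"
      then obtain a a' where a: "a \<in> A" "C = R `` {a}" "a' \<in> A" "C' = R `` {a'}"
        by (auto elim!: quotientE)
      then have cls: "R' `` {X a} = R' `` {X a'}" using eq \<Phi> by simp
      have "R `` {b} = {x \<in> A. X x \<in> R' `` {X b}}" if "b \<in> A" for b using that R by auto
      from this[OF a(1)] this[OF a(3)] show "C = C'" unfolding a(2,4) cls by (rule trans[OF _ sym])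
    qed
    show "\<Phi> ` (A // R) = B // R'"
    proof (rule Set.equalityI; rule Set.subsetI)
      fix D assume "D \<in> \<Phi> ` (A // R)"
      then obtain a where "a \<in> A" "D = R' `` {X a}" using \<Phi> by (auto elim!: quotientE)
      then show "D \<in> B // R'" using X by (auto intro: quotientI)
    next
      fix D assume "D \<in> B // R'"
      then obtain y where y: "y \<in> B" "D = R' `` {y}" by (rule quotientE)
      then obtain a where a: "a \<in> A" "(X a, y) \<in> R'" using surj by blast
      then have "D = \<Phi> (R `` {a})" using \<Phi> y equiv_class_eq[OF eqv a(2)] by simp
      then show "D \<in> \<Phi> ` (A // R)" using a(1) by (auto intro: quotientI)
    qed
  qed
  then show ?thesis using \<Phi> by (rule that)
qed

theorem theorem1:
  fixes d N :: nat
  assumes "d \<le> N"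
  shows "\<exists>\<Phi>. bij_betw \<Phi> (generating_sets d N // affine_rel d N)
                        (toric_subvarieties d N // proj_rel d N) \<and>
    (\<forall>S \<in> generating_sets d N. \<forall>ms. distinct ms \<and> set ms = S \<longrightarrow>
      toric_of d N ms \<in> \<Phi> (affine_rel d N `` {S}))"
proof -
  \<comment> \<open>One enumeration per set is fixed to define the map; any other enumeration gives
    a projectively equivalent variety, by \<open>rel\<close> and \<open>self\<close>, hence the same
    class.\<close>
  define enum where "enum = (\<lambda>S :: int vec set. SOME ms. distinct ms \<and> set ms = S)"
  have enum: "distinct (enum S)" "set (enum S) = S" if "S \<in> generating_sets d N" for S
  proof -
    have "\<exists>ms. distinct ms \<and> set ms = S"
      using that finite_distinct_list[of S] by (auto simp: generating_sets_def)
    then have "distinct (enum S) \<and> set (enum S) = S" unfolding enum_def by (rule someI_ex)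
    then show "distinct (enum S)" "set (enum S) = S" by auto
  qed
  define X where "X = (\<lambda>S. toric_of d N (enum S))"
  have X: "X S \<in> toric_subvarieties d N" if "S \<in> generating_sets d N" for S
    unfolding X_def by (rule toric_of_in_toric_subvarieties[OF that enum[OF that]])
  have rel: "(X S, toric_of d N ms) \<in> proj_rel d N \<longleftrightarrow> affine_equiv d S (set ms)"
    if "S \<in> generating_sets d N" "distinct ms" "set ms \<in> generating_sets d N" for S ms
    using affine_equiv_iff_proj_equiv[OF that(1) enum[OF that(1)] that(3,2) refl] X[OF that(1)]
      toric_of_in_toric_subvarieties[OF that(3,2) refl]
    by (simp add: X_def proj_rel_def)
  have self: "affine_equiv d S S" if "S \<in> generating_sets d N" for S
    using affine_equiv_iff_proj_equiv[OF that enum[OF that] that enum[OF that]] proj_equiv_refl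
      X[OF that] toric_subvarieties_space by (simp add: X_def)
  have surj: "\<exists>S\<in>generating_sets d N. (X S, Y) \<in> proj_rel d N" if Y: "Y \<in> toric_subvarieties d N" for Y
  proof -
    obtain ms where ms: "distinct ms" "set ms \<in> generating_sets d N" "proj_equiv N (toric_of d N ms) Y"
      using toric_subvariety_is_toric_of[OF Y] by blast
    have "(toric_of d N ms, Y) \<in> proj_rel d N"
      using toric_of_in_toric_subvarieties[OF ms(2,1) refl] Y ms(3) by (simp add: proj_rel_def)
    moreover have "(X (set ms), toric_of d N ms) \<in> proj_rel d N"
      using rel[OF ms(2,1,2)] self[OF ms(2)] by simp
    ultimately have "(X (set ms), Y) \<in> proj_rel d N"
      using equiv_proj_rel[of d N] by (auto simp: equiv_def elim: transE)
    then show ?thesis using ms(2) by blast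
  qed
  have "affine_rel d N = {(S, S') \<in> generating_sets d N \<times> generating_sets d N. (X S, X S') \<in> proj_rel d N}"
    using rel enum by (auto simp: affine_rel_def X_def)
  from quotient_bijection[OF equiv_proj_rel X surj this]
  obtain \<Phi> where \<Phi>: "bij_betw \<Phi> (generating_sets d N // affine_rel d N) (toric_subvarieties d N // proj_rel d N)"
    "\<And>S. S \<in> generating_sets d N \<Longrightarrow> \<Phi> (affine_rel d N `` {S}) = proj_rel d N `` {X S}"
    by blast
  have "toric_of d N ms \<in> \<Phi> (affine_rel d N `` {S})"
    if "S \<in> generating_sets d N" "distinct ms" "set ms = S" for S ms
    using \<Phi>(2)[OF that(1)] rel[OF that(1,2)] self[OF that(1)] that by simp
  with \<Phi>(1) show ?thesis by blast
qed

end
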